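(* Let $G$ be a Lie group modelled on an integral complete locally convex space. If $G$ is $R$-regular, then $G$ has the strong Trotter property (and hence also the strong commutator property).
   Context: Conventions. Locally convex spaces are real and Hausdorff. A map $f:U\to F$ from an open subset $U$ of a locally convex space $E$ to a locally convex space $F$ is $C^1$ if it is continuous, $df(x,y)=\lim_{t\to0}t^{-1}(f(x+ty)-f(x))$ exists for all $(x,y)\in U\times E$, and $df$ is continuous; it is $C^k$ ($k\ge2$) if it is $C^1$ and $df$ is $C^{k-1}$; smooth means $C^k$ for all $k$. Manifolds and Lie groups modelled on locally convex spaces are defined with this notion. $e$ is the neutral element, $L(G)=T_eG$ the Lie algebra with its Lie bracket, $g.v=T\lambda_g(v)$ for $v\in TG$, where $\lambda_g(x)=gx$. $R$-regularity. $E$ is integral complete if each continuous curve $\gamma:[0,1]\to E$ has a weak integral in $E$ (an element $w$ with $\lambda(w)=\int_0^1\lambda(\gamma(t))\,dt$ for all continuous linear functionals $\lambda$). Let $E$ be integral complete and $a<b$. $R([a,b],E)$ is the space of classes $[\gamma]$ (modulo equality almost everywhere) of regulated functions $\gamma:[a,b]\to E$, i.e. uniform limits of sequences of functions each of which is constant on the open subintervals of some partition of $[a,b]$; its topology is defined by the seminorms $\operatorname{ess\,sup}(q\circ\gamma)$, $q$ a continuous seminorm on $E$. Such $\gamma$ have weak integrals. $AC_R([a,b],E)$ is the space of continuous $\eta:[a,b]\to E$ of the form $\eta(t)=\eta(a)+\int_a^t\gamma(s)\,ds$ with $[\gamma]\in R([a,b],E)$; $\eta':=[\gamma]$ is unique,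 and the space is topologized so that $\eta\mapsto(\eta(a),\eta')\in E\times R([a,b],E)$ is an isomorphism of topological vector spaces. If $G$ is a Lie group modelled on $E$, $AC_R([0,1],G)$ is the set of continuous $\eta:[0,1]\to G$ for which there are $0=t_0<\dots<t_n=1$ and charts $\phi_j:U_j\to V_j\subseteq E$ of $G$ with $\eta([t_{j-1},t_j])\subseteq U_j$ and $\eta_j:=\phi_j\circ\eta|_{[t_{j-1},t_j]}\in AC_R([t_{j-1},t_j],E)$. Writing $\eta_j'=[\gamma_j]$, $\delta^\ell(\eta)\in R([0,1],L(G))$ is the class of $t\mapsto\eta(t)^{-1}.T\phi_j^{-1}(\eta_j(t),\gamma_j(t))$ for $t\in[t_{j-1},t_j[$. $AC_R([0,1],G)$ is a group under pointwise multiplication, with the unique Lie group structure such that for each chart $\phi:U\to V$ of $G$ with $e\in U=U^{-1}$, the set of $\eta$ with image in $U$ is open and $\eta\mapsto\phi\circ\eta$ is a $C^\infty$-diffeomorphism from it onto the open set of elements of $AC_R([0,1],E)$ with image in $V$. $G$ is $R$-regular if for each $[\gamma]\in R([0,1],L(G))$ there is a (necessarily unique) $\operatorname{Evol}([\gamma]):=\eta\in AC_R([0,1],G)$ with $\eta(0)=e$ and $\delta^\ell(\eta)=[\gamma]$, and $\operatorname{Evol}:R([0,1],L(G))\to AC_R([0,1],G)$ is smooth. Trotter and commutator properties. Let $G$ have a smooth exponential function $\exp_G:L(G)\to G$ (for each $v$, $t\mapsto\exp_G(tv)$ is a smooth one-parameter group with derivative $v$ at $0$; $R$-regular Lie groups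 have one). $G$ has the strong Trotter property if for each $C^1$-curve $\gamma:[0,1]\to G$ with $\gamma(0)=e$, $(\gamma(t/n))^n\to\exp_G(t\gamma'(0))$ as $n\to\infty$, uniformly for $t$ in compact subsets of $[0,\infty[$. $G$ has the strong commutator property if for all $C^1$-curves $\gamma,\eta:[0,1]\to G$ with $\gamma(0)=\eta(0)=e$, $\big(\gamma(\sqrt t/n)\eta(\sqrt t/n)\gamma(\sqrt t/n)^{-1}\eta(\sqrt t/n)^{-1}\big)^{n^2}\to\exp_G(t[\gamma'(0),\eta'(0)])$ as $n\to\infty$, uniformly for $t$ in compact subsets of $[0,\infty[$. (Terms are considered for $n$ large enough that the arguments lie in $[0,1]$; uniform convergence means that for each identity neighbourhood $U$, the $n$-th term lies in $gU\cap Ug$, $g$ the limit value, for all $t$ in the compact set and all large $n$.) *)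

theory Defs
  imports "HOL-Analysis.Analysis" "HOL-Algebra.Coset" "HOL-Library.Function_Algebras"
begin

section \<open>Locally convex spaces\<close>

instantiation "fun" :: (type, real_vector) real_vector
begin

definition scaleR_fun :: "real \<Rightarrow> ('a \<Rightarrow> 'b) \<Rightarrow> 'a \<Rightarrow> 'b" where
  "scaleR_fun r f = (\<lambda>x. r *\<^sub>R f x)"

instance
  by standard (simp_all add: scaleR_fun_def fun_eq_iff scaleR_add_right scaleR_add_left)

end

text \<open>
  A locally convex space is given by a topology on a linear subspace (its topspace) of a type of
  class \<^class>\<open>real_vector\<close>; the type only supplies the algebraic operations.
\<close>

definition lcs :: "'a::real_vector topology \<Rightarrow> bool" where
  "lcs E \<longleftrightarrow>
     subspace (topspace E) \<and> Hausdorff_space E \<and>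
     continuous_map (prod_topology E E) E (\<lambda>(x, y). x + y) \<and>
     continuous_map (prod_topology euclideanreal E) E (\<lambda>(r, x). r *\<^sub>R x) \<and>
     (\<forall>U. openin E U \<and> 0 \<in> U \<longrightarrow> (\<exists>V. openin E V \<and> convex V \<and> 0 \<in> V \<and> V \<subseteq> U))"

definition continuous_functional :: "'a::real_vector topology \<Rightarrow> ('a \<Rightarrow> real) \<Rightarrow> bool" where
  "continuous_functional E l \<longleftrightarrow>
     continuous_map E euclideanreal l \<and>
     (\<forall>x\<in>topspace E. \<forall>y\<in>topspace E. l (x + y) = l x + l y) \<and>
     (\<forall>r. \<forall>x\<in>topspace E. l (r *\<^sub>R x) = r * l x)"

definition continuous_seminorm :: "'a::real_vector topology \<Rightarrow> ('a \<Rightarrow> real) \<Rightarrow> bool" where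
  "continuous_seminorm E q \<longleftrightarrow>
     continuous_map E euclideanreal q \<and>
     (\<forall>x\<in>topspace E. \<forall>y\<in>topspace E. q (x + y) \<le> q x + q y) \<and>
     (\<forall>r. \<forall>x\<in>topspace E. q (r *\<^sub>R x) = \<bar>r\<bar> * q x)"

definition weak_integral ::
    "'a::real_vector topology \<Rightarrow> real \<Rightarrow> real \<Rightarrow> (real \<Rightarrow> 'a) \<Rightarrow> 'a \<Rightarrow> bool" where
  "weak_integral E a b \<gamma> w \<longleftrightarrow>
     w \<in> topspace E \<and>
     (\<forall>l. continuous_functional E l \<longrightarrow> ((\<lambda>t. l (\<gamma> t)) has_integral l w) {a..b})"

definition integral_complete :: "'a::real_vector topology \<Rightarrow> bool" where
  "integral_complete E \<longleftrightarrow>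
     (\<forall>\<gamma>. continuous_map (top_of_set {0..1}) E \<gamma> \<longrightarrow> (\<exists>w. weak_integral E 0 1 \<gamma> w))"


section \<open>Differential calculus\<close>

definition dir_deriv ::
    "'b::real_vector topology \<Rightarrow> ('a::real_vector \<Rightarrow> 'b) \<Rightarrow> 'a \<Rightarrow> 'a \<Rightarrow> 'b" where
  "dir_deriv F f x y = (THE l. limitin F (\<lambda>t. (f (x + t *\<^sub>R y) - f x) /\<^sub>R t) l (at (0::real)))"

definition C1_on ::
    "'a::real_vector topology \<Rightarrow> 'b::real_vector topology \<Rightarrow> 'a set \<Rightarrow> ('a \<Rightarrow> 'b) \<Rightarrow> bool" where
  "C1_on E F U f \<longleftrightarrow>
     openin E U \<and>
     continuous_map (subtopology E U) F f \<and>
     (\<forall>x\<in>U. \<forall>y\<in>topspace E. \<exists>l. limitin F (\<lambda>t. (f (x + t *\<^sub>R y) - f x) /\<^sub>R t) l (at (0::real))) \<and>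
     continuous_map (subtopology (prod_topology E E) (U \<times> topspace E)) F
       (\<lambda>(x, y). dir_deriv F f x y)"

text \<open>
  That \<open>f\<close> is C^(k+1) on an open set \<open>U\<close> of \<open>E\<close> means that \<open>f\<close> is C^1 and its differential is C^k
  on the open set \<open>U \<times> E\<close> of \<open>E \<times> E\<close>. HOL does not admit this recursion as it stands, because the
  type of the domain changes. It is therefore carried out on the type of sequences, where the
  product of two spaces is formed on the same type by splitting a sequence into its even and its
  odd part; \<open>E\<close> itself is identified with the sequences concentrated at index 0.
  The literal recursion is recovered in \<open>Ck_on_0\<close> and \<open>Ck_on_Suc\<close> below.
\<close>

definition unshuffle :: "(nat \<Rightarrow> 'a) \<Rightarrow> (nat \<Rightarrow> 'a) \<times> (nat \<Rightarrow> 'a)" where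
  "unshuffle z = ((\<lambda>i. z (2 * i)), (\<lambda>i. z (2 * i + 1)))"

primrec Ck_seq ::
    "nat \<Rightarrow> (nat \<Rightarrow> 'a::real_vector) topology \<Rightarrow> 'b::real_vector topology \<Rightarrow>
     (nat \<Rightarrow> 'a) set \<Rightarrow> ((nat \<Rightarrow> 'a) \<Rightarrow> 'b) \<Rightarrow> bool" where
  "Ck_seq 0 E F U f \<longleftrightarrow> openin E U \<and> continuous_map (subtopology E U) F f"
| "Ck_seq (Suc k) E F U f \<longleftrightarrow>
     C1_on E F U f \<and>
     Ck_seq k (pullback_topology UNIV unshuffle (prod_topology E E)) F
       (unshuffle -` (U \<times> topspace E)) ((\<lambda>(x, y). dir_deriv F f x y) \<circ> unshuffle)"

definition Ck_on ::
    "nat \<Rightarrow> 'a::real_vector topology \<Rightarrow> 'b::real_vector topology \<Rightarrow> 'a set \<Rightarrow> ('a \<Rightarrow> 'b) \<Rightarrow> bool" where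
  "Ck_on k E F U f \<longleftrightarrow>
     Ck_seq k (pullback_topology {z. \<forall>i>0. z i = 0} (\<lambda>z. z 0) E) F
       {z. (\<forall>i>0. z i = 0) \<and> z 0 \<in> U} (f \<circ> (\<lambda>z. z 0))"

definition smooth_on ::
    "'a::real_vector topology \<Rightarrow> 'b::real_vector topology \<Rightarrow> 'a set \<Rightarrow> ('a \<Rightarrow> 'b) \<Rightarrow> bool" where
  "smooth_on E F U f \<longleftrightarrow> (\<forall>k. Ck_on k E F U f)"

lemma image_Int_vimage: "U \<subseteq> h ` A \<Longrightarrow> h ` (A \<inter> h -` U) = U"
  by blast

lemma homeomorphic_map_subtopology:
  assumes h: "homeomorphic_map E1 E2 h" and U: "U \<subseteq> topspace E2"
  shows "homeomorphic_map (subtopology E1 (topspace E1 \<inter> h -` U)) (subtopology E2 U) h"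
proof (rule homeomorphic_map_subtopologies[OF h])
  show "h ` (topspace E1 \<inter> (topspace E1 \<inter> h -` U)) = topspace E2 \<inter> U"
    using U homeomorphic_imp_surjective_map[OF h] image_Int_vimage[of U h "topspace E1"]
    by (simp add: Int_absorb1)
qed

lemma continuous_map_homeo_iff:
  assumes h: "homeomorphic_map X Y h"
  shows "continuous_map X F (f \<circ> h) \<longleftrightarrow> continuous_map Y F f"
proof
  assume "continuous_map Y F f"
  thus "continuous_map X F (f \<circ> h)"
    using continuous_map_compose homeomorphic_imp_continuous_map[OF h] by blast
next
  assume "continuous_map X F (f \<circ> h)"
  thus "continuous_map Y F f"
    using h continuous_compose_quotient_map_eq unfolding homeomorphic_map_def by blast
qed

lemma homeomorphic_map_pullback:
  assumes "bij_betw h A (topspace E)"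
  shows "homeomorphic_map (pullback_topology A h E) E h"
proof -
  have img: "h ` A = topspace E" and inj: "inj_on h A"
    using assms by (auto simp: bij_betw_def)
  have ts: "topspace (pullback_topology A h E) = A"
    unfolding topspace_pullback_topology using img by auto
  show ?thesis
  proof (rule bijective_open_imp_homeomorphic_map)
    show "continuous_map (pullback_topology A h E) E h"
      unfolding continuous_map_def ts
    proof (intro conjI allI impI)
      show "h \<in> A \<rightarrow> topspace E" using img by auto
    next
      fix U assume "openin E U"
      thus "openin (pullback_topology A h E) {x \<in> A. h x \<in> U}"
        unfolding openin_pullback_topology by (intro exI[of _ U]) auto
    qed
    show "open_map (pullback_topology A h E) E h"
      unfolding open_map_def
    proof (intro allI impI)
      fix V assume "openin (pullback_topology A h E) V"
      then obtain U where U: "openin E U" "V = h -` U \<inter> A"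
        unfolding openin_pullback_topology by blast
      have "h ` V = U"
        using image_Int_vimage[of U h A] openin_subset[OF U(1)] img U(2) by (simp add: Int_commute)
      thus "openin E (h ` V)" using U(1) by simp
    qed
    show "h ` topspace (pullback_topology A h E) = topspace E" "inj_on h (topspace (pullback_topology A h E))"
      using img inj ts by auto
  qed
qed

lemma bij_unshuffle: "bij (unshuffle :: (nat \<Rightarrow> 'a) \<Rightarrow> _)"
proof (rule bijI)
  show "inj (unshuffle :: (nat \<Rightarrow> 'a) \<Rightarrow> _)"
  proof (rule injI)
    fix x y :: "nat \<Rightarrow> 'a" assume "unshuffle x = unshuffle y"
    hence e: "x (2 * i) = y (2 * i)" "x (2 * i + 1) = y (2 * i + 1)" for i
      unfolding unshuffle_def by (auto dest: fun_cong)
    show "x = y"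
    proof
      fix i show "x i = y i" using e[of "i div 2"] by (cases "even i") auto
    qed
  qed
  show "surj (unshuffle :: (nat \<Rightarrow> 'a) \<Rightarrow> _)"
  proof -
    have "unshuffle (\<lambda>i. if even i then fst p (i div 2) else snd p (i div 2)) = p"
      for p :: "(nat \<Rightarrow> 'a) \<times> (nat \<Rightarrow> 'a)"
      by (simp add: unshuffle_def)
    thus ?thesis unfolding surj_def by (metis (no_types))
  qed
qed

lemma homeomorphic_map_prod:
  assumes h: "homeomorphic_map E1 E2 h"
  shows "homeomorphic_map (prod_topology E1 E1) (prod_topology E2 E2) (map_prod h h)"
proof -
  obtain g where g: "homeomorphic_maps E1 E2 h g"
    using h homeomorphic_map_maps by blast
  have "homeomorphic_maps (prod_topology E1 E1) (prod_topology E2 E2) (\<lambda>(x,y). (h x, h y)) (\<lambda>(x,y). (g x, g y))"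
    using g homeomorphic_maps_prod by blast
  moreover have "(\<lambda>(x,y). (h x, h y)) = map_prod h h" by auto
  ultimately show ?thesis
    using homeomorphic_maps_map by metis
qed

lemma dir_deriv_comp_linear:
  assumes "linear h"
  shows "dir_deriv F (f \<circ> h) x y = dir_deriv F f (h x) (h y)"
  unfolding dir_deriv_def o_def
  by (simp add: linear_add[OF assms] linear_cmul[OF assms])

lemma C1_on_comp_linear:
  assumes lin: "linear h" and h: "homeomorphic_map E1 E2 h" and U: "U \<subseteq> topspace E2"
  shows "C1_on E1 F (topspace E1 \<inter> h -` U) (f \<circ> h) \<longleftrightarrow> C1_on E2 F U f"
proof -
  let ?V = "topspace E1 \<inter> h -` U"
  have img: "h ` topspace E1 = topspace E2" by (rule homeomorphic_imp_surjective_map[OF h])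
  have imV: "h ` ?V = U" using image_Int_vimage[of U h "topspace E1"] img U by simp
  have 1: "openin E1 ?V \<longleftrightarrow> openin E2 U"
    using homeomorphic_map_openness[OF h, of ?V] imV by auto
  have 2: "continuous_map (subtopology E1 ?V) F (f \<circ> h) \<longleftrightarrow> continuous_map (subtopology E2 U) F f"
    by (rule continuous_map_homeo_iff[OF homeomorphic_map_subtopology[OF h U]])
  have 3: "(\<forall>x\<in>?V. \<forall>y\<in>topspace E1. \<exists>l. limitin F (\<lambda>t. ((f \<circ> h) (x + t *\<^sub>R y) - (f \<circ> h) x) /\<^sub>R t) l (at (0::real)))
     \<longleftrightarrow> (\<forall>x\<in>U. \<forall>y\<in>topspace E2. \<exists>l. limitin F (\<lambda>t. (f (x + t *\<^sub>R y) - f x) /\<^sub>R t) l (at (0::real)))"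
    (is "?L1 \<longleftrightarrow> ?L2")
  proof -
    have "?L2 \<longleftrightarrow> (\<forall>x\<in>h ` ?V. \<forall>y\<in>h ` topspace E1.
       \<exists>l. limitin F (\<lambda>t. (f (x + t *\<^sub>R y) - f x) /\<^sub>R t) l (at (0::real)))"
      by (simp only: imV img)
    also have "\<dots> \<longleftrightarrow> ?L1"
      by (simp only: ball_simps o_def linear_add[OF lin] linear_cmul[OF lin])
    finally show ?thesis by simp
  qed
  have "(topspace (prod_topology E1 E1) \<inter> map_prod h h -` (U \<times> topspace E2)) = ?V \<times> topspace E1"
    using img by auto
  moreover have "U \<times> topspace E2 \<subseteq> topspace (prod_topology E2 E2)" using U by auto
  ultimately have "homeomorphic_map (subtopology (prod_topology E1 E1) (?V \<times> topspace E1))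
     (subtopology (prod_topology E2 E2) (U \<times> topspace E2)) (map_prod h h)"
    using homeomorphic_map_subtopology[OF homeomorphic_map_prod[OF h]] by metis
  moreover have "(\<lambda>(x, y). dir_deriv F (f \<circ> h) x y) = (\<lambda>(x, y). dir_deriv F f x y) \<circ> map_prod h h"
    by (auto simp: dir_deriv_comp_linear[OF lin])
  ultimately have 4: "continuous_map (subtopology (prod_topology E1 E1) (?V \<times> topspace E1)) F
       (\<lambda>(x, y). dir_deriv F (f \<circ> h) x y) \<longleftrightarrow>
     continuous_map (subtopology (prod_topology E2 E2) (U \<times> topspace E2)) F
       (\<lambda>(x, y). dir_deriv F f x y)"
    by (simp only: continuous_map_homeo_iff)
  show ?thesis unfolding C1_on_def using 1 2 3 4 by simp
qed

lemma Ck_seq_comp_linear: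
  fixes h :: "(nat \<Rightarrow> 'a::real_vector) \<Rightarrow> (nat \<Rightarrow> 'c::real_vector)"
  assumes "linear h" "homeomorphic_map E1 E2 h" "U \<subseteq> topspace E2"
  shows "Ck_seq k E1 F (topspace E1 \<inter> h -` U) (f \<circ> h) \<longleftrightarrow> Ck_seq k E2 F U f"
  using assms
proof (induction k arbitrary: E1 E2 U f h)
  case 0
  have "homeomorphic_map (subtopology E1 (topspace E1 \<inter> h -` U)) (subtopology E2 U) h"
    using homeomorphic_map_subtopology 0 by blast
  moreover have "h ` (topspace E1 \<inter> h -` U) = U"
    using image_Int_vimage[of U h "topspace E1"] homeomorphic_imp_surjective_map[OF 0(2)] 0(3)
    by simp
  ultimately show ?case
    using continuous_map_homeo_iff[of _ _ h F f]
      homeomorphic_map_openness[OF 0(2), of "topspace E1 \<inter> h -` U"]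
    by (simp only: Ck_seq.simps) simp
next
  case (Suc k)
  let ?P1 = "pullback_topology UNIV unshuffle (prod_topology E1 E1)"
  let ?P2 = "pullback_topology UNIV unshuffle (prod_topology E2 E2)"
  define h' where "h' = inv_into UNIV unshuffle \<circ> map_prod h h \<circ> (unshuffle :: (nat \<Rightarrow> 'a) \<Rightarrow> _)"
  have uh: "unshuffle (h' z) = map_prod h h (unshuffle z)" for z
    unfolding h'_def by (simp add: surj_f_inv_f[OF bij_is_surj[OF bij_unshuffle]])
  have inju: "unshuffle x = unshuffle y \<Longrightarrow> x = y" for x y :: "nat \<Rightarrow> 'c"
    using bij_is_inj[OF bij_unshuffle] by (meson injD)
  have u_add: "unshuffle (x + y) = unshuffle x + unshuffle y" for x y :: "nat \<Rightarrow> 'd::real_vector"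
    by (simp add: unshuffle_def plus_prod_def fun_eq_iff)
  have u_sc: "unshuffle (r *\<^sub>R x) = r *\<^sub>R unshuffle x" for r and x :: "nat \<Rightarrow> 'd::real_vector"
    by (simp add: unshuffle_def scaleR_prod_def fun_eq_iff scaleR_fun_def)
  have lin': "linear h'"
  proof (rule linearI)
    fix x y
    have "unshuffle (h' (x + y)) = unshuffle (h' x + h' y)"
      unfolding uh u_add by (simp add: map_prod_def case_prod_unfold linear_add[OF Suc.prems(1)] plus_prod_def)
    thus "h' (x + y) = h' x + h' y" by (rule inju)
  next
    fix r x
    have "unshuffle (h' (r *\<^sub>R x)) = unshuffle (r *\<^sub>R h' x)"
      unfolding uh u_sc by (simp add: map_prod_def case_prod_unfold linear_cmul[OF Suc.prems(1)] scaleR_prod_def)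
    thus "h' (r *\<^sub>R x) = r *\<^sub>R h' x" by (rule inju)
  qed
  have tsP: "topspace (pullback_topology UNIV unshuffle T) = unshuffle -` topspace T"
    for T :: "((nat \<Rightarrow> 'd) \<times> (nat \<Rightarrow> 'd)) topology"
    by (auto simp: topspace_pullback_topology)
  have pull: "homeomorphic_map (pullback_topology UNIV unshuffle T) T unshuffle"
    for T :: "((nat \<Rightarrow> 'd) \<times> (nat \<Rightarrow> 'd)) topology"
  proof -
    have eq: "pullback_topology UNIV unshuffle T = pullback_topology (unshuffle -` topspace T) unshuffle T"
      unfolding topology_eq openin_pullback_topology using openin_subset by fast
    have "bij_betw unshuffle (unshuffle -` topspace T) (topspace T)"
      using bij_unshuffle by (metis bij_betw_def bij_is_inj bij_is_surj inj_on_subset subset_UNIV surj_image_vimage_eq)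
    thus ?thesis unfolding eq by (rule homeomorphic_map_pullback)
  qed
  have h'hom: "homeomorphic_map ?P1 ?P2 h'"
  proof -
    have a: "homeomorphic_map ?P1 (prod_topology E2 E2) (map_prod h h \<circ> unshuffle)"
      using homeomorphic_map_compose[OF pull homeomorphic_map_prod[OF Suc.prems(2)]] .
    obtain g where g: "homeomorphic_maps ?P2 (prod_topology E2 E2) unshuffle g"
      using pull homeomorphic_map_maps by blast
    hence "homeomorphic_map (prod_topology E2 E2) ?P2 g"
      using homeomorphic_maps_map by blast
    with a have "homeomorphic_map ?P1 ?P2 (g \<circ> (map_prod h h \<circ> unshuffle))"
      by (rule homeomorphic_map_compose)
    moreover have "(g \<circ> (map_prod h h \<circ> unshuffle)) z = h' z" if "z \<in> topspace ?P1" for z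
    proof -
      have "unshuffle (g (map_prod h h (unshuffle z))) = map_prod h h (unshuffle z)"
      proof -
        have "map_prod h h (unshuffle z) \<in> topspace (prod_topology E2 E2)"
          using homeomorphic_imp_surjective_map[OF a] that by auto
        thus ?thesis using g unfolding homeomorphic_maps_def by blast
      qed
      hence "unshuffle (g (map_prod h h (unshuffle z))) = unshuffle (h' z)" by (simp only: uh)
      thus ?thesis unfolding comp_apply by (rule inju)
    qed
    ultimately show ?thesis by (rule homeomorphic_map_eq)
  qed
  have img: "h ` topspace E1 = topspace E2" by (rule homeomorphic_imp_surjective_map[OF Suc.prems(2)])
  have sub: "unshuffle -` (U \<times> topspace E2) \<subseteq> topspace ?P2"
    using Suc.prems(3) by (auto simp: tsP)
  have set_eq: "topspace ?P1 \<inter> h' -` unshuffle -` (U \<times> topspace E2)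
      = unshuffle -` ((topspace E1 \<inter> h -` U) \<times> topspace E1)"
    using img by (auto simp: tsP uh)
  have fun_eq: "(\<lambda>(x, y). dir_deriv F (f \<circ> h) x y) \<circ> unshuffle
      = ((\<lambda>(x, y). dir_deriv F f x y) \<circ> unshuffle) \<circ> h'"
    by (rule ext) (simp add: uh dir_deriv_comp_linear[OF Suc.prems(1)] map_prod_def case_prod_unfold)
  show ?case
    unfolding Ck_seq.simps set_eq fun_eq Suc.IH[OF lin' h'hom sub, unfolded set_eq]
    by (simp only: C1_on_comp_linear[OF Suc.prems])
qed

lemma homeomorphic_map_pullback':
  assumes "inj_on h A" "topspace E \<subseteq> h ` A"
  shows "homeomorphic_map (pullback_topology A h E) E h"
proof -
  let ?B = "A \<inter> h -` topspace E"
  have "pullback_topology A h E = pullback_topology ?B h E"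
    unfolding topology_eq openin_pullback_topology using openin_subset by fast
  moreover have "bij_betw h ?B (topspace E)"
    using assms image_Int_vimage[of "topspace E" h A] unfolding bij_betw_def
    by (meson inf_le1 inj_on_subset)
  ultimately show ?thesis using homeomorphic_map_pullback[of h ?B E] by simp
qed

lemma homeomorphic_map_factor:
  assumes p: "homeomorphic_map Y Z p" and q: "homeomorphic_map X Z q"
    and h: "\<And>x. x \<in> topspace X \<Longrightarrow> h x \<in> topspace Y" "\<And>x. x \<in> topspace X \<Longrightarrow> p (h x) = q x"
  shows "homeomorphic_map X Y h"
proof -
  obtain g where g: "homeomorphic_maps Y Z p g"
    using p homeomorphic_map_maps by blast
  hence "homeomorphic_map Z Y g" using homeomorphic_maps_map by blast
  with q have gq: "homeomorphic_map X Y (g \<circ> q)" by (rule homeomorphic_map_compose)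
  have "(g \<circ> q) x = h x" if "x \<in> topspace X" for x
  proof -
    have "g (p (h x)) = h x" using g h(1)[OF that] unfolding homeomorphic_maps_def by blast
    thus ?thesis using h(2)[OF that] by simp
  qed
  with gq show ?thesis by (rule homeomorphic_map_eq)
qed

lemma homeomorphic_map_seq_embed:
  fixes E :: "'a::real_vector topology"
  shows "homeomorphic_map (pullback_topology {z. \<forall>i>0::nat. z i = 0} (\<lambda>z. z 0) E) E (\<lambda>z. z 0)"
proof (rule homeomorphic_map_pullback')
  show "inj_on (\<lambda>z. z 0) {z :: nat \<Rightarrow> 'a. \<forall>i>0. z i = 0}"
  proof (rule inj_onI)
    fix x y :: "nat \<Rightarrow> 'a"
    assume "x \<in> {z. \<forall>i>0. z i = 0}" "y \<in> {z. \<forall>i>0. z i = 0}" "x 0 = y 0"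
    thus "x = y" by (intro ext) (metis (mono_tags) mem_Collect_eq gr0I)
  qed
  have "x \<in> (\<lambda>z. z 0) ` {z :: nat \<Rightarrow> 'a. \<forall>i>0. z i = 0}" for x
    by (rule image_eqI[where x = "\<lambda>i. if i = 0 then x else 0"]) auto
  thus "topspace E \<subseteq> (\<lambda>z. z 0) ` {z :: nat \<Rightarrow> 'a. \<forall>i>0. z i = 0}" by blast
qed

lemma topspace_seq_embed:
  "topspace (pullback_topology {z. \<forall>i>0::nat. z i = 0} (\<lambda>z. z 0) E)
     = {z. (\<forall>i>0. z i = 0) \<and> z 0 \<in> topspace E}"
  by (auto simp: topspace_pullback_topology)

lemma linear_eval: "linear (\<lambda>z :: 'i \<Rightarrow> 'a::real_vector. z i)"
  by (rule linearI) (simp_all add: scaleR_fun_def)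

lemma seq_embed_set:
  assumes "U \<subseteq> topspace E"
  shows "{z. (\<forall>i>0. z i = 0) \<and> z 0 \<in> U} =
    topspace (pullback_topology {z. \<forall>i>0::nat. z i = 0} (\<lambda>z. z 0) E) \<inter> (\<lambda>z. z 0) -` U"
  using assms by (auto simp: topspace_seq_embed)

lemma Ck_on_0:
  assumes U: "U \<subseteq> topspace E"
  shows "Ck_on 0 E F U f \<longleftrightarrow> openin E U \<and> continuous_map (subtopology E U) F f"
proof -
  let ?S = "pullback_topology {z. \<forall>i>0::nat. z i = 0} (\<lambda>z. z 0) E"
  let ?V = "topspace ?S \<inter> (\<lambda>z. z 0) -` U"
  have hom: "homeomorphic_map ?S E (\<lambda>z. z 0)" by (rule homeomorphic_map_seq_embed)
  have "(\<lambda>z. z 0) ` ?V = U"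
    by (rule image_Int_vimage) (simp only: homeomorphic_imp_surjective_map[OF hom] U)
  hence "openin ?S ?V \<longleftrightarrow> openin E U"
    using homeomorphic_map_openness[OF hom, of ?V] by auto
  thus ?thesis
    unfolding Ck_on_def seq_embed_set[OF U] Ck_seq.simps
      continuous_map_homeo_iff[OF homeomorphic_map_subtopology[OF hom U]] by (simp only:)
qed

lemma Ck_on_Suc:
  fixes E :: "'a::real_vector topology"
  assumes U: "U \<subseteq> topspace E"
  shows "Ck_on (Suc k) E F U f \<longleftrightarrow>
    C1_on E F U f \<and> Ck_on k (prod_topology E E) F (U \<times> topspace E) (\<lambda>(x, y). dir_deriv F f x y)"
proof -
  let ?S = "pullback_topology {z. \<forall>i>0::nat. z i = 0} (\<lambda>z. z 0) E"
  let ?T = "pullback_topology {z. \<forall>i>0::nat. z i = 0} (\<lambda>z. z 0) (prod_topology E E)"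
  let ?P = "pullback_topology UNIV unshuffle (prod_topology ?S ?S)"
  let ?V = "topspace ?S \<inter> (\<lambda>z. z 0) -` U"
  define h :: "(nat \<Rightarrow> 'a) \<Rightarrow> (nat \<Rightarrow> 'a \<times> 'a)" where "h z = (\<lambda>i. if i = 0 then (z 0, z 1) else 0)" for z
  have hom: "homeomorphic_map ?S E (\<lambda>z. z 0)" by (rule homeomorphic_map_seq_embed)
  have inju: "inj (unshuffle :: (nat \<Rightarrow> 'a) \<Rightarrow> _)" and suru: "surj (unshuffle :: (nat \<Rightarrow> 'a) \<Rightarrow> _)"
    using bij_unshuffle by (auto simp: bij_def)
  have hu: "homeomorphic_map ?P (prod_topology ?S ?S) unshuffle"
    by (rule homeomorphic_map_pullback') (use inju suru in auto)
  have lin: "linear h"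
    by (rule linearI) (auto simp: h_def fun_eq_iff scaleR_fun_def zero_prod_def)
  have tsP: "topspace ?P = {z. fst (unshuffle z) \<in> topspace ?S \<and> snd (unshuffle z) \<in> topspace ?S}"
    by (auto simp: topspace_pullback_topology mem_Times_iff)
  have hh: "homeomorphic_map ?P ?T h"
  proof (rule homeomorphic_map_factor[OF homeomorphic_map_seq_embed
        homeomorphic_map_compose[OF hu homeomorphic_map_prod[OF hom]]])
    fix x assume "x \<in> topspace ?P"
    thus "h x \<in> topspace ?T"
      by (auto simp: tsP topspace_seq_embed h_def unshuffle_def)
    show "h x 0 = (map_prod (\<lambda>z. z 0) (\<lambda>z. z 0) \<circ> unshuffle) x"
      by (simp add: h_def unshuffle_def)
  qed
  have sub: "U \<times> topspace E \<subseteq> topspace (prod_topology E E)" using U by auto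
  have 1: "unshuffle -` (?V \<times> topspace ?S) =
     topspace ?P \<inter> h -` (topspace ?T \<inter> (\<lambda>z. z 0) -` (U \<times> topspace E))"
    using U by (auto simp: tsP topspace_seq_embed h_def unshuffle_def)
  have 2: "(\<lambda>(x, y). dir_deriv F (f \<circ> (\<lambda>z. z 0)) x y) \<circ> unshuffle
      = ((\<lambda>(x, y). dir_deriv F f x y) \<circ> (\<lambda>z. z 0)) \<circ> h"
    by (rule ext) (simp add: dir_deriv_comp_linear[OF linear_eval] h_def unshuffle_def)
  have 3: "topspace ?T \<inter> (\<lambda>z. z 0) -` (U \<times> topspace E) \<subseteq> topspace ?T" by blast
  show ?thesis
    unfolding Ck_on_def seq_embed_set[OF U] seq_embed_set[OF sub] Ck_seq.simps
      C1_on_comp_linear[OF linear_eval hom U]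
    by (simp only: 1 2 Ck_seq_comp_linear[OF lin hh 3])
qed


section \<open>Regulated and absolutely continuous functions\<close>

text \<open>
  Classes of functions on \<open>[a, b]\<close> modulo equality almost everywhere are represented by classes of
  functions on the real line, extending by 0 outside \<open>[a, b]\<close>.
\<close>

quotient_type (overloaded) 'a aefun = "real \<Rightarrow> 'a" / "\<lambda>f g. AE t in lebesgue. f t = g t"
  by (rule equivpI) (auto intro!: reflpI sympI transpI elim: eventually_mono eventually_elim2)

instantiation aefun :: (real_vector) real_vector
begin

lift_definition zero_aefun :: "'a aefun" is "\<lambda>t. 0" .

lift_definition plus_aefun :: "'a aefun \<Rightarrow> 'a aefun \<Rightarrow> 'a aefun" is "\<lambda>f g t. f t + g t"
  by (erule (1) eventually_elim2) simp

lift_definition minus_aefun :: "'a aefun \<Rightarrow> 'a aefun \<Rightarrow> 'a aefun" is "\<lambda>f g t. f t - g t"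
  by (erule (1) eventually_elim2) simp

lift_definition uminus_aefun :: "'a aefun \<Rightarrow> 'a aefun" is "\<lambda>f t. - f t"
  by (elim eventually_mono) simp

lift_definition scaleR_aefun :: "real \<Rightarrow> 'a aefun \<Rightarrow> 'a aefun" is "\<lambda>r f t. r *\<^sub>R f t"
  by (elim eventually_mono) simp

instance
  by standard (transfer; simp add: algebra_simps)+

end

definition ae_class :: "real \<Rightarrow> real \<Rightarrow> (real \<Rightarrow> 'a::real_vector) \<Rightarrow> 'a aefun" where
  "ae_class a b \<gamma> = abs_aefun (\<lambda>t. if t \<in> {a..b} then \<gamma> t else 0)"

definition is_partition :: "real \<Rightarrow> real \<Rightarrow> nat \<Rightarrow> (nat \<Rightarrow> real) \<Rightarrow> bool" where
  "is_partition a b n p \<longleftrightarrow> p 0 = a \<and> p n = b \<and> (\<forall>j<n. p j < p (Suc j))"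

definition step_function :: "'a topology \<Rightarrow> real \<Rightarrow> real \<Rightarrow> (real \<Rightarrow> 'a) \<Rightarrow> bool" where
  "step_function E a b s \<longleftrightarrow>
     s ` {a..b} \<subseteq> topspace E \<and>
     (\<exists>n p. is_partition a b n p \<and> (\<forall>j<n. \<exists>c. \<forall>t\<in>{p j<..<p (Suc j)}. s t = c))"

definition regulated :: "'a::real_vector topology \<Rightarrow> real \<Rightarrow> real \<Rightarrow> (real \<Rightarrow> 'a) \<Rightarrow> bool" where
  "regulated E a b \<gamma> \<longleftrightarrow>
     \<gamma> ` {a..b} \<subseteq> topspace E \<and>
     (\<exists>s. (\<forall>n. step_function E a b (s n)) \<and>
       (\<forall>W. openin E W \<and> 0 \<in> W \<longrightarrow>
         (\<forall>\<^sub>F n in sequentially. \<forall>t\<in>{a..b}. s n t - \<gamma> t \<in> W)))"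

definition R_set :: "'a::real_vector topology \<Rightarrow> real \<Rightarrow> real \<Rightarrow> 'a aefun set" where
  "R_set E a b = ae_class a b ` {\<gamma>. regulated E a b \<gamma>}"

definition ess_sup :: "('a \<Rightarrow> real) \<Rightarrow> real \<Rightarrow> real \<Rightarrow> 'a aefun \<Rightarrow> real" where
  "ess_sup q a b X = Inf {c. AE t in lebesgue_on {a..b}. q (rep_aefun X t) \<le> c}"

definition R_space :: "'a::real_vector topology \<Rightarrow> real \<Rightarrow> real \<Rightarrow> 'a aefun topology" where
  "R_space E a b = topology_generated_by
     {{Y \<in> R_set E a b. ess_sup q a b (Y - X) < \<epsilon>} | q X \<epsilon>.
        continuous_seminorm E q \<and> X \<in> R_set E a b \<and> 0 < \<epsilon>}"

definition AC_primitive ::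
    "'a::real_vector topology \<Rightarrow> real \<Rightarrow> real \<Rightarrow> (real \<Rightarrow> 'a) \<Rightarrow> (real \<Rightarrow> 'a) \<Rightarrow> bool" where
  "AC_primitive E a b \<eta> \<gamma> \<longleftrightarrow>
     continuous_map (top_of_set {a..b}) E \<eta> \<and> regulated E a b \<gamma> \<and>
     (\<forall>t\<in>{a..b}. weak_integral E a t \<gamma> (\<eta> t - \<eta> a))"

text \<open>Functions on \<open>[a, b]\<close> with values in \<open>E\<close> are normalized to be 0 outside \<open>[a, b]\<close>.\<close>

definition AC_set :: "'a::real_vector topology \<Rightarrow> real \<Rightarrow> real \<Rightarrow> (real \<Rightarrow> 'a) set" where
  "AC_set E a b = {\<eta>. (\<forall>t. t \<notin> {a..b} \<longrightarrow> \<eta> t = 0) \<and> (\<exists>\<gamma>. AC_primitive E a b \<eta> \<gamma>)}"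

definition AC_deriv :: "'a::real_vector topology \<Rightarrow> real \<Rightarrow> real \<Rightarrow> (real \<Rightarrow> 'a) \<Rightarrow> 'a aefun" where
  "AC_deriv E a b \<eta> = (THE X. \<exists>\<gamma>. AC_primitive E a b \<eta> \<gamma> \<and> X = ae_class a b \<gamma>)"

definition AC_space :: "'a::real_vector topology \<Rightarrow> real \<Rightarrow> real \<Rightarrow> (real \<Rightarrow> 'a) topology" where
  "AC_space E a b =
     pullback_topology (AC_set E a b) (\<lambda>\<eta>. (\<eta> a, AC_deriv E a b \<eta>)) (prod_topology E (R_space E a b))"


section \<open>Manifolds\<close>

type_synonym ('m, 'e) chart = "'m set \<times> ('m \<Rightarrow> 'e)"

text \<open>
  A manifold is given by an arbitrary atlas; its charts are the members of the maximal atlas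
  containing it.
\<close>

record ('m, 'e) manifold =
  model :: "'e topology"
  mtop :: "'m topology"
  atlas :: "('m, 'e) chart set"

definition chart_inv :: "('m, 'e) chart \<Rightarrow> 'e \<Rightarrow> 'm" where
  "chart_inv c = inv_into (fst c) (snd c)"

definition smooth_transition ::
    "'e::real_vector topology \<Rightarrow> ('m, 'e) chart \<Rightarrow> ('m, 'e) chart \<Rightarrow> bool" where
  "smooth_transition E c d \<longleftrightarrow> smooth_on E E (snd c ` (fst c \<inter> fst d)) (snd d \<circ> chart_inv c)"

definition charts :: "('m, 'e::real_vector) manifold \<Rightarrow> ('m, 'e) chart set" where
  "charts M = {(U, \<phi>).
     openin (mtop M) U \<and> openin (model M) (\<phi> ` U) \<and>
     homeomorphic_map (subtopology (mtop M) U) (subtopology (model M) (\<phi> ` U)) \<phi> \<and>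
     (\<forall>d\<in>atlas M. smooth_transition (model M) (U, \<phi>) d \<and> smooth_transition (model M) d (U, \<phi>))}"

definition charts_at :: "('m, 'e::real_vector) manifold \<Rightarrow> 'm \<Rightarrow> ('m, 'e) chart set" where
  "charts_at M x = {c \<in> charts M. x \<in> fst c}"

definition smooth_manifold :: "('m, 'e::real_vector) manifold \<Rightarrow> bool" where
  "smooth_manifold M \<longleftrightarrow>
     lcs (model M) \<and> Hausdorff_space (mtop M) \<and>
     atlas M \<subseteq> charts M \<and> (\<Union>c\<in>atlas M. fst c) = topspace (mtop M)"

definition lcs_manifold :: "'e topology \<Rightarrow> ('e, 'e) manifold" where
  "lcs_manifold E = \<lparr>model = E, mtop = E, atlas = {(topspace E, \<lambda>x. x)}\<rparr>"

definition prod_manifold ::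
    "('m, 'e) manifold \<Rightarrow> ('n, 'f) manifold \<Rightarrow> ('m \<times> 'n, 'e \<times> 'f) manifold" where
  "prod_manifold M N =
     \<lparr>model = prod_topology (model M) (model N), mtop = prod_topology (mtop M) (mtop N),
      atlas = {(U \<times> W, map_prod \<phi> \<psi>) | U \<phi> W \<psi>. (U, \<phi>) \<in> atlas M \<and> (W, \<psi>) \<in> atlas N}\<rparr>"

definition smooth_map_on ::
    "('m, 'e::real_vector) manifold \<Rightarrow> ('n, 'f::real_vector) manifold \<Rightarrow> 'm set \<Rightarrow>
     ('m \<Rightarrow> 'n) \<Rightarrow> bool" where
  "smooth_map_on M N S f \<longleftrightarrow>
     openin (mtop M) S \<and> continuous_map (subtopology (mtop M) S) (mtop N) f \<and>
     (\<forall>c\<in>charts M. \<forall>d\<in>charts N.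
        smooth_on (model M) (model N) (snd c ` {x \<in> S \<inter> fst c. f x \<in> fst d})
          (snd d \<circ> f \<circ> chart_inv c))"

definition diffeomorphism_on ::
    "('m, 'e::real_vector) manifold \<Rightarrow> ('n, 'f::real_vector) manifold \<Rightarrow> 'm set \<Rightarrow> 'n set \<Rightarrow>
     ('m \<Rightarrow> 'n) \<Rightarrow> bool" where
  "diffeomorphism_on M N S T f \<longleftrightarrow>
     bij_betw f S T \<and> smooth_map_on M N S f \<and> smooth_map_on N M T (inv_into S f)"

text \<open>
  A tangent vector at \<open>x\<close> is a family of elements of the model space, indexed by the charts around
  \<open>x\<close> and compatible with the differentials of the transition maps. It is extended by 0 to all other
  pairs, so that the vector space operations are the pointwise ones.
\<close>

type_synonym ('m, 'e) tvec = "('m, 'e) chart \<Rightarrow> 'e"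

definition tangent_set :: "('m, 'e::real_vector) manifold \<Rightarrow> 'm \<Rightarrow> ('m, 'e) tvec set" where
  "tangent_set M x = {v.
     (\<forall>c. c \<notin> charts_at M x \<longrightarrow> v c = 0) \<and>
     (\<forall>c\<in>charts_at M x. v c \<in> topspace (model M)) \<and>
     (\<forall>c\<in>charts_at M x. \<forall>d\<in>charts_at M x.
        v d = dir_deriv (model M) (snd d \<circ> chart_inv c) (snd c x) (v c))}"

definition tangent_space :: "('m, 'e::real_vector) manifold \<Rightarrow> 'm \<Rightarrow> ('m, 'e) tvec topology" where
  "tangent_space M x = topology_generated_by
     {{v \<in> tangent_set M x. v c \<in> U} | c U. c \<in> charts_at M x \<and> openin (model M) U}"

definition chart_vec :: "('m, 'e::real_vector) manifold \<Rightarrow> ('m, 'e) chart \<Rightarrow> 'e \<Rightarrow> 'e \<Rightarrow> ('m, 'e) tvec" where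
  \<comment> \<open>the image of \<open>(y, w)\<close> under the tangent map of the inverse of the chart \<open>c\<close>\<close>
  "chart_vec M c y w = (\<lambda>d. if d \<in> charts_at M (chart_inv c y)
     then dir_deriv (model M) (snd d \<circ> chart_inv c) y w else 0)"

definition tangent_map ::
    "('m, 'e::real_vector) manifold \<Rightarrow> ('n, 'f::real_vector) manifold \<Rightarrow> ('m \<Rightarrow> 'n) \<Rightarrow> 'm \<Rightarrow>
     ('m, 'e) tvec \<Rightarrow> ('n, 'f) tvec" where
  "tangent_map M N f x v = (\<lambda>d. if d \<in> charts_at N (f x)
     then let c = (SOME c. c \<in> charts_at M x)
          in dir_deriv (model N) (snd d \<circ> f \<circ> chart_inv c) (snd c x) (v c)
     else 0)"

definition vector_field_bracket ::
    "('m, 'e::real_vector) manifold \<Rightarrow> ('m \<Rightarrow> ('m, 'e) tvec) \<Rightarrow> ('m \<Rightarrow> ('m, 'e) tvec) \<Rightarrow> 'm \<Rightarrow>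
     ('m, 'e) tvec" where
  "vector_field_bracket M X Y x = (\<lambda>c. if c \<in> charts_at M x
     then dir_deriv (model M) (\<lambda>y. Y (chart_inv c y) c) (snd c x) (X x c) -
          dir_deriv (model M) (\<lambda>y. X (chart_inv c y) c) (snd c x) (Y x c)
     else 0)"

text \<open>The derivative at \<open>t\<close> of a curve in \<open>M\<close> with parameter set \<open>J\<close>.\<close>

definition velocity ::
    "('m, 'e::real_vector) manifold \<Rightarrow> real set \<Rightarrow> (real \<Rightarrow> 'm) \<Rightarrow> real \<Rightarrow> ('m, 'e) tvec" where
  "velocity M J \<gamma> t = (\<lambda>c. if c \<in> charts_at M (\<gamma> t)
     then THE l. limitin (model M) (\<lambda>s. (snd c (\<gamma> s) - snd c (\<gamma> t)) /\<^sub>R (s - t)) l (at t within J)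
     else 0)"

definition C1_curve_on :: "'e::real_vector topology \<Rightarrow> real set \<Rightarrow> (real \<Rightarrow> 'e) \<Rightarrow> bool" where
  "C1_curve_on E J \<gamma> \<longleftrightarrow>
     continuous_map (top_of_set J) E \<gamma> \<and>
     (\<exists>\<gamma>'. continuous_map (top_of_set J) E \<gamma>' \<and>
       (\<forall>t\<in>J. limitin E (\<lambda>s. (\<gamma> s - \<gamma> t) /\<^sub>R (s - t)) (\<gamma>' t) (at t within J)))"

definition C1_curve :: "('m, 'e::real_vector) manifold \<Rightarrow> (real \<Rightarrow> 'm) \<Rightarrow> bool" where
  "C1_curve M \<gamma> \<longleftrightarrow>
     continuous_map (top_of_set {0..1}) (mtop M) \<gamma> \<and>
     (\<forall>c\<in>charts M. C1_curve_on (model M) {t \<in> {0..1}. \<gamma> t \<in> fst c} (snd c \<circ> \<gamma>))"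


section \<open>Lie groups\<close>

record ('g, 'e) lie_structure = "'g monoid" +
  mfd :: "('g, 'e) manifold"

definition lie_group :: "('g, 'e::real_vector) lie_structure \<Rightarrow> bool" where
  "lie_group G \<longleftrightarrow>
     group G \<and> smooth_manifold (mfd G) \<and> topspace (mtop (mfd G)) = carrier G \<and>
     smooth_map_on (prod_manifold (mfd G) (mfd G)) (mfd G) (carrier G \<times> carrier G)
       (\<lambda>(x, y). x \<otimes>\<^bsub>G\<^esub> y) \<and>
     smooth_map_on (mfd G) (mfd G) (carrier G) (\<lambda>x. inv\<^bsub>G\<^esub> x)"

definition lie_algebra :: "('g, 'e::real_vector) lie_structure \<Rightarrow> ('g, 'e) tvec topology" where
  "lie_algebra G = tangent_space (mfd G) \<one>\<^bsub>G\<^esub>"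

text \<open>\<open>left_act G g x v\<close> is \<open>g.v\<close> for a tangent vector \<open>v\<close> at \<open>x\<close>.\<close>

definition left_act ::
    "('g, 'e::real_vector) lie_structure \<Rightarrow> 'g \<Rightarrow> 'g \<Rightarrow> ('g, 'e) tvec \<Rightarrow> ('g, 'e) tvec" where
  "left_act G g x v = tangent_map (mfd G) (mfd G) (\<lambda>h. g \<otimes>\<^bsub>G\<^esub> h) x v"

text \<open>The Lie bracket is that of the left invariant vector fields.\<close>

definition lie_bracket ::
    "('g, 'e::real_vector) lie_structure \<Rightarrow> ('g, 'e) tvec \<Rightarrow> ('g, 'e) tvec \<Rightarrow> ('g, 'e) tvec" where
  "lie_bracket G v w =
     vector_field_bracket (mfd G) (\<lambda>g. left_act G g \<one>\<^bsub>G\<^esub> v) (\<lambda>g. left_act G g \<one>\<^bsub>G\<^esub> w) \<one>\<^bsub>G\<^esub>"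

definition AC_data ::
    "('g, 'e::real_vector) lie_structure \<Rightarrow> (real \<Rightarrow> 'g) \<Rightarrow> nat \<Rightarrow> (nat \<Rightarrow> real) \<Rightarrow>
     (nat \<Rightarrow> ('g, 'e) chart) \<Rightarrow> (nat \<Rightarrow> real \<Rightarrow> 'e) \<Rightarrow> bool" where
  "AC_data G \<eta> n p c \<gamma> \<longleftrightarrow>
     is_partition 0 1 n p \<and>
     (\<forall>j<n. c j \<in> charts (mfd G) \<and> \<eta> ` {p j..p (Suc j)} \<subseteq> fst (c j) \<and>
        AC_primitive (model (mfd G)) (p j) (p (Suc j)) (snd (c j) \<circ> \<eta>) (\<gamma> j))"

definition AC_group_set :: "('g, 'e::real_vector) lie_structure \<Rightarrow> (real \<Rightarrow> 'g) set" where
  "AC_group_set G = {\<eta> \<in> extensional {0..1}.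
     continuous_map (top_of_set {0..1}) (mtop (mfd G)) \<eta> \<and> (\<exists>n p c \<gamma>. AC_data G \<eta> n p c \<gamma>)}"

text \<open>\<open>left_log_deriv G \<eta> X\<close> states that \<open>X\<close> is the left logarithmic derivative of \<open>\<eta>\<close>.\<close>

definition left_log_deriv ::
    "('g, 'e::real_vector) lie_structure \<Rightarrow> (real \<Rightarrow> 'g) \<Rightarrow> ('g, 'e) tvec aefun \<Rightarrow> bool" where
  "left_log_deriv G \<eta> X \<longleftrightarrow>
     (\<exists>n p c \<gamma> f. AC_data G \<eta> n p c \<gamma> \<and>
        (\<forall>j<n. \<forall>t\<in>{p j..<p (Suc j)}.
           f t = left_act G (inv\<^bsub>G\<^esub> (\<eta> t)) (\<eta> t) (chart_vec (mfd G) (c j) (snd (c j) (\<eta> t)) (\<gamma> j t))) \<and>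
        X = ae_class 0 1 f)"

definition AC_group ::
    "('g, 'e::real_vector) lie_structure \<Rightarrow> (real \<Rightarrow> 'g, real \<Rightarrow> 'e) manifold \<Rightarrow>
     (real \<Rightarrow> 'g, real \<Rightarrow> 'e) lie_structure" where
  "AC_group G M =
     \<lparr>carrier = AC_group_set G,
      monoid.mult = (\<lambda>\<eta> \<zeta>. \<lambda>t\<in>{0..1}. \<eta> t \<otimes>\<^bsub>G\<^esub> \<zeta> t),
      one = (\<lambda>t\<in>{0..1}. \<one>\<^bsub>G\<^esub>),
      mfd = M\<rparr>"

text \<open>
  \<open>AC_manifold G M\<close> states that \<open>M\<close> is the (unique) manifold structure defining the Lie group
  structure of the group of absolutely continuous functions from \<open>[0, 1]\<close> to \<open>G\<close>.
\<close>

definition AC_manifold ::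
    "('g, 'e::real_vector) lie_structure \<Rightarrow> (real \<Rightarrow> 'g, real \<Rightarrow> 'e) manifold \<Rightarrow> bool" where
  "AC_manifold G M \<longleftrightarrow>
     lie_group (AC_group G M) \<and> model M = AC_space (model (mfd G)) 0 1 \<and>
     (\<forall>(U, \<phi>)\<in>charts (mfd G). \<one>\<^bsub>G\<^esub> \<in> U \<and> (\<lambda>x. inv\<^bsub>G\<^esub> x) ` U = U \<longrightarrow>
        (let S = {\<eta> \<in> AC_group_set G. \<eta> ` {0..1} \<subseteq> U};
             T = {\<zeta> \<in> AC_set (model (mfd G)) 0 1. \<zeta> ` {0..1} \<subseteq> \<phi> ` U}
         in openin (mtop M) S \<and> openin (AC_space (model (mfd G)) 0 1) T \<and>
            diffeomorphism_on M (lcs_manifold (AC_space (model (mfd G)) 0 1)) S T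
              (\<lambda>\<eta> t. if t \<in> {0..1} then \<phi> (\<eta> t) else 0)))"

definition R_regular :: "('g, 'e::real_vector) lie_structure \<Rightarrow> bool" where
  "R_regular G \<longleftrightarrow>
     (\<exists>Evol.
        (\<forall>X\<in>R_set (lie_algebra G) 0 1.
           Evol X \<in> AC_group_set G \<and> Evol X 0 = \<one>\<^bsub>G\<^esub> \<and> left_log_deriv G (Evol X) X) \<and>
        (\<exists>M. AC_manifold G M \<and>
           smooth_map_on (lcs_manifold (R_space (lie_algebra G) 0 1)) M (R_set (lie_algebra G) 0 1) Evol))"

definition smooth_exponential ::
    "('g, 'e::real_vector) lie_structure \<Rightarrow> (('g, 'e) tvec \<Rightarrow> 'g) \<Rightarrow> bool" where
  "smooth_exponential G expG \<longleftrightarrow>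
     smooth_map_on (lcs_manifold (lie_algebra G)) (mfd G) (topspace (lie_algebra G)) expG \<and>
     (\<forall>v\<in>topspace (lie_algebra G).
        smooth_map_on (lcs_manifold euclideanreal) (mfd G) UNIV (\<lambda>t. expG (t *\<^sub>R v)) \<and>
        (\<forall>s t. expG ((s + t) *\<^sub>R v) = expG (s *\<^sub>R v) \<otimes>\<^bsub>G\<^esub> expG (t *\<^sub>R v)) \<and>
        velocity (mfd G) UNIV (\<lambda>t. expG (t *\<^sub>R v)) 0 = v)"

definition uniform_limit_on ::
    "('g, 'e) lie_structure \<Rightarrow> real set \<Rightarrow> (nat \<Rightarrow> real \<Rightarrow> 'g) \<Rightarrow> (real \<Rightarrow> 'g) \<Rightarrow> bool" where
  "uniform_limit_on G K f g \<longleftrightarrow>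
     (\<forall>U. openin (mtop (mfd G)) U \<and> \<one>\<^bsub>G\<^esub> \<in> U \<longrightarrow>
        (\<forall>\<^sub>F n in sequentially. \<forall>t\<in>K. f n t \<in> (g t <#\<^bsub>G\<^esub> U) \<inter> (U #>\<^bsub>G\<^esub> g t)))"

definition strong_Trotter :: "('g, 'e::real_vector) lie_structure \<Rightarrow> bool" where
  "strong_Trotter G \<longleftrightarrow>
     (\<exists>expG. smooth_exponential G expG \<and>
       (\<forall>\<gamma>. C1_curve (mfd G) \<gamma> \<and> \<gamma> 0 = \<one>\<^bsub>G\<^esub> \<longrightarrow>
         (\<forall>K. compact K \<and> K \<subseteq> {0..} \<longrightarrow>
           uniform_limit_on G K
             (\<lambda>n t. \<gamma> (t / real n) [^]\<^bsub>G\<^esub> n)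
             (\<lambda>t. expG (t *\<^sub>R velocity (mfd G) {0..1} \<gamma> 0)))))"

definition strong_commutator :: "('g, 'e::real_vector) lie_structure \<Rightarrow> bool" where
  "strong_commutator G \<longleftrightarrow>
     (\<exists>expG. smooth_exponential G expG \<and>
       (\<forall>\<gamma> \<eta>. C1_curve (mfd G) \<gamma> \<and> \<gamma> 0 = \<one>\<^bsub>G\<^esub> \<and> C1_curve (mfd G) \<eta> \<and> \<eta> 0 = \<one>\<^bsub>G\<^esub> \<longrightarrow>
         (\<forall>K. compact K \<and> K \<subseteq> {0..} \<longrightarrow>
           uniform_limit_on G K
             (\<lambda>n t. (\<gamma> (sqrt t / real n) \<otimes>\<^bsub>G\<^esub> \<eta> (sqrt t / real n) \<otimes>\<^bsub>G\<^esub>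
                      inv\<^bsub>G\<^esub> (\<gamma> (sqrt t / real n)) \<otimes>\<^bsub>G\<^esub> inv\<^bsub>G\<^esub> (\<eta> (sqrt t / real n))) [^]\<^bsub>G\<^esub> (n ^ 2))
             (\<lambda>t. expG (t *\<^sub>R lie_bracket G (velocity (mfd G) {0..1} \<gamma> 0)
                                              (velocity (mfd G) {0..1} \<eta> 0))))))"

end

theory Submission
  imports Defs
begin

text \<open>
  The map \<open>evol X = Evol X 1\<close> from \<open>R([0, 1], L(G))\<close> to \<open>G\<close> is smooth, hence continuous, and \<open>exp v\<close> is
  its value at the constant \<open>v\<close>. Let \<open>k\<close> be the left logarithmic derivative of a C^1 curve \<open>\<gamma>\<close> starting
  at the neutral element, so that \<open>k(0) = \<gamma>'(0)\<close>. The function \<open>X(n, t)\<close> with the values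
  \<open>t k(t (s - j/n))\<close> for \<open>s\<close> in \<open>[j/n, (j+1)/n[\<close> is regulated, and the uniqueness of evolutions gives
  \<open>\<gamma>(t/n)^n = evol X(n, t)\<close>. As \<open>n\<close> tends to infinity, \<open>X(n, t)\<close> tends to the constant \<open>t \<gamma>'(0)\<close>
  uniformly in \<open>s\<close>, and locally uniformly in \<open>t\<close>. So the Trotter formula expresses the continuity of
  \<open>evol\<close> at the constants.

  This argument uses the derivative of \<open>\<gamma>\<close> at positive times only, and its limit at 0. It therefore also applies to
  the curve \<open>\<alpha>(t) = \<gamma>(r) \<eta>(r) \<gamma>(r)\<^sup>-\<^sup>1 \<eta>(r)\<^sup>-\<^sup>1\<close> with \<open>r = sqrt t\<close>. In a chart, the commutator map has
  vanishing differential at the neutral element, and its second derivative shows that \<open>\<alpha>'(t)\<close> tends to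
  \<open>[\<gamma>'(0), \<eta>'(0)]\<close> as \<open>t\<close> tends to 0. The commutator formula is the Trotter formula for \<open>\<alpha>\<close>
  along the squares.
\<close>

section \<open>Seminorms and functionals on locally convex spaces\<close>

text \<open>Evolutions are unique because all exceptional sets are countable. A regulated function
  is continuous off a countable set, its primitives are differentiable there, and a continuous curve
  whose derivative vanishes off a countable set is constant. For null sets the last step would fail
  (Cantor function). Hence equality of classes is upgraded to equality at the common points of
  continuity of two representatives.

  The Lie group of absolutely continuous curves is described by charts near its neutral element
  only. Smoothness of the evaluation at 1 is proved there, where it is linear in a chart, and then
  translated.

  Curves are differentiated by means of \<open>inv (\<zeta> t) \<otimes> \<zeta> s\<close> in one
  fixed chart at the neutral element. This makes left translations and affine changes of the
  parameter harmless, although the curve itself may leave the chart.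

  Uniformity in \<open>t\<close> comes from limits in \<open>n\<close> and \<open>t\<close> jointly
  and from compactness. Both one-sided quotients of the two sides of the formula tend to the neutral
  element, which gives the two-sided form of the convergence.\<close>

definition sublinear :: "('a::real_vector \<Rightarrow> real) \<Rightarrow> bool" where
  "sublinear p \<longleftrightarrow> (\<forall>x y. p (x + y) \<le> p x + p y) \<and> (\<forall>r\<ge>0. \<forall>x. p (r *\<^sub>R x) = r * p x)"

text \<open>For positive scalars one inequality suffices: applied to the inverse scalar it gives the
  other one.\<close>

lemma sublinearI:
  assumes add: "\<And>x y. p (x + y) \<le> p x + p y"
    and hom: "\<And>r x. 0 < r \<Longrightarrow> p (r *\<^sub>R x) \<le> r * p x" and zero: "p 0 = 0"
  shows "sublinear p"
  unfolding sublinear_def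
proof (intro conjI allI impI add)
  fix r :: real and x assume "0 \<le> r"
  show "p (r *\<^sub>R x) = r * p x"
  proof (cases "r = 0")
    case False
    hence r: "0 < r" using \<open>0 \<le> r\<close> by simp
    have "p x \<le> inverse r * p (r *\<^sub>R x)"
      using hom[of "inverse r" "r *\<^sub>R x"] r by simp
    hence "r * p x \<le> p (r *\<^sub>R x)" using r by (simp add: field_simps)
    with hom[OF r, of x] show ?thesis by simp
  qed (simp add: zero)
qed

lemma sublinear_zero: "sublinear p \<Longrightarrow> p 0 = 0"
  unfolding sublinear_def by (metis mult_zero_left order_refl scale_zero_left)

lemma sublinear_lower: "sublinear p \<Longrightarrow> - p (- x) \<le> p x"
  using sublinear_zero[of p] unfolding sublinear_def by (metis add.right_inverse diff_0 diff_le_eq)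

text \<open>The single step of Hahn-Banach. Any sublinear \<open>p'\<close> as required satisfies
  \<open>p' y \<le> p (y + t *\<^sub>R a) - t * p a\<close> for all \<open>t \<ge> 0\<close>, and
  the infimum \<open>D\<close> of these right-hand sides turns out to be sublinear itself.\<close>

lemma sublinear_decrease:
  assumes p: "sublinear p"
  shows "\<exists>p'. sublinear p' \<and> (\<forall>x. p' x \<le> p x) \<and> p' (- a) \<le> - p a"
proof -
  define D where "D y = (INF t\<in>{0..}. p (y + t *\<^sub>R a) - t * p a)" for y
  have add: "p (x + y) \<le> p x + p y" and hom: "0 \<le> r \<Longrightarrow> p (r *\<^sub>R x) = r * p x" for x y r
    using p by (auto simp: sublinear_def)
  \<comment> \<open>The bound is independent of \<open>t\<close>, so the infimum defining
    \<open>D\<close> is finite.\<close>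
  have lb: "- p (- y) \<le> p (y + t *\<^sub>R a) - t * p a" if "0 \<le> t" for y t
    using add[of "y + t *\<^sub>R a" "- y"] hom[OF that, of a] by simp
  have bdd: "bdd_below ((\<lambda>t. p (y + t *\<^sub>R a) - t * p a) ` {0..})" for y
    using lb by (intro bdd_belowI2[where m = "- p (- y)"]) auto
  have Dle: "D y \<le> p (y + t *\<^sub>R a) - t * p a" if "0 \<le> t" for y t
    unfolding D_def by (rule cINF_lower[OF bdd]) (use that in auto)
  have Dge: "m \<le> D y" if "\<And>t. 0 \<le> t \<Longrightarrow> m \<le> p (y + t *\<^sub>R a) - t * p a" for m y
    unfolding D_def by (rule cINF_greatest) (use that in auto)
  have "sublinear D"
  proof (rule sublinearI)
    fix y z
    have "D (y + z) - (p (z + s *\<^sub>R a) - s * p a) \<le> D y" if s: "0 \<le> s" for s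
    proof (rule Dge)
      fix t :: real assume t: "0 \<le> t"
      have "D (y + z) \<le> p ((y + t *\<^sub>R a) + (z + s *\<^sub>R a)) - (t + s) * p a"
        using Dle[of "t + s" "y + z"] s t by (simp add: algebra_simps)
      also have "\<dots> \<le> (p (y + t *\<^sub>R a) - t * p a) + (p (z + s *\<^sub>R a) - s * p a)"
        using add[of "y + t *\<^sub>R a" "z + s *\<^sub>R a"] by (simp add: algebra_simps)
      finally show "D (y + z) - (p (z + s *\<^sub>R a) - s * p a) \<le> p (y + t *\<^sub>R a) - t * p a" by simp
    qed
    hence "D (y + z) - D y \<le> D z" by (intro Dge) (simp add: algebra_simps)
    thus "D (y + z) \<le> D y + D z" by simp
  next
    fix r :: real and y assume r: "0 < r"
    have "D (r *\<^sub>R y) / r \<le> D y"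
    proof (rule Dge)
      fix t :: real assume t: "0 \<le> t"
      have "D (r *\<^sub>R y) \<le> p (r *\<^sub>R (y + t *\<^sub>R a)) - (r * t) * p a"
        using Dle[of "r * t" "r *\<^sub>R y"] r t by (simp add: algebra_simps)
      also have "\<dots> = r * (p (y + t *\<^sub>R a) - t * p a)"
        using hom[of r "y + t *\<^sub>R a"] r by (simp add: algebra_simps)
      finally show "D (r *\<^sub>R y) / r \<le> p (y + t *\<^sub>R a) - t * p a" using r by (simp add: field_simps)
    qed
    thus "D (r *\<^sub>R y) \<le> r * D y" using r by (simp add: field_simps)
  next
    show "D 0 = 0"
    proof (rule antisym)
      show "D 0 \<le> 0" using Dle[of 0 0] sublinear_zero[OF p] by simp
      show "0 \<le> D 0" by (rule Dge) (simp add: hom)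
    qed
  qed
  moreover have "D x \<le> p x" for x using Dle[of 0 x] by simp
  moreover have "D (- a) \<le> - p a" using Dle[of 1 "- a"] sublinear_zero[OF p] by simp
  ultimately show ?thesis by blast
qed

text \<open>Zorn's lemma yields a minimal sublinear functional; as it cannot be pressed down by
  \<open>sublinear_decrease\<close>, it is odd and therefore linear. The search takes place below
  \<open>q0\<close>, which has already been pressed down along \<open>x0\<close>; this forces the
  value at \<open>x0\<close>.\<close>

theorem hahn_banach_sublinear:
  fixes q :: "'a::real_vector \<Rightarrow> real"
  assumes q: "sublinear q"
  shows "\<exists>l. linear l \<and> (\<forall>x. l x \<le> q x) \<and> l x0 = q x0"
proof -
  obtain q0 where q0: "sublinear q0" "\<And>x. q0 x \<le> q x" "q0 (- x0) \<le> - q x0"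
    using sublinear_decrease[OF q] by blast
  define A where "A = {p. sublinear p \<and> (\<forall>x. p x \<le> q0 x)}"
  have "\<exists>m\<in>A. \<forall>a\<in>A. a \<le> m \<longrightarrow> a = m"
  proof (rule predicate_Zorn)
    show "partial_order_on A (relation_of (\<lambda>p p'. p' \<le> p) A)"
      by (rule partial_order_on_relation_ofI) auto
    fix C assume "C \<in> Chains (relation_of (\<lambda>p p'. p' \<le> p) A)"
    hence CA: "p \<in> C \<Longrightarrow> p \<in> A" and tot: "p \<in> C \<Longrightarrow> p' \<in> C \<Longrightarrow> p \<le> p' \<or> p' \<le> p" for p p'
      unfolding Chains_def relation_of_def by auto
    show "\<exists>u\<in>A. \<forall>a\<in>C. u \<le> a"
    proof (cases "C = {}")
      case True thus ?thesis using q0 by (auto simp: A_def)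
    next
      case False
      define u where "u x = (INF p\<in>C. p x)" for x
      have sl: "sublinear p" if "p \<in> C" for p using CA[OF that] by (simp add: A_def)
      \<comment> \<open>A lower bound common to the whole chain, so that its pointwise infimum is
        finite.\<close>
      have lb: "- q0 (- x) \<le> p x" if "p \<in> C" for p x
      proof -
        have "p (- x) \<le> q0 (- x)" using CA[OF that] by (simp add: A_def)
        thus ?thesis using sublinear_lower[OF sl[OF that], of x] by linarith
      qed
      have ule: "u x \<le> p x" if "p \<in> C" for p x
        unfolding u_def using that lb by (intro cINF_lower bdd_belowI2) auto
      have uge: "m \<le> u x" if "\<And>p. p \<in> C \<Longrightarrow> m \<le> p x" for m x
        unfolding u_def using that False by (intro cINF_greatest) auto
      have "sublinear u"
      proof (rule sublinearI)
        fix x y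
        have "u (x + y) - p' y \<le> u x" if p': "p' \<in> C" for p'
        proof (rule uge)
          fix p assume p: "p \<in> C"
          \<comment> \<open>One of two members of a chain lies below both, and subadditivity of this
            one covers the sum.\<close>
          define m where "m = (if p \<le> p' then p else p')"
          have m: "m \<in> C" "m \<le> p" "m \<le> p'" using tot[OF p p'] p p' by (auto simp: m_def)
          have "u (x + y) \<le> m (x + y)" using ule m by blast
          also have "\<dots> \<le> m x + m y" using sl[OF m(1)] by (simp add: sublinear_def)
          also have "\<dots> \<le> p x + p' y" using m by (intro add_mono) (auto simp: le_fun_def)
          finally show "u (x + y) - p' y \<le> p x" by simp
        qed
        hence "u (x + y) - u x \<le> u y" by (intro uge) (simp add: algebra_simps)
        thus "u (x + y) \<le> u x + u y" by simp
      next
        fix r :: real and x assume r: "0 < r"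
        have "u (r *\<^sub>R x) / r \<le> u x"
        proof (rule uge)
          fix p assume p: "p \<in> C"
          have "u (r *\<^sub>R x) \<le> r * p x" using ule[OF p] sl[OF p] r by (metis less_imp_le sublinear_def)
          thus "u (r *\<^sub>R x) / r \<le> p x" using r by (simp add: field_simps)
        qed
        thus "u (r *\<^sub>R x) \<le> r * u x" using r by (simp add: field_simps)
      next
        have "p 0 = 0" if "p \<in> C" for p using sublinear_zero sl that by blast
        hence "(\<lambda>p. p 0) ` C = {0}" using False by (auto simp: image_iff)
        thus "u 0 = 0" unfolding u_def by simp
      qed
      moreover have "u x \<le> q0 x" for x
      proof -
        obtain p where p: "p \<in> C" using False by blast
        have "p x \<le> q0 x" using CA[OF p] by (simp add: A_def)
        thus ?thesis using ule[OF p, of x] by linarith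
      qed
      ultimately show ?thesis using ule by (intro bexI[of _ u]) (auto simp: A_def le_fun_def)
    qed
  qed
  then obtain l where l: "l \<in> A" and lmin: "\<And>p. p \<in> A \<Longrightarrow> p \<le> l \<Longrightarrow> p = l" by blast
  have ls: "sublinear l" using l by (simp add: A_def)
  \<comment> \<open>By minimality, pressing \<open>l\<close> down along \<open>a\<close> gives back
    \<open>l\<close> itself.\<close>
  have odd: "l (- a) = - l a" for a
  proof -
    obtain p where p: "sublinear p" "\<And>x. p x \<le> l x" "p (- a) \<le> - l a"
      using sublinear_decrease[OF ls] by blast
    have "p \<in> A" using p l unfolding A_def by (auto intro: order_trans)
    hence "p = l" using p by (intro lmin) (auto simp: le_fun_def)
    hence "l (- a) \<le> - l a" using p by simp
    moreover have "- l a \<le> l (- a)" using sublinear_lower[OF ls, of "- a"] by simp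
    ultimately show ?thesis by simp
  qed
  have "linear l"
  proof (rule linearI)
    fix x y
    have "l (x + y) \<le> l x + l y" "l (- x + - y) \<le> l (- x) + l (- y)"
      using ls unfolding sublinear_def by blast+
    moreover have "l (- x + - y) = - l (x + y)" using odd[of "x + y"] by simp
    ultimately show "l (x + y) = l x + l y" unfolding odd by linarith
    fix r :: real
    show "l (r *\<^sub>R x) = r *\<^sub>R l x"
    proof (cases "0 \<le> r")
      case True thus ?thesis using ls by (simp add: sublinear_def)
    next
      case False
      hence "l ((- r) *\<^sub>R x) = (- r) * l x" using ls by (simp only: sublinear_def)
      thus ?thesis using odd[of "r *\<^sub>R x"] by simp
    qed
  qed
  moreover have le: "l x \<le> q x" for x
  proof -
    have "l x \<le> q0 x" using l by (simp add: A_def)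
    thus ?thesis using q0(2)[of x] by linarith
  qed
  moreover have "l x0 = q x0"
  proof -
    have "l (- x0) \<le> q0 (- x0)" using l by (simp add: A_def)
    thus ?thesis using q0(3) le[of x0] odd[of x0] by linarith
  qed
  ultimately show ?thesis by blast
qed

section \<open>Algebraic operations, limits and continuous seminorms in a locally convex
  space\<close>

lemma lcs_subspace: "lcs E \<Longrightarrow> subspace (topspace E)"
  and lcs_Hausdorff: "lcs E \<Longrightarrow> Hausdorff_space E"
  by (auto simp: lcs_def)

lemma lcs_closed:
  assumes "lcs E"
  shows lcs_zero: "0 \<in> topspace E"
    and lcs_add: "x \<in> topspace E \<Longrightarrow> y \<in> topspace E \<Longrightarrow> x + y \<in> topspace E"
    and lcs_diff: "x \<in> topspace E \<Longrightarrow> y \<in> topspace E \<Longrightarrow> x - y \<in> topspace E"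
    and lcs_scaleR: "x \<in> topspace E \<Longrightarrow> r *\<^sub>R x \<in> topspace E"
    and lcs_uminus: "x \<in> topspace E \<Longrightarrow> - x \<in> topspace E"
  using lcs_subspace[OF assms] by (auto simp: subspace_0 subspace_add subspace_diff subspace_scale subspace_neg)

lemma lcs_limitin_add:
  assumes E: "lcs E" and f: "limitin E f a F" and g: "limitin E g b F"
  shows "limitin E (\<lambda>x. f x + g x) (a + b) F"
proof -
  have "limitin (prod_topology E E) (\<lambda>x. (f x, g x)) (a, b) F"
    using f g by (simp add: limitin_pairwise o_def)
  hence "limitin E ((\<lambda>(x, y). x + y) \<circ> (\<lambda>x. (f x, g x))) ((\<lambda>(x, y). x + y) (a, b)) F"
    using E unfolding lcs_def by (intro continuous_map_limit) auto
  thus ?thesis by (simp add: o_def)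
qed

lemma lcs_limitin_scaleR:
  assumes E: "lcs E" and f: "(f \<longlongrightarrow> a) F" and g: "limitin E g b F"
  shows "limitin E (\<lambda>x. f x *\<^sub>R g x) (a *\<^sub>R b) F"
proof -
  have "limitin (prod_topology euclideanreal E) (\<lambda>x. (f x, g x)) (a, b) F"
    using f g by (simp add: limitin_pairwise o_def)
  hence "limitin E ((\<lambda>(r, x). r *\<^sub>R x) \<circ> (\<lambda>x. (f x, g x))) ((\<lambda>(r, x). r *\<^sub>R x) (a, b)) F"
    using E unfolding lcs_def by (intro continuous_map_limit) auto
  thus ?thesis by (simp add: o_def)
qed

lemma lcs_limitin_diff:
  assumes E: "lcs E" and f: "limitin E f a F" and g: "limitin E g b F"
  shows "limitin E (\<lambda>x. f x - g x) (a - b) F"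
  using lcs_limitin_add[OF E f lcs_limitin_scaleR[OF E tendsto_const[of "-1"] g]] by simp

text \<open>Continuity as convergence along the full neighbourhood filters \<open>nhdsin\<close>,
  the point itself included. Continuity proofs thus become computations with limits, which may be
  composed, added and scaled.\<close>

lemma continuous_map_limitin:
  "continuous_map X Y f \<longleftrightarrow> (\<forall>x\<in>topspace X. limitin Y f (f x) (nhdsin X x))"
proof (intro iffI ballI)
  assume f: "continuous_map X Y f"
  fix x assume x: "x \<in> topspace X"
  have "limitin X (\<lambda>z. z) x (nhdsin X x)"
    using x by (auto simp: limitin_def eventually_nhdsin)
  from continuous_map_limit[OF f this] show "limitin Y f (f x) (nhdsin X x)" by (simp add: o_def)
next
  assume L: "\<forall>x\<in>topspace X. limitin Y f (f x) (nhdsin X x)"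
  show "continuous_map X Y f"
    unfolding continuous_map_def
  proof (intro conjI allI impI)
    show "f \<in> topspace X \<rightarrow> topspace Y" using L by (auto simp: limitin_def)
    fix U assume U: "openin Y U"
    show "openin X {x \<in> topspace X. f x \<in> U}"
    proof (subst openin_subopen, intro ballI)
      fix x assume x: "x \<in> {x \<in> topspace X. f x \<in> U}"
      hence "\<forall>\<^sub>F z in nhdsin X x. f z \<in> U" using L U by (auto simp: limitin_def)
      then obtain S where "openin X S" "x \<in> S" "\<forall>z\<in>S. f z \<in> U"
        using x by (auto simp: eventually_nhdsin)
      thus "\<exists>T. openin X T \<and> x \<in> T \<and> T \<subseteq> {x \<in> topspace X. f x \<in> U}"
        using openin_subset[of X S] by blast
    qed
  qed
qed

lemma limitin_nhdsin_id: "x \<in> topspace X \<Longrightarrow> limitin X (\<lambda>z. z) x (nhdsin X x)"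
  by (auto simp: limitin_def eventually_nhdsin)

lemma continuous_map_translate:
  assumes "lcs E" "c \<in> topspace E"
  shows "continuous_map E E (\<lambda>x. x + c)"
  unfolding continuous_map_limitin
  using lcs_limitin_add[OF assms(1) limitin_nhdsin_id, of _ "\<lambda>_. c" c] assms(2) by simp

lemma continuous_map_scale:
  assumes "lcs E"
  shows "continuous_map E E (\<lambda>x. r *\<^sub>R x)"
  unfolding continuous_map_limitin
  using lcs_limitin_scaleR[OF assms tendsto_const limitin_nhdsin_id] by simp

lemma openin_translate:
  assumes E: "lcs E" and c: "c \<in> topspace E" and U: "openin E U"
  shows "openin E {x \<in> topspace E. x - c \<in> U}"
  using openin_continuous_map_preimage[OF continuous_map_translate[OF E lcs_uminus[OF E c]] U] by simp

lemma continuous_seminormD: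
  assumes "continuous_seminorm E q"
  shows "continuous_map E euclideanreal q"
    and "x \<in> topspace E \<Longrightarrow> y \<in> topspace E \<Longrightarrow> q (x + y) \<le> q x + q y"
    and "x \<in> topspace E \<Longrightarrow> q (r *\<^sub>R x) = \<bar>r\<bar> * q x"
  using assms by (auto simp: continuous_seminorm_def)

lemma csn_facts:
  assumes E: "lcs E" and q: "continuous_seminorm E q"
  shows csn_zero: "q 0 = 0"
    and csn_uminus: "x \<in> topspace E \<Longrightarrow> q (- x) = q x"
    and csn_nonneg: "x \<in> topspace E \<Longrightarrow> 0 \<le> q x"
    and csn_diff: "x \<in> topspace E \<Longrightarrow> y \<in> topspace E \<Longrightarrow> q (x - y) \<le> q x + q y"
    and csn_minus_commute: "x \<in> topspace E \<Longrightarrow> y \<in> topspace E \<Longrightarrow> q (x - y) = q (y - x)"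
    and csn_triangle: "x \<in> topspace E \<Longrightarrow> y \<in> topspace E \<Longrightarrow> z \<in> topspace E \<Longrightarrow> q (x - z) \<le> q (x - y) + q (y - z)"
    and csn_abs_diff: "x \<in> topspace E \<Longrightarrow> y \<in> topspace E \<Longrightarrow> \<bar>q x - q y\<bar> \<le> q (x - y)"
proof -
  note c = lcs_closed[OF E] and s = continuous_seminormD[OF q]
  show z: "q 0 = 0" using s(3)[of 0 0] c by simp
  show um: "q (- x) = q x" if "x \<in> topspace E" for x using s(3)[OF that, of "-1"] by simp
  show "0 \<le> q x" if "x \<in> topspace E" for x
    using s(2)[OF that c(5)[OF that]] um[OF that] z by simp
  show d: "q (x - y) \<le> q x + q y" if "x \<in> topspace E" "y \<in> topspace E" for x y
    using s(2)[OF that(1) c(5)[OF that(2)]] um[OF that(2)] by simp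
  show mc: "q (x - y) = q (y - x)" if "x \<in> topspace E" "y \<in> topspace E" for x y
    using um[OF c(3)[OF that]] by simp
  show t: "q (x - z) \<le> q (x - y) + q (y - z)" if "x \<in> topspace E" "y \<in> topspace E" "z \<in> topspace E" for x y z
    using s(2)[OF c(3)[OF that(1,2)] c(3)[OF that(2,3)]] by simp
  show "\<bar>q x - q y\<bar> \<le> q (x - y)" if "x \<in> topspace E" "y \<in> topspace E" for x y
    using s(2)[OF c(3)[OF that] that(2)] s(2)[OF c(3)[OF that(2,1)] that(1)] mc[OF that] by simp
qed

lemma openin_csn_ball:
  assumes E: "lcs E" and q: "continuous_seminorm E q" and c: "c \<in> topspace E"
  shows "openin E {x \<in> topspace E. q (x - c) < r}"
proof -
  have "openin E {x \<in> topspace E. q x \<in> {..<r}}"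
    using continuous_seminormD(1)[OF q] openin_continuous_map_preimage by (metis open_lessThan open_openin)
  from openin_translate[OF E c this] show ?thesis
    by (rule back_subst[of "openin E"]) (use lcs_diff[OF E _ c] in auto)
qed

text \<open>By homogeneity, a bound on one neighbourhood of 0 makes \<open>q\<close> small on its
  multiples, and the reverse triangle inequality carries this to all other points.\<close>

lemma csnI:
  assumes E: "lcs E"
    and add: "\<And>x y. x \<in> topspace E \<Longrightarrow> y \<in> topspace E \<Longrightarrow> q (x + y) \<le> q x + q y"
    and hom: "\<And>r x. x \<in> topspace E \<Longrightarrow> q (r *\<^sub>R x) = \<bar>r\<bar> * q x"
    and W: "openin E W" "0 \<in> W" "\<And>x. x \<in> W \<Longrightarrow> q x \<le> 1"
  shows "continuous_seminorm E q"
proof -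
  note c = lcs_closed[OF E]
  have um: "q (- x) = q x" if "x \<in> topspace E" for x using hom[OF that, of "-1"] by simp
  have ad: "\<bar>q x - q y\<bar> \<le> q (x - y)" if "x \<in> topspace E" "y \<in> topspace E" for x y
    using add[OF c(3)[OF that] that(2)] add[OF c(3)[OF that(2,1)] that(1)] um[OF c(3)[OF that]] by simp
  have "continuous_map E euclideanreal q"
    unfolding continuous_map_limitin limitin_canonical_iff
  proof (intro ballI tendstoI)
    fix x and e :: real assume x: "x \<in> topspace E" and e: "0 < e"
    let ?S = "{y \<in> topspace E. y - x \<in> {y \<in> topspace E. (2 / e) *\<^sub>R y \<in> W}}"
    have "openin E ?S"
      by (intro openin_translate[OF E x] openin_continuous_map_preimage[OF continuous_map_scale[OF E] W(1)])
    moreover have "x \<in> ?S" using x W(2) c(1) by simp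
    moreover have "dist (q y) (q x) < e" if "y \<in> ?S" for y
    proof -
      have y: "y \<in> topspace E" "y - x \<in> topspace E" "q ((2 / e) *\<^sub>R (y - x)) \<le> 1" using that W(3) by auto
      hence "(2 / e) * q (y - x) \<le> 1" using hom[OF y(2), of "2 / e"] e by simp
      hence "q (y - x) \<le> e / 2" using e by (simp add: field_simps)
      thus ?thesis using ad[OF y(1) x] e by (simp add: dist_real_def)
    qed
    ultimately show "\<forall>\<^sub>F y in nhdsin E x. dist (q y) (q x) < e"
      by (auto simp: eventually_nhdsin)
  qed
  thus ?thesis unfolding continuous_seminorm_def using add hom by simp
qed

text \<open>The seminorm is the Minkowski functional of a symmetric convex open neighbourhood of 0.
  This is the bridge from the definition of \<open>lcs\<close> by neighbourhoods to estimates, see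
  \<open>limitin_csn\<close>.\<close>

lemma lcs_seminorm_nbhd:
  assumes E: "lcs E" and U: "openin E U" "0 \<in> U"
  obtains q where "continuous_seminorm E q" "\<And>x. x \<in> topspace E \<Longrightarrow> q x < 1 \<Longrightarrow> x \<in> U"
proof -
  note c = lcs_closed[OF E]
  obtain V0 where V0: "openin E V0" "convex V0" "0 \<in> V0" "V0 \<subseteq> U"
    using E U unfolding lcs_def by blast
  \<comment> \<open>Intersecting with the reflected set makes the neighbourhood symmetric; negative
    scalars in the homogeneity of \<open>q\<close> rely on this.\<close>
  define V where "V = V0 \<inter> {x \<in> topspace E. (-1) *\<^sub>R x \<in> V0}"
  have Vo: "openin E V"
    unfolding V_def using V0 openin_continuous_map_preimage[OF continuous_map_scale[OF E] V0(1)] by blast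
  have Vt: "V \<subseteq> topspace E" using Vo openin_subset by blast
  have V0': "0 \<in> V" using V0 c(1) by (simp add: V_def)
  have Vneg: "- x \<in> V" if "x \<in> V" for x using that V0 Vt c(5) by (auto simp: V_def)
  have Vconv: "convex V"
  proof -
    have "V = V0 \<inter> (\<lambda>x. (-1) *\<^sub>R x) -` V0"
      using openin_subset[OF V0(1)] by (auto simp: V_def)
    moreover have "convex ((\<lambda>x. (-1) *\<^sub>R x) -` V0)"
      by (rule convex_linear_vimage[OF _ V0(2)]) (simp add: linear_iff algebra_simps)
    ultimately show ?thesis using V0(2) convex_Int by metis
  qed
  have Vscale: "r *\<^sub>R x \<in> V" if "x \<in> V" "0 \<le> r" "r \<le> 1" for r x
    using convexD[OF Vconv V0' that(1), of "1 - r" r] that by simp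
  define S where "S x = {r. 0 < r \<and> inverse r *\<^sub>R x \<in> V}" for x
  define q where "q x = Inf (S x)" for x
  have bdd: "bdd_below (S x)" for x by (rule bdd_belowI[of _ 0]) (auto simp: S_def)
  have qle: "q x \<le> r" if "r \<in> S x" for x r unfolding q_def using cInf_lower[OF that bdd] .
  have ne: "S x \<noteq> {}" if x: "x \<in> topspace E" for x
  proof -
    have "limitin E (\<lambda>r. r *\<^sub>R x) (0 *\<^sub>R x) (at_right (0::real))"
      by (rule lcs_limitin_scaleR[OF E]) (use x in auto)
    hence "\<forall>\<^sub>F r in at_right (0::real). r *\<^sub>R x \<in> V" using Vo V0' by (simp add: limitin_def)
    hence "\<forall>\<^sub>F r in at_right (0::real). r *\<^sub>R x \<in> V \<and> 0 < r"
      by (intro eventually_conj eventually_at_right_less)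
    then obtain r where "0 < r" "r *\<^sub>R x \<in> V"
      using eventually_happens trivial_limit_at_right_real by (metis (mono_tags, lifting))
    thus ?thesis by (auto simp: S_def intro!: exI[of _ "inverse r"])
  qed
  have lt: "\<exists>r\<in>S x. r < e" if "x \<in> topspace E" "q x < e" for x e
    using that ne[OF that(1)] cInf_lessD unfolding q_def by blast
  have nn: "0 \<le> q x" if "x \<in> topspace E" for x
    unfolding q_def using ne[OF that] by (intro cInf_greatest) (auto simp: S_def)
  have hom1: "q (r *\<^sub>R x) \<le> \<bar>r\<bar> * q x" if x: "x \<in> topspace E" and r: "r \<noteq> 0" for r x
  proof -
    have "q (r *\<^sub>R x) / \<bar>r\<bar> \<le> s" if s: "s \<in> S x" for s
    proof -
      have "inverse s *\<^sub>R x \<in> V" "0 < s" using s by (auto simp: S_def)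
      hence "inverse (\<bar>r\<bar> * s) *\<^sub>R (r *\<^sub>R x) \<in> V"
        using r Vneg[of "inverse s *\<^sub>R x"] by (cases "0 < r") (auto simp: field_simps)
      hence "\<bar>r\<bar> * s \<in> S (r *\<^sub>R x)" using r \<open>0 < s\<close> by (simp add: S_def)
      from qle[OF this] show ?thesis using r by (simp add: field_simps)
    qed
    hence "q (r *\<^sub>R x) / \<bar>r\<bar> \<le> q x" unfolding q_def[of x] using ne[OF x] by (intro cInf_greatest) auto
    thus ?thesis using r by (simp add: field_simps)
  qed
  have "continuous_seminorm E q"
  proof (rule csnI[OF E _ _ Vo V0'])
    show "q x \<le> 1" if "x \<in> V" for x using that by (intro qle) (simp add: S_def)
    have z: "q 0 = 0"
    proof (rule antisym)
      show "q 0 \<le> 0" by (rule field_le_epsilon) (simp add: qle S_def V0')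
      show "0 \<le> q 0" using nn c(1) by simp
    qed
    show "q (r *\<^sub>R x) = \<bar>r\<bar> * q x" if x: "x \<in> topspace E" for r x
    proof (cases "r = 0")
      case False
      have "q x \<le> \<bar>inverse r\<bar> * q (r *\<^sub>R x)" using hom1[OF c(4)[OF x, of r], of "inverse r"] False by simp
      hence "\<bar>r\<bar> * q x \<le> q (r *\<^sub>R x)" using False by (simp add: field_simps)
      thus ?thesis using hom1[OF x False] by simp
    qed (simp add: z)
    show "q (x + y) \<le> q x + q y" if x: "x \<in> topspace E" and y: "y \<in> topspace E" for x y
    proof (rule field_le_epsilon)
      fix e :: real assume e: "0 < e"
      obtain r where r: "r \<in> S x" "r < q x + e / 2" using lt[OF x, of "q x + e / 2"] e by auto
      obtain s where s: "s \<in> S y" "s < q y + e / 2" using lt[OF y, of "q y + e / 2"] e by auto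
      have "0 < r" "0 < s" "inverse r *\<^sub>R x \<in> V" "inverse s *\<^sub>R y \<in> V" using r s by (auto simp: S_def)
      \<comment> \<open>These weights combine membership in \<open>V\<close> at the scales
        \<open>r\<close> and \<open>s\<close> into membership at the scale
        \<open>r + s\<close>.\<close>
      hence "(r / (r + s)) *\<^sub>R (inverse r *\<^sub>R x) + (s / (r + s)) *\<^sub>R (inverse s *\<^sub>R y) \<in> V"
        by (intro convexD[OF Vconv]) (auto simp: add_divide_distrib[symmetric])
      also have "(r / (r + s)) *\<^sub>R (inverse r *\<^sub>R x) + (s / (r + s)) *\<^sub>R (inverse s *\<^sub>R y) = inverse (r + s) *\<^sub>R (x + y)"
        using \<open>0 < r\<close> \<open>0 < s\<close> by (simp add: scaleR_add_right field_simps)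
      finally have "r + s \<in> S (x + y)" using \<open>0 < r\<close> \<open>0 < s\<close> by (simp add: S_def)
      thus "q (x + y) \<le> q x + q y + e" using qle r s by fastforce
    qed
  qed
  moreover have "x \<in> U" if x: "x \<in> topspace E" "q x < 1" for x
  proof -
    obtain r where r: "0 < r" "r < 1" "inverse r *\<^sub>R x \<in> V" using lt[OF x] by (auto simp: S_def)
    have "r *\<^sub>R (inverse r *\<^sub>R x) \<in> V" using r by (intro Vscale[OF r(3)]) auto
    thus ?thesis using r V0(4) by (auto simp: V_def)
  qed
  ultimately show thesis using that by blast
qed

lemma lcs_seminorm_nbhd_at:
  assumes E: "lcs E" and U: "openin E U" "a \<in> U"
  obtains q where "continuous_seminorm E q" "\<And>x. x \<in> topspace E \<Longrightarrow> q (x - a) < 1 \<Longrightarrow> x \<in> U"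
proof -
  have a: "a \<in> topspace E" using U openin_subset by blast
  have 1: "openin E {x \<in> topspace E. x - (- a) \<in> U}"
    by (rule openin_translate[OF E lcs_uminus[OF E a] U(1)])
  have 2: "0 \<in> {x \<in> topspace E. x - (- a) \<in> U}" using U lcs_zero[OF E] by simp
  obtain q where q: "continuous_seminorm E q"
    "\<And>x. x \<in> topspace E \<Longrightarrow> q x < 1 \<Longrightarrow> x \<in> {x \<in> topspace E. x - (- a) \<in> U}"
    using lcs_seminorm_nbhd[OF E 1 2] by blast
  have "x \<in> U" if "x \<in> topspace E" "q (x - a) < 1" for x
    using q(2)[OF lcs_diff[OF E that(1) a] that(2)] by simp
  thus thesis using that q(1) by blast
qed

lemma limitin_csn:
  assumes E: "lcs E"
  shows "limitin E f a F \<longleftrightarrow> a \<in> topspace E \<and> (\<forall>\<^sub>F x in F. f x \<in> topspace E) \<and>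
     (\<forall>q e. continuous_seminorm E q \<longrightarrow> 0 < e \<longrightarrow> (\<forall>\<^sub>F x in F. q (f x - a) < e))"
    (is "?L \<longleftrightarrow> ?R")
proof
  assume L: ?L
  hence a: "a \<in> topspace E" by (rule limitin_topspace)
  have "\<forall>\<^sub>F x in F. q (f x - a) < e" if "continuous_seminorm E q" "0 < e" for q e
  proof -
    have "\<forall>\<^sub>F x in F. f x \<in> {x \<in> topspace E. q (x - a) < e}"
      using limitinD[OF L openin_csn_ball[OF E that(1) a]] a csn_zero[OF E that(1)] that(2) by simp
    thus ?thesis by eventually_elim simp
  qed
  thus ?R using a limitinD[OF L openin_topspace] by blast
next
  assume R: ?R
  show ?L
    unfolding limitin_def
  proof (intro conjI allI impI)
    fix U assume U: "openin E U \<and> a \<in> U"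
    then obtain q where q: "continuous_seminorm E q" "\<And>x. x \<in> topspace E \<Longrightarrow> q (x - a) < 1 \<Longrightarrow> x \<in> U"
      using lcs_seminorm_nbhd_at[OF E] by metis
    have "\<forall>\<^sub>F x in F. f x \<in> topspace E" "\<forall>\<^sub>F x in F. q (f x - a) < 1" using R q(1) by auto
    thus "\<forall>\<^sub>F x in F. f x \<in> U" by eventually_elim (rule q(2))
  qed (use R in blast)
qed

text \<open>A functional that is dominated by \<open>q\<close> and attains it at \<open>a\<close>.
  Through it, mean value and integral estimates are reduced to real functions.\<close>

lemma csn_functional:
  assumes E: "lcs E" and q: "continuous_seminorm E q" and a: "a \<in> topspace E"
  obtains l where "linear l" "continuous_functional E l" "\<And>x. x \<in> topspace E \<Longrightarrow> \<bar>l x\<bar> \<le> q x" "l a = q a"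
proof -
  note c = lcs_closed[OF E] and s = continuous_seminormD[OF q]
  \<comment> \<open>The seminorm is under control on \<open>topspace E\<close> only. Composed with a
    linear projection \<open>\<pi>\<close> onto this subspace, it becomes sublinear on the whole
    type, as \<open>hahn_banach_sublinear\<close> requires.\<close>
  have "linear (\<lambda>x::'a. x)" by (simp add: linear_iff)
  from linear_exists_left_inverse_on[OF this lcs_subspace[OF E]]
  obtain \<pi> :: "'a \<Rightarrow> 'a" where \<pi>: "\<pi> ` UNIV \<subseteq> topspace E" "linear \<pi>" "\<And>v. v \<in> topspace E \<Longrightarrow> \<pi> v = v"
    by auto
  have "sublinear (q \<circ> \<pi>)"
    using \<pi> s(2)[of "\<pi> _" "\<pi> _"] s(3)[of "\<pi> _"]
    by (auto simp: sublinear_def linear_add[OF \<pi>(2)] linear_scale[OF \<pi>(2)] image_subset_iff)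
  then obtain l where l: "linear l" "\<And>x. l x \<le> q (\<pi> x)" "l a = q (\<pi> a)"
    using hahn_banach_sublinear[of "q \<circ> \<pi>" a] by auto
  have le: "\<bar>l x\<bar> \<le> q x" if "x \<in> topspace E" for x
    using l(2)[of x] l(2)[of "- x"] \<pi>(3)[OF that] \<pi>(3)[OF c(5)[OF that]]
      csn_uminus[OF E q that] linear_neg[OF l(1), of x] by simp
  have "continuous_map E euclideanreal l"
    unfolding continuous_map_limitin limitin_canonical_iff
  proof (intro ballI tendstoI)
    fix x and e :: real assume x: "x \<in> topspace E" and e: "0 < e"
    have "\<forall>\<^sub>F y in nhdsin E x. q (y - x) < e"
      using limitin_nhdsin_id[OF x] q e by (simp add: limitin_csn[OF E])
    moreover have "\<forall>\<^sub>F y in nhdsin E x. y \<in> topspace E"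
      using limitin_nhdsin_id[OF x] by (simp add: limitin_csn[OF E])
    ultimately show "\<forall>\<^sub>F y in nhdsin E x. dist (l y) (l x) < e"
    proof eventually_elim
      case (elim y)
      have "\<bar>l y - l x\<bar> \<le> q (y - x)" using le[OF c(3)[OF elim(2) x]] linear_diff[OF l(1)] by simp
      thus ?case using elim by (simp add: dist_real_def)
    qed
  qed
  hence "continuous_functional E l"
    unfolding continuous_functional_def using linear_add[OF l(1)] linear_scale[OF l(1)] by simp
  thus thesis using that l(1) le l(3) \<pi>(3)[OF a] by metis
qed

text \<open>If no continuous seminorm separates the points, the constant sequence \<open>x\<close>
  converges to \<open>y\<close> as well as to \<open>x\<close>.\<close>

lemma lcs_eqI_csn:
  assumes E: "lcs E" and x: "x \<in> topspace E" and y: "y \<in> topspace E"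
    and q: "\<And>q. continuous_seminorm E q \<Longrightarrow> q (x - y) = 0"
  shows "x = y"
proof -
  have "limitin E (\<lambda>n::nat. x) y sequentially" unfolding limitin_csn[OF E] using x y by (simp add: q)
  moreover have "limitin E (\<lambda>n::nat. x) x sequentially" using x by simp
  ultimately show ?thesis
    using limitin_Hausdorff_unique[OF _ _ sequentially_bot lcs_Hausdorff[OF E]] by blast
qed

lemma continuous_seminorm_add:
  assumes E: "lcs E" and "continuous_seminorm E p" "continuous_seminorm E q"
  shows "continuous_seminorm E (\<lambda>x. p x + q x)"
proof -
  have "continuous_map E euclideanreal (\<lambda>x. p x + q x)"
    using continuous_seminormD(1) assms by (intro continuous_map_add) auto
  moreover have "p (x + y) + q (x + y) \<le> p x + q x + (p y + q y)" if "x \<in> topspace E" "y \<in> topspace E" for x y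
    using continuous_seminormD(2)[OF assms(2) that] continuous_seminormD(2)[OF assms(3) that] by simp
  ultimately show ?thesis
    using continuous_seminormD(3)[OF assms(2)] continuous_seminormD(3)[OF assms(3)]
    by (simp add: continuous_seminorm_def algebra_simps)
qed

section \<open>Differential calculus in locally convex spaces\<close>

lemma limitin_nhdsin_compose:
  assumes g: "limitin Y g l (nhdsin X x)" and a: "limitin X a x F"
  shows "limitin Y (\<lambda>i. g (a i)) l F"
  unfolding limitin_def
proof (intro conjI allI impI)
  show "l \<in> topspace Y" using g by (rule limitin_topspace)
  fix U assume "openin Y U \<and> l \<in> U"
  hence "\<forall>\<^sub>F z in nhdsin X x. g z \<in> U" using g by (simp add: limitin_def)
  then obtain S where "openin X S" "x \<in> S" "\<forall>z\<in>S. g z \<in> U"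
    using limitin_topspace[OF a] by (auto simp: eventually_nhdsin)
  thus "\<forall>\<^sub>F i in F. g (a i) \<in> U" using limitinD[OF a] by (metis (mono_tags, lifting) eventually_mono)
qed

text \<open>On an open set, the neighbourhood filters of the subspace and of the whole space agree.
  This removes subtopologies from the later continuity proofs.\<close>

lemma continuous_map_open_iff:
  assumes S: "openin X S"
  shows "continuous_map (subtopology X S) Y g \<longleftrightarrow> (\<forall>x\<in>S. limitin Y g (g x) (nhdsin X x))"
proof -
  have SX: "topspace (subtopology X S) = S" using openin_subset[OF S] by auto
  have "nhdsin (subtopology X S) x = nhdsin X x" if x: "x \<in> S" for x
  proof -
    have "eventually P (nhdsin (subtopology X S) x) \<longleftrightarrow> eventually P (nhdsin X x)" for P
    proof -
      have "(\<exists>T. openin (subtopology X S) T \<and> x \<in> T \<and> (\<forall>z\<in>T. P z)) \<longleftrightarrow>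
        (\<exists>T. openin X T \<and> x \<in> T \<and> (\<forall>z\<in>T. P z))" (is "?L \<longleftrightarrow> ?R")
      proof
        assume ?L thus ?R using openin_trans_full[OF _ S] by blast
      next
        assume ?R
        then obtain T where T: "openin X T" "x \<in> T" "\<forall>z\<in>T. P z" by blast
        thus ?L using x openin_subtopology_Int[OF T(1), of S] by (intro exI[of _ "T \<inter> S"]) auto
      qed
      thus ?thesis using x SX openin_subset[OF S] by (auto simp: eventually_nhdsin)
    qed
    thus ?thesis by (simp add: filter_eq_iff)
  qed
  thus ?thesis unfolding continuous_map_limitin SX by auto
qed

lemma limitin_open_compose:
  assumes "continuous_map (subtopology X S) Y g" "openin X S" "x \<in> S" "limitin X a x F"
  shows "limitin Y (\<lambda>i. g (a i)) (g x) F"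
  by (rule limitin_nhdsin_compose[OF _ assms(4)]) (use assms(1,3) continuous_map_open_iff[OF assms(2)] in blast)

lemma limitin_pairI:
  "limitin X a x F \<Longrightarrow> limitin Y b y F \<Longrightarrow> limitin (prod_topology X Y) (\<lambda>i. (a i, b i)) (x, y) F"
  by (simp add: limitin_pairwise o_def)

lemma limitin_fst: "limitin (prod_topology X Y) p z F \<Longrightarrow> limitin X (\<lambda>i. fst (p i)) (fst z) F"
  and limitin_snd: "limitin (prod_topology X Y) p z F \<Longrightarrow> limitin Y (\<lambda>i. snd (p i)) (snd z) F"
  by (cases z; simp add: limitin_pairwise o_def)+

lemma nhdsin_fst: "x \<in> topspace X \<Longrightarrow> y \<in> topspace Y \<Longrightarrow> limitin X fst x (nhdsin (prod_topology X Y) (x, y))"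
  and nhdsin_snd: "x \<in> topspace X \<Longrightarrow> y \<in> topspace Y \<Longrightarrow> limitin Y snd y (nhdsin (prod_topology X Y) (x, y))"
  using limitin_fst[OF limitin_nhdsin_id[of "(x, y)" "prod_topology X Y"]]
    limitin_snd[OF limitin_nhdsin_id[of "(x, y)" "prod_topology X Y"]] by auto

section \<open>Continuously differentiable maps\<close>

lemma dir_derivI:
  assumes "Hausdorff_space F" "limitin F (\<lambda>t. (f (x + t *\<^sub>R y) - f x) /\<^sub>R t) l (at (0::real))"
  shows "dir_deriv F f x y = l"
  unfolding dir_deriv_def
  by (intro the_equality assms(2) limitin_Hausdorff_unique[OF _ assms(2) _ assms(1)]) auto

lemma C1_on_limitin_iff:
  "C1_on E F U f \<longleftrightarrow> openin E U \<and> (\<forall>x\<in>U. limitin F f (f x) (nhdsin E x)) \<and>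
     (\<forall>x\<in>U. \<forall>y\<in>topspace E. \<exists>l. limitin F (\<lambda>t. (f (x + t *\<^sub>R y) - f x) /\<^sub>R t) l (at (0::real))) \<and>
     (\<forall>x\<in>U. \<forall>y\<in>topspace E.
        limitin F (\<lambda>p. dir_deriv F f (fst p) (snd p)) (dir_deriv F f x y) (nhdsin (prod_topology E E) (x, y)))"
proof (cases "openin E U")
  case True
  hence o: "openin (prod_topology E E) (U \<times> topspace E)" by (simp add: openin_prod_Times_iff)
  show ?thesis
    unfolding C1_on_def continuous_map_open_iff[OF True] continuous_map_open_iff[OF o] case_prod_unfold
    using True by auto
qed (simp add: C1_on_def)

lemma C1_limitin:
  assumes "lcs F" "C1_on E F U f" "x \<in> U" "y \<in> topspace E"
  shows "limitin F (\<lambda>t. (f (x + t *\<^sub>R y) - f x) /\<^sub>R t) (dir_deriv F f x y) (at (0::real))"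
proof -
  obtain l where l: "limitin F (\<lambda>t. (f (x + t *\<^sub>R y) - f x) /\<^sub>R t) l (at (0::real))"
    using assms unfolding C1_on_def by blast
  thus ?thesis using dir_derivI[OF lcs_Hausdorff[OF assms(1)] l] by simp
qed

lemma C1_openin: "C1_on E F U f \<Longrightarrow> openin E U" and C1_subset: "C1_on E F U f \<Longrightarrow> U \<subseteq> topspace E"
  unfolding C1_on_def by (auto dest: openin_subset)

lemma C1_cont:
  assumes "C1_on E F U f" "x \<in> U" "limitin E a x \<Phi>"
  shows "limitin F (\<lambda>i. f (a i)) (f x) \<Phi>"
proof (rule limitin_nhdsin_compose[OF _ assms(3)])
  show "limitin F f (f x) (nhdsin E x)" using assms(1,2) by (simp add: C1_on_limitin_iff)
qed

lemma C1_mem: "C1_on E F U f \<Longrightarrow> x \<in> U \<Longrightarrow> f x \<in> topspace F"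
  using limitin_topspace[of F f "f x" "nhdsin E x"] by (simp add: C1_on_limitin_iff)

lemma C1_deriv_mem: "lcs F \<Longrightarrow> C1_on E F U f \<Longrightarrow> x \<in> U \<Longrightarrow> y \<in> topspace E \<Longrightarrow> dir_deriv F f x y \<in> topspace F"
  by (rule limitin_topspace[OF C1_limitin])

lemma C1_deriv_cont:
  assumes "C1_on E F U f" "x \<in> U" "limitin E a x \<Phi>" "limitin E b y \<Phi>"
  shows "limitin F (\<lambda>i. dir_deriv F f (a i) (b i)) (dir_deriv F f x y) \<Phi>"
proof -
  have "limitin F (\<lambda>p. dir_deriv F f (fst p) (snd p)) (dir_deriv F f x y) (nhdsin (prod_topology E E) (x, y))"
    using assms limitin_topspace[OF assms(4)] by (simp add: C1_on_limitin_iff)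
  from limitin_nhdsin_compose[OF this limitin_pairI[OF assms(3,4)]] show ?thesis by simp
qed

lemma eventually_line_in:
  assumes "lcs E" "openin E U" "x \<in> U" "y \<in> topspace E"
  shows "\<forall>\<^sub>F t in at (0::real). x + t *\<^sub>R y \<in> U"
proof -
  have x: "x \<in> topspace E" using assms openin_subset by blast
  have "limitin E (\<lambda>t. x + t *\<^sub>R y) (x + 0 *\<^sub>R y) (at (0::real))"
    using assms x by (intro lcs_limitin_add lcs_limitin_scaleR tendsto_ident_at) auto
  thus ?thesis using assms by (auto simp: limitin_def)
qed

text \<open>Since \<open>U\<close> is open, the point \<open>x + t *\<^sub>R y\<close> stays in
  \<open>U\<close> for small \<open>t\<close>, so only values on \<open>U\<close> enter the
  limit.\<close>

lemma dir_deriv_cong: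
  assumes "lcs E" "openin E U" "x \<in> U" "y \<in> topspace E" "\<And>z. z \<in> U \<Longrightarrow> f z = g z"
  shows "limitin F (\<lambda>t. (f (x + t *\<^sub>R y) - f x) /\<^sub>R t) l (at (0::real)) \<longleftrightarrow>
         limitin F (\<lambda>t. (g (x + t *\<^sub>R y) - g x) /\<^sub>R t) l (at (0::real))"
    and "dir_deriv F f x y = dir_deriv F g x y"
proof -
  have ev: "\<forall>\<^sub>F t in at (0::real). (f (x + t *\<^sub>R y) - f x) /\<^sub>R t = (g (x + t *\<^sub>R y) - g x) /\<^sub>R t"
    using eventually_line_in[OF assms(1-4)] by eventually_elim (simp add: assms)
  hence ev': "\<forall>\<^sub>F t in at (0::real). (g (x + t *\<^sub>R y) - g x) /\<^sub>R t = (f (x + t *\<^sub>R y) - f x) /\<^sub>R t"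
    by eventually_elim (rule sym)
  show *: "limitin F (\<lambda>t. (f (x + t *\<^sub>R y) - f x) /\<^sub>R t) l (at (0::real)) \<longleftrightarrow>
         limitin F (\<lambda>t. (g (x + t *\<^sub>R y) - g x) /\<^sub>R t) l (at (0::real))" for l
    using limitin_transform_eventually[OF ev] limitin_transform_eventually[OF ev'] by blast
  show "dir_deriv F f x y = dir_deriv F g x y" unfolding dir_deriv_def * ..
qed

text \<open>Testing with functionals reduces the mean value estimate to the real mean value theorem.\<close>

lemma C1_line_estimate:
  assumes E: "lcs E" and F: "lcs F" and f: "C1_on E F U f" and q: "continuous_seminorm F q"
    and b: "b \<in> topspace E" and v: "v \<in> topspace F"
    and line: "\<And>\<theta>. 0 \<le> \<theta> \<Longrightarrow> \<theta> \<le> 1 \<Longrightarrow> a + (\<theta> * \<tau>) *\<^sub>R b \<in> U"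
    and B: "\<And>\<theta>. 0 \<le> \<theta> \<Longrightarrow> \<theta> \<le> 1 \<Longrightarrow> q (dir_deriv F f (a + (\<theta> * \<tau>) *\<^sub>R b) b - v) \<le> B"
  shows "q (f (a + \<tau> *\<^sub>R b) - f a - \<tau> *\<^sub>R v) \<le> \<bar>\<tau>\<bar> * B"
proof -
  note cF = lcs_closed[OF F]
  define w where "w = f (a + \<tau> *\<^sub>R b) - f a - \<tau> *\<^sub>R v"
  have fa: "f a \<in> topspace F" "f (a + \<tau> *\<^sub>R b) \<in> topspace F"
    using C1_mem[OF f] line[of 0] line[of 1] by auto
  have w: "w \<in> topspace F" unfolding w_def by (intro cF fa v)
  \<comment> \<open>The functional is chosen for the error \<open>w\<close> itself, so it detects
    the full size \<open>q w\<close>.\<close>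
  obtain l where l: "linear l" "continuous_functional F l"
    "\<And>x. x \<in> topspace F \<Longrightarrow> \<bar>l x\<bar> \<le> q x" "l w = q w"
    using csn_functional[OF F q w] by blast
  have lc: "continuous_map F euclideanreal l" using l(2) by (simp add: continuous_functional_def)
  define d where "d \<theta> = dir_deriv F f (a + (\<theta> * \<tau>) *\<^sub>R b) b" for \<theta>
  have D: "DERIV (\<lambda>\<theta>. l (f (a + (\<theta> * \<tau>) *\<^sub>R b))) \<theta> :> l (d \<theta>) * \<tau>" if \<theta>: "0 \<le> \<theta>" "\<theta> \<le> 1" for \<theta>
  proof -
    have "limitin F (\<lambda>t. (f (a + (\<theta> * \<tau>) *\<^sub>R b + t *\<^sub>R b) - f (a + (\<theta> * \<tau>) *\<^sub>R b)) /\<^sub>R t) (d \<theta>) (at (0::real))"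
      unfolding d_def by (rule C1_limitin[OF F f line[OF \<theta>] b])
    from continuous_map_limit[OF lc this]
    have "((\<lambda>t. l ((f (a + (\<theta> * \<tau>) *\<^sub>R b + t *\<^sub>R b) - f (a + (\<theta> * \<tau>) *\<^sub>R b)) /\<^sub>R t)) \<longlongrightarrow> l (d \<theta>)) (at 0)"
      by (simp add: o_def)
    moreover have "l ((f (a + (\<theta> * \<tau>) *\<^sub>R b + t *\<^sub>R b) - f (a + (\<theta> * \<tau>) *\<^sub>R b)) /\<^sub>R t)
        = (l (f (a + (\<theta> * \<tau> + t) *\<^sub>R b)) - l (f (a + (\<theta> * \<tau>) *\<^sub>R b))) / t" for t
      by (simp add: linear_diff[OF l(1)] linear_scale[OF l(1)] scaleR_add_left add.assoc divide_inverse_commute)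
    ultimately have "DERIV (\<lambda>\<sigma>. l (f (a + \<sigma> *\<^sub>R b))) (\<theta> * \<tau>) :> l (d \<theta>)"
      unfolding DERIV_def by simp
    moreover have "DERIV (\<lambda>\<theta>. \<theta> * \<tau>) \<theta> :> \<tau>" by (auto intro!: derivative_eq_intros)
    ultimately show ?thesis by (rule DERIV_chain2)
  qed
  obtain z where z: "0 < z" "z < 1"
    "l (f (a + (1 * \<tau>) *\<^sub>R b)) - l (f (a + (0 * \<tau>) *\<^sub>R b)) = (1 - 0) * (l (d z) * \<tau>)"
    using MVT2[of 0 1 "\<lambda>\<theta>. l (f (a + (\<theta> * \<tau>) *\<^sub>R b))" "\<lambda>\<theta>. l (d \<theta>) * \<tau>"] D by auto
  have dz: "d z - v \<in> topspace F" unfolding d_def using C1_deriv_mem[OF F f line b] z v cF(3) by simp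
  have "l w = l (f (a + \<tau> *\<^sub>R b)) - l (f a) - \<tau> * l v"
    by (simp add: w_def linear_diff[OF l(1)] linear_scale[OF l(1)])
  hence "q w = \<tau> * l (d z - v)"
    using z(3) l(4) by (simp add: linear_diff[OF l(1)] right_diff_distrib)
  also have "\<dots> \<le> \<bar>\<tau>\<bar> * \<bar>l (d z - v)\<bar>" by (metis abs_ge_self abs_mult)
  also have "\<dots> \<le> \<bar>\<tau>\<bar> * B"
    using l(3)[OF dz] B[of z] z by (intro mult_left_mono) (auto simp: d_def)
  finally show ?thesis by (simp add: w_def)
qed

lemma limitin_csnD:
  "lcs E \<Longrightarrow> limitin E f a F \<Longrightarrow> continuous_seminorm E q \<Longrightarrow> 0 < e \<Longrightarrow> \<forall>\<^sub>F x in F. q (f x - a) < e"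
  by (simp add: limitin_csn)

text \<open>
  Difference quotients converge even if base point, direction and step vary simultaneously; the
  chain rule and the linearity of the differential are special cases.
\<close>

lemma C1_quotient:
  assumes E: "lcs E" and F: "lcs F" and f: "C1_on E F U f" and x: "x \<in> U"
    and a: "limitin E a x \<Phi>" and b: "limitin E b y \<Phi>" and \<tau>: "(\<tau> \<longlongrightarrow> 0) \<Phi>" "\<forall>\<^sub>F i in \<Phi>. \<tau> i \<noteq> 0"
  shows "limitin F (\<lambda>i. (f (a i + \<tau> i *\<^sub>R b i) - f (a i)) /\<^sub>R \<tau> i) (dir_deriv F f x y) \<Phi>"
proof -
  note cE = lcs_closed[OF E] and cF = lcs_closed[OF F]
  have y: "y \<in> topspace E" using limitin_topspace[OF b] .
  have xE: "x \<in> topspace E" using limitin_topspace[OF a] .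
  have U: "openin E U" using C1_openin[OF f] .
  define D where "D = dir_deriv F f x y"
  have D: "D \<in> topspace F" unfolding D_def by (rule C1_deriv_mem[OF F f x y])
  have ab: "limitin E (\<lambda>i. a i + \<tau> i *\<^sub>R b i) x \<Phi>"
    using lcs_limitin_add[OF E a lcs_limitin_scaleR[OF E \<tau>(1) b]] by simp
  have memF: "\<forall>\<^sub>F i in \<Phi>. (f (a i + \<tau> i *\<^sub>R b i) - f (a i)) /\<^sub>R \<tau> i \<in> topspace F"
    using limitinD[OF a U x] limitinD[OF ab U x] by eventually_elim (intro cF C1_mem[OF f])
  have "\<forall>\<^sub>F i in \<Phi>. q ((f (a i + \<tau> i *\<^sub>R b i) - f (a i)) /\<^sub>R \<tau> i - D) < e"
    if q: "continuous_seminorm F q" and e: "0 < e" for q e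
  proof -
    have "\<forall>\<^sub>F p in nhdsin (prod_topology E E) (x, y). q (dir_deriv F f (fst p) (snd p) - D) < e / 2"
      unfolding D_def
      by (rule limitin_csnD[OF F C1_deriv_cont[OF f x nhdsin_fst[OF xE y] nhdsin_snd[OF xE y]] q]) (use e in simp)
    then obtain S where S: "openin (prod_topology E E) S" "(x, y) \<in> S"
      "\<And>p. p \<in> S \<Longrightarrow> q (dir_deriv F f (fst p) (snd p) - D) < e / 2"
      using xE y by (auto simp: eventually_nhdsin)
    have "\<exists>N P. openin E N \<and> openin E P \<and> x \<in> N \<and> y \<in> P \<and> N \<times> P \<subseteq> S"
      using S(1,2) by (simp add: openin_prod_topology_alt)
    then obtain N P where NP: "openin E N" "openin E P" "x \<in> N" "y \<in> P" "N \<times> P \<subseteq> S" by blast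
    have NU: "openin E (N \<inter> U)" "x \<in> N \<inter> U" using NP U x by auto
    obtain p where p: "continuous_seminorm E p" "\<And>z. z \<in> topspace E \<Longrightarrow> p (z - x) < 1 \<Longrightarrow> z \<in> N \<inter> U"
      using lcs_seminorm_nbhd_at[OF E NU] by blast
    have "\<forall>\<^sub>F i in \<Phi>. a i \<in> topspace E" "\<forall>\<^sub>F i in \<Phi>. p (a i - x) < 1"
      "\<forall>\<^sub>F i in \<Phi>. a i + \<tau> i *\<^sub>R b i \<in> topspace E" "\<forall>\<^sub>F i in \<Phi>. p (a i + \<tau> i *\<^sub>R b i - x) < 1"
      using a ab p(1) unfolding limitin_csn[OF E] by auto
    moreover have "\<forall>\<^sub>F i in \<Phi>. b i \<in> P" using limitinD[OF b NP(2,4)] .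
    ultimately show ?thesis using \<tau>(2) memF
    proof eventually_elim
      case (elim i)
      have bi: "b i \<in> topspace E" using elim(5) openin_subset[OF NP(2)] by blast
      \<comment> \<open>The \<open>p\<close>-ball around \<open>x\<close> is convex and contains
        both end points. Hence the whole segment lies in \<open>N \<inter> U\<close>, where the
        differential in the direction \<open>b i\<close> is close to \<open>D\<close>.\<close>
      have seg: "a i + (\<theta> * \<tau> i) *\<^sub>R b i \<in> N \<inter> U" if \<theta>: "0 \<le> \<theta>" "\<theta> \<le> 1" for \<theta>
      proof (rule p(2))
        show "a i + (\<theta> * \<tau> i) *\<^sub>R b i \<in> topspace E" by (intro cE elim(1) bi)
        have "a i + (\<theta> * \<tau> i) *\<^sub>R b i - x = (1 - \<theta>) *\<^sub>R (a i - x) + \<theta> *\<^sub>R (a i + \<tau> i *\<^sub>R b i - x)"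
          by (simp add: algebra_simps)
        also have "p \<dots> \<le> p ((1 - \<theta>) *\<^sub>R (a i - x)) + p (\<theta> *\<^sub>R (a i + \<tau> i *\<^sub>R b i - x))"
          by (rule continuous_seminormD(2)[OF p(1)]) (intro cE elim xE bi)+
        also have "\<dots> = (1 - \<theta>) * p (a i - x) + \<theta> * p (a i + \<tau> i *\<^sub>R b i - x)"
          using continuous_seminormD(3)[OF p(1) cE(3)[OF elim(1) xE]]
            continuous_seminormD(3)[OF p(1) cE(3)[OF elim(3) xE]] \<theta> by simp
        also have "\<dots> < 1" using \<theta> elim(2,4) by (intro convex_bound_lt) auto
        finally show "p (a i + (\<theta> * \<tau> i) *\<^sub>R b i - x) < 1" .
      qed
      have "q (f (a i + \<tau> i *\<^sub>R b i) - f (a i) - \<tau> i *\<^sub>R D) \<le> \<bar>\<tau> i\<bar> * (e / 2)"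
      proof (rule C1_line_estimate[OF E F f q bi D])
        fix \<theta> :: real assume "0 \<le> \<theta>" "\<theta> \<le> 1"
        note s = seg[OF this]
        show "a i + (\<theta> * \<tau> i) *\<^sub>R b i \<in> U" using s by simp
        have "(a i + (\<theta> * \<tau> i) *\<^sub>R b i, b i) \<in> S" using s NP(5) elim(5) by blast
        from S(3)[OF this] show "q (dir_deriv F f (a i + (\<theta> * \<tau> i) *\<^sub>R b i) (b i) - D) \<le> e / 2" by simp
      qed
      moreover have "f (a i + \<tau> i *\<^sub>R b i) - f (a i) - \<tau> i *\<^sub>R D
          = \<tau> i *\<^sub>R ((f (a i + \<tau> i *\<^sub>R b i) - f (a i)) /\<^sub>R \<tau> i - D)"
        using elim(6) by (simp add: algebra_simps)
      moreover have "q (\<tau> i *\<^sub>R ((f (a i + \<tau> i *\<^sub>R b i) - f (a i)) /\<^sub>R \<tau> i - D))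
          = \<bar>\<tau> i\<bar> * q ((f (a i + \<tau> i *\<^sub>R b i) - f (a i)) /\<^sub>R \<tau> i - D)"
        by (rule continuous_seminormD(3)[OF q cF(3)[OF elim(7) D]])
      ultimately have "\<bar>\<tau> i\<bar> * q ((f (a i + \<tau> i *\<^sub>R b i) - f (a i)) /\<^sub>R \<tau> i - D) \<le> \<bar>\<tau> i\<bar> * (e / 2)" by simp
      hence "q ((f (a i + \<tau> i *\<^sub>R b i) - f (a i)) /\<^sub>R \<tau> i - D) \<le> e / 2"
        using elim(6) by (subst (asm) mult_le_cancel_left_pos) auto
      thus ?case using e by simp
    qed
  qed
  thus ?thesis unfolding limitin_csn[OF F] using D memF by (simp add: D_def)
qed

lemma C1_dir_deriv_linear:
  assumes E: "lcs E" and F: "lcs F" and f: "C1_on E F U f" and x: "x \<in> U"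
  shows C1_dir_deriv_add: "y \<in> topspace E \<Longrightarrow> z \<in> topspace E \<Longrightarrow>
      dir_deriv F f x (y + z) = dir_deriv F f x y + dir_deriv F f x z"
    and C1_dir_deriv_scale: "y \<in> topspace E \<Longrightarrow> dir_deriv F f x (r *\<^sub>R y) = r *\<^sub>R dir_deriv F f x y"
proof -
  note cE = lcs_closed[OF E] and H = lcs_Hausdorff[OF F]
  have xE: "x \<in> topspace E" using C1_subset[OF f] x by blast
  have id: "((\<lambda>t. t) \<longlongrightarrow> 0) (at (0::real))" by (rule tendsto_ident_at)
  have nz: "\<forall>\<^sub>F t in at (0::real). t \<noteq> 0" by (simp add: eventually_at_filter)
  {
    assume y: "y \<in> topspace E" and z: "z \<in> topspace E"
    have l: "limitin E (\<lambda>t. x + t *\<^sub>R y) x (at (0::real))"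
      using lcs_limitin_add[OF E _ lcs_limitin_scaleR[OF E id], of "\<lambda>_. x" x "\<lambda>_. y" y] xE y by simp
    \<comment> \<open>The increment along \<open>y + z\<close> is split at the moving base point
      \<open>x + t *\<^sub>R y\<close>; the second summand is covered by
      \<open>C1_quotient\<close>.\<close>
    have "limitin F (\<lambda>t. (f (x + t *\<^sub>R y) - f x) /\<^sub>R t + (f (x + t *\<^sub>R y + t *\<^sub>R z) - f (x + t *\<^sub>R y)) /\<^sub>R t)
        (dir_deriv F f x y + dir_deriv F f x z) (at (0::real))"
      by (intro lcs_limitin_add[OF F] C1_limitin[OF F f x y] C1_quotient[OF E F f x l _ id nz]) (simp add: z)
    hence "limitin F (\<lambda>t. (f (x + t *\<^sub>R (y + z)) - f x) /\<^sub>R t) (dir_deriv F f x y + dir_deriv F f x z) (at (0::real))"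
      by (simp add: scaleR_diff_right scaleR_add_right add.assoc)
    from dir_derivI[OF H this]
    show "dir_deriv F f x (y + z) = dir_deriv F f x y + dir_deriv F f x z" .
  }
  assume y: "y \<in> topspace E"
  show "dir_deriv F f x (r *\<^sub>R y) = r *\<^sub>R dir_deriv F f x y"
  proof (cases "r = 0")
    case True
    have "limitin F (\<lambda>t. (f (x + t *\<^sub>R 0) - f x) /\<^sub>R t) 0 (at (0::real))" using lcs_zero[OF F] by simp
    from dir_derivI[OF H this] show ?thesis using True by simp
  next
    case False
    have "limitin F (\<lambda>t. r *\<^sub>R ((f (x + (r * t) *\<^sub>R y) - f x) /\<^sub>R (r * t))) (r *\<^sub>R dir_deriv F f x y) (at (0::real))"
      using False xE y nz
      by (intro lcs_limitin_scaleR[OF F] C1_quotient[OF E F f x])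
        (auto intro!: tendsto_eq_intros elim!: eventually_mono)
    moreover have "r *\<^sub>R (z /\<^sub>R (r * t)) = z /\<^sub>R t" for z :: 'b and t using False by simp
    ultimately have "limitin F (\<lambda>t. (f (x + t *\<^sub>R (r *\<^sub>R y)) - f x) /\<^sub>R t) (r *\<^sub>R dir_deriv F f x y) (at (0::real))"
      by (simp only: scaleR_scaleR mult.commute)
    from dir_derivI[OF H this] show ?thesis .
  qed
qed

lemma C1_dir_deriv_zero:
  assumes "lcs E" "lcs F" "C1_on E F U f" "x \<in> U" shows "dir_deriv F f x 0 = 0"
  using C1_dir_deriv_scale[OF assms lcs_zero[OF assms(1)], of 0] by simp

lemma C1_comp:
  assumes E: "lcs E" and F: "lcs F" and H: "lcs H" and f: "C1_on E F U f" and g: "C1_on F H V g"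
    and fU: "f ` U \<subseteq> V"
  shows "C1_on E H U (g \<circ> f)"
    and "x \<in> U \<Longrightarrow> y \<in> topspace E \<Longrightarrow> dir_deriv H (g \<circ> f) x y = dir_deriv H g (f x) (dir_deriv F f x y)"
proof -
  have id: "((\<lambda>t. t) \<longlongrightarrow> 0) (at (0::real))" by (rule tendsto_ident_at)
  have nz: "\<forall>\<^sub>F t in at (0::real). t \<noteq> 0" by (simp add: eventually_at_filter)
  have lim: "limitin H (\<lambda>t. ((g \<circ> f) (x + t *\<^sub>R y) - (g \<circ> f) x) /\<^sub>R t) (dir_deriv H g (f x) (dir_deriv F f x y)) (at (0::real))"
    if x: "x \<in> U" and y: "y \<in> topspace E" for x y
  proof -
    \<comment> \<open>The difference quotient of \<open>f\<close> serves as the moving direction for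
      \<open>g\<close>.\<close>
    have "limitin H (\<lambda>t. (g (f x + t *\<^sub>R ((f (x + t *\<^sub>R y) - f x) /\<^sub>R t)) - g (f x)) /\<^sub>R t)
        (dir_deriv H g (f x) (dir_deriv F f x y)) (at (0::real))"
      using x fU C1_mem[OF f x]
      by (intro C1_quotient[OF F H g _ _ C1_limitin[OF F f x y] id nz]) auto
    moreover have "\<forall>\<^sub>F t in at (0::real). (g (f x + t *\<^sub>R ((f (x + t *\<^sub>R y) - f x) /\<^sub>R t)) - g (f x)) /\<^sub>R t
       = ((g \<circ> f) (x + t *\<^sub>R y) - (g \<circ> f) x) /\<^sub>R t"
      using nz by eventually_elim simp
    ultimately show ?thesis by (rule limitin_transform_eventually[rotated])
  qed
  have dd: "dir_deriv H (g \<circ> f) x y = dir_deriv H g (f x) (dir_deriv F f x y)" if "x \<in> U" "y \<in> topspace E" for x y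
    by (rule dir_derivI[OF lcs_Hausdorff[OF H] lim[OF that]])
  thus "x \<in> U \<Longrightarrow> y \<in> topspace E \<Longrightarrow> dir_deriv H (g \<circ> f) x y = dir_deriv H g (f x) (dir_deriv F f x y)" .
  show "C1_on E H U (g \<circ> f)"
    unfolding C1_on_limitin_iff
  proof (intro conjI ballI)
    show U: "openin E U" using C1_openin[OF f] .
    fix x assume x: "x \<in> U"
    have xE: "x \<in> topspace E" using x C1_subset[OF f] by blast
    have fx: "f x \<in> V" using x fU by blast
    show "limitin H (g \<circ> f) ((g \<circ> f) x) (nhdsin E x)"
      using C1_cont[OF g fx C1_cont[OF f x limitin_nhdsin_id[OF xE]]] by (simp add: o_def)
    fix y assume y: "y \<in> topspace E"
    show "\<exists>l. limitin H (\<lambda>t. ((g \<circ> f) (x + t *\<^sub>R y) - (g \<circ> f) x) /\<^sub>R t) l (at (0::real))" using lim[OF x y] by blast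
    note n1 = nhdsin_fst[OF xE y] and n2 = nhdsin_snd[OF xE y]
    have "limitin H (\<lambda>p. dir_deriv H g (f (fst p)) (dir_deriv F f (fst p) (snd p))) (dir_deriv H g (f x) (dir_deriv F f x y))
       (nhdsin (prod_topology E E) (x, y))"
      by (intro C1_deriv_cont[OF g fx] C1_cont[OF f x n1] C1_deriv_cont[OF f x n1 n2])
    moreover have "\<forall>\<^sub>F p in nhdsin (prod_topology E E) (x, y).
        dir_deriv H g (f (fst p)) (dir_deriv F f (fst p) (snd p)) = dir_deriv H (g \<circ> f) (fst p) (snd p)"
      using limitinD[OF n1 U x] limitinD[OF n2 openin_topspace y] by eventually_elim (simp add: dd)
    ultimately show "limitin H (\<lambda>p. dir_deriv H (g \<circ> f) (fst p) (snd p)) (dir_deriv H (g \<circ> f) x y)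
       (nhdsin (prod_topology E E) (x, y))"
      unfolding dd[OF x y] by (rule limitin_transform_eventually[rotated])
  qed
qed

lemma C1_onI:
  assumes "openin E U" "\<And>x. x \<in> U \<Longrightarrow> limitin F f (f x) (nhdsin E x)"
    and "\<And>x y. x \<in> U \<Longrightarrow> y \<in> topspace E \<Longrightarrow> \<exists>l. limitin F (\<lambda>t. (f (x + t *\<^sub>R y) - f x) /\<^sub>R t) l (at (0::real))"
    and "\<And>x y. x \<in> U \<Longrightarrow> y \<in> topspace E \<Longrightarrow>
        limitin F (\<lambda>p. dir_deriv F f (fst p) (snd p)) (dir_deriv F f x y) (nhdsin (prod_topology E E) (x, y))"
  shows "C1_on E F U f"
  unfolding C1_on_limitin_iff using assms by simp

lemma C1_onD:
  assumes "C1_on E F U f" "x \<in> U"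
  shows "limitin F f (f x) (nhdsin E x)"
    and "y \<in> topspace E \<Longrightarrow> \<exists>l. limitin F (\<lambda>t. (f (x + t *\<^sub>R y) - f x) /\<^sub>R t) l (at (0::real))"
    and "y \<in> topspace E \<Longrightarrow>
        limitin F (\<lambda>p. dir_deriv F f (fst p) (snd p)) (dir_deriv F f x y) (nhdsin (prod_topology E E) (x, y))"
  using assms by (simp_all add: C1_on_limitin_iff)

lemma C1_on_mono:
  assumes "C1_on E F U f" "openin E W" "W \<subseteq> U"
  shows "C1_on E F W f"
  using assms(2) subsetD[OF assms(3)] C1_onD[OF assms(1)] by (intro C1_onI) auto

lemma C1_on_local:
  assumes "\<And>x. x \<in> U \<Longrightarrow> \<exists>W. x \<in> W \<and> W \<subseteq> U \<and> C1_on E F W f"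
  shows "C1_on E F U f"
proof (rule C1_onI)
  show "openin E U"
  proof (subst openin_subopen, intro ballI)
    fix x assume "x \<in> U"
    then obtain W where W: "x \<in> W" "W \<subseteq> U" "C1_on E F W f" using assms by blast
    show "\<exists>T. openin E T \<and> x \<in> T \<and> T \<subseteq> U" using W(1,2) C1_openin[OF W(3)] by blast
  qed
next
  fix x assume "x \<in> U"
  then obtain W where W: "x \<in> W" "C1_on E F W f" using assms by blast
  note d = C1_onD[OF W(2,1)]
  show "limitin F f (f x) (nhdsin E x)" by (rule d(1))
  fix y assume y: "y \<in> topspace E"
  show "\<exists>l. limitin F (\<lambda>t. (f (x + t *\<^sub>R y) - f x) /\<^sub>R t) l (at (0::real))" by (rule d(2)[OF y])
  show "limitin F (\<lambda>p. dir_deriv F f (fst p) (snd p)) (dir_deriv F f x y) (nhdsin (prod_topology E E) (x, y))"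
    by (rule d(3)[OF y])
qed

lemma C1_on_cong:
  assumes "lcs E" "\<And>x. x \<in> U \<Longrightarrow> f x = g x" "C1_on E F U f"
  shows "C1_on E F U g"
proof -
  have U: "openin E U" using C1_openin[OF assms(3)] .
  note c = dir_deriv_cong[where f = f and g = g, OF assms(1) U _ _ assms(2)]
  show ?thesis
    unfolding C1_on_limitin_iff
  proof (intro conjI ballI U)
    fix x assume x: "x \<in> U"
    have xE: "x \<in> topspace E" using x C1_subset[OF assms(3)] by blast
    have "\<forall>\<^sub>F z in nhdsin E x. f z = g z"
      using limitinD[OF limitin_nhdsin_id[OF xE] U x] by eventually_elim (rule assms(2))
    from limitin_transform_eventually[OF this C1_cont[OF assms(3) x limitin_nhdsin_id[OF xE]]]
    show "limitin F g (g x) (nhdsin E x)" by (simp add: assms(2)[OF x])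
    fix y assume y: "y \<in> topspace E"
    show "\<exists>l. limitin F (\<lambda>t. (g (x + t *\<^sub>R y) - g x) /\<^sub>R t) l (at (0::real))"
      using C1_onD(2)[OF assms(3) x y] c(1)[OF x y] by simp
    have "\<forall>\<^sub>F p in nhdsin (prod_topology E E) (x, y). dir_deriv F f (fst p) (snd p) = dir_deriv F g (fst p) (snd p)"
      using limitinD[OF nhdsin_fst[OF xE y] U x] limitinD[OF nhdsin_snd[OF xE y] openin_topspace y]
      by eventually_elim (rule c(2))
    from limitin_transform_eventually[OF this C1_deriv_cont[OF assms(3) x nhdsin_fst[OF xE y] nhdsin_snd[OF xE y]]]
    show "limitin F (\<lambda>p. dir_deriv F g (fst p) (snd p)) (dir_deriv F g x y) (nhdsin (prod_topology E E) (x, y))"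
      by (simp add: c(2)[OF x y])
  qed
qed

section \<open>Pullbacks, products and linear maps\<close>

lemma limitin_pullback:
  "limitin (pullback_topology A h X) a z F \<longleftrightarrow> z \<in> A \<and> (\<forall>\<^sub>F i in F. a i \<in> A) \<and> limitin X (\<lambda>i. h (a i)) (h z) F"
proof (intro iffI conjI)
  assume L: "limitin (pullback_topology A h X) a z F"
  have z: "z \<in> A" "h z \<in> topspace X" using limitin_topspace[OF L] by (auto simp: topspace_pullback_topology)
  show "z \<in> A" by fact
  have ev: "\<forall>\<^sub>F i in F. a i \<in> h -` U \<inter> A" if "openin X U" "h z \<in> U" for U
    by (rule limitinD[OF L]) (use that z in \<open>auto simp: openin_pullback_topology\<close>)
  show "\<forall>\<^sub>F i in F. a i \<in> A" using ev[OF openin_topspace z(2)] by eventually_elim simp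
  show "limitin X (\<lambda>i. h (a i)) (h z) F"
    unfolding limitin_def
  proof (intro conjI allI impI z(2))
    fix U assume "openin X U \<and> h z \<in> U"
    hence "\<forall>\<^sub>F i in F. a i \<in> h -` U \<inter> A" using ev by simp
    thus "\<forall>\<^sub>F i in F. h (a i) \<in> U" by eventually_elim simp
  qed
next
  assume R: "z \<in> A \<and> (\<forall>\<^sub>F i in F. a i \<in> A) \<and> limitin X (\<lambda>i. h (a i)) (h z) F"
  show "limitin (pullback_topology A h X) a z F"
    unfolding limitin_def
  proof (intro conjI allI impI)
    show "z \<in> topspace (pullback_topology A h X)"
      using R limitin_topspace[of X _ "h z" F] by (auto simp: topspace_pullback_topology)
    fix U assume "openin (pullback_topology A h X) U \<and> z \<in> U"
    then obtain V where V: "openin X V" "U = h -` V \<inter> A" "h z \<in> V" by (auto simp: openin_pullback_topology)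
    have "\<forall>\<^sub>F i in F. h (a i) \<in> V" "\<forall>\<^sub>F i in F. a i \<in> A" using R V limitinD by (auto simp: limitin_def)
    thus "\<forall>\<^sub>F i in F. a i \<in> U" unfolding V(2) by eventually_elim simp
  qed
qed

text \<open>Three spaces arise in this way: the sequences concentrated at index 0, the square of a
  sequence space realised on the same type, and a tangent space seen through one chart.\<close>

lemma lcs_pullback:
  assumes E: "lcs E" and h: "linear h" and A: "subspace A" and inj: "inj_on h A"
  shows "lcs (pullback_topology A h E)"
  unfolding lcs_def
proof (intro conjI allI impI)
  let ?P = "pullback_topology A h E"
  note add = linear_add[OF h] and sc = linear_scale[OF h]
  have ts: "topspace ?P = A \<inter> h -` topspace E" by (auto simp: topspace_pullback_topology)
  show "subspace (topspace ?P)"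
    unfolding ts using linear_subspace_vimage[OF h lcs_subspace[OF E]] by (rule subspace_inter[OF A])
  show "Hausdorff_space ?P"
    unfolding Hausdorff_space_def
  proof (intro allI impI)
    fix x y assume xy: "x \<in> topspace ?P \<and> y \<in> topspace ?P \<and> x \<noteq> y"
    hence "h x \<in> topspace E" "h y \<in> topspace E" "h x \<noteq> h y" using inj by (auto simp: ts inj_on_def)
    then obtain U V where UV: "openin E U" "openin E V" "h x \<in> U" "h y \<in> V" "disjnt U V"
      using lcs_Hausdorff[OF E] unfolding Hausdorff_space_def by metis
    have "openin ?P (h -` U \<inter> A)" "openin ?P (h -` V \<inter> A)" using UV by (auto simp: openin_pullback_topology)
    moreover have "x \<in> h -` U \<inter> A" "y \<in> h -` V \<inter> A" "disjnt (h -` U \<inter> A) (h -` V \<inter> A)"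
      using UV xy by (auto simp: ts disjnt_def)
    ultimately show "\<exists>U V. openin ?P U \<and> openin ?P V \<and> x \<in> U \<and> y \<in> V \<and> disjnt U V" by blast
  qed
  show "continuous_map (prod_topology ?P ?P) ?P (\<lambda>(x, y). x + y)"
    unfolding continuous_map_limitin case_prod_unfold limitin_pullback
  proof (intro ballI conjI)
    fix p assume p: "p \<in> topspace (prod_topology ?P ?P)"
    have "limitin ?P (\<lambda>q. fst q) (fst p) (nhdsin (prod_topology ?P ?P) p)"
      "limitin ?P (\<lambda>q. snd q) (snd p) (nhdsin (prod_topology ?P ?P) p)"
      using limitin_fst[OF limitin_nhdsin_id[OF p]] limitin_snd[OF limitin_nhdsin_id[OF p]] by auto
    hence l: "\<forall>\<^sub>F q in nhdsin (prod_topology ?P ?P) p. fst q \<in> A" "\<forall>\<^sub>F q in nhdsin (prod_topology ?P ?P) p. snd q \<in> A"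
      "limitin E (\<lambda>q. h (fst q)) (h (fst p)) (nhdsin (prod_topology ?P ?P) p)"
      "limitin E (\<lambda>q. h (snd q)) (h (snd p)) (nhdsin (prod_topology ?P ?P) p)"
      by (auto simp: limitin_pullback)
    show "fst p + snd p \<in> A" using p by (auto simp: ts intro: subspace_add[OF A])
    show "\<forall>\<^sub>F q in nhdsin (prod_topology ?P ?P) p. fst q + snd q \<in> A"
      using l(1,2) by eventually_elim (rule subspace_add[OF A])
    show "limitin E (\<lambda>q. h (fst q + snd q)) (h (fst p + snd p)) (nhdsin (prod_topology ?P ?P) p)"
      unfolding add by (rule lcs_limitin_add[OF E l(3,4)])
  qed
  show "continuous_map (prod_topology euclideanreal ?P) ?P (\<lambda>(r, x). r *\<^sub>R x)"
    unfolding continuous_map_limitin case_prod_unfold limitin_pullback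
  proof (intro ballI conjI)
    fix p assume p: "p \<in> topspace (prod_topology euclideanreal ?P)"
    let ?F = "nhdsin (prod_topology euclideanreal ?P) p"
    have l: "limitin euclideanreal (\<lambda>q. fst q) (fst p) ?F" "limitin ?P (\<lambda>q. snd q) (snd p) ?F"
      using limitin_fst[OF limitin_nhdsin_id[OF p]] limitin_snd[OF limitin_nhdsin_id[OF p]] by auto
    hence l': "\<forall>\<^sub>F q in ?F. snd q \<in> A" "limitin E (\<lambda>q. h (snd q)) (h (snd p)) ?F"
      by (auto simp: limitin_pullback)
    show "fst p *\<^sub>R snd p \<in> A" using p by (auto simp: ts intro: subspace_scale[OF A])
    show "\<forall>\<^sub>F q in ?F. fst q *\<^sub>R snd q \<in> A" using l'(1) by eventually_elim (rule subspace_scale[OF A])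
    show "limitin E (\<lambda>q. h (fst q *\<^sub>R snd q)) (h (fst p *\<^sub>R snd p)) ?F"
      unfolding sc using lcs_limitin_scaleR[OF E _ l'(2)] l(1) by simp
  qed
  fix U assume "openin ?P U \<and> 0 \<in> U"
  then obtain V where V: "openin E V" "U = h -` V \<inter> A" "0 \<in> V" by (auto simp: openin_pullback_topology linear_0[OF h])
  then obtain W where W: "openin E W" "convex W" "0 \<in> W" "W \<subseteq> V" using E unfolding lcs_def by blast
  have "openin ?P (h -` W \<inter> A)" using W by (auto simp: openin_pullback_topology)
  moreover have "convex (h -` W \<inter> A)"
    by (intro convex_Int convex_linear_vimage[OF h W(2)] subspace_imp_convex[OF A])
  moreover have "0 \<in> h -` W \<inter> A" using W subspace_0[OF A] by (simp add: linear_0[OF h])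
  ultimately show "\<exists>V. openin ?P V \<and> convex V \<and> 0 \<in> V \<and> V \<subseteq> U" using W(4) V(2) by blast
qed

lemma lcs_prod:
  assumes E: "lcs E" and F: "lcs F"
  shows "lcs (prod_topology E F)"
  unfolding lcs_def
proof (intro conjI allI impI)
  let ?P = "prod_topology E F"
  show "subspace (topspace ?P)" using subspace_Times[OF lcs_subspace[OF E] lcs_subspace[OF F]] by simp
  show "Hausdorff_space ?P" using lcs_Hausdorff[OF E] lcs_Hausdorff[OF F] by (simp add: Hausdorff_space_prod_topology)
  show "continuous_map (prod_topology ?P ?P) ?P (\<lambda>(x, y). x + y)"
    unfolding continuous_map_limitin case_prod_unfold
  proof
    fix p assume p: "p \<in> topspace (prod_topology ?P ?P)"
    note l = limitin_fst[OF limitin_nhdsin_id[OF p]] limitin_snd[OF limitin_nhdsin_id[OF p]]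
    show "limitin ?P (\<lambda>q. fst q + snd q) (fst p + snd p) (nhdsin (prod_topology ?P ?P) p)"
      using limitin_pairI[OF lcs_limitin_add[OF E limitin_fst[OF l(1)] limitin_fst[OF l(2)]]
          lcs_limitin_add[OF F limitin_snd[OF l(1)] limitin_snd[OF l(2)]]]
      by (simp add: plus_prod_def)
  qed
  show "continuous_map (prod_topology euclideanreal ?P) ?P (\<lambda>(r, x). r *\<^sub>R x)"
    unfolding continuous_map_limitin case_prod_unfold
  proof
    fix p assume p: "p \<in> topspace (prod_topology euclideanreal ?P)"
    note l = limitin_fst[OF limitin_nhdsin_id[OF p], simplified] limitin_snd[OF limitin_nhdsin_id[OF p]]
    show "limitin ?P (\<lambda>q. fst q *\<^sub>R snd q) (fst p *\<^sub>R snd p) (nhdsin (prod_topology euclideanreal ?P) p)"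
      using limitin_pairI[OF lcs_limitin_scaleR[OF E l(1) limitin_fst[OF l(2)]]
          lcs_limitin_scaleR[OF F l(1) limitin_snd[OF l(2)]]]
      by (simp add: scaleR_prod_def)
  qed
  fix U assume "openin ?P U \<and> 0 \<in> U"
  hence "openin ?P U" "(0, 0) \<in> U" by (auto simp: zero_prod_def)
  hence "\<exists>A B. openin E A \<and> openin F B \<and> 0 \<in> A \<and> 0 \<in> B \<and> A \<times> B \<subseteq> U"
    by (simp add: openin_prod_topology_alt)
  then obtain A B where AB: "openin E A" "openin F B" "0 \<in> A" "0 \<in> B" "A \<times> B \<subseteq> U" by blast
  obtain A' where A': "openin E A'" "convex A'" "0 \<in> A'" "A' \<subseteq> A" using E AB unfolding lcs_def by blast
  obtain B' where B': "openin F B'" "convex B'" "0 \<in> B'" "B' \<subseteq> B" using F AB unfolding lcs_def by blast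
  have "openin ?P (A' \<times> B')" "convex (A' \<times> B')" "0 \<in> A' \<times> B'" "A' \<times> B' \<subseteq> U"
    using A' B' AB(5) by (auto simp: openin_prod_Times_iff convex_Times zero_prod_def)
  thus "\<exists>V. openin ?P V \<and> convex V \<and> 0 \<in> V \<and> V \<subseteq> U" by (intro exI[of _ "A' \<times> B'"]) simp
qed

text \<open>In contrast to \<open>C1_on_comp_linear\<close>, the map \<open>h\<close> is continuous
  and linear but need not be a homeomorphism, so it may be a projection.\<close>

lemma C1_on_linear_pre:
  assumes h: "linear h" "continuous_map E1 E2 h" and f: "C1_on E2 F U f"
  shows "C1_on E1 F (topspace E1 \<inter> h -` U) (f \<circ> h)"
proof (rule C1_onI)
  have eq: "topspace E1 \<inter> h -` U = {x \<in> topspace E1. h x \<in> U}" by auto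
  show "openin E1 (topspace E1 \<inter> h -` U)"
    unfolding eq by (rule openin_continuous_map_preimage[OF h(2) C1_openin[OF f]])
  fix x assume "x \<in> topspace E1 \<inter> h -` U"
  hence x: "x \<in> topspace E1" "h x \<in> U" by auto
  have hl: "limitin E2 (\<lambda>i. h (a i)) (h z) \<Phi>" if "limitin E1 a z \<Phi>" for a z and \<Phi> :: "'z filter"
    using continuous_map_limit[OF h(2) that] by (simp add: o_def)
  have hl': "limitin E2 (\<lambda>i. h (a i)) (h z) \<Phi>" if "limitin E1 a z \<Phi>" for a z and \<Phi> :: "'a filter"
    using continuous_map_limit[OF h(2) that] by (simp add: o_def)
  have hl'': "limitin E2 (\<lambda>i. h (a i)) (h z) \<Phi>" if "limitin E1 a z \<Phi>" for a z and \<Phi> :: "('a \<times> 'a) filter"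
    using continuous_map_limit[OF h(2) that] by (simp add: o_def)
  show "limitin F (f \<circ> h) ((f \<circ> h) x) (nhdsin E1 x)"
    using C1_cont[OF f x(2) hl'[OF limitin_nhdsin_id[OF x(1)]]] by (simp add: o_def)
  fix y assume y: "y \<in> topspace E1"
  have hy: "h y \<in> topspace E2" using continuous_map_image_subset_topspace[OF h(2)] y by blast
  show "\<exists>l. limitin F (\<lambda>t. ((f \<circ> h) (x + t *\<^sub>R y) - (f \<circ> h) x) /\<^sub>R t) l (at (0::real))"
    using C1_onD(2)[OF f x(2) hy] by (simp add: linear_add[OF h(1)] linear_scale[OF h(1)])
  show "limitin F (\<lambda>p. dir_deriv F (f \<circ> h) (fst p) (snd p)) (dir_deriv F (f \<circ> h) x y) (nhdsin (prod_topology E1 E1) (x, y))"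
    unfolding dir_deriv_comp_linear[OF h(1)]
    by (intro C1_deriv_cont[OF f x(2)] hl'' nhdsin_fst nhdsin_snd x y)
qed

lemma C1_pair:
  assumes E: "lcs E" and F1: "lcs F1" and F2: "lcs F2" and f: "C1_on E F1 U f" and g: "C1_on E F2 U g"
  shows "C1_on E (prod_topology F1 F2) U (\<lambda>x. (f x, g x))"
    and "x \<in> U \<Longrightarrow> y \<in> topspace E \<Longrightarrow>
      dir_deriv (prod_topology F1 F2) (\<lambda>x. (f x, g x)) x y = (dir_deriv F1 f x y, dir_deriv F2 g x y)"
proof -
  let ?F = "prod_topology F1 F2"
  have lim: "limitin ?F (\<lambda>t. ((f (x + t *\<^sub>R y), g (x + t *\<^sub>R y)) - (f x, g x)) /\<^sub>R t)
      (dir_deriv F1 f x y, dir_deriv F2 g x y) (at (0::real))" if "x \<in> U" "y \<in> topspace E" for x y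
    using limitin_pairI[OF C1_limitin[OF F1 f that] C1_limitin[OF F2 g that]] by simp
  have dd: "dir_deriv ?F (\<lambda>x. (f x, g x)) x y = (dir_deriv F1 f x y, dir_deriv F2 g x y)"
    if "x \<in> U" "y \<in> topspace E" for x y
    by (rule dir_derivI[OF lcs_Hausdorff[OF lcs_prod[OF F1 F2]] lim[OF that]])
  thus "x \<in> U \<Longrightarrow> y \<in> topspace E \<Longrightarrow>
      dir_deriv (prod_topology F1 F2) (\<lambda>x. (f x, g x)) x y = (dir_deriv F1 f x y, dir_deriv F2 g x y)" .
  show "C1_on E ?F U (\<lambda>x. (f x, g x))"
  proof (rule C1_onI)
    show U: "openin E U" using C1_openin[OF f] .
    fix x assume x: "x \<in> U"
    have xE: "x \<in> topspace E" using x C1_subset[OF f] by blast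
    show "limitin ?F (\<lambda>x. (f x, g x)) (f x, g x) (nhdsin E x)"
      by (rule limitin_pairI[OF C1_onD(1)[OF f x] C1_onD(1)[OF g x]])
    fix y assume y: "y \<in> topspace E"
    show "\<exists>l. limitin ?F (\<lambda>t. ((f (x + t *\<^sub>R y), g (x + t *\<^sub>R y)) - (f x, g x)) /\<^sub>R t) l (at (0::real))"
      using lim[OF x y] by blast
    have "\<forall>\<^sub>F p in nhdsin (prod_topology E E) (x, y).
       (dir_deriv F1 f (fst p) (snd p), dir_deriv F2 g (fst p) (snd p)) = dir_deriv ?F (\<lambda>x. (f x, g x)) (fst p) (snd p)"
      using limitinD[OF nhdsin_fst[OF xE y] U x] limitinD[OF nhdsin_snd[OF xE y] openin_topspace y]
      by eventually_elim (simp add: dd)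
    from limitin_transform_eventually[OF this limitin_pairI[OF C1_onD(3)[OF f x y] C1_onD(3)[OF g x y]]]
    show "limitin ?F (\<lambda>p. dir_deriv ?F (\<lambda>x. (f x, g x)) (fst p) (snd p)) (dir_deriv ?F (\<lambda>x. (f x, g x)) x y)
        (nhdsin (prod_topology E E) (x, y))"
      by (simp add: dd[OF x y])
  qed
qed

lemma C1_linear:
  assumes E: "lcs E" and F: "lcs F" and L: "linear L" "continuous_map E F L"
  shows "C1_on E F (topspace E) L"
    and "y \<in> topspace E \<Longrightarrow> dir_deriv F L x y = L y"
proof -
  have m: "L y \<in> topspace F" if "y \<in> topspace E" for y
    using continuous_map_image_subset_topspace[OF L(2)] that by blast
  have nz: "\<forall>\<^sub>F t in at (0::real). t \<noteq> 0" by (simp add: eventually_at_filter)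
  have lim: "limitin F (\<lambda>t. (L (x + t *\<^sub>R y) - L x) /\<^sub>R t) (L y) (at (0::real))" if y: "y \<in> topspace E" for x y
  proof (rule limitin_eventually[OF m[OF y]])
    show "\<forall>\<^sub>F t in at 0. (L (x + t *\<^sub>R y) - L x) /\<^sub>R t = L y"
      using nz by eventually_elim (simp add: linear_add[OF L(1)] linear_scale[OF L(1)])
  qed
  have dd: "dir_deriv F L x y = L y" if "y \<in> topspace E" for x y
    by (rule dir_derivI[OF lcs_Hausdorff[OF F] lim[OF that]])
  thus "y \<in> topspace E \<Longrightarrow> dir_deriv F L x y = L y" .
  show "C1_on E F (topspace E) L"
  proof (rule C1_onI)
    fix x assume x: "x \<in> topspace E"
    show "limitin F L (L x) (nhdsin E x)" using L(2) x by (simp add: continuous_map_limitin)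
    fix y assume y: "y \<in> topspace E"
    show "\<exists>l. limitin F (\<lambda>t. (L (x + t *\<^sub>R y) - L x) /\<^sub>R t) l (at (0::real))" using lim[OF y] by blast
    have "\<forall>\<^sub>F p in nhdsin (prod_topology E E) (x, y). L (snd p) = dir_deriv F L (fst p) (snd p)"
      using limitinD[OF nhdsin_snd[OF x y] openin_topspace y] by eventually_elim (simp add: dd)
    moreover have "limitin F (\<lambda>p. L (snd p)) (L y) (nhdsin (prod_topology E E) (x, y))"
      using continuous_map_limit[OF L(2) nhdsin_snd[OF x y]] by (simp add: o_def)
    ultimately show "limitin F (\<lambda>p. dir_deriv F L (fst p) (snd p)) (dir_deriv F L x y) (nhdsin (prod_topology E E) (x, y))"
      unfolding dd[OF y] by (rule limitin_transform_eventually)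
  qed simp
qed

lemma C1_const:
  assumes F: "lcs F" and c: "c \<in> topspace F" and U: "openin E U"
  shows "C1_on E F U (\<lambda>x. c)" and "dir_deriv F (\<lambda>x. c) x y = 0"
proof -
  have lim: "limitin F (\<lambda>t. (c - c) /\<^sub>R t) 0 (at (0::real))" using lcs_zero[OF F] by simp
  have dd: "dir_deriv F (\<lambda>x. c) x y = 0" for x y by (rule dir_derivI[OF lcs_Hausdorff[OF F] lim])
  thus "dir_deriv F (\<lambda>x. c) x y = 0" .
  show "C1_on E F U (\<lambda>x. c)" using lim U c lcs_zero[OF F] by (intro C1_onI exI[of _ 0]) (auto simp: dd)
qed

section \<open>Higher differentiability\<close>

text \<open>The product of \<open>E\<close> with itself on the type of sequences, as in the
  recursion of \<open>Ck_seq\<close>.\<close>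

abbreviation lcs_square :: "(nat \<Rightarrow> 'a::real_vector) topology \<Rightarrow> (nat \<Rightarrow> 'a) topology" where
  "lcs_square E \<equiv> pullback_topology UNIV unshuffle (prod_topology E E)"

definition shuffle :: "(nat \<Rightarrow> 'a) \<times> (nat \<Rightarrow> 'a) \<Rightarrow> nat \<Rightarrow> 'a" where
  "shuffle p = (\<lambda>i. if even i then fst p (i div 2) else snd p (i div 2))"

lemma unshuffle_shuffle [simp]: "unshuffle (shuffle p) = p"
  by (simp add: unshuffle_def shuffle_def)

lemma linear_unshuffle: "linear (unshuffle :: (nat \<Rightarrow> 'a::real_vector) \<Rightarrow> _)"
  by (rule linearI) (simp_all add: unshuffle_def plus_prod_def scaleR_prod_def fun_eq_iff scaleR_fun_def)

lemma linear_shuffle: "linear (shuffle :: _ \<Rightarrow> nat \<Rightarrow> 'a::real_vector)"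
  by (rule linearI) (simp_all add: shuffle_def fun_eq_iff scaleR_fun_def)

lemma lcs_square: "lcs E \<Longrightarrow> lcs (lcs_square E)"
  by (intro lcs_pullback lcs_prod linear_unshuffle subspace_UNIV) (auto simp: bij_is_inj bij_unshuffle)

lemma topspace_square: "topspace (lcs_square E) = unshuffle -` (topspace E \<times> topspace E)"
  by (auto simp: topspace_pullback_topology)

lemma openin_square: "openin E U \<Longrightarrow> openin (lcs_square E) (unshuffle -` (U \<times> topspace E))"
  by (auto simp: openin_pullback_topology openin_prod_Times_iff intro!: exI[of _ "U \<times> topspace E"])

lemma continuous_map_unshuffle: "continuous_map (lcs_square E) (prod_topology E E) unshuffle"
  using continuous_map_pullback[of "prod_topology E E" "prod_topology E E" "\<lambda>x. x" UNIV unshuffle] by (simp add: o_def)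

lemma continuous_map_shuffle: "continuous_map (prod_topology E E) (lcs_square E) shuffle"
  by (rule continuous_map_pullback') (auto simp: o_def)

lemma Ck_seq_SucD1: "Ck_seq (Suc k) E F U f \<Longrightarrow> C1_on E F U f"
  and Ck_seq_SucD2: "Ck_seq (Suc k) E F U f \<Longrightarrow>
    Ck_seq k (lcs_square E) F (unshuffle -` (U \<times> topspace E)) ((\<lambda>(x, y). dir_deriv F f x y) \<circ> unshuffle)"
  by (simp_all only: Ck_seq.simps)

lemma Ck_seq_SucI: "C1_on E F U f \<Longrightarrow>
    Ck_seq k (lcs_square E) F (unshuffle -` (U \<times> topspace E)) ((\<lambda>(x, y). dir_deriv F f x y) \<circ> unshuffle) \<Longrightarrow>
    Ck_seq (Suc k) E F U f"
  by (simp only: Ck_seq.simps)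

lemma Ck_seq_openin: "Ck_seq k E F U f \<Longrightarrow> openin E U"
  by (cases k) (auto dest: C1_openin)

lemma Ck_seq_cong:
  assumes "lcs E" "\<And>x. x \<in> U \<Longrightarrow> f x = g x" "Ck_seq k E F U f"
  shows "Ck_seq k E F U g"
  using assms
proof (induction k arbitrary: E U f g)
  case 0
  have "U \<subseteq> topspace E" using 0 openin_subset by auto
  thus ?case using 0 continuous_map_eq[of "subtopology E U" F f g] by auto
next
  case (Suc k)
  have C: "C1_on E F U f" using Suc.prems(3) by simp
  show ?case
    unfolding Ck_seq.simps
  proof
    show "C1_on E F U g" by (rule C1_on_cong[OF Suc.prems(1,2) C])
    show "Ck_seq k (lcs_square E) F (unshuffle -` (U \<times> topspace E)) ((\<lambda>(x, y). dir_deriv F g x y) \<circ> unshuffle)"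
    proof (rule Suc.IH[OF lcs_square[OF Suc.prems(1)]])
      show "Ck_seq k (lcs_square E) F (unshuffle -` (U \<times> topspace E)) ((\<lambda>(x, y). dir_deriv F f x y) \<circ> unshuffle)"
        using Suc.prems(3) by simp
      fix z assume "z \<in> unshuffle -` (U \<times> topspace E)"
      thus "((\<lambda>(x, y). dir_deriv F f x y) \<circ> unshuffle) z = ((\<lambda>(x, y). dir_deriv F g x y) \<circ> unshuffle) z"
        using dir_deriv_cong(2)[where f = f and g = g, OF Suc.prems(1) C1_openin[OF C] _ _ Suc.prems(2)]
        by (auto simp: case_prod_unfold)
    qed
  qed
qed

lemma Ck_seq_mono:
  assumes "Ck_seq k E F U f" "openin E W" "W \<subseteq> U"
  shows "Ck_seq k E F W f"
  using assms
proof (induction k arbitrary: E U W f)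
  case 0
  thus ?case using continuous_map_from_subtopology_mono[of E U F f W] by simp
next
  case (Suc k)
  show ?case
    unfolding Ck_seq.simps
  proof
    show "C1_on E F W f" using Suc.prems C1_on_mono[of E F U f W] by simp
    show "Ck_seq k (lcs_square E) F (unshuffle -` (W \<times> topspace E)) ((\<lambda>(x, y). dir_deriv F f x y) \<circ> unshuffle)"
      using Suc.prems(3) by (intro Suc.IH[OF Ck_seq_SucD2[OF Suc.prems(1)] openin_square[OF Suc.prems(2)]]) auto
  qed
qed

text \<open>The differential lives on \<open>U \<times> topspace E\<close>; a cover of
  \<open>U\<close> by open sets \<open>W\<close> induces the cover by the cylinders
  \<open>W \<times> topspace E\<close>, to which the induction hypothesis applies.\<close>

lemma Ck_seq_local:
  assumes "\<And>x. x \<in> U \<Longrightarrow> \<exists>W. x \<in> W \<and> W \<subseteq> U \<and> Ck_seq k E F W f"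
  shows "Ck_seq k E F U f"
  using assms
proof (induction k arbitrary: E U f)
  case 0
  have U: "openin E U"
  proof (subst openin_subopen, intro ballI)
    fix x assume "x \<in> U"
    from 0[OF this] show "\<exists>T. openin E T \<and> x \<in> T \<and> T \<subseteq> U" by auto
  qed
  have "limitin F f (f x) (nhdsin E x)" if x: "x \<in> U" for x
  proof -
    obtain W where W: "x \<in> W" "openin E W" "continuous_map (subtopology E W) F f" using 0[OF x] by auto
    thus ?thesis using continuous_map_open_iff[OF W(2), of F f] by simp
  qed
  thus ?case using U by (simp add: continuous_map_open_iff)
next
  case (Suc k)
  show ?case
    unfolding Ck_seq.simps
  proof
    show "C1_on E F U f"
    proof (rule C1_on_local)
      fix x assume "x \<in> U"
      from Suc.prems[OF this] show "\<exists>W. x \<in> W \<and> W \<subseteq> U \<and> C1_on E F W f" by auto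
    qed
    show "Ck_seq k (lcs_square E) F (unshuffle -` (U \<times> topspace E)) ((\<lambda>(x, y). dir_deriv F f x y) \<circ> unshuffle)"
    proof (rule Suc.IH)
      fix z assume z: "z \<in> unshuffle -` (U \<times> topspace E)"
      hence "fst (unshuffle z) \<in> U" by auto
      from Suc.prems[OF this] obtain W where "fst (unshuffle z) \<in> W" "W \<subseteq> U" "Ck_seq (Suc k) E F W f" by blast
      thus "\<exists>W. z \<in> W \<and> W \<subseteq> unshuffle -` (U \<times> topspace E) \<and>
          Ck_seq k (lcs_square E) F W ((\<lambda>(x, y). dir_deriv F f x y) \<circ> unshuffle)"
        using z by (intro exI[of _ "unshuffle -` (W \<times> topspace E)"]) auto
    qed
  qed
qed

lemma Ck_seq_SucD: "Ck_seq (Suc k) E F U f \<Longrightarrow> Ck_seq k E F U f"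
proof (induction k arbitrary: E U f)
  case 0 thus ?case by (simp add: C1_on_def)
next
  case (Suc k)
  thus ?case unfolding Ck_seq.simps(2)[of "Suc k"] Ck_seq.simps(2)[of k] by blast
qed

text \<open>The differential of \<open>f \<circ> h\<close> at \<open>(x, y)\<close> is that of
  \<open>f\<close> at \<open>(h x, h y)\<close>. So the induction proceeds with the square of
  \<open>h\<close>, transported to sequences as \<open>h'\<close>.\<close>

lemma Ck_seq_linear_pre:
  fixes h :: "(nat \<Rightarrow> 'a::real_vector) \<Rightarrow> (nat \<Rightarrow> 'c::real_vector)"
  assumes "linear h" "continuous_map E1 E2 h" "Ck_seq k E2 F U f"
  shows "Ck_seq k E1 F (topspace E1 \<inter> h -` U) (f \<circ> h)"
  using assms
proof (induction k arbitrary: E1 E2 U f h)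
  case 0
  have eq: "topspace E1 \<inter> h -` U = {x \<in> topspace E1. h x \<in> U}" by auto
  have o: "openin E1 (topspace E1 \<inter> h -` U)"
    unfolding eq by (rule openin_continuous_map_preimage[OF 0(2)]) (use 0 in simp)
  have c: "continuous_map (subtopology E1 (topspace E1 \<inter> h -` U)) (subtopology E2 U) h"
    using 0(2) by (auto simp: continuous_map_in_subtopology continuous_map_from_subtopology)
  show ?case using o continuous_map_compose[OF c, of F f] 0(3) by (simp only: Ck_seq.simps)
next
  case (Suc k)
  define h' where "h' = shuffle \<circ> (\<lambda>p. (h (fst p), h (snd p))) \<circ> (unshuffle :: (nat \<Rightarrow> 'a) \<Rightarrow> _)"
  have sub: "U \<subseteq> topspace E2" using openin_subset[OF Ck_seq_openin[OF Suc.prems(3)]] .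
  have img: "h ` topspace E1 \<subseteq> topspace E2" by (rule continuous_map_image_subset_topspace[OF Suc.prems(2)])
  have lin: "linear (\<lambda>p. (h (fst p), h (snd p)))"
    by (rule linearI) (simp_all add: linear_add[OF Suc.prems(1)] linear_scale[OF Suc.prems(1)])
  have "continuous_map (prod_topology E1 E1) (prod_topology E2 E2) (\<lambda>p. (h (fst p), h (snd p)))"
    using continuous_map_compose[OF continuous_map_fst Suc.prems(2)] continuous_map_compose[OF continuous_map_snd Suc.prems(2)]
    by (intro continuous_map_pairedI) (auto simp: o_def)
  hence "continuous_map (lcs_square E1) (lcs_square E2) h'"
    unfolding h'_def by (intro continuous_map_compose[OF continuous_map_unshuffle] continuous_map_compose[OF _ continuous_map_shuffle])
  moreover have "linear h'" unfolding h'_def by (intro linear_compose linear_unshuffle lin linear_shuffle)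
  ultimately have "Ck_seq k (lcs_square E1) F (topspace (lcs_square E1) \<inter> h' -` unshuffle -` (U \<times> topspace E2))
      (((\<lambda>(x, y). dir_deriv F f x y) \<circ> unshuffle) \<circ> h')"
    by (intro Suc.IH[OF _ _ Ck_seq_SucD2[OF Suc.prems(3)]])
  moreover have "topspace (lcs_square E1) \<inter> h' -` unshuffle -` (U \<times> topspace E2)
      = unshuffle -` ((topspace E1 \<inter> h -` U) \<times> topspace E1)"
    using img by (auto simp: topspace_square h'_def)
  moreover have "((\<lambda>(x, y). dir_deriv F f x y) \<circ> unshuffle) \<circ> h' = (\<lambda>(x, y). dir_deriv F (f \<circ> h) x y) \<circ> unshuffle"
    by (auto simp: fun_eq_iff dir_deriv_comp_linear[OF Suc.prems(1)] h'_def case_prod_unfold)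
  ultimately show ?case
    using C1_on_linear_pre[OF Suc.prems(1,2) Ck_seq_SucD1[OF Suc.prems(3)]] by (intro Ck_seq_SucI) (simp_all only:)
qed

lemma Ck_seq_pair:
  assumes "lcs E" "lcs F1" "lcs F2" "Ck_seq k E F1 U f" "Ck_seq k E F2 U g"
  shows "Ck_seq k E (prod_topology F1 F2) U (\<lambda>x. (f x, g x))"
  using assms
proof (induction k arbitrary: E U f g)
  case 0
  thus ?case by (auto intro: continuous_map_pairedI)
next
  case (Suc k)
  let ?F = "prod_topology F1 F2"
  have fg: "C1_on E F1 U f" "C1_on E F2 U g" using Suc.prems by auto
  note C = C1_pair[OF Suc.prems(1,2,3) fg]
  show ?case
    unfolding Ck_seq.simps
  proof (intro conjI C(1))
    have "Ck_seq k (lcs_square E) ?F (unshuffle -` (U \<times> topspace E))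
      (\<lambda>z. (((\<lambda>(x, y). dir_deriv F1 f x y) \<circ> unshuffle) z, ((\<lambda>(x, y). dir_deriv F2 g x y) \<circ> unshuffle) z))"
      by (intro Suc.IH lcs_square Suc.prems(1,2,3) Ck_seq_SucD2[OF Suc.prems(4)] Ck_seq_SucD2[OF Suc.prems(5)])
    thus "Ck_seq k (lcs_square E) ?F (unshuffle -` (U \<times> topspace E)) ((\<lambda>(x, y). dir_deriv ?F (\<lambda>x. (f x, g x)) x y) \<circ> unshuffle)"
      by (rule Ck_seq_cong[OF lcs_square[OF Suc.prems(1)], rotated]) (auto simp: C(2) case_prod_unfold)
  qed
qed

text \<open>The differential of \<open>L\<close> is \<open>L \<circ> snd\<close>, which is
  continuous and linear again.\<close>

lemma Ck_seq_linear:
  assumes "lcs E" "lcs F" "linear L" "continuous_map E F L"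
  shows "Ck_seq k E F (topspace E) L"
  using assms
proof (induction k arbitrary: E L)
  case 0 thus ?case by simp
next
  case (Suc k)
  note C = C1_linear[OF Suc.prems]
  have "Ck_seq k (lcs_square E) F (topspace (lcs_square E)) (L \<circ> (snd \<circ> unshuffle))"
    by (intro Suc.IH lcs_square Suc.prems linear_compose linear_unshuffle linear_snd continuous_map_compose[OF _ Suc.prems(4)]
        continuous_map_compose[OF continuous_map_unshuffle] continuous_map_snd)
  hence "Ck_seq k (lcs_square E) F (unshuffle -` (topspace E \<times> topspace E)) ((\<lambda>(x, y). dir_deriv F L x y) \<circ> unshuffle)"
    unfolding topspace_square by (rule Ck_seq_cong[OF lcs_square[OF Suc.prems(1)], rotated]) (auto simp: C(2) case_prod_unfold)
  thus ?case by (rule Ck_seq_SucI[OF C(1)])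
qed

lemma Ck_seq_const:
  fixes E :: "(nat \<Rightarrow> 'a::real_vector) topology" and F :: "'b::real_vector topology"
  assumes "lcs F" "c \<in> topspace F" "openin E U"
  shows "Ck_seq k E F U (\<lambda>x. c)"
  using assms
proof (induction k arbitrary: E U c)
  case 0 thus ?case by simp
next
  case (Suc k)
  have "(\<lambda>(x, y). dir_deriv F (\<lambda>x. c) x y) \<circ> unshuffle = (\<lambda>z :: nat \<Rightarrow> 'a. 0)"
    using C1_const(2)[OF Suc.prems] by (auto simp: fun_eq_iff case_prod_unfold)
  hence "Ck_seq k (lcs_square E) F (unshuffle -` (U \<times> topspace E)) ((\<lambda>(x, y). dir_deriv F (\<lambda>x. c) x y) \<circ> unshuffle)"
    using Suc.IH[OF Suc.prems(1) lcs_zero[OF Suc.prems(1)] openin_square[OF Suc.prems(3)]] by (simp only:)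
  thus ?case by (rule Ck_seq_SucI[OF C1_const(1)[OF Suc.prems]])
qed

lemma Ck_seq_linear_post:
  assumes "lcs E" "lcs F" "lcs F'" "linear L" "continuous_map F F' L" "Ck_seq k E F U f"
  shows "Ck_seq k E F' U (L \<circ> f)"
  using assms
proof (induction k arbitrary: E U f)
  case 0
  hence c: "openin E U" "continuous_map (subtopology E U) F f" by auto
  show ?case using c(1) continuous_map_compose[OF c(2) 0(5)] by (simp only: Ck_seq.simps)
next
  case (Suc k)
  have f: "C1_on E F U f" using Suc.prems by simp
  have im: "f ` U \<subseteq> topspace F" using C1_mem[OF f] by blast
  note L = C1_linear[OF Suc.prems(2-5)]
  note C = C1_comp[OF Suc.prems(1-3) f L(1) im]
  have "Ck_seq k (lcs_square E) F' (unshuffle -` (U \<times> topspace E)) (L \<circ> ((\<lambda>(x, y). dir_deriv F f x y) \<circ> unshuffle))"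
    by (intro Suc.IH lcs_square Suc.prems(1-5) Ck_seq_SucD2[OF Suc.prems(6)])
  hence "Ck_seq k (lcs_square E) F' (unshuffle -` (U \<times> topspace E)) ((\<lambda>(x, y). dir_deriv F' (L \<circ> f) x y) \<circ> unshuffle)"
    by (rule Ck_seq_cong[OF lcs_square[OF Suc.prems(1)], rotated])
      (auto simp: C(2) case_prod_unfold L(2) C1_deriv_mem[OF Suc.prems(2) f])
  thus ?case by (rule Ck_seq_SucI[OF C(1)])
qed

text \<open>By the chain rule, the differential of \<open>g \<circ> f\<close> is the composition of
  that of \<open>g\<close> with \<open>\<Phi> = (f \<circ> fst, df)\<close>. Both are of class C^k,
  and \<open>shuffle\<close> keeps \<open>\<Phi>\<close> within sequences, where the induction
  hypothesis is available.\<close>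

lemma Ck_seq_comp:
  fixes E :: "(nat \<Rightarrow> 'a::real_vector) topology" and F :: "(nat \<Rightarrow> 'b::real_vector) topology"
  assumes "lcs E" "lcs F" "lcs H" "Ck_seq k E F U f" "Ck_seq k F H V g" "f ` U \<subseteq> V"
  shows "Ck_seq k E H U (g \<circ> f)"
  using assms
proof (induction k arbitrary: E F U V f g)
  case 0
  have "continuous_map (subtopology E U) (subtopology F V) f"
    using 0 by (auto simp: continuous_map_in_subtopology)
  from continuous_map_compose[OF this, of H g] show ?case using 0 by (simp only: Ck_seq.simps)
next
  case (Suc k)
  note E = Suc.prems(1) and F = Suc.prems(2) and H = Suc.prems(3)
  have f: "C1_on E F U f" and g: "C1_on F H V g" using Suc.prems by auto
  note C = C1_comp[OF E F H f g Suc.prems(6)]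
  have sub: "U \<subseteq> topspace E" by (rule C1_subset[OF f])
  define W where "W = unshuffle -` (U \<times> topspace E)"
  define df where "df = (\<lambda>(x, y). dir_deriv F f x y) \<circ> unshuffle"
  define \<Phi> where "\<Phi> = shuffle \<circ> (\<lambda>z. ((f \<circ> (fst \<circ> unshuffle)) z, df z))"
  have df: "Ck_seq k (lcs_square E) F W df" unfolding df_def W_def by (rule Ck_seq_SucD2[OF Suc.prems(4)])
  have "Ck_seq k (lcs_square E) F (topspace (lcs_square E) \<inter> (fst \<circ> unshuffle) -` U) (f \<circ> (fst \<circ> unshuffle))"
    by (intro Ck_seq_linear_pre[of _ _ E] linear_compose linear_unshuffle linear_fst
        continuous_map_compose[OF continuous_map_unshuffle] continuous_map_fst Ck_seq_SucD[OF Suc.prems(4)])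
  moreover have "topspace (lcs_square E) \<inter> (fst \<circ> unshuffle) -` U = W"
    using sub by (auto simp: topspace_square W_def)
  ultimately have "Ck_seq k (lcs_square E) F W (f \<circ> (fst \<circ> unshuffle))" by simp
  hence "Ck_seq k (lcs_square E) (lcs_square F) W \<Phi>"
    unfolding \<Phi>_def using df
    by (intro Ck_seq_linear_post[OF lcs_square[OF E] lcs_prod[OF F F] lcs_square[OF F] linear_shuffle continuous_map_shuffle]
        Ck_seq_pair lcs_square E F)
  moreover have "Ck_seq k (lcs_square F) H (unshuffle -` (V \<times> topspace F)) ((\<lambda>(x, y). dir_deriv H g x y) \<circ> unshuffle)"
    by (rule Ck_seq_SucD2[OF Suc.prems(5)])
  moreover have "\<Phi> ` W \<subseteq> unshuffle -` (V \<times> topspace F)"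
    using Suc.prems(6) C1_deriv_mem[OF F f] by (auto simp: \<Phi>_def W_def df_def case_prod_unfold)
  ultimately have "Ck_seq k (lcs_square E) H W (((\<lambda>(x, y). dir_deriv H g x y) \<circ> unshuffle) \<circ> \<Phi>)"
    by (rule Suc.IH[OF lcs_square[OF E] lcs_square[OF F] H])
  hence "Ck_seq k (lcs_square E) H W ((\<lambda>(x, y). dir_deriv H (g \<circ> f) x y) \<circ> unshuffle)"
    by (rule Ck_seq_cong[OF lcs_square[OF E], rotated]) (auto simp: C(2) case_prod_unfold W_def \<Phi>_def df_def)
  thus ?case unfolding W_def by (rule Ck_seq_SucI[OF C(1)])
qed

section \<open>Transfer from sequences to arbitrary locally convex spaces\<close>

abbreviation lcs_seq :: "'a::real_vector topology \<Rightarrow> (nat \<Rightarrow> 'a) topology" where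
  "lcs_seq E \<equiv> pullback_topology {z. \<forall>i>0. z i = 0} (\<lambda>z. z 0) E"

definition seq_embed :: "'a::zero \<Rightarrow> nat \<Rightarrow> 'a" where
  "seq_embed x = (\<lambda>i. if i = 0 then x else 0)"

lemma linear_seq_embed: "linear (seq_embed :: 'a::real_vector \<Rightarrow> _)"
  by (rule linearI) (auto simp: seq_embed_def fun_eq_iff scaleR_fun_def)

lemma continuous_map_seq_embed: "continuous_map E (lcs_seq E) seq_embed"
  by (rule continuous_map_pullback') (auto simp: o_def seq_embed_def)

lemma continuous_map_seq_eval: "continuous_map (lcs_seq E) E (\<lambda>z. z 0)"
  using continuous_map_pullback[of E E "\<lambda>x. x"] by (simp add: o_def)

lemma lcs_seq: "lcs E \<Longrightarrow> lcs (lcs_seq E)"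
proof (rule lcs_pullback)
  show "subspace {z :: nat \<Rightarrow> 'a. \<forall>i>0. z i = 0}" by (auto simp: subspace_def scaleR_fun_def)
  show "inj_on (\<lambda>z. z 0) {z :: nat \<Rightarrow> 'a. \<forall>i>0. z i = 0}"
  proof (rule inj_onI)
    fix x y :: "nat \<Rightarrow> 'a"
    assume "x \<in> {z. \<forall>i>0. z i = 0}" "y \<in> {z. \<forall>i>0. z i = 0}" "x 0 = y 0"
    thus "x = y" by (intro ext) (metis (mono_tags) mem_Collect_eq gr0I)
  qed
qed (auto intro: linear_eval)

lemma smooth_on_openin: "smooth_on E F U f \<Longrightarrow> openin E U"
proof -
  assume "smooth_on E F U f"
  hence "Ck_seq 0 (lcs_seq E) F {z. (\<forall>i>0. z i = 0) \<and> z 0 \<in> U} (f \<circ> (\<lambda>z. z 0))"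
    by (simp only: smooth_on_def Ck_on_def)
  hence o: "openin (lcs_seq E) {z. (\<forall>i>0. z i = 0) \<and> z 0 \<in> U}"
    by (rule Ck_seq_openin)
  from openin_continuous_map_preimage[OF continuous_map_seq_embed this]
  have 1: "openin E {x \<in> topspace E. x \<in> U}" by (simp add: seq_embed_def)
  have 2: "U \<subseteq> topspace E"
  proof
    fix x assume "x \<in> U"
    hence "seq_embed x \<in> {z. (\<forall>i>0. z i = 0) \<and> z 0 \<in> U}" by (simp add: seq_embed_def)
    hence "seq_embed x \<in> topspace (lcs_seq E)"
      using openin_subset[OF o] by blast
    thus "x \<in> topspace E" by (simp add: topspace_pullback_topology seq_embed_def)
  qed
  have "{x \<in> topspace E. x \<in> U} = U" using 2 by auto
  thus ?thesis using 1 by simp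
qed

lemma smooth_on_comp:
  assumes E: "lcs E" and F: "lcs F" and H: "lcs H" and f: "smooth_on E F U f" and g: "smooth_on F H V g"
    and fU: "f ` U \<subseteq> V"
  shows "smooth_on E H U (g \<circ> f)"
  unfolding smooth_on_def Ck_on_def
proof
  fix k
  let ?U = "{z. (\<forall>i>0. z i = 0) \<and> z 0 \<in> U}" and ?V = "{z. (\<forall>i>0. z i = 0) \<and> z 0 \<in> V}"
  have "Ck_seq k (lcs_seq E) F ?U (f \<circ> (\<lambda>z. z 0))" using f by (simp add: smooth_on_def Ck_on_def)
  \<comment> \<open>The composition rule \<open>Ck_seq_comp\<close> needs sequences in the middle,
    too; the values of \<open>f\<close> are therefore embedded at index 0.\<close>
  hence "Ck_seq k (lcs_seq E) (lcs_seq F) ?U (seq_embed \<circ> (f \<circ> (\<lambda>z. z 0)))"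
    by (intro Ck_seq_linear_post[OF lcs_seq[OF E] F lcs_seq[OF F] linear_seq_embed continuous_map_seq_embed])
  moreover have "Ck_seq k (lcs_seq F) H ?V (g \<circ> (\<lambda>z. z 0))" using g by (simp add: smooth_on_def Ck_on_def)
  ultimately have "Ck_seq k (lcs_seq E) H ?U ((g \<circ> (\<lambda>z. z 0)) \<circ> (seq_embed \<circ> (f \<circ> (\<lambda>z. z 0))))"
    by (rule Ck_seq_comp[OF lcs_seq[OF E] lcs_seq[OF F] H]) (use fU in \<open>auto simp: seq_embed_def\<close>)
  moreover have "(g \<circ> (\<lambda>z. z 0)) \<circ> (seq_embed \<circ> (f \<circ> (\<lambda>z. z 0))) = g \<circ> f \<circ> (\<lambda>z. z (0::nat))"
    by (auto simp: seq_embed_def)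
  ultimately show "Ck_seq k (lcs_seq E) H ?U (g \<circ> f \<circ> (\<lambda>z. z 0))" by simp
qed

lemma smooth_on_cong:
  assumes "lcs E" "\<And>x. x \<in> U \<Longrightarrow> f x = g x" "smooth_on E F U f"
  shows "smooth_on E F U g"
  unfolding smooth_on_def Ck_on_def
proof
  fix k
  have "Ck_seq k (lcs_seq E) F {z. (\<forall>i>0. z i = 0) \<and> z 0 \<in> U} (f \<circ> (\<lambda>z. z 0))"
    using assms(3) by (simp only: smooth_on_def Ck_on_def)
  thus "Ck_seq k (lcs_seq E) F {z. (\<forall>i>0. z i = 0) \<and> z 0 \<in> U} (g \<circ> (\<lambda>z. z 0))"
    by (rule Ck_seq_cong[OF lcs_seq[OF assms(1)], rotated]) (use assms(2) in auto)
qed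

lemma openin_lcs_seq: "openin E U \<Longrightarrow> openin (lcs_seq E) {z. (\<forall>i>0. z i = 0) \<and> z 0 \<in> U}"
  by (auto simp: openin_pullback_topology intro!: exI[of _ U])

lemma smooth_on_mono:
  assumes "smooth_on E F U f" "openin E W" "W \<subseteq> U"
  shows "smooth_on E F W f"
  unfolding smooth_on_def Ck_on_def
proof
  fix k
  have "Ck_seq k (lcs_seq E) F {z. (\<forall>i>0. z i = 0) \<and> z 0 \<in> U} (f \<circ> (\<lambda>z. z 0))"
    using assms(1) by (simp only: smooth_on_def Ck_on_def)
  thus "Ck_seq k (lcs_seq E) F {z. (\<forall>i>0. z i = 0) \<and> z 0 \<in> W} (f \<circ> (\<lambda>z. z 0))"
    by (rule Ck_seq_mono[OF _ openin_lcs_seq[OF assms(2)]]) (use assms(3) in auto)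
qed

lemma smooth_on_local:
  assumes "\<And>x. x \<in> U \<Longrightarrow> \<exists>W. x \<in> W \<and> W \<subseteq> U \<and> smooth_on E F W f"
  shows "smooth_on E F U f"
  unfolding smooth_on_def Ck_on_def
proof (rule allI, rule Ck_seq_local)
  fix k and z :: "nat \<Rightarrow> 'a" assume z: "z \<in> {z. (\<forall>i>0. z i = 0) \<and> z 0 \<in> U}"
  hence "z 0 \<in> U" by simp
  from assms[OF this] obtain W where W: "z 0 \<in> W" "W \<subseteq> U" "smooth_on E F W f" by (elim exE conjE)
  have "Ck_seq k (lcs_seq E) F {z. (\<forall>i>0. z i = 0) \<and> z 0 \<in> W} (f \<circ> (\<lambda>z. z 0))"
    using W(3) by (simp only: smooth_on_def Ck_on_def)
  thus "\<exists>W. z \<in> W \<and> W \<subseteq> {z. (\<forall>i>0. z i = 0) \<and> z 0 \<in> U} \<and> Ck_seq k (lcs_seq E) F W (f \<circ> (\<lambda>z. z 0))"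
    by (rule_tac x = "{z. (\<forall>i>0. z i = 0) \<and> z 0 \<in> W}" in exI) (use z W(1,2) in \<open>simp add: subset_iff\<close>)
qed

lemma smooth_on_pair:
  assumes "lcs E" "lcs F1" "lcs F2" "smooth_on E F1 U f" "smooth_on E F2 U g"
  shows "smooth_on E (prod_topology F1 F2) U (\<lambda>x. (f x, g x))"
  unfolding smooth_on_def Ck_on_def
proof
  fix k
  have "Ck_seq k (lcs_seq E) F1 {z. (\<forall>i>0. z i = 0) \<and> z 0 \<in> U} (f \<circ> (\<lambda>z. z 0))"
    "Ck_seq k (lcs_seq E) F2 {z. (\<forall>i>0. z i = 0) \<and> z 0 \<in> U} (g \<circ> (\<lambda>z. z 0))"
    using assms(4,5) by (simp_all only: smooth_on_def Ck_on_def)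
  from Ck_seq_pair[OF lcs_seq[OF assms(1)] assms(2,3) this]
  show "Ck_seq k (lcs_seq E) (prod_topology F1 F2) {z. (\<forall>i>0. z i = 0) \<and> z 0 \<in> U} ((\<lambda>x. (f x, g x)) \<circ> (\<lambda>z. z 0))"
    by (simp only: o_def)
qed

lemma smooth_on_linear:
  assumes "lcs E" "lcs F" "linear L" "continuous_map E F L"
  shows "smooth_on E F (topspace E) L"
  unfolding smooth_on_def Ck_on_def topspace_seq_embed[symmetric]
  by (intro allI Ck_seq_linear lcs_seq assms linear_compose[OF linear_eval] continuous_map_compose[OF continuous_map_seq_eval])

lemma smooth_on_const:
  assumes "lcs F" "c \<in> topspace F" "openin E U"
  shows "smooth_on E F U (\<lambda>x. c)"
  unfolding smooth_on_def Ck_on_def o_def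
  by (intro allI Ck_seq_const assms openin_lcs_seq)

lemma smooth_on_id: "lcs E \<Longrightarrow> openin E U \<Longrightarrow> smooth_on E E U (\<lambda>x. x)"
  by (rule smooth_on_mono[OF smooth_on_linear[of E E "\<lambda>x. x"]]) (auto simp: linear_iff dest: openin_subset)

lemma smooth_on_fst: "lcs E \<Longrightarrow> lcs F \<Longrightarrow> openin (prod_topology E F) U \<Longrightarrow> smooth_on (prod_topology E F) E U fst"
  by (rule smooth_on_mono[OF smooth_on_linear[of "prod_topology E F" E fst]])
    (simp_all add: lcs_prod linear_fst continuous_map_fst openin_subset del: topspace_prod_topology)

lemma smooth_on_snd: "lcs E \<Longrightarrow> lcs F \<Longrightarrow> openin (prod_topology E F) U \<Longrightarrow> smooth_on (prod_topology E F) F U snd"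
  by (rule smooth_on_mono[OF smooth_on_linear[of "prod_topology E F" F snd]])
    (simp_all add: lcs_prod linear_snd continuous_map_snd openin_subset del: topspace_prod_topology)

lemma smooth_on_imp_C1:
  assumes "smooth_on E F U f" shows "C1_on E F U f"
proof -
  have "Ck_on (Suc 0) E F U f" using assms by (simp add: smooth_on_def)
  thus ?thesis using Ck_on_Suc[OF openin_subset[OF smooth_on_openin[OF assms]]] by blast
qed

lemma smooth_on_dir_deriv:
  assumes "smooth_on E F U f"
  shows "smooth_on (prod_topology E E) F (U \<times> topspace E) (\<lambda>(x, y). dir_deriv F f x y)"
  unfolding smooth_on_def
proof
  fix k
  have "Ck_on (Suc k) E F U f" using assms by (simp add: smooth_on_def)
  thus "Ck_on k (prod_topology E E) F (U \<times> topspace E) (\<lambda>(x, y). dir_deriv F f x y)"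
    using Ck_on_Suc[OF openin_subset[OF smooth_on_openin[OF assms]]] by blast
qed

section \<open>Smooth maps between manifolds\<close>

lemma smooth_on_map_prod:
  assumes E: "lcs E1" "lcs E2" and F: "lcs F1" "lcs F2"
    and f: "smooth_on E1 F1 U f" and g: "smooth_on E2 F2 V g"
  shows "smooth_on (prod_topology E1 E2) (prod_topology F1 F2) (U \<times> V) (map_prod f g)"
proof -
  have UV: "openin (prod_topology E1 E2) (U \<times> V)"
    using smooth_on_openin[OF f] smooth_on_openin[OF g] by (simp add: openin_prod_Times_iff)
  note P = lcs_prod[OF E]
  have "smooth_on (prod_topology E1 E2) F1 (U \<times> V) (f \<circ> fst)"
    by (rule smooth_on_comp[OF P E(1) F(1) smooth_on_fst[OF E UV] f]) auto
  moreover have "smooth_on (prod_topology E1 E2) F2 (U \<times> V) (g \<circ> snd)"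
    by (rule smooth_on_comp[OF P E(2) F(2) smooth_on_snd[OF E UV] g]) auto
  ultimately have "smooth_on (prod_topology E1 E2) (prod_topology F1 F2) (U \<times> V) (\<lambda>x. ((f \<circ> fst) x, (g \<circ> snd) x))"
    by (rule smooth_on_pair[OF P F])
  moreover have "(\<lambda>x. ((f \<circ> fst) x, (g \<circ> snd) x)) = map_prod f g" by (simp add: fun_eq_iff)
  ultimately show ?thesis by simp
qed

section \<open>Charts of the maximal atlas\<close>

lemma chart_facts:
  assumes c: "c \<in> charts M"
  shows chart_openin: "openin (mtop M) (fst c)"
    and chart_image_openin: "openin (model M) (snd c ` fst c)"
    and chart_homeo: "homeomorphic_map (subtopology (mtop M) (fst c)) (subtopology (model M) (snd c ` fst c)) (snd c)"
    and chart_trans: "d \<in> atlas M \<Longrightarrow> smooth_transition (model M) c d"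
    and chart_trans': "d \<in> atlas M \<Longrightarrow> smooth_transition (model M) d c"
  using c by (auto simp: charts_def)

lemma chart_inj:
  assumes c: "c \<in> charts M"
  shows "inj_on (snd c) (fst c)"
proof -
  have "topspace (subtopology (mtop M) (fst c)) = fst c" using openin_subset[OF chart_openin[OF c]] by auto
  thus ?thesis using homeomorphic_imp_injective_map[OF chart_homeo[OF c]] by simp
qed

lemma chart_inv_chart: "c \<in> charts M \<Longrightarrow> x \<in> fst c \<Longrightarrow> chart_inv c (snd c x) = x"
  unfolding chart_inv_def by (rule inv_into_f_f[OF chart_inj])

lemma chart_chart_inv: "y \<in> snd c ` W \<Longrightarrow> W \<subseteq> fst c \<Longrightarrow> snd c (chart_inv c y) = y"
  unfolding chart_inv_def by (rule f_inv_into_f) blast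

lemma chart_inv_in: "c \<in> charts M \<Longrightarrow> y \<in> snd c ` W \<Longrightarrow> W \<subseteq> fst c \<Longrightarrow> chart_inv c y \<in> W"
  using chart_inv_chart by fastforce

lemma chart_limitin:
  assumes c: "c \<in> charts M" and a: "limitin (mtop M) a x F" and x: "x \<in> fst c"
  shows "limitin (model M) (\<lambda>i. snd c (a i)) (snd c x) F"
proof (rule limitin_open_compose[OF _ chart_openin[OF c] x a])
  show "continuous_map (subtopology (mtop M) (fst c)) (model M) (snd c)"
    using homeomorphic_imp_continuous_map[OF chart_homeo[OF c]] by (simp add: continuous_map_in_subtopology)
qed

lemma chart_inv_limitin:
  assumes c: "c \<in> charts M" and a: "limitin (model M) a y F" and y: "y \<in> snd c ` fst c"
  shows "limitin (mtop M) (\<lambda>i. chart_inv c (a i)) (chart_inv c y) F"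
proof (rule limitin_open_compose[OF _ chart_image_openin[OF c] y a])
  obtain g where g: "homeomorphic_maps (subtopology (mtop M) (fst c)) (subtopology (model M) (snd c ` fst c)) (snd c) g"
    using chart_homeo[OF c] homeomorphic_map_maps by blast
  hence gc: "continuous_map (subtopology (model M) (snd c ` fst c)) (subtopology (mtop M) (fst c)) g"
    and gi: "\<And>x. x \<in> fst c \<Longrightarrow> g (snd c x) = x"
    using openin_subset[OF chart_openin[OF c]] by (auto simp: homeomorphic_maps_def)
  have "continuous_map (subtopology (model M) (snd c ` fst c)) (mtop M) g"
    using gc by (simp add: continuous_map_in_subtopology)
  thus "continuous_map (subtopology (model M) (snd c ` fst c)) (mtop M) (chart_inv c)"
    by (rule continuous_map_eq) (auto simp: gi chart_inv_chart[OF c])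
qed

lemma chart_open_image:
  assumes c: "c \<in> charts M" and W: "openin (mtop M) W" "W \<subseteq> fst c"
  shows "openin (model M) (snd c ` W)"
proof -
  have "openin (subtopology (mtop M) (fst c)) W" using W openin_open_subtopology[OF chart_openin[OF c]] by blast
  hence "openin (subtopology (model M) (snd c ` fst c)) (snd c ` W)"
    using homeomorphic_imp_open_map[OF chart_homeo[OF c]] by (simp add: open_map_def)
  thus ?thesis using openin_open_subtopology[OF chart_image_openin[OF c]] by blast
qed

lemma smooth_manifoldD:
  assumes "smooth_manifold M"
  shows manifold_lcs: "lcs (model M)" and manifold_atlas: "atlas M \<subseteq> charts M"
    and manifold_cover: "(\<Union>c\<in>atlas M. fst c) = topspace (mtop M)"
  using assms by (auto simp: smooth_manifold_def)

lemma chart_exists: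
  assumes "smooth_manifold M" "x \<in> topspace (mtop M)"
  obtains c where "c \<in> atlas M" "c \<in> charts M" "x \<in> fst c"
  using manifold_cover[OF assms(1)] manifold_atlas[OF assms(1)] assms(2) by blast

text \<open>By definition, a chart is compatible with the charts of the given atlas. The transition
  between two arbitrary charts is locally factored through an atlas chart \<open>e\<close>.\<close>

lemma charts_compatible:
  assumes M: "smooth_manifold M" and c: "c \<in> charts M" and d: "d \<in> charts M"
  shows "smooth_on (model M) (model M) (snd c ` (fst c \<inter> fst d)) (snd d \<circ> chart_inv c)"
proof (rule smooth_on_local)
  note L = manifold_lcs[OF M]
  fix y assume y: "y \<in> snd c ` (fst c \<inter> fst d)"
  then obtain x where x: "x \<in> fst c" "x \<in> fst d" "y = snd c x" by blast
  have "x \<in> topspace (mtop M)" using x openin_subset[OF chart_openin[OF c]] by blast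
  then obtain e where e: "e \<in> atlas M" "e \<in> charts M" "x \<in> fst e" by (rule chart_exists[OF M])
  define W where "W = fst c \<inter> fst d \<inter> fst e"
  have Wc: "W \<subseteq> fst c" and We: "W \<subseteq> fst e" by (auto simp: W_def)
  have Wo: "openin (mtop M) W"
    unfolding W_def by (intro openin_Int chart_openin c d e)
  have "smooth_on (model M) (model M) (snd c ` (fst c \<inter> fst e)) (snd e \<circ> chart_inv c)"
    using chart_trans[OF c e(1)] by (simp add: smooth_transition_def)
  hence 1: "smooth_on (model M) (model M) (snd c ` W) (snd e \<circ> chart_inv c)"
    by (rule smooth_on_mono[OF _ chart_open_image[OF c Wo Wc]]) (auto simp: W_def)
  have 2: "smooth_on (model M) (model M) (snd e ` (fst e \<inter> fst d)) (snd d \<circ> chart_inv e)"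
    using chart_trans'[OF d e(1)] by (simp add: smooth_transition_def)
  have "smooth_on (model M) (model M) (snd c ` W) ((snd d \<circ> chart_inv e) \<circ> (snd e \<circ> chart_inv c))"
    by (rule smooth_on_comp[OF L L L 1 2]) (auto simp: W_def chart_inv_chart[OF c])
  hence "smooth_on (model M) (model M) (snd c ` W) (snd d \<circ> chart_inv c)"
    by (rule smooth_on_cong[OF L, rotated]) (auto simp: W_def chart_inv_chart[OF c] chart_inv_chart[OF e(2)])
  moreover have "y \<in> snd c ` W" "snd c ` W \<subseteq> snd c ` (fst c \<inter> fst d)" using x e by (auto simp: W_def)
  ultimately show "\<exists>W. y \<in> W \<and> W \<subseteq> snd c ` (fst c \<inter> fst d) \<and> smooth_on (model M) (model M) W (snd d \<circ> chart_inv c)"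
    by (intro exI[of _ "snd c ` W"] conjI)
qed

section \<open>Local criteria for smooth maps\<close>

lemma smooth_map_onD:
  assumes "smooth_map_on M N S f"
  shows smooth_map_openin: "openin (mtop M) S"
    and smooth_map_cont: "continuous_map (subtopology (mtop M) S) (mtop N) f"
    and smooth_map_charts: "c \<in> charts M \<Longrightarrow> d \<in> charts N \<Longrightarrow>
        smooth_on (model M) (model N) (snd c ` {x \<in> S \<inter> fst c. f x \<in> fst d}) (snd d \<circ> f \<circ> chart_inv c)"
  using assms by (auto simp only: smooth_map_on_def)

lemma smooth_map_limitin:
  assumes "smooth_map_on M N S f" "x \<in> S" "limitin (mtop M) a x F"
  shows "limitin (mtop N) (\<lambda>i. f (a i)) (f x) F"
  by (rule limitin_open_compose[OF smooth_map_cont[OF assms(1)] smooth_map_openin[OF assms(1)] assms(2,3)])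

lemma smooth_map_mem:
  assumes "smooth_map_on M N S f" "x \<in> S"
  shows "f x \<in> topspace (mtop N)"
proof -
  have "x \<in> topspace (mtop M)" using openin_subset[OF smooth_map_openin[OF assms(1)]] assms(2) by blast
  from limitin_topspace[OF smooth_map_limitin[OF assms limitin_nhdsin_id[OF this]]] show ?thesis .
qed

lemma openin_preimage_open:
  assumes S: "openin X S" and f: "continuous_map (subtopology X S) Y f" and T: "openin Y T"
  shows "openin X {x \<in> S. f x \<in> T}"
proof -
  have "openin (subtopology X S) {x \<in> topspace (subtopology X S). f x \<in> T}"
    by (rule openin_continuous_map_preimage[OF f T])
  moreover have "{x \<in> topspace (subtopology X S). f x \<in> T} = {x \<in> S. f x \<in> T}" using openin_subset[OF S] by auto
  ultimately show ?thesis using openin_open_subtopology[OF S] by simp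
qed

text \<open>Smoothness near \<open>x\<close> tested in a single pair of charts, while
  \<open>smooth_map_on\<close> quantifies over all pairs. The open set \<open>W\<close> is part of
  the data so that it can be shrunk at will.\<close>

definition smooth_rep ::
    "('m, 'e::real_vector) manifold \<Rightarrow> ('n, 'f::real_vector) manifold \<Rightarrow> ('m \<Rightarrow> 'n) \<Rightarrow> 'm \<Rightarrow>
     ('m, 'e) chart \<Rightarrow> ('n, 'f) chart \<Rightarrow> 'm set \<Rightarrow> bool" where
  "smooth_rep M N f x c d W \<longleftrightarrow> c \<in> charts M \<and> d \<in> charts N \<and> openin (mtop M) W \<and> x \<in> W \<and> W \<subseteq> fst c \<and>
     f ` W \<subseteq> fst d \<and> smooth_on (model M) (model N) (snd c ` W) (snd d \<circ> f \<circ> chart_inv c)"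

lemma smooth_repD:
  assumes "smooth_rep M N f x c d W"
  shows "c \<in> charts M" "d \<in> charts N" "openin (mtop M) W" "x \<in> W" "W \<subseteq> fst c" "f ` W \<subseteq> fst d"
    "smooth_on (model M) (model N) (snd c ` W) (snd d \<circ> f \<circ> chart_inv c)"
  using assms by (simp_all only: smooth_rep_def)

lemma smooth_rep_mono:
  assumes r: "smooth_rep M N f x c d W" and V: "openin (mtop M) V" "x \<in> V" "V \<subseteq> W"
  shows "smooth_rep M N f x c d V"
proof -
  note r = smooth_repD[OF r]
  have Vc: "V \<subseteq> fst c" "f ` V \<subseteq> fst d" using V r by auto
  have "smooth_on (model M) (model N) (snd c ` V) (snd d \<circ> f \<circ> chart_inv c)"
    by (rule smooth_on_mono[OF r(7) chart_open_image[OF r(1) V(1) Vc(1)]]) (use V in auto)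
  thus ?thesis using r V Vc by (simp only: smooth_rep_def)
qed

text \<open>Near \<open>x\<close>, the map is the composition of the chart \<open>c\<close>, the
  continuous representative and the inverse of the chart \<open>d\<close>.\<close>

lemma smooth_rep_limitin:
  assumes M: "smooth_manifold M" and N: "smooth_manifold N" and r: "smooth_rep M N f x c d W"
    and a: "limitin (mtop M) a x F"
  shows "limitin (mtop N) (\<lambda>i. f (a i)) (f x) F"
proof -
  note r = smooth_repD[OF r]
  have xc: "x \<in> fst c" "snd c x \<in> snd c ` W" "f x \<in> fst d" using r by auto
  have "limitin (model N) (\<lambda>i. (snd d \<circ> f \<circ> chart_inv c) (snd c (a i))) ((snd d \<circ> f \<circ> chart_inv c) (snd c x)) F"
    by (rule C1_cont[OF smooth_on_imp_C1[OF r(7)] xc(2) chart_limitin[OF r(1) a xc(1)]])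
  moreover have "(snd d \<circ> f \<circ> chart_inv c) (snd c x) \<in> snd d ` fst d"
    using xc by (simp add: chart_inv_chart[OF r(1)])
  ultimately have "limitin (mtop N) (\<lambda>i. chart_inv d ((snd d \<circ> f \<circ> chart_inv c) (snd c (a i))))
      (chart_inv d ((snd d \<circ> f \<circ> chart_inv c) (snd c x))) F"
    by (rule chart_inv_limitin[OF r(2)])
  moreover have "chart_inv d ((snd d \<circ> f \<circ> chart_inv c) (snd c x)) = f x"
    using xc by (simp add: chart_inv_chart[OF r(1)] chart_inv_chart[OF r(2)])
  moreover have "\<forall>\<^sub>F i in F. chart_inv d ((snd d \<circ> f \<circ> chart_inv c) (snd c (a i))) = f (a i)"
    using limitinD[OF a r(3,4)]
  proof eventually_elim
    case (elim i)
    hence "a i \<in> fst c" "f (a i) \<in> fst d" using r(5,6) by auto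
    thus ?case by (simp add: chart_inv_chart[OF r(1)] chart_inv_chart[OF r(2)])
  qed
  ultimately show ?thesis using limitin_transform_eventually[of _ _ F "mtop N" "f x"] by simp
qed

text \<open>One suitable pair of charts around each point suffices, and continuity comes for free.
  For arbitrary \<open>c'\<close> and \<open>d'\<close>, the representative is locally the good one,
  composed on both sides with chart transitions.\<close>

lemma smooth_map_onI_local:
  assumes M: "smooth_manifold M" and N: "smooth_manifold N"
    and loc: "\<And>x. x \<in> S \<Longrightarrow> \<exists>c d W. smooth_rep M N f x c d W \<and> W \<subseteq> S"
  shows "smooth_map_on M N S f"
  unfolding smooth_map_on_def
proof (intro conjI ballI)
  note LM = manifold_lcs[OF M] and LN = manifold_lcs[OF N]
  show S: "openin (mtop M) S"
  proof (subst openin_subopen, intro ballI)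
    fix x assume "x \<in> S"
    from loc[OF this] obtain c d W where "smooth_rep M N f x c d W" "W \<subseteq> S" by (elim exE conjE)
    thus "\<exists>T. openin (mtop M) T \<and> x \<in> T \<and> T \<subseteq> S" by (intro exI[of _ W] conjI smooth_repD)
  qed
  show cont: "continuous_map (subtopology (mtop M) S) (mtop N) f"
    unfolding continuous_map_open_iff[OF S]
  proof
    fix x assume x: "x \<in> S"
    from loc[OF this] obtain c d W where r: "smooth_rep M N f x c d W" by (elim exE conjE)
    have "x \<in> topspace (mtop M)" using x openin_subset[OF S] by blast
    from smooth_rep_limitin[OF M N r limitin_nhdsin_id[OF this]]
    show "limitin (mtop N) f (f x) (nhdsin (mtop M) x)" .
  qed
  fix c' d' assume c': "c' \<in> charts M" and d': "d' \<in> charts N"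
  let ?A = "{x \<in> S \<inter> fst c'. f x \<in> fst d'}"
  have Ao: "openin (mtop M) ?A"
  proof -
    have "openin (mtop M) ({x \<in> S. f x \<in> fst d'} \<inter> fst c')"
      by (intro openin_Int openin_preimage_open[OF S cont] chart_openin c' d')
    moreover have "{x \<in> S. f x \<in> fst d'} \<inter> fst c' = ?A" by auto
    ultimately show ?thesis by simp
  qed
  show "smooth_on (model M) (model N) (snd c' ` ?A) (snd d' \<circ> f \<circ> chart_inv c')"
  proof (rule smooth_on_local)
    fix y assume "y \<in> snd c' ` ?A"
    then obtain x where x: "x \<in> ?A" "y = snd c' x" by blast
    hence "x \<in> S" by simp
    from loc[OF this] obtain c d W0 where r0: "smooth_rep M N f x c d W0" by (elim exE conjE)
    define W where "W = W0 \<inter> ?A"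
    have r: "smooth_rep M N f x c d W"
      by (rule smooth_rep_mono[OF r0]) (use smooth_repD[OF r0] x Ao in \<open>auto simp: W_def\<close>)
    note r = smooth_repD[OF r]
    have Wc': "W \<subseteq> fst c'" and Wd': "f ` W \<subseteq> fst d'" by (auto simp: W_def)
    have "smooth_on (model M) (model M) (snd c' ` W) (snd c \<circ> chart_inv c')"
      by (rule smooth_on_mono[OF charts_compatible[OF M c' r(1)] chart_open_image[OF c' r(3) Wc']])
        (use Wc' r(5) in auto)
    hence "smooth_on (model M) (model N) (snd c' ` W) ((snd d \<circ> f \<circ> chart_inv c) \<circ> (snd c \<circ> chart_inv c'))"
      by (rule smooth_on_comp[OF LM LM LN _ r(7)]) (use Wc' r(5) in \<open>auto simp: chart_inv_chart[OF c']\<close>)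
    hence "smooth_on (model M) (model N) (snd c' ` W)
        ((snd d' \<circ> chart_inv d) \<circ> ((snd d \<circ> f \<circ> chart_inv c) \<circ> (snd c \<circ> chart_inv c')))"
    proof (rule smooth_on_comp[OF LM LN LN _ charts_compatible[OF N r(2) d']])
      show "((snd d \<circ> f \<circ> chart_inv c) \<circ> (snd c \<circ> chart_inv c')) ` (snd c' ` W) \<subseteq> snd d ` (fst d \<inter> fst d')"
        using Wc' Wd' r(5,6) by (auto simp: chart_inv_chart[OF c'] chart_inv_chart[OF r(1)] subset_iff)
    qed
    hence "smooth_on (model M) (model N) (snd c' ` W) (snd d' \<circ> f \<circ> chart_inv c')"
    proof (rule smooth_on_cong[OF LM, rotated])
      fix z assume "z \<in> snd c' ` W"
      then obtain w where w: "w \<in> W" "z = snd c' w" by blast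
      hence "w \<in> fst c'" "w \<in> fst c" "f w \<in> fst d" using Wc' r(5,6) by auto
      thus "((snd d' \<circ> chart_inv d) \<circ> ((snd d \<circ> f \<circ> chart_inv c) \<circ> (snd c \<circ> chart_inv c'))) z = (snd d' \<circ> f \<circ> chart_inv c') z"
        by (simp add: w(2) chart_inv_chart[OF c'] chart_inv_chart[OF r(1)] chart_inv_chart[OF r(2)])
    qed
    moreover have "y \<in> snd c' ` W" "snd c' ` W \<subseteq> snd c' ` ?A" using x r(4) by (auto simp: W_def)
    ultimately show "\<exists>W. y \<in> W \<and> W \<subseteq> snd c' ` ?A \<and> smooth_on (model M) (model N) W (snd d' \<circ> f \<circ> chart_inv c')"
      by (intro exI[of _ "snd c' ` W"] conjI)
  qed
qed

lemma smooth_map_rep: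
  assumes f: "smooth_map_on M N S f" and c: "c \<in> charts M" and d: "d \<in> charts N"
    and x: "x \<in> S" "x \<in> fst c" "f x \<in> fst d"
  shows "smooth_rep M N f x c d {x \<in> S \<inter> fst c. f x \<in> fst d}"
proof -
  have "openin (mtop M) ({x \<in> S. f x \<in> fst d} \<inter> fst c)"
    by (intro openin_Int openin_preimage_open[OF smooth_map_openin[OF f] smooth_map_cont[OF f]] chart_openin c d)
  moreover have "{x \<in> S. f x \<in> fst d} \<inter> fst c = {x \<in> S \<inter> fst c. f x \<in> fst d}" by auto
  ultimately show ?thesis
    using smooth_map_charts[OF f c d] c d x by (auto simp: smooth_rep_def)
qed

lemma smooth_map_on_cong:
  assumes M: "smooth_manifold M" and N: "smooth_manifold N" and f: "smooth_map_on M N S f"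
    and eq: "\<And>x. x \<in> S \<Longrightarrow> f x = g x"
  shows "smooth_map_on M N S g"
proof (rule smooth_map_onI_local[OF M N])
  fix x assume x: "x \<in> S"
  have xM: "x \<in> topspace (mtop M)" using x openin_subset[OF smooth_map_openin[OF f]] by blast
  obtain c where c: "c \<in> charts M" "x \<in> fst c" using chart_exists[OF M xM] by metis
  obtain d where d: "d \<in> charts N" "f x \<in> fst d" using chart_exists[OF N smooth_map_mem[OF f x]] by metis
  let ?W = "{x \<in> S \<inter> fst c. f x \<in> fst d}"
  note r = smooth_repD[OF smooth_map_rep[OF f c(1) d(1) x c(2) d(2)]]
  have "smooth_on (model M) (model N) (snd c ` ?W) (snd d \<circ> g \<circ> chart_inv c)"
    by (rule smooth_on_cong[OF manifold_lcs[OF M] _ r(7)]) (auto simp: eq chart_inv_chart[OF c(1)])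
  moreover have "g ` ?W \<subseteq> fst d" using eq by auto
  ultimately have "smooth_rep M N g x c d ?W" using r by (simp only: smooth_rep_def)
  thus "\<exists>c d W. smooth_rep M N g x c d W \<and> W \<subseteq> S" by (intro exI conjI) (assumption, auto)
qed

lemma smooth_map_on_comp:
  assumes M: "smooth_manifold M" and N: "smooth_manifold N" and P: "smooth_manifold P"
    and f: "smooth_map_on M N S f" and g: "smooth_map_on N P T g"
  shows "smooth_map_on M P {x \<in> S. f x \<in> T} (\<lambda>x. g (f x))"
proof (rule smooth_map_onI_local[OF M P])
  fix x assume "x \<in> {x \<in> S. f x \<in> T}"
  hence x: "x \<in> S" "f x \<in> T" by auto
  have xM: "x \<in> topspace (mtop M)" using x openin_subset[OF smooth_map_openin[OF f]] by blast
  obtain c where c: "c \<in> charts M" "x \<in> fst c" using chart_exists[OF M xM] by metis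
  obtain d where d: "d \<in> charts N" "f x \<in> fst d" using chart_exists[OF N smooth_map_mem[OF f x(1)]] by metis
  obtain e where e: "e \<in> charts P" "g (f x) \<in> fst e" using chart_exists[OF P smooth_map_mem[OF g x(2)]] by metis
  let ?A = "{x \<in> S \<inter> fst c. f x \<in> fst d}" and ?B = "{y \<in> T \<inter> fst d. g y \<in> fst e}"
  note r = smooth_map_rep[OF f c(1) d(1) x(1) c(2) d(2)] and s = smooth_repD[OF smooth_map_rep[OF g d(1) e(1) x(2) d(2) e(2)]]
  define W where "W = ?A \<inter> {x \<in> S. f x \<in> ?B}"
  have Wo: "openin (mtop M) W"
    unfolding W_def by (intro openin_Int smooth_repD(3)[OF r] openin_preimage_open[OF smooth_map_openin[OF f] smooth_map_cont[OF f] s(3)])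
  have "smooth_rep M N f x c d W"
    by (rule smooth_rep_mono[OF r Wo]) (use x d e c in \<open>auto simp: W_def\<close>)
  note r' = smooth_repD[OF this]
  have "smooth_on (model M) (model P) (snd c ` W) ((snd e \<circ> g \<circ> chart_inv d) \<circ> (snd d \<circ> f \<circ> chart_inv c))"
    by (rule smooth_on_comp[OF manifold_lcs[OF M] manifold_lcs[OF N] manifold_lcs[OF P] r'(7) s(7)])
      (auto simp: W_def chart_inv_chart[OF c(1)])
  hence "smooth_on (model M) (model P) (snd c ` W) (snd e \<circ> (\<lambda>x. g (f x)) \<circ> chart_inv c)"
    by (rule smooth_on_cong[OF manifold_lcs[OF M], rotated])
      (auto simp: W_def chart_inv_chart[OF c(1)] chart_inv_chart[OF d(1)])
  moreover have "(\<lambda>x. g (f x)) ` W \<subseteq> fst e" by (auto simp: W_def)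
  ultimately have "smooth_rep M P (\<lambda>x. g (f x)) x c e W" using r' e(1) by (simp only: smooth_rep_def)
  thus "\<exists>c d W. smooth_rep M P (\<lambda>x. g (f x)) x c d W \<and> W \<subseteq> {x \<in> S. f x \<in> T}"
    by (intro exI conjI) (assumption, auto simp: W_def)
qed

lemma smooth_map_on_compose:
  assumes "smooth_manifold M" "smooth_manifold N" "smooth_manifold P"
    and f: "smooth_map_on M N S f" and "smooth_map_on N P T g" and "f ` S \<subseteq> T"
  shows "smooth_map_on M P S (\<lambda>x. g (f x))"
proof -
  have "{x \<in> S. f x \<in> T} = S" using assms(6) by auto
  thus ?thesis using smooth_map_on_comp[OF assms(1-5)] by simp
qed

section \<open>Products of manifolds\<close>

definition prod_chart :: "('m, 'e) chart \<Rightarrow> ('n, 'f) chart \<Rightarrow> ('m \<times> 'n, 'e \<times> 'f) chart" where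
  "prod_chart c d = (fst c \<times> fst d, map_prod (snd c) (snd d))"

lemma prod_chart_simps [simp]:
  "fst (prod_chart c d) = fst c \<times> fst d" "snd (prod_chart c d) (x, y) = (snd c x, snd d y)"
  "snd (prod_chart c d) ` (A \<times> B) = snd c ` A \<times> snd d ` B"
  by (auto simp: prod_chart_def map_prod_def image_iff)

lemma prod_chart_inv:
  assumes "inj_on (snd c) (fst c)" "inj_on (snd d) (fst d)" "x \<in> snd c ` fst c" "y \<in> snd d ` fst d"
  shows "chart_inv (prod_chart c d) (x, y) = (chart_inv c x, chart_inv d y)"
proof -
  obtain a b where ab: "a \<in> fst c" "x = snd c a" "b \<in> fst d" "y = snd d b" using assms(3,4) by auto
  have "inj_on (snd (prod_chart c d)) (fst c \<times> fst d)"
    using assms(1,2) by (auto simp: inj_on_def)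
  from inv_into_f_f[OF this, of "(a, b)"] show ?thesis
    using ab assms(1,2) by (simp add: chart_inv_def)
qed

lemma smooth_transition_prod:
  assumes "lcs E" "lcs F" and inj: "inj_on (snd c) (fst c)" "inj_on (snd d) (fst d)"
    and "smooth_transition E c c'" "smooth_transition F d d'"
  shows "smooth_transition (prod_topology E F) (prod_chart c d) (prod_chart c' d')"
proof -
  let ?A = "snd c ` (fst c \<inter> fst c')" and ?B = "snd d ` (fst d \<inter> fst d')"
  have "smooth_on (prod_topology E F) (prod_topology E F) (?A \<times> ?B) (map_prod (snd c' \<circ> chart_inv c) (snd d' \<circ> chart_inv d))"
    using assms by (intro smooth_on_map_prod) (auto simp: smooth_transition_def)
  hence "smooth_on (prod_topology E F) (prod_topology E F) (?A \<times> ?B) (snd (prod_chart c' d') \<circ> chart_inv (prod_chart c d))"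
    by (rule smooth_on_cong[OF lcs_prod[OF assms(1,2)], rotated]) (auto simp: prod_chart_inv[OF inj])
  moreover have "snd (prod_chart c d) ` (fst (prod_chart c d) \<inter> fst (prod_chart c' d')) = ?A \<times> ?B"
    by (simp add: Times_Int_Times)
  ultimately show ?thesis by (simp add: smooth_transition_def)
qed

lemma prod_manifold_simps [simp]:
  "model (prod_manifold M N) = prod_topology (model M) (model N)"
  "mtop (prod_manifold M N) = prod_topology (mtop M) (mtop N)"
  by (simp_all add: prod_manifold_def)

lemma prod_manifold_atlas: "atlas (prod_manifold M N) = {prod_chart c d | c d. c \<in> atlas M \<and> d \<in> atlas N}"
  by (fastforce simp: prod_manifold_def prod_chart_def)

text \<open>The atlas of a product contains products of atlas charts, whereas the charts at given
  points of the factors are drawn from the maximal atlases.\<close>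

lemma prod_chart_in_charts:
  assumes M: "smooth_manifold M" and N: "smooth_manifold N" and c: "c \<in> charts M" and d: "d \<in> charts N"
  shows "prod_chart c d \<in> charts (prod_manifold M N)"
proof -
  note L = manifold_lcs[OF M] manifold_lcs[OF N]
  have hom: "homeomorphic_map (prod_topology (subtopology (mtop M) (fst c)) (subtopology (mtop N) (fst d)))
     (prod_topology (subtopology (model M) (snd c ` fst c)) (subtopology (model N) (snd d ` fst d))) (map_prod (snd c) (snd d))"
  proof -
    obtain g h where "homeomorphic_maps (subtopology (mtop M) (fst c)) (subtopology (model M) (snd c ` fst c)) (snd c) g"
      "homeomorphic_maps (subtopology (mtop N) (fst d)) (subtopology (model N) (snd d ` fst d)) (snd d) h"
      using chart_homeo[OF c] chart_homeo[OF d] homeomorphic_map_maps by metis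
    hence "homeomorphic_maps (prod_topology (subtopology (mtop M) (fst c)) (subtopology (mtop N) (fst d)))
      (prod_topology (subtopology (model M) (snd c ` fst c)) (subtopology (model N) (snd d ` fst d)))
      (\<lambda>(x, y). (snd c x, snd d y)) (\<lambda>(x, y). (g x, h y))"
      by (simp add: homeomorphic_maps_prod)
    hence "homeomorphic_map (prod_topology (subtopology (mtop M) (fst c)) (subtopology (mtop N) (fst d)))
      (prod_topology (subtopology (model M) (snd c ` fst c)) (subtopology (model N) (snd d ` fst d)))
      (\<lambda>(x, y). (snd c x, snd d y))"
      using homeomorphic_maps_map by blast
    thus ?thesis by (simp add: map_prod_def)
  qed
  have tr: "smooth_transition (prod_topology (model M) (model N)) (prod_chart c d) e \<and>
      smooth_transition (prod_topology (model M) (model N)) e (prod_chart c d)"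
    if e: "e \<in> atlas (prod_manifold M N)" for e
  proof -
    obtain c' d' where cd: "c' \<in> atlas M" "d' \<in> atlas N" "e = prod_chart c' d'" using e prod_manifold_atlas[of M N] by auto
    have cd': "c' \<in> charts M" "d' \<in> charts N" using cd manifold_atlas[OF M] manifold_atlas[OF N] by auto
    show ?thesis
      unfolding cd(3) using chart_inj[OF c] chart_inj[OF d] chart_inj[OF cd'(1)] chart_inj[OF cd'(2)]
      by (intro conjI smooth_transition_prod L chart_trans[OF c cd(1)] chart_trans[OF d cd(2)]
          chart_trans'[OF c cd(1)] chart_trans'[OF d cd(2)])
  qed
  have "openin (prod_topology (mtop M) (mtop N)) (fst c \<times> fst d)"
    "openin (prod_topology (model M) (model N)) (map_prod (snd c) (snd d) ` (fst c \<times> fst d))"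
    using chart_openin[OF c] chart_openin[OF d] chart_image_openin[OF c] chart_image_openin[OF d]
    by (auto simp: openin_prod_Times_iff map_prod_surj_on[OF refl refl])
  thus ?thesis
    using hom tr by (simp add: charts_def prod_chart_def map_prod_surj_on[OF refl refl] subtopology_Times)
qed

lemma smooth_manifold_prod:
  assumes M: "smooth_manifold M" and N: "smooth_manifold N"
  shows "smooth_manifold (prod_manifold M N)"
proof -
  have "atlas (prod_manifold M N) \<subseteq> charts (prod_manifold M N)"
  proof
    fix e assume "e \<in> atlas (prod_manifold M N)"
    then obtain c d where cd: "c \<in> atlas M" "d \<in> atlas N" "e = prod_chart c d" by (auto simp: prod_manifold_atlas)
    show "e \<in> charts (prod_manifold M N)"
      unfolding cd(3)
      by (rule prod_chart_in_charts[OF M N subsetD[OF manifold_atlas[OF M] cd(1)] subsetD[OF manifold_atlas[OF N] cd(2)]])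
  qed
  moreover have "(\<Union>c\<in>atlas (prod_manifold M N). fst c) = topspace (mtop M) \<times> topspace (mtop N)"
    unfolding prod_manifold_atlas manifold_cover[OF M, symmetric] manifold_cover[OF N, symmetric]
    by (force simp: prod_chart_def)
  moreover have "Hausdorff_space (mtop M)" "Hausdorff_space (mtop N)" using M N by (auto simp: smooth_manifold_def)
  ultimately show ?thesis
    using lcs_prod[OF manifold_lcs[OF M] manifold_lcs[OF N]]
    by (simp add: smooth_manifold_def Hausdorff_space_prod_topology)
qed

lemma smooth_map_on_pair:
  assumes P: "smooth_manifold P" and M: "smooth_manifold M" and N: "smooth_manifold N"
    and f: "smooth_map_on P M S f" and g: "smooth_map_on P N S g"
  shows "smooth_map_on P (prod_manifold M N) S (\<lambda>x. (f x, g x))"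
proof (rule smooth_map_onI_local[OF P smooth_manifold_prod[OF M N]])
  fix x assume x: "x \<in> S"
  have xP: "x \<in> topspace (mtop P)" using x openin_subset[OF smooth_map_openin[OF f]] by blast
  obtain c where c: "c \<in> charts P" "x \<in> fst c" using chart_exists[OF P xP] by metis
  obtain d where d: "d \<in> charts M" "f x \<in> fst d" using chart_exists[OF M smooth_map_mem[OF f x]] by metis
  obtain e where e: "e \<in> charts N" "g x \<in> fst e" using chart_exists[OF N smooth_map_mem[OF g x]] by metis
  let ?A = "{x \<in> S \<inter> fst c. f x \<in> fst d}" and ?B = "{x \<in> S \<inter> fst c. g x \<in> fst e}"
  note r = smooth_map_rep[OF f c(1) d(1) x c(2) d(2)] and s = smooth_map_rep[OF g c(1) e(1) x c(2) e(2)]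
  have AB: "openin (mtop P) (?A \<inter> ?B)" "x \<in> ?A \<inter> ?B"
    using smooth_repD(3,4)[OF r] smooth_repD(3,4)[OF s] by (auto intro: openin_Int)
  note r' = smooth_repD[OF smooth_rep_mono[OF r AB]] and s' = smooth_repD[OF smooth_rep_mono[OF s AB]]
  have "smooth_on (model P) (prod_topology (model M) (model N)) (snd c ` (?A \<inter> ?B))
     (\<lambda>y. ((snd d \<circ> f \<circ> chart_inv c) y, (snd e \<circ> g \<circ> chart_inv c) y))"
    by (rule smooth_on_pair[OF manifold_lcs[OF P] manifold_lcs[OF M] manifold_lcs[OF N] r'(7) s'(7)]) auto
  hence "smooth_rep P (prod_manifold M N) (\<lambda>x. (f x, g x)) x c (prod_chart d e) (?A \<inter> ?B)"
    using prod_chart_in_charts[OF M N d(1) e(1)] AB c(1)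
    by (auto simp: smooth_rep_def o_def)
  thus "\<exists>c d W. smooth_rep P (prod_manifold M N) (\<lambda>x. (f x, g x)) x c d W \<and> W \<subseteq> S"
    by (intro exI conjI) (assumption, auto)
qed

lemma smooth_map_on_const:
  assumes M: "smooth_manifold M" and N: "smooth_manifold N" and S: "openin (mtop M) S" and k: "k \<in> topspace (mtop N)"
  shows "smooth_map_on M N S (\<lambda>x. k)"
proof (rule smooth_map_onI_local[OF M N])
  fix x assume x: "x \<in> S"
  have xM: "x \<in> topspace (mtop M)" using x openin_subset[OF S] by blast
  obtain c where c: "c \<in> charts M" "x \<in> fst c" using chart_exists[OF M xM] by metis
  obtain d where d: "d \<in> charts N" "k \<in> fst d" using chart_exists[OF N k] by metis
  have o: "openin (mtop M) (S \<inter> fst c)" by (intro openin_Int S chart_openin c)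
  have "snd d k \<in> topspace (model N)" using openin_subset[OF chart_image_openin[OF d(1)]] d(2) by blast
  hence "smooth_on (model M) (model N) (snd c ` (S \<inter> fst c)) (\<lambda>y. snd d k)"
    by (intro smooth_on_const manifold_lcs N chart_open_image[OF c(1) o]) auto
  hence "smooth_rep M N (\<lambda>x. k) x c d (S \<inter> fst c)" using c d x o by (auto simp: smooth_rep_def o_def)
  thus "\<exists>c d W. smooth_rep M N (\<lambda>x. k) x c d W \<and> W \<subseteq> S" by (intro exI conjI) (assumption, auto)
qed

section \<open>Locally convex spaces as manifolds\<close>

lemma lcs_manifold_simps [simp]:
  "model (lcs_manifold E) = E" "mtop (lcs_manifold E) = E" "atlas (lcs_manifold E) = {(topspace E, \<lambda>x. x)}"
  by (simp_all add: lcs_manifold_def)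

lemma chart_inv_id: "x \<in> U \<Longrightarrow> chart_inv (U, \<lambda>x. x) x = x"
  by (simp add: chart_inv_def inv_into_f_f[of "\<lambda>x. x"])

lemma lcs_manifold_chart: "lcs E \<Longrightarrow> (topspace E, \<lambda>x. x) \<in> charts (lcs_manifold E)"
proof -
  assume E: "lcs E"
  have "smooth_on E E (topspace E) ((\<lambda>x. x) \<circ> chart_inv (topspace E, \<lambda>x. x))"
    by (rule smooth_on_cong[OF E _ smooth_on_id[OF E openin_topspace]]) (simp add: chart_inv_id)
  moreover have "homeomorphic_map E E (\<lambda>x. x)" using homeomorphic_map_id[of E E] by (simp add: id_def)
  ultimately show ?thesis by (simp add: charts_def smooth_transition_def)
qed

lemma smooth_manifold_lcs: "lcs E \<Longrightarrow> smooth_manifold (lcs_manifold E)"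
  using lcs_manifold_chart[of E] lcs_Hausdorff[of E] by (simp add: smooth_manifold_def)

lemma smooth_on_imp_smooth_map:
  assumes E: "lcs E" and F: "lcs F" and f: "smooth_on E F U f"
  shows "smooth_map_on (lcs_manifold E) (lcs_manifold F) U f"
proof (rule smooth_map_onI_local[OF smooth_manifold_lcs[OF E] smooth_manifold_lcs[OF F]])
  fix x assume x: "x \<in> U"
  note U = smooth_on_openin[OF f]
  have UE: "U \<subseteq> topspace E" using openin_subset[OF U] .
  have "smooth_on E F U ((\<lambda>x. x) \<circ> f \<circ> chart_inv (topspace E, \<lambda>x. x))"
    by (rule smooth_on_cong[OF E _ f]) (use UE in \<open>auto simp: chart_inv_id\<close>)
  moreover have "f ` U \<subseteq> topspace F" using C1_mem[OF smooth_on_imp_C1[OF f]] by blast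
  ultimately have "smooth_rep (lcs_manifold E) (lcs_manifold F) f x (topspace E, \<lambda>x. x) (topspace F, \<lambda>x. x) U"
    using U UE x lcs_manifold_chart[OF E] lcs_manifold_chart[OF F] by (simp add: smooth_rep_def)
  thus "\<exists>c d W. smooth_rep (lcs_manifold E) (lcs_manifold F) f x c d W \<and> W \<subseteq> U" by (intro exI conjI) (assumption, simp)
qed

lemma smooth_map_imp_smooth_on:
  assumes E: "lcs E" and F: "lcs F" and f: "smooth_map_on (lcs_manifold E) (lcs_manifold F) U f"
  shows "smooth_on E F U f"
proof -
  have UE: "U \<subseteq> topspace E" using openin_subset[OF smooth_map_openin[OF f]] by simp
  have "(\<lambda>x. x) ` {x \<in> U \<inter> topspace E. f x \<in> topspace F} = U"
    using UE smooth_map_mem[OF f] by auto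
  hence "smooth_on E F U ((\<lambda>x. x) \<circ> f \<circ> chart_inv (topspace E, \<lambda>x. x))"
    using smooth_map_charts[OF f lcs_manifold_chart[OF E] lcs_manifold_chart[OF F]] by simp
  thus ?thesis by (rule smooth_on_cong[OF E, rotated]) (use UE in \<open>auto simp: chart_inv_id\<close>)
qed

text \<open>With charts and their inverses as smooth maps, the smoothness of the group operations in
  charts follows by composing maps of manifolds.\<close>

lemma smooth_map_chart:
  assumes M: "smooth_manifold M" and c: "c \<in> charts M"
  shows "smooth_map_on M (lcs_manifold (model M)) (fst c) (snd c)"
    and "smooth_map_on (lcs_manifold (model M)) M (snd c ` fst c) (chart_inv c)"
proof -
  note L = manifold_lcs[OF M]
  note T = lcs_manifold_chart[OF L] and U = chart_image_openin[OF c]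
  have UE: "snd c ` fst c \<subseteq> topspace (model M)" using openin_subset[OF U] .
  have id: "smooth_on (model M) (model M) (snd c ` fst c) (\<lambda>y. y)" by (rule smooth_on_id[OF L U])
  have "smooth_on (model M) (model M) (snd c ` fst c) ((\<lambda>x. x) \<circ> snd c \<circ> chart_inv c)"
    by (rule smooth_on_cong[OF L _ id]) (auto simp: chart_inv_chart[OF c])
  hence "smooth_rep M (lcs_manifold (model M)) (snd c) x c (topspace (model M), \<lambda>x. x) (fst c)" if "x \<in> fst c" for x
    using that c T chart_openin[OF c] UE by (simp add: smooth_rep_def)
  thus "smooth_map_on M (lcs_manifold (model M)) (fst c) (snd c)"
    by (intro smooth_map_onI_local[OF M smooth_manifold_lcs[OF L]] exI conjI) (assumption, simp)
  have "smooth_on (model M) (model M) (snd c ` fst c) (snd c \<circ> chart_inv c \<circ> chart_inv (topspace (model M), \<lambda>x. x))"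
    by (rule smooth_on_cong[OF L _ id]) (use UE in \<open>auto simp: chart_inv_chart[OF c] chart_inv_id\<close>)
  moreover have "chart_inv c ` (snd c ` fst c) \<subseteq> fst c" by (auto simp: chart_inv_chart[OF c])
  ultimately have "smooth_rep (lcs_manifold (model M)) M (chart_inv c) y (topspace (model M), \<lambda>x. x) c (snd c ` fst c)"
    if "y \<in> snd c ` fst c" for y
    using that c T U UE by (simp add: smooth_rep_def)
  thus "smooth_map_on (lcs_manifold (model M)) M (snd c ` fst c) (chart_inv c)"
    by (intro smooth_map_onI_local[OF smooth_manifold_lcs[OF L] M] exI conjI) (assumption, simp)
qed

text \<open>Used to shrink a chart at the neutral element to a domain that is stable under
  inversion, as \<open>AC_manifold\<close> demands.\<close>

lemma chart_restrict:
  assumes M: "smooth_manifold M" and c: "c \<in> charts M" and W: "openin (mtop M) W" "W \<subseteq> fst c"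
  shows "(W, snd c) \<in> charts M"
proof -
  note L = manifold_lcs[OF M]
  have o: "openin (model M) (snd c ` W)" by (rule chart_open_image[OF c W])
  have ci: "chart_inv (W, snd c) (snd c x) = x" if "x \<in> W" for x
    using inv_into_f_f[OF inj_on_subset[OF chart_inj[OF c] W(2)] that] by (simp add: chart_inv_def)
  have "homeomorphic_map (subtopology (subtopology (mtop M) (fst c)) W)
      (subtopology (subtopology (model M) (snd c ` fst c)) (snd c ` W)) (snd c)"
    by (rule homeomorphic_map_subtopologies[OF chart_homeo[OF c]])
      (use W openin_subset[OF W(1)] openin_subset[OF o] in auto)
  moreover have "subtopology (subtopology (mtop M) (fst c)) W = subtopology (mtop M) W"
    "subtopology (subtopology (model M) (snd c ` fst c)) (snd c ` W) = subtopology (model M) (snd c ` W)"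
    using W(2) by (simp_all add: subtopology_subtopology Int_absorb1 image_mono)
  ultimately have h: "homeomorphic_map (subtopology (mtop M) W) (subtopology (model M) (snd c ` W)) (snd c)" by simp
  have "smooth_transition (model M) (W, snd c) d \<and> smooth_transition (model M) d (W, snd c)" if d: "d \<in> atlas M" for d
  proof -
    have d': "d \<in> charts M" using d manifold_atlas[OF M] by blast
    have o1: "openin (model M) (snd c ` (W \<inter> fst d))"
      by (rule chart_open_image[OF c openin_Int[OF W(1) chart_openin[OF d']]]) (use W in auto)
    have o2: "openin (model M) (snd d ` (fst d \<inter> W))"
      by (rule chart_open_image[OF d' openin_Int[OF chart_openin[OF d'] W(1)]]) auto
    have 1: "smooth_on (model M) (model M) (snd c ` (W \<inter> fst d)) (snd d \<circ> chart_inv c)"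
      by (rule smooth_on_mono[OF charts_compatible[OF M c d'] o1]) (use W in auto)
    have "smooth_on (model M) (model M) (snd c ` (W \<inter> fst d)) (snd d \<circ> chart_inv (W, snd c))"
      by (rule smooth_on_cong[OF L _ 1]) (use W(2) in \<open>auto simp: ci chart_inv_chart[OF c] subset_iff\<close>)
    moreover have "smooth_on (model M) (model M) (snd d ` (fst d \<inter> W)) (snd c \<circ> chart_inv d)"
      by (rule smooth_on_mono[OF charts_compatible[OF M d' c] o2]) (use W in auto)
    ultimately show ?thesis by (simp add: smooth_transition_def)
  qed
  thus ?thesis using h o W(1) by (simp add: charts_def)
qed

section \<open>Topologies defined by seminorms\<close>

definition seminorm_topology :: "'a::real_vector set \<Rightarrow> ('a \<Rightarrow> real) set \<Rightarrow> 'a topology" where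
  "seminorm_topology V Q = topology_generated_by {{y \<in> V. q (y - x) < e} | q x e. q \<in> Q \<and> x \<in> V \<and> 0 < e}"

text \<open>An abstraction of the topology of \<open>R_space\<close>. Directedness makes the balls
  of single members of \<open>Q\<close> a base, and separation gives the Hausdorff property.\<close>

locale seminorm_family =
  fixes V :: "'a::real_vector set" and Q :: "('a \<Rightarrow> real) set"
  assumes V: "subspace V" and Q_nonempty: "Q \<noteq> {}"
    and Q_add: "q \<in> Q \<Longrightarrow> x \<in> V \<Longrightarrow> y \<in> V \<Longrightarrow> q (x + y) \<le> q x + q y"
    and Q_scale: "q \<in> Q \<Longrightarrow> x \<in> V \<Longrightarrow> q (r *\<^sub>R x) = \<bar>r\<bar> * q x"
    and Q_directed: "p \<in> Q \<Longrightarrow> q \<in> Q \<Longrightarrow> \<exists>r\<in>Q. \<forall>x\<in>V. p x \<le> r x \<and> q x \<le> r x"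
    and Q_separating: "x \<in> V \<Longrightarrow> (\<And>q. q \<in> Q \<Longrightarrow> q x = 0) \<Longrightarrow> x = 0"
begin

abbreviation "T \<equiv> seminorm_topology V Q"

lemma V_closed: "0 \<in> V" "x \<in> V \<Longrightarrow> y \<in> V \<Longrightarrow> x + y \<in> V" "x \<in> V \<Longrightarrow> y \<in> V \<Longrightarrow> x - y \<in> V" "x \<in> V \<Longrightarrow> r *\<^sub>R x \<in> V"
  using V by (auto simp: subspace_0 subspace_add subspace_diff subspace_scale)

lemma Q_zero: "q \<in> Q \<Longrightarrow> q 0 = 0"
  using Q_scale[of q 0 0] V_closed by simp

lemma Q_minus: "q \<in> Q \<Longrightarrow> x \<in> V \<Longrightarrow> y \<in> V \<Longrightarrow> q (x - y) = q (y - x)"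
  using Q_scale[of q "x - y" "-1"] V_closed by simp

lemma Q_nonneg: "q \<in> Q \<Longrightarrow> x \<in> V \<Longrightarrow> 0 \<le> q x"
  using Q_add[of q x "- x"] Q_scale[of q x "-1"] V_closed(4)[of x "-1"] Q_zero[of q] by simp

lemma Q_triangle: "q \<in> Q \<Longrightarrow> x \<in> V \<Longrightarrow> y \<in> V \<Longrightarrow> z \<in> V \<Longrightarrow> q (x - z) \<le> q (x - y) + q (y - z)"
  using Q_add[of q "x - y" "y - z"] V_closed(3) by simp

lemma topspace_T: "topspace T = V"
proof -
  obtain q where q: "q \<in> Q" using Q_nonempty by blast
  have "x \<in> topspace T" if "x \<in> V" for x
    unfolding seminorm_topology_def topology_generated_by_topspace
    using q that Q_zero[OF q] by (intro UnionI[of "{y \<in> V. q (y - x) < 1}"]) (auto intro!: exI[of _ q] exI[of _ x] exI[of _ "1::real"])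
  thus ?thesis unfolding seminorm_topology_def topology_generated_by_topspace by auto
qed

lemma openin_ball: "q \<in> Q \<Longrightarrow> x \<in> V \<Longrightarrow> 0 < e \<Longrightarrow> openin T {y \<in> V. q (y - x) < e}"
  unfolding seminorm_topology_def by (rule topology_generated_by_Basis) blast

text \<open>Induction over the generation of open sets; an intersection of two balls contains a ball
  of a common upper bound of the two seminorms.\<close>

lemma openin_ball_subset:
  assumes "openin T U" "x \<in> U"
  shows "\<exists>q\<in>Q. \<exists>e>0. {y \<in> V. q (y - x) < e} \<subseteq> U"
  using assms(1)[unfolded seminorm_topology_def, THEN openin_topology_generated_by] assms(2)
proof (induction arbitrary: x rule: generate_topology_on.induct)
  case (Int A B)
  obtain p d where p: "p \<in> Q" "0 < d" "{y \<in> V. p (y - x) < d} \<subseteq> A" using Int.IH(1)[of x] Int.prems by blast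
  obtain q e where q: "q \<in> Q" "0 < e" "{y \<in> V. q (y - x) < e} \<subseteq> B" using Int.IH(2)[of x] Int.prems by blast
  obtain r where r: "r \<in> Q" "\<And>z. z \<in> V \<Longrightarrow> p z \<le> r z \<and> q z \<le> r z" using Q_directed[OF p(1) q(1)] by blast
  have "x \<in> V"
  proof -
    have "openin T A" using Int.hyps(1) by (simp add: seminorm_topology_def openin_topology_generated_by_iff)
    thus ?thesis using openin_subset Int.prems topspace_T by blast
  qed
  hence "{y \<in> V. r (y - x) < min d e} \<subseteq> A \<inter> B" using r(2)[OF V_closed(3)] p(3) q(3) by fastforce
  thus ?case using r(1) p(2) q(2) by (intro bexI[of _ r] exI[of _ "min d e"]) auto
next
  case (UN K)
  then obtain k where k: "k \<in> K" "x \<in> k" by blast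
  from UN.IH[OF k] obtain q e where "q \<in> Q" "0 < e" "{y \<in> V. q (y - x) < e} \<subseteq> k" by blast
  thus ?case using k(1) by (intro bexI[of _ q] exI[of _ e]) auto
next
  case (Basis S)
  then obtain q a e where S: "S = {y \<in> V. q (y - a) < e}" "q \<in> Q" "a \<in> V" "0 < e" by blast
  have x: "x \<in> V" "q (x - a) < e" using Basis.prems S(1) by auto
  have "{y \<in> V. q (y - x) < e - q (x - a)} \<subseteq> S"
    using Q_triangle[OF S(2) _ x(1) S(3)] S(1) by fastforce
  thus ?case using S(2) x by (intro bexI[of _ q] exI[of _ "e - q (x - a)"]) auto
qed simp

lemma limitin_T:
  "limitin T f a F \<longleftrightarrow> a \<in> V \<and> (\<forall>\<^sub>F i in F. f i \<in> V) \<and> (\<forall>q\<in>Q. \<forall>e>0. \<forall>\<^sub>F i in F. q (f i - a) < e)"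
proof (intro iffI conjI ballI allI impI)
  assume L: "limitin T f a F"
  show a: "a \<in> V" using limitin_topspace[OF L] topspace_T by simp
  show "\<forall>\<^sub>F i in F. f i \<in> V" using limitinD[OF L openin_topspace] a topspace_T by simp
  fix q e assume q: "q \<in> Q" and e: "(0::real) < e"
  have "\<forall>\<^sub>F i in F. f i \<in> {y \<in> V. q (y - a) < e}"
    by (rule limitinD[OF L openin_ball[OF q a e]]) (use a e Q_zero[OF q] in auto)
  thus "\<forall>\<^sub>F i in F. q (f i - a) < e" by eventually_elim simp
next
  assume R: "a \<in> V \<and> (\<forall>\<^sub>F i in F. f i \<in> V) \<and> (\<forall>q\<in>Q. \<forall>e>0. \<forall>\<^sub>F i in F. q (f i - a) < e)"
  show "limitin T f a F"
    unfolding limitin_def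
  proof (intro conjI allI impI)
    show "a \<in> topspace T" using R topspace_T by simp
    fix U assume "openin T U \<and> a \<in> U"
    then obtain q e where q: "q \<in> Q" "0 < e" "{y \<in> V. q (y - a) < e} \<subseteq> U" using openin_ball_subset by metis
    have "\<forall>\<^sub>F i in F. f i \<in> V" "\<forall>\<^sub>F i in F. q (f i - a) < e" using R q by auto
    thus "\<forall>\<^sub>F i in F. f i \<in> U" by eventually_elim (use q(3) in auto)
  qed
qed

lemma lcs_T: "lcs T"
  unfolding lcs_def
proof (intro conjI allI impI)
  show "subspace (topspace T)" using V topspace_T by simp
  show "Hausdorff_space T"
    unfolding Hausdorff_space_def
  proof (intro allI impI)
    fix x y assume xy: "x \<in> topspace T \<and> y \<in> topspace T \<and> x \<noteq> y"
    hence V': "x \<in> V" "y \<in> V" using topspace_T by auto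
    have "x - y \<noteq> 0" using xy by simp
    then obtain q where q: "q \<in> Q" "q (x - y) \<noteq> 0" using Q_separating[OF V_closed(3)[OF V']] by blast
    define d where "d = q (x - y) / 2"
    have d: "0 < d" using q(2) Q_nonneg[OF q(1) V_closed(3)[OF V']] by (simp add: d_def)
    have "disjnt {z \<in> V. q (z - x) < d} {z \<in> V. q (z - y) < d}"
    proof -
      have "q (x - y) < q (x - y)" if "z \<in> V" "q (z - x) < d" "q (z - y) < d" for z
        using Q_triangle[OF q(1) V'(1) that(1) V'(2)] Q_minus[OF q(1) that(1) V'(1)] that by (simp add: d_def)
      thus ?thesis by (auto simp: disjnt_def)
    qed
    thus "\<exists>U W. openin T U \<and> openin T W \<and> x \<in> U \<and> y \<in> W \<and> disjnt U W"
      using openin_ball[OF q(1) V'(1) d] openin_ball[OF q(1) V'(2) d] V' d Q_zero[OF q(1)]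
      by (intro exI[of _ "{z \<in> V. q (z - x) < d}"] exI[of _ "{z \<in> V. q (z - y) < d}"]) simp
  qed
  show "continuous_map (prod_topology T T) T (\<lambda>(x, y). x + y)"
    unfolding continuous_map_limitin case_prod_unfold limitin_T
  proof (intro ballI conjI allI impI)
    fix p assume p: "p \<in> topspace (prod_topology T T)"
    note l = limitin_fst[OF limitin_nhdsin_id[OF p], unfolded limitin_T] limitin_snd[OF limitin_nhdsin_id[OF p], unfolded limitin_T]
    have pV: "fst p \<in> V" "snd p \<in> V" using l by auto
    have ev: "\<forall>\<^sub>F z in nhdsin (prod_topology T T) p. fst z \<in> V" "\<forall>\<^sub>F z in nhdsin (prod_topology T T) p. snd z \<in> V" using l by auto
    show "fst p + snd p \<in> V" by (intro V_closed pV)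
    show "\<forall>\<^sub>F z in nhdsin (prod_topology T T) p. fst z + snd z \<in> V" using ev by eventually_elim (rule V_closed)
    fix q e assume q: "q \<in> Q" and e: "(0::real) < e"
    have "\<forall>\<^sub>F z in nhdsin (prod_topology T T) p. q (fst z - fst p) < e / 2"
      "\<forall>\<^sub>F z in nhdsin (prod_topology T T) p. q (snd z - snd p) < e / 2"
      using l q half_gt_zero[OF e] by blast+
    thus "\<forall>\<^sub>F z in nhdsin (prod_topology T T) p. q (fst z + snd z - (fst p + snd p)) < e"
      using ev
    proof eventually_elim
      case (elim z)
      have "fst z + snd z - (fst p + snd p) = (fst z - fst p) + (snd z - snd p)" by (rule add_diff_add)
      moreover have "q ((fst z - fst p) + (snd z - snd p)) < e"
        using Q_add[OF q V_closed(3)[OF elim(3) pV(1)] V_closed(3)[OF elim(4) pV(2)]] elim(1,2) by simp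
      ultimately show ?case by (simp only:)
    qed
  qed
  show "continuous_map (prod_topology euclideanreal T) T (\<lambda>(r, x). r *\<^sub>R x)"
    unfolding continuous_map_limitin case_prod_unfold limitin_T
  proof (intro ballI conjI allI impI)
    fix p assume p: "p \<in> topspace (prod_topology euclideanreal T)"
    let ?F = "nhdsin (prod_topology euclideanreal T) p"
    have l1: "((\<lambda>z. fst z) \<longlongrightarrow> fst p) ?F" using limitin_fst[OF limitin_nhdsin_id[OF p]] by simp
    note l = limitin_snd[OF limitin_nhdsin_id[OF p], unfolded limitin_T]
    have pV: "snd p \<in> V" using l by auto
    have ev: "\<forall>\<^sub>F z in ?F. snd z \<in> V" using l by auto
    show "fst p *\<^sub>R snd p \<in> V" by (intro V_closed pV)
    show "\<forall>\<^sub>F z in ?F. fst z *\<^sub>R snd z \<in> V" using ev by eventually_elim (rule V_closed)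
    fix q e assume q: "q \<in> Q" and e: "(0::real) < e"
    \<comment> \<open>A bound for \<open>\<bar>fst z\<bar>\<close> near \<open>p\<close>. With it,
      each of the two terms of the product difference can be kept within
      \<open>e / 2\<close>.\<close>
    define C where "C = \<bar>fst p\<bar> + 1"
    have C: "0 < C" by (simp add: C_def)
    have "\<forall>\<^sub>F z in ?F. q (snd z - snd p) < e / (2 * C)" using l q e C by simp
    moreover have "((\<lambda>z. \<bar>fst z\<bar>) \<longlongrightarrow> \<bar>fst p\<bar>) ?F" by (rule tendsto_rabs[OF l1])
    hence "\<forall>\<^sub>F z in ?F. \<bar>fst z\<bar> < C" by (rule order_tendstoD) (simp add: C_def)
    moreover have "((\<lambda>z. \<bar>fst z - fst p\<bar> * q (snd p)) \<longlongrightarrow> \<bar>fst p - fst p\<bar> * q (snd p)) ?F"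
      by (intro tendsto_intros l1)
    hence "\<forall>\<^sub>F z in ?F. \<bar>fst z - fst p\<bar> * q (snd p) < e / 2" by (rule order_tendstoD) (use e in simp)
    ultimately show "\<forall>\<^sub>F z in ?F. q (fst z *\<^sub>R snd z - fst p *\<^sub>R snd p) < e"
      using ev
    proof eventually_elim
      case (elim z)
      have d: "snd z - snd p \<in> V" by (intro V_closed elim pV)
      have "fst z *\<^sub>R snd z - fst p *\<^sub>R snd p = fst z *\<^sub>R (snd z - snd p) + (fst z - fst p) *\<^sub>R snd p"
        by (simp add: algebra_simps)
      hence "q (fst z *\<^sub>R snd z - fst p *\<^sub>R snd p) \<le> \<bar>fst z\<bar> * q (snd z - snd p) + \<bar>fst z - fst p\<bar> * q (snd p)"
        using Q_add[OF q V_closed(4)[OF d] V_closed(4)[OF pV]] Q_scale[OF q d] Q_scale[OF q pV] by simp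
      also have "\<bar>fst z\<bar> * q (snd z - snd p) \<le> C * (e / (2 * C))"
        by (intro mult_mono) (use elim Q_nonneg[OF q d] C in auto)
      also have "C * (e / (2 * C)) = e / 2" using C by simp
      finally show ?case using elim by simp
    qed
  qed
  fix U assume "openin T U \<and> 0 \<in> U"
  then obtain q e where q: "q \<in> Q" "0 < e" "{y \<in> V. q (y - 0) < e} \<subseteq> U" using openin_ball_subset by metis
  have "convex {y \<in> V. q (y - 0) < e}"
  proof (rule convexI)
    fix x y u v assume xy: "x \<in> {y \<in> V. q (y - 0) < e}" "y \<in> {y \<in> V. q (y - 0) < e}"
      and uv: "(0::real) \<le> u" "0 \<le> v" "u + v = 1"
    have "q (u *\<^sub>R x + v *\<^sub>R y) \<le> u * q x + v * q y"
      using Q_add[OF q(1) V_closed(4) V_closed(4), of x y u v] Q_scale[OF q(1)] xy uv by auto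
    also have "\<dots> < e" using xy uv by (intro convex_bound_lt) auto
    finally show "u *\<^sub>R x + v *\<^sub>R y \<in> {y \<in> V. q (y - 0) < e}" using xy by (auto intro: V_closed)
  qed
  thus "\<exists>W. openin T W \<and> convex W \<and> 0 \<in> W \<and> W \<subseteq> U"
    using openin_ball[OF q(1) V_closed(1) q(2)] q Q_zero[OF q(1)] V_closed(1)
    by (intro exI[of _ "{y \<in> V. q (y - 0) < e}"]) simp
qed

end

section \<open>Null sets of real numbers\<close>

lemma negligible_countable_real: "countable (D :: real set) \<Longrightarrow> negligible D"
  using negligible_countable_Union[of "(\<lambda>x. {x}) ` D"] by auto

lemma AE_countable_complement: "countable (D :: real set) \<Longrightarrow> AE t in lebesgue. t \<notin> D"
  unfolding eventually_ae_filter_negligible using negligible_countable_real by auto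

text \<open>A nonempty open set contains an interval, and intervals are not negligible.\<close>

lemma AE_lebesgue_open:
  fixes U :: "real set"
  assumes ae: "AE t in lebesgue. P t" and U: "open U" "U \<noteq> {}"
  shows "\<exists>t\<in>U. P t"
proof (rule ccontr)
  assume "\<not> (\<exists>t\<in>U. P t)"
  obtain N where N: "negligible N" "{x. \<not> P x} \<subseteq> N" using ae by (auto simp: eventually_ae_filter_negligible)
  have UN: "U \<subseteq> N" using N(2) \<open>\<not> (\<exists>t\<in>U. P t)\<close> by blast
  obtain x e where "x \<in> U" "0 < e" "ball x e \<subseteq> U" using U by (meson all_not_in_conv open_contains_ball)
  hence "{x - e<..<x + e} \<subseteq> N" using UN by (metis ball_eq_greaterThanLessThan subset_trans)
  hence "box (x - e) (x + e) \<subseteq> N" by simp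
  hence "negligible (box (x - e) (x + e))" using N(1) negligible_subset by blast
  thus False using \<open>0 < e\<close> negligible_interval(2)[of "x - e" "x + e"] by simp
qed

text \<open>The set on which \<open>f\<close> and \<open>g\<close> agree accumulates at
  \<open>t0\<close>, and along it the two limits coincide. This is how equality of classes is turned
  into equality of representatives at points of continuity.\<close>

lemma AE_eq_limit_eq:
  fixes a b t0 :: real
  assumes E: "Hausdorff_space E" and ae: "AE t in lebesgue. t \<in> {a<..<b} \<longrightarrow> f t = g t" and t0: "t0 \<in> {a<..<b}"
    and f: "limitin E f l (at t0)" and g: "limitin E g m (at t0)"
  shows "l = m"
proof -
  define S where "S = {t. f t = g t}"
  have nb: "at t0 within S \<noteq> bot"
    unfolding trivial_limit_within islimpt_def
  proof (rule notI, erule notE, intro allI impI)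
    fix T assume T: "t0 \<in> T" "open T"
    have o: "open (T \<inter> {a<..<b} - {t0})" by (intro open_Diff open_Int T) auto
    have "T \<inter> {a<..<b} - {t0} \<noteq> {}"
    proof
      assume "T \<inter> {a<..<b} - {t0} = {}"
      hence "T \<inter> {a<..<b} = {t0}" using T t0 by blast
      thus False using not_open_singleton[of t0] T by (metis open_Int open_greaterThanLessThan)
    qed
    from AE_lebesgue_open[OF ae o this] show "\<exists>y\<in>S. y \<in> T \<and> y \<noteq> t0" by (auto simp: S_def)
  qed
  have le: "at t0 within S \<le> at t0" by (rule at_le) simp
  have sub: "limitin E h k (at t0 within S)" if "limitin E h k (at t0)" for h k
    using that le filter_leD[OF le] by (simp add: limitin_def)
  have "\<forall>\<^sub>F t in at t0 within S. f t = g t" by (simp add: eventually_at_filter S_def)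
  from limitin_transform_eventually[OF this sub[OF f]] sub[OF g] nb
  show ?thesis by (rule limitin_Hausdorff_unique[OF _ _ _ E])
qed

text \<open>The mean value theorem with a countable exceptional set. After a small slope is
  subtracted, some level \<open>c\<close> between the end values is not attained on
  \<open>D\<close>. At the last point \<open>x\<close> with \<open>g x \<le> c\<close>, the function
  has the value \<open>c\<close> and exceeds it to the right, against its negative derivative
  there.\<close>

lemma nonincreasing_off_countable:
  fixes f :: "real \<Rightarrow> real"
  assumes ab: "a \<le> b" and cont: "continuous_on {a..b} f" and D: "countable D"
    and deriv: "\<And>t. t \<in> {a<..<b} - D \<Longrightarrow> (f has_real_derivative 0) (at t)"
  shows "f b \<le> f a"
proof (rule ccontr)
  assume "\<not> f b \<le> f a"
  hence lt: "f a < f b" by simp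
  hence ab': "a < b" using ab by (cases "a = b") auto
  \<comment> \<open>The slope that uses up exactly half of the supposed increase of
    \<open>f\<close>, so that \<open>g a < g b\<close> remains.\<close>
  define e where "e = (f b - f a) / (2 * (b - a))"
  have e: "0 < e" using lt ab' by (simp add: e_def)
  define g where "g t = f t - e * (t - a)" for t
  have "e * (b - a) = (f b - f a) / 2" using ab' unfolding e_def by (subst times_divide_eq_left, subst mult_divide_mult_cancel_right) auto
  hence gab: "g a < g b" using lt by (simp add: g_def)
  \<comment> \<open>The image of a countable set is countable, whatever the set looks like; this is
    where null sets would not do.\<close>
  have "uncountable ({g a<..<g b} - g ` (insert a (insert b D)))"
    using gab D by (intro uncountable_minus_countable uncountable_open_interval[THEN iffD2]) auto
  hence "{g a<..<g b} - g ` (insert a (insert b D)) \<noteq> {}" by (metis countable_empty)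
  then obtain c where "c \<in> {g a<..<g b} - g ` (insert a (insert b D))" by blast
  hence c: "g a < c" "c < g b" "c \<notin> g ` (insert a (insert b D))" by auto
  have gc: "continuous_on {a..b} g" unfolding g_def by (intro continuous_intros cont)
  define S where "S = {a..b} \<inter> g -` {..c}"
  have S: "closed S" unfolding S_def by (rule continuous_closed_preimage[OF gc]) auto
  have aS: "a \<in> S" using c ab by (simp add: S_def)
  have bd: "bdd_above S" by (rule bdd_aboveI[of _ b]) (auto simp: S_def)
  define x where "x = Sup S"
  have x: "x \<in> S" unfolding x_def by (rule closed_contains_Sup[OF _ bd S]) (use aS in auto)
  have xb: "x < b"
  proof -
    have "x \<le> b" "g x \<le> c" using x by (auto simp: S_def)
    thus ?thesis using c by (cases "x = b") auto
  qed
  have above: "c < g t" if "x < t" "t \<le> b" for t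
  proof (rule ccontr)
    assume "\<not> c < g t"
    hence "t \<in> S" using that x by (auto simp: S_def)
    hence "t \<le> x" unfolding x_def by (rule cSup_upper[OF _ bd])
    thus False using that by simp
  qed
  have gx: "g x = c"
  proof (rule ccontr)
    assume "g x \<noteq> c"
    hence lt: "g x < c" using x by (auto simp: S_def)
    have "\<exists>z\<ge>x. z \<le> b \<and> g z = c"
      by (rule IVT') (use lt c xb gc x in \<open>auto simp: S_def intro: continuous_on_subset\<close>)
    then obtain z where z: "x \<le> z" "z \<le> b" "g z = c" by blast
    hence "x < z" using lt by (cases "x = z") auto
    thus False using above[OF _ z(2)] z(3) by simp
  qed
  have xa: "a < x" using x gx c by (cases "x = a") (auto simp: S_def)
  have "x \<notin> D" using gx c by auto
  hence "(f has_real_derivative 0) (at x)" using deriv xa xb by simp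
  hence "(g has_real_derivative - e) (at x)"
    unfolding g_def by (auto intro!: derivative_eq_intros)
  from has_real_derivative_neg_dec_right[OF this] e
  obtain d where d: "0 < d" "\<And>h. 0 < h \<Longrightarrow> x + h \<in> UNIV \<Longrightarrow> h < d \<Longrightarrow> g (x + h) < g x" by auto
  define h where "h = min (d / 2) (b - x)"
  have h: "0 < h" "h < d" "x + h \<le> b" using d(1) xb by (auto simp: h_def)
  show False using above[of "x + h"] d(2)[of h] h gx by simp
qed

lemma constant_off_countable:
  fixes f :: "real \<Rightarrow> real"
  assumes ab: "a \<le> b" and cont: "continuous_on {a..b} f" and D: "countable D"
    and deriv: "\<And>t. t \<in> {a<..<b} - D \<Longrightarrow> (f has_real_derivative 0) (at t)"
  shows "f b = f a"
proof (rule antisym)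
  show "f b \<le> f a" by (rule nonincreasing_off_countable[OF assms])
  have "- f b \<le> - f a"
    by (rule nonincreasing_off_countable[OF ab continuous_on_minus[OF cont] D]) (use DERIV_minus[OF deriv] in auto)
  thus "f a \<le> f b" by simp
qed

section \<open>Regulated functions\<close>

lemma partition_cover:
  assumes "is_partition a b n p" "a \<le> t" "t < b"
  shows "\<exists>j<n. p j \<le> t \<and> t < p (Suc j)"
proof -
  have "\<exists>j<m. p j \<le> t \<and> t < p (Suc j)" if "m \<le> n" "t < p m" for m
    using that
  proof (induction m)
    case 0 thus ?case using assms by (simp add: is_partition_def)
  next
    case (Suc m)
    show ?case
    proof (cases "t < p m")
      case True thus ?thesis using Suc by (metis Suc_leD less_Suc_eq)
    next
      case False thus ?thesis using Suc.prems by (intro exI[of _ m]) auto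
    qed
  qed
  from this[of n] show ?thesis using assms by (simp add: is_partition_def)
qed

lemma partition_mono:
  assumes "is_partition a b n p" "i \<le> j" "j \<le> n"
  shows "p i \<le> p j"
  using assms(2,3)
proof (induction rule: dec_induct)
  case (step m)
  hence "p m < p (Suc m)" using assms(1) by (simp add: is_partition_def)
  thus ?case using step by simp
qed simp

lemma partition_bounds:
  assumes "is_partition a b n p" "j \<le> n" shows "a \<le> p j" "p j \<le> b"
  using partition_mono[OF assms(1), of 0 j] partition_mono[OF assms(1), of j n] assms by (auto simp: is_partition_def)

text \<open>Step functions described by an unordered set of breakpoints. The property survives
  enlarging \<open>D\<close>, so a sum is handled by the union of two sets, without merging
  partitions.\<close>

definition const_avoiding :: "real \<Rightarrow> real \<Rightarrow> real set \<Rightarrow> (real \<Rightarrow> 'a) \<Rightarrow> bool" where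
  "const_avoiding a b D s \<longleftrightarrow> (\<forall>t u. a \<le> t \<longrightarrow> t < u \<longrightarrow> u \<le> b \<longrightarrow> {t..u} \<inter> D = {} \<longrightarrow> s t = s u)"

lemma step_function_finite:
  assumes "a < b" "step_function E a b s"
  shows "\<exists>D. finite D \<and> const_avoiding a b D s"
proof -
  obtain n p where p: "is_partition a b n p" and c: "\<And>j. j < n \<Longrightarrow> \<exists>c. \<forall>t\<in>{p j<..<p (Suc j)}. s t = c"
    using assms(2) unfolding step_function_def by blast
  have "s t = s u" if tu: "a \<le> t" "t < u" "u \<le> b" and D: "{t..u} \<inter> p ` {..n} = {}" for t u
  proof -
    obtain j where j: "j < n" "p j \<le> t" "t < p (Suc j)" using partition_cover[OF p tu(1)] tu by auto
    have "p j \<notin> {t..u}" "p (Suc j) \<notin> {t..u}" using D j(1) by auto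
    hence "t \<in> {p j<..<p (Suc j)}" "u \<in> {p j<..<p (Suc j)}" using j tu by auto
    thus ?thesis using c[OF j(1)] by metis
  qed
  thus ?thesis by (intro exI[of _ "p ` {..n}"]) (auto simp: const_avoiding_def)
qed

text \<open>Sorting the breakpoints together with both end points restores a partition. The constant
  value on an open piece is the one at its midpoint.\<close>

lemma step_functionI_finite:
  assumes ab: "a < b" and s: "s ` {a..b} \<subseteq> topspace E" and D: "finite D" "const_avoiding a b D s"
  shows "step_function E a b s"
proof -
  define D' where "D' = insert a (insert b (D \<inter> {a..b}))"
  have D': "finite D'" "a \<in> D'" "b \<in> D'" "D' \<subseteq> {a..b}" using D ab by (auto simp: D'_def)
  define xs where "xs = sorted_list_of_set D'"
  have xs: "sorted_wrt (<) xs" "set xs = D'" using D' by (auto simp: xs_def)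
  have ne: "xs \<noteq> []" using xs(2) D' by auto
  define n where "n = length xs - 1"
  have len: "length xs = Suc n" using ne by (simp add: n_def)
  have nth: "i < j \<Longrightarrow> j \<le> n \<Longrightarrow> xs ! i < xs ! j" for i j
    using xs(1) len by (simp add: sorted_wrt_nth_less)
  have mem: "xs ! i \<in> D'" if "i \<le> n" for i using that len xs(2) by (metis le_imp_less_Suc nth_mem)
  have idx: "\<exists>i\<le>n. xs ! i = x" if "x \<in> D'" for x using that xs(2) len by (metis in_set_conv_nth less_Suc_eq_le)
  have p0: "xs ! 0 = a"
  proof -
    obtain i where i: "i \<le> n" "xs ! i = a" using idx D' by blast
    have "a \<le> xs ! 0" using mem[of 0] D'(4) by auto
    thus ?thesis using nth[of 0 i] i by (cases "i = 0") auto
  qed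
  have pn: "xs ! n = b"
  proof -
    obtain i where i: "i \<le> n" "xs ! i = b" using idx D' by blast
    have "xs ! n \<le> b" using mem[of n] D'(4) by auto
    thus ?thesis using nth[of i n] i by (cases "i = n") auto
  qed
  have part: "is_partition a b n (\<lambda>j. xs ! j)" unfolding is_partition_def using p0 pn nth by auto
  have c: "s t = s ((xs ! j + xs ! Suc j) / 2)" if j: "j < n" and t: "t \<in> {xs ! j<..<xs ! Suc j}" for j t
  proof -
    let ?m = "(xs ! j + xs ! Suc j) / 2"
    have m: "?m \<in> {xs ! j<..<xs ! Suc j}" using nth[of j "Suc j"] j by auto
    have av: "{xs ! j<..<xs ! Suc j} \<inter> D' = {}"
    proof (rule ccontr)
      assume "{xs ! j<..<xs ! Suc j} \<inter> D' \<noteq> {}"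
      then obtain i where i: "i \<le> n" "xs ! j < xs ! i" "xs ! i < xs ! Suc j" using idx by fastforce
      hence "\<not> i < j" "i \<noteq> j" "i \<noteq> Suc j" "\<not> Suc j < i" using nth[of i j] nth[of "Suc j" i] j by auto
      thus False by simp
    qed
    have bd: "a \<le> xs ! j" "xs ! Suc j \<le> b" using mem[of j] mem[of "Suc j"] D'(4) j by auto
    have seg: "s u = s v" if uv: "u \<in> {xs ! j<..<xs ! Suc j}" "v \<in> {xs ! j<..<xs ! Suc j}" "u < v" for u v
    proof -
      have "{u..v} \<subseteq> {xs ! j<..<xs ! Suc j}" "{u..v} \<subseteq> {a..b}" using uv bd by auto
      hence "{u..v} \<inter> D = {}" using av by (auto simp: D'_def)
      thus ?thesis using D(2) uv bd unfolding const_avoiding_def by auto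
    qed
    show ?thesis
    proof (cases t ?m rule: linorder_cases)
      case less show ?thesis by (rule seg[OF t m less])
    next
      case equal thus ?thesis by (rule arg_cong)
    next
      case greater show ?thesis by (rule seg[OF m t greater, symmetric])
    qed
  qed
  have "\<exists>c. \<forall>t\<in>{xs ! j<..<xs ! Suc j}. s t = c" if "j < n" for j
    by (intro exI ballI) (rule c[OF that])
  thus ?thesis unfolding step_function_def using s part by (intro conjI exI[of _ n] exI[of _ "\<lambda>j. xs ! j"]) auto
qed

lemma step_function_add:
  assumes ab: "a < b" and E: "lcs E" and "step_function E a b s" "step_function E a b s'"
  shows "step_function E a b (\<lambda>t. s t + s' t)"
proof -
  obtain D D' where D: "finite D" "const_avoiding a b D s" "finite D'" "const_avoiding a b D' s'"
    using step_function_finite[OF ab] assms(3,4) by metis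
  show ?thesis
  proof (rule step_functionI_finite[OF ab])
    show "(\<lambda>t. s t + s' t) ` {a..b} \<subseteq> topspace E"
      using assms(3,4) lcs_add[OF E] by (auto simp: step_function_def image_subset_iff)
    show "finite (D \<union> D')" using D by simp
    show "const_avoiding a b (D \<union> D') (\<lambda>t. s t + s' t)"
      unfolding const_avoiding_def
    proof (intro allI impI)
      fix t u :: real assume h: "a \<le> t" "t < u" "u \<le> b" "{t..u} \<inter> (D \<union> D') = {}"
      hence "{t..u} \<inter> D = {}" "{t..u} \<inter> D' = {}" by auto
      thus "s t + s' t = s u + s' u" using D(2,4) h(1-3) unfolding const_avoiding_def by metis
    qed
  qed
qed

lemma step_function_scale:
  assumes E: "lcs E" and "step_function E a b s"
  shows "step_function E a b (\<lambda>t. r *\<^sub>R s t)"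
proof -
  obtain n p where p: "is_partition a b n p" and c: "\<And>j. j < n \<Longrightarrow> \<exists>c. \<forall>t\<in>{p j<..<p (Suc j)}. s t = c"
    using assms(2) unfolding step_function_def by blast
  have "\<exists>c. \<forall>t\<in>{p j<..<p (Suc j)}. r *\<^sub>R s t = c" if "j < n" for j using c[OF that] by metis
  moreover have "(\<lambda>t. r *\<^sub>R s t) ` {a..b} \<subseteq> topspace E"
    using assms(2) lcs_scaleR[OF E] by (auto simp: step_function_def image_subset_iff)
  ultimately show ?thesis unfolding step_function_def using p by (intro conjI exI[of _ n] exI[of _ p]) auto
qed

lemma step_function_finite_image:
  assumes "a < b" "step_function E a b s"
  shows "finite (s ` {a..b})"
proof -
  obtain n p where p: "is_partition a b n p" and c: "\<And>j. j < n \<Longrightarrow> \<exists>c. \<forall>t\<in>{p j<..<p (Suc j)}. s t = c"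
    using assms(2) unfolding step_function_def by blast
  obtain C where C: "\<And>j t. j < n \<Longrightarrow> t \<in> {p j<..<p (Suc j)} \<Longrightarrow> s t = C j" using c by metis
  have "s t \<in> C ` {..<n} \<union> s ` (insert b (p ` {..<n}))" if t: "t \<in> {a..b}" for t
  proof (cases "t = b")
    case False
    then obtain j where j: "j < n" "p j \<le> t" "t < p (Suc j)" using partition_cover[OF p, of t] t by auto
    show ?thesis
    proof (cases "p j = t")
      case False
      hence "s t = C j" using C j by auto
      thus ?thesis using j by blast
    qed (use j in blast)
  qed simp
  hence "s ` {a..b} \<subseteq> C ` {..<n} \<union> s ` (insert b (p ` {..<n}))" by blast
  thus ?thesis by (rule finite_subset) simp
qed

lemma regulatedD:
  assumes "regulated E a b \<gamma>"
  shows regulated_mem: "t \<in> {a..b} \<Longrightarrow> \<gamma> t \<in> topspace E"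
    and regulated_approx: "\<exists>s. (\<forall>n. step_function E a b (s n)) \<and>
       (\<forall>W. openin E W \<and> 0 \<in> W \<longrightarrow> (\<forall>\<^sub>F n in sequentially. \<forall>t\<in>{a..b}. s n t - \<gamma> t \<in> W))"
  using assms unfolding regulated_def by auto

lemma step_function_mem: "step_function E a b s \<Longrightarrow> t \<in> {a..b} \<Longrightarrow> s t \<in> topspace E"
  by (auto simp: step_function_def)

lemma regulatedI_csn:
  assumes E: "lcs E" and \<gamma>: "\<And>t. t \<in> {a..b} \<Longrightarrow> \<gamma> t \<in> topspace E" and s: "\<And>n. step_function E a b (s n)"
    and conv: "\<And>q e. continuous_seminorm E q \<Longrightarrow> 0 < e \<Longrightarrow> \<forall>\<^sub>F n in sequentially. \<forall>t\<in>{a..b}. q (s n t - \<gamma> t) < e"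
  shows "regulated E a b \<gamma>"
  unfolding regulated_def
proof (intro conjI exI allI impI)
  show "\<gamma> ` {a..b} \<subseteq> topspace E" using \<gamma> by auto
  show "step_function E a b (s n)" for n by (rule s)
  fix W assume "openin E W \<and> 0 \<in> W"
  then obtain q where q: "continuous_seminorm E q" "\<And>x. x \<in> topspace E \<Longrightarrow> q x < 1 \<Longrightarrow> x \<in> W"
    using lcs_seminorm_nbhd[OF E] by blast
  show "\<forall>\<^sub>F n in sequentially. \<forall>t\<in>{a..b}. s n t - \<gamma> t \<in> W"
    using conv[OF q(1) zero_less_one]
    by eventually_elim (use q(2) lcs_diff[OF E] step_function_mem[OF s] \<gamma> in auto)
qed

lemma regulated_csn:
  assumes E: "lcs E" and s: "\<forall>W. openin E W \<and> 0 \<in> W \<longrightarrow> (\<forall>\<^sub>F n in sequentially. \<forall>t\<in>{a..b}. s n t - \<gamma> t \<in> W)"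
    and q: "continuous_seminorm E q" and e: "0 < e"
  shows "\<forall>\<^sub>F n in sequentially. \<forall>t\<in>{a..b}. q (s n t - \<gamma> t) < e"
proof -
  have "openin E {x \<in> topspace E. q (x - 0) < e}" by (rule openin_csn_ball[OF E q lcs_zero[OF E]])
  moreover have "0 \<in> {x \<in> topspace E. q (x - 0) < e}" using lcs_zero[OF E] csn_zero[OF E q] e by simp
  ultimately have "\<forall>\<^sub>F n in sequentially. \<forall>t\<in>{a..b}. s n t - \<gamma> t \<in> {x \<in> topspace E. q (x - 0) < e}" using s by blast
  thus ?thesis by eventually_elim simp
qed

lemma regulated_add:
  assumes ab: "a < b" and E: "lcs E" and f: "regulated E a b f" and g: "regulated E a b g"
  shows "regulated E a b (\<lambda>t. f t + g t)"
proof -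
  obtain s where s: "\<forall>n. step_function E a b (s n)"
    "\<forall>W. openin E W \<and> 0 \<in> W \<longrightarrow> (\<forall>\<^sub>F n in sequentially. \<forall>t\<in>{a..b}. s n t - f t \<in> W)" using regulated_approx[OF f] by blast
  obtain s' where s': "\<forall>n. step_function E a b (s' n)"
    "\<forall>W. openin E W \<and> 0 \<in> W \<longrightarrow> (\<forall>\<^sub>F n in sequentially. \<forall>t\<in>{a..b}. s' n t - g t \<in> W)" using regulated_approx[OF g] by blast
  show ?thesis
  proof (rule regulatedI_csn[OF E])
    show "f t + g t \<in> topspace E" if "t \<in> {a..b}" for t
      by (rule lcs_add[OF E regulated_mem[OF f that] regulated_mem[OF g that]])
    show "step_function E a b (\<lambda>t. s n t + s' n t)" for n using step_function_add[OF ab E] s s' by blast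
    fix q and e :: real assume q: "continuous_seminorm E q" and e: "0 < e"
    show "\<forall>\<^sub>F n in sequentially. \<forall>t\<in>{a..b}. q (s n t + s' n t - (f t + g t)) < e"
      using regulated_csn[OF E s(2) q half_gt_zero[OF e]] regulated_csn[OF E s'(2) q half_gt_zero[OF e]]
    proof eventually_elim
      case (elim n)
      show ?case
      proof
        fix t assume t: "t \<in> {a..b}"
        have "s n t - f t \<in> topspace E" "s' n t - g t \<in> topspace E"
          by (rule lcs_diff[OF E step_function_mem[OF s(1)[THEN spec] t] regulated_mem[OF f t]],
              rule lcs_diff[OF E step_function_mem[OF s'(1)[THEN spec] t] regulated_mem[OF g t]])
        from continuous_seminormD(2)[OF q this] elim t
        have "q ((s n t - f t) + (s' n t - g t)) < e" by fastforce
        thus "q (s n t + s' n t - (f t + g t)) < e" by (simp add: algebra_simps)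
      qed
    qed
  qed
qed

lemma regulated_scale:
  assumes E: "lcs E" and f: "regulated E a b f"
  shows "regulated E a b (\<lambda>t. r *\<^sub>R f t)"
proof -
  obtain s where s: "\<forall>n. step_function E a b (s n)"
    "\<forall>W. openin E W \<and> 0 \<in> W \<longrightarrow> (\<forall>\<^sub>F n in sequentially. \<forall>t\<in>{a..b}. s n t - f t \<in> W)" using regulated_approx[OF f] by blast
  show ?thesis
  proof (rule regulatedI_csn[OF E])
    show "r *\<^sub>R f t \<in> topspace E" if "t \<in> {a..b}" for t by (rule lcs_scaleR[OF E regulated_mem[OF f that]])
    show "step_function E a b (\<lambda>t. r *\<^sub>R s n t)" for n using step_function_scale[OF E] s by blast
    fix q and e :: real assume q: "continuous_seminorm E q" and e: "0 < e"
    \<comment> \<open>The summand 1 covers the case \<open>r = 0\<close>.\<close>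
    have "0 < e / (\<bar>r\<bar> + 1)" using e by simp
    from regulated_csn[OF E s(2) q this]
    show "\<forall>\<^sub>F n in sequentially. \<forall>t\<in>{a..b}. q (r *\<^sub>R s n t - r *\<^sub>R f t) < e"
    proof eventually_elim
      case (elim n)
      show ?case
      proof
        fix t assume t: "t \<in> {a..b}"
        have m: "s n t - f t \<in> topspace E"
          by (rule lcs_diff[OF E step_function_mem[OF s(1)[THEN spec] t] regulated_mem[OF f t]])
        have "q (s n t - f t) < e / (\<bar>r\<bar> + 1)" using elim t by blast
        hence "q (s n t - f t) * (\<bar>r\<bar> + 1) < e" by (simp add: pos_less_divide_eq)
        moreover have "\<bar>r\<bar> * q (s n t - f t) \<le> q (s n t - f t) * (\<bar>r\<bar> + 1)"
          using csn_nonneg[OF E q m] by (simp add: algebra_simps)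
        ultimately show "q (r *\<^sub>R s n t - r *\<^sub>R f t) < e"
          using continuous_seminormD(3)[OF q m, of r] by (simp add: scaleR_diff_right)
      qed
    qed
  qed
qed

text \<open>A step function has finitely many values, and a regulated function stays within distance
  1 of some step function. It follows that the set of essential bounds in \<open>ess_sup\<close> is
  nonempty.\<close>

lemma regulated_bounded:
  assumes ab: "a < b" and E: "lcs E" and f: "regulated E a b f" and q: "continuous_seminorm E q"
  shows "\<exists>B. \<forall>t\<in>{a..b}. q (f t) \<le> B"
proof -
  obtain s where s: "\<forall>n. step_function E a b (s n)"
    "\<forall>W. openin E W \<and> 0 \<in> W \<longrightarrow> (\<forall>\<^sub>F n in sequentially. \<forall>t\<in>{a..b}. s n t - f t \<in> W)" using regulated_approx[OF f] by blast
  obtain n where n: "\<forall>t\<in>{a..b}. q (s n t - f t) < 1"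
    using eventually_happens'[OF sequentially_bot regulated_csn[OF E s(2) q zero_less_one]] by blast
  have fin: "finite (q ` (s n ` {a..b}))" using step_function_finite_image[OF ab] s(1) by blast
  have "q (f t) \<le> Max (q ` (s n ` {a..b})) + 1" if t: "t \<in> {a..b}" for t
  proof -
    have m: "s n t \<in> topspace E" "f t \<in> topspace E"
      by (rule step_function_mem[OF s(1)[THEN spec] t], rule regulated_mem[OF f t])
    have "q (s n t) \<le> Max (q ` (s n ` {a..b}))" using fin t by (intro Max_ge) auto
    thus ?thesis using csn_abs_diff[OF E q m] n t by fastforce
  qed
  thus ?thesis by blast
qed

text \<open>The exceptional set collects the breakpoints of all approximating step functions.
  Elsewhere each of these is locally constant, and continuity passes to the uniform limit.\<close>

lemma regulated_continuous:
  assumes ab: "a < b" and E: "lcs E" and f: "regulated E a b f"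
  shows "\<exists>D. countable D \<and> (\<forall>t\<in>{a<..<b} - D. limitin E f (f t) (at t))"
proof -
  obtain s where s: "\<forall>n. step_function E a b (s n)"
    "\<forall>W. openin E W \<and> 0 \<in> W \<longrightarrow> (\<forall>\<^sub>F n in sequentially. \<forall>t\<in>{a..b}. s n t - f t \<in> W)" using regulated_approx[OF f] by blast
  have "\<forall>n. \<exists>D. finite D \<and> const_avoiding a b D (s n)"
    by (rule allI, rule step_function_finite[OF ab s(1)[THEN spec]])
  then obtain D where D: "\<And>n. finite (D n)" "\<And>n. const_avoiding a b (D n) (s n)" by metis
  have "limitin E f (f t) (at t)" if t: "t \<in> {a<..<b} - (\<Union>n. D n)" for t
    unfolding limitin_csn[OF E]
  proof (intro conjI allI impI)
    have tab: "t \<in> {a..b}" using t by auto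
    show ft: "f t \<in> topspace E" by (rule regulated_mem[OF f tab])
    have ev: "\<forall>\<^sub>F u in at t. u \<in> {a<..<b}" by (rule eventually_at_in_open') (use t in auto)
    thus "\<forall>\<^sub>F u in at t. f u \<in> topspace E" by eventually_elim (use regulated_mem[OF f] in auto)
    fix q and e :: real assume q: "continuous_seminorm E q" and e: "0 < e"
    obtain n where n: "\<forall>u\<in>{a..b}. q (s n u - f u) < e / 2"
      using eventually_happens'[OF sequentially_bot regulated_csn[OF E s(2) q half_gt_zero[OF e]]] by blast
    \<comment> \<open>The ball avoids the finitely many breakpoints of \<open>s n\<close>, hence
      \<open>s n\<close> is constant on it.\<close>
    have "open ({a<..<b} - D n)" using D(1) by (intro open_Diff finite_imp_closed) auto
    moreover have "t \<in> {a<..<b} - D n" using t by blast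
    ultimately obtain d where d: "0 < d" "ball t d \<subseteq> {a<..<b} - D n" using open_contains_ball by blast
    have "\<forall>\<^sub>F u in at t. u \<in> ball t d" by (rule eventually_at_in_open') (use d in auto)
    thus "\<forall>\<^sub>F u in at t. q (f u - f t) < e"
    proof eventually_elim
      case (elim u)
      have seg: "x \<in> ball t d" if "min t u \<le> x" "x \<le> max t u" for x
        using that elim by (auto simp: dist_real_def min_def max_def split: if_splits)
      have sub: "{min t u..max t u} \<subseteq> {a<..<b} - D n" using seg d(2) by (meson atLeastAtMost_iff subset_iff)
      have "u \<in> {min t u..max t u}" by auto
      from subsetD[OF sub this] have uab: "u \<in> {a..b}" by simp
      have "s n (min t u) = s n (max t u)"
      proof (cases "t = u")
        case False
        hence "min t u < max t u" by auto
        moreover have "a \<le> min t u" "max t u \<le> b" using tab uab by auto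
        moreover have "{min t u..max t u} \<inter> D n = {}" using sub by blast
        ultimately show ?thesis using D(2)[of n] unfolding const_avoiding_def by blast
      qed simp
      hence eq: "s n u = s n t" by (auto simp: min_def max_def split: if_splits)
      have m: "s n t \<in> topspace E" "f u \<in> topspace E"
        by (rule step_function_mem[OF s(1)[THEN spec] tab], rule regulated_mem[OF f uab])
      have "q (f u - f t) \<le> q (f u - s n t) + q (s n t - f t)" by (rule csn_triangle[OF E q m(2,1) ft])
      also have "q (f u - s n t) = q (s n u - f u)" using csn_minus_commute[OF E q m(2,1)] eq by simp
      finally have "q (f u - f t) \<le> q (s n u - f u) + q (s n t - f t)" .
      moreover have "q (s n u - f u) < e / 2" "q (s n t - f t) < e / 2" using n tab uab by auto
      ultimately show ?case by linarith
    qed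
  qed
  moreover have "countable (\<Union>n. D n)" by (intro countable_UN) (simp_all add: countable_finite D(1))
  ultimately show ?thesis by blast
qed

lemma step_function_const: "a < b \<Longrightarrow> c \<in> topspace E \<Longrightarrow> step_function E a b (\<lambda>t. c)"
  by (rule step_functionI_finite[where D = "{}"]) (auto simp: const_avoiding_def)

lemma regulated_const: "a < b \<Longrightarrow> lcs E \<Longrightarrow> c \<in> topspace E \<Longrightarrow> regulated E a b (\<lambda>t. c)"
  by (rule regulatedI_csn[where s = "\<lambda>n t. c"]) (auto simp: csn_zero intro: step_function_const)

section \<open>The spaces of regulated and of absolutely continuous functions\<close>

lemma ae_class_eq_iff:
  "ae_class a b f = ae_class a b g \<longleftrightarrow> (AE t in lebesgue. t \<in> {a..b} \<longrightarrow> f t = g t)"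
proof -
  have "((if t \<in> {a..b} then f t else 0) = (if t \<in> {a..b} then g t else 0)) \<longleftrightarrow> (t \<in> {a..b} \<longrightarrow> f t = g t)" for t
    by (cases "t \<in> {a..b}") auto
  thus ?thesis unfolding ae_class_def aefun.abs_eq_iff by simp
qed

lemma ae_class_add: "ae_class a b f + ae_class a b g = ae_class a b (\<lambda>t. f t + g t)"
  unfolding ae_class_def plus_aefun.abs_eq by (rule arg_cong[where f = abs_aefun]) auto

lemma ae_class_diff: "ae_class a b f - ae_class a b g = ae_class a b (\<lambda>t. f t - g t)"
  unfolding ae_class_def minus_aefun.abs_eq by (rule arg_cong[where f = abs_aefun]) auto

lemma ae_class_scale: "r *\<^sub>R ae_class a b f = ae_class a b (\<lambda>t. r *\<^sub>R f t)"
  unfolding ae_class_def scaleR_aefun.abs_eq by (rule arg_cong[where f = abs_aefun]) auto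

lemma ae_class_zero: "ae_class a b (\<lambda>t. 0) = 0"
  unfolding ae_class_def zero_aefun_def by (rule arg_cong[where f = abs_aefun]) auto

lemma rep_ae_class: "AE t in lebesgue. rep_aefun (ae_class a b f) t = (if t \<in> {a..b} then f t else 0)"
proof -
  have "abs_aefun (rep_aefun (ae_class a b f)) = abs_aefun (\<lambda>t. if t \<in> {a..b} then f t else 0)"
    unfolding Quotient3_abs_rep[OF Quotient3_aefun] ae_class_def ..
  thus ?thesis by (simp only: aefun.abs_eq_iff)
qed

text \<open>Replaces the representative picked by \<open>rep_aefun\<close> by a given one.\<close>

lemma ess_sup_ae_class:
  "ess_sup q a b (ae_class a b f) = Inf {c. AE t in lebesgue. t \<in> {a..b} \<longrightarrow> q (f t) \<le> c}"
proof -
  have "(AE t in lebesgue_on {a..b}. q (rep_aefun (ae_class a b f) t) \<le> c) \<longleftrightarrow>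
      (AE t in lebesgue. t \<in> {a..b} \<longrightarrow> q (f t) \<le> c)" (is "?L \<longleftrightarrow> ?R") for c
  proof -
    have "?L \<longleftrightarrow> (AE t in lebesgue. t \<in> {a..b} \<longrightarrow> q (rep_aefun (ae_class a b f) t) \<le> c)"
      by (rule AE_restrict_space_iff) simp
    also have "\<dots> \<longleftrightarrow> ?R"
    proof
      assume "AE t in lebesgue. t \<in> {a..b} \<longrightarrow> q (rep_aefun (ae_class a b f) t) \<le> c"
      with rep_ae_class[of a b f] show ?R by eventually_elim auto
    next
      assume ?R
      with rep_ae_class[of a b f] show "AE t in lebesgue. t \<in> {a..b} \<longrightarrow> q (rep_aefun (ae_class a b f) t) \<le> c"
        by eventually_elim auto
    qed
    finally show ?thesis .
  qed
  thus ?thesis by (simp only: ess_sup_def)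
qed

locale regulated_space =
  fixes E :: "'a::real_vector topology" and a b :: real
  assumes E: "lcs E" and ab: "a < b"
begin

text \<open>As \<open>a < b\<close>, an essential bound is a bound at some actual point of the
  interval. This makes the set of essential bounds bounded below, so that its infimum is
  meaningful.\<close>

lemma AE_bound_nonneg:
  assumes q: "continuous_seminorm E q" and f: "regulated E a b f" and c: "AE t in lebesgue. t \<in> {a..b} \<longrightarrow> q (f t) \<le> c"
  shows "0 \<le> c"
proof -
  have "{a<..<b} \<noteq> {}" using ab by simp
  then obtain t where t: "t \<in> {a<..<b}" "t \<in> {a..b} \<longrightarrow> q (f t) \<le> c"
    using AE_lebesgue_open[OF c open_greaterThanLessThan] by blast
  hence "t \<in> {a..b}" by simp
  hence "0 \<le> q (f t)" "q (f t) \<le> c" using csn_nonneg[OF E q regulated_mem[OF f]] t(2) by auto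
  thus ?thesis by simp
qed

lemma ess_sup_le:
  assumes q: "continuous_seminorm E q" and f: "regulated E a b f" and c: "AE t in lebesgue. t \<in> {a..b} \<longrightarrow> q (f t) \<le> c"
  shows "ess_sup q a b (ae_class a b f) \<le> c"
  unfolding ess_sup_ae_class
  by (rule cInf_lower) (use c AE_bound_nonneg[OF q f] in \<open>auto intro!: bdd_belowI[of _ 0]\<close>)

lemma ess_sup_nonempty:
  assumes q: "continuous_seminorm E q" and f: "regulated E a b f"
  shows "{c. AE t in lebesgue. t \<in> {a..b} \<longrightarrow> q (f t) \<le> c} \<noteq> {}"
proof -
  obtain B where "\<forall>t\<in>{a..b}. q (f t) \<le> B" using regulated_bounded[OF ab E f q] by blast
  hence "AE t in lebesgue. t \<in> {a..b} \<longrightarrow> q (f t) \<le> B" by auto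
  thus ?thesis by blast
qed

lemma ess_sup_less:
  assumes q: "continuous_seminorm E q" and f: "regulated E a b f" and e: "ess_sup q a b (ae_class a b f) < e"
  obtains c where "c < e" "AE t in lebesgue. t \<in> {a..b} \<longrightarrow> q (f t) \<le> c"
  using cInf_lessD[OF ess_sup_nonempty[OF q f] e[unfolded ess_sup_ae_class]] by blast

lemma ess_sup_nonneg:
  assumes q: "continuous_seminorm E q" and f: "regulated E a b f"
  shows "0 \<le> ess_sup q a b (ae_class a b f)"
  unfolding ess_sup_ae_class using ess_sup_nonempty[OF q f] AE_bound_nonneg[OF q f] by (intro cInf_greatest) auto

lemma R_setE:
  assumes "X \<in> R_set E a b"
  obtains f where "regulated E a b f" "X = ae_class a b f"
  using assms by (auto simp: R_set_def)

lemma R_setI: "regulated E a b f \<Longrightarrow> ae_class a b f \<in> R_set E a b"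
  by (auto simp: R_set_def)

lemma ess_sup_scale_le:
  assumes q: "continuous_seminorm E q" and f: "regulated E a b f" and r: "r \<noteq> 0"
  shows "ess_sup q a b (r *\<^sub>R ae_class a b f) \<le> \<bar>r\<bar> * ess_sup q a b (ae_class a b f)"
proof (rule field_le_epsilon)
  fix e :: real assume "0 < e"
  hence "ess_sup q a b (ae_class a b f) < ess_sup q a b (ae_class a b f) + e / \<bar>r\<bar>" using r by simp
  then obtain c where c: "c < ess_sup q a b (ae_class a b f) + e / \<bar>r\<bar>" "AE t in lebesgue. t \<in> {a..b} \<longrightarrow> q (f t) \<le> c"
    by (rule ess_sup_less[OF q f])
  have "AE t in lebesgue. t \<in> {a..b} \<longrightarrow> q (r *\<^sub>R f t) \<le> \<bar>r\<bar> * c"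
    using c(2)
  proof eventually_elim
    case (elim t)
    show ?case
    proof
      assume t: "t \<in> {a..b}"
      show "q (r *\<^sub>R f t) \<le> \<bar>r\<bar> * c"
        using elim t continuous_seminormD(3)[OF q regulated_mem[OF f t], of r] by (simp add: mult_left_mono)
    qed
  qed
  hence "ess_sup q a b (r *\<^sub>R ae_class a b f) \<le> \<bar>r\<bar> * c"
    unfolding ae_class_scale by (rule ess_sup_le[OF q regulated_scale[OF E f]])
  also have "\<dots> \<le> \<bar>r\<bar> * (ess_sup q a b (ae_class a b f) + e / \<bar>r\<bar>)" using c(1) by (intro mult_left_mono) auto
  also have "\<dots> = \<bar>r\<bar> * ess_sup q a b (ae_class a b f) + e" using r by (simp add: distrib_left)
  finally show "ess_sup q a b (r *\<^sub>R ae_class a b f) \<le> \<bar>r\<bar> * ess_sup q a b (ae_class a b f) + e" .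
qed

sublocale R: seminorm_family "R_set E a b" "{ess_sup q a b | q. continuous_seminorm E q}"
proof
  have zero: "ae_class a b (\<lambda>t. 0) \<in> R_set E a b" by (rule R_setI[OF regulated_const[OF ab E lcs_zero[OF E]]])
  show "subspace (R_set E a b)"
    unfolding subspace_def
  proof (intro conjI ballI allI)
    show "0 \<in> R_set E a b" using zero by (simp add: ae_class_zero)
    fix X assume "X \<in> R_set E a b"
    then obtain f where f: "regulated E a b f" "X = ae_class a b f" by (rule R_setE)
    show "r *\<^sub>R X \<in> R_set E a b" for r
      unfolding f(2) ae_class_scale by (rule R_setI[OF regulated_scale[OF E f(1)]])
    fix Y assume "Y \<in> R_set E a b"
    then obtain g where g: "regulated E a b g" "Y = ae_class a b g" by (rule R_setE)
    show "X + Y \<in> R_set E a b"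
      unfolding f(2) g(2) ae_class_add by (rule R_setI[OF regulated_add[OF ab E f(1) g(1)]])
  qed
  have "continuous_seminorm E (\<lambda>x. 0)" by (simp add: continuous_seminorm_def)
  thus "{ess_sup q a b | q. continuous_seminorm E q} \<noteq> {}" by blast
next
  fix s X Y assume "s \<in> {ess_sup q a b | q. continuous_seminorm E q}" "X \<in> R_set E a b" "Y \<in> R_set E a b"
  then obtain q f g where q: "s = ess_sup q a b" "continuous_seminorm E q"
    and f: "regulated E a b f" "X = ae_class a b f" and g: "regulated E a b g" "Y = ae_class a b g"
    by (auto elim!: R_setE)
  show "s (X + Y) \<le> s X + s Y"
  proof (rule field_le_epsilon)
    fix e :: real assume e: "0 < e"
    obtain c where c: "c < s X + e / 2" "AE t in lebesgue. t \<in> {a..b} \<longrightarrow> q (f t) \<le> c"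
      by (rule ess_sup_less[OF q(2) f(1), of "s X + e / 2"]) (use q f e in auto)
    obtain d where d: "d < s Y + e / 2" "AE t in lebesgue. t \<in> {a..b} \<longrightarrow> q (g t) \<le> d"
      by (rule ess_sup_less[OF q(2) g(1), of "s Y + e / 2"]) (use q g e in auto)
    have "AE t in lebesgue. t \<in> {a..b} \<longrightarrow> q (f t + g t) \<le> c + d"
      using c(2) d(2)
    proof eventually_elim
      case (elim t)
      show ?case
      proof
        assume t: "t \<in> {a..b}"
        show "q (f t + g t) \<le> c + d"
          using elim t continuous_seminormD(2)[OF q(2) regulated_mem[OF f(1) t] regulated_mem[OF g(1) t]] by simp
      qed
    qed
    hence "s (X + Y) \<le> c + d"
      unfolding q(1) f(2) g(2) ae_class_add by (rule ess_sup_le[OF q(2) regulated_add[OF ab E f(1) g(1)]])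
    thus "s (X + Y) \<le> s X + s Y + e" using c(1) d(1) by simp
  qed
next
  fix s X r assume "s \<in> {ess_sup q a b | q. continuous_seminorm E q}" "X \<in> R_set E a b"
  then obtain q f where q: "s = ess_sup q a b" "continuous_seminorm E q"
    and f: "regulated E a b f" "X = ae_class a b f" by (auto elim!: R_setE)
  show "s (r *\<^sub>R X) = \<bar>r\<bar> * s X"
  proof (cases "r = 0")
    case True
    have "AE t in lebesgue. t \<in> {a..b} \<longrightarrow> q ((\<lambda>t. 0) t) \<le> 0" using csn_zero[OF E q(2)] by simp
    from ess_sup_le[OF q(2) regulated_const[OF ab E lcs_zero[OF E]] this] ess_sup_nonneg[OF q(2) regulated_const[OF ab E lcs_zero[OF E]]]
    show ?thesis using True q(1) by (simp add: ae_class_zero)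
  next
    case False
    have "ess_sup q a b (inverse r *\<^sub>R ae_class a b (\<lambda>t. r *\<^sub>R f t)) \<le> \<bar>inverse r\<bar> * ess_sup q a b (ae_class a b (\<lambda>t. r *\<^sub>R f t))"
      by (rule ess_sup_scale_le[OF q(2) regulated_scale[OF E f(1)]]) (use False in simp)
    hence "s X \<le> \<bar>inverse r\<bar> * s (r *\<^sub>R X)"
      using False unfolding ae_class_scale[symmetric] by (simp add: q(1) f(2))
    hence "\<bar>r\<bar> * s X \<le> s (r *\<^sub>R X)" using False by (simp add: field_simps)
    moreover have "s (r *\<^sub>R X) \<le> \<bar>r\<bar> * s X" using ess_sup_scale_le[OF q(2) f(1) False] by (simp add: q(1) f(2))
    ultimately show ?thesis by simp
  qed
next
  fix s s' assume "s \<in> {ess_sup q a b | q. continuous_seminorm E q}" "s' \<in> {ess_sup q a b | q. continuous_seminorm E q}"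
  then obtain p q where p: "s = ess_sup p a b" "continuous_seminorm E p" and q: "s' = ess_sup q a b" "continuous_seminorm E q" by auto
  \<comment> \<open>The sum dominates both seminorms, which yields directedness.\<close>
  define r where "r x = p x + q x" for x
  have r: "continuous_seminorm E r" unfolding r_def by (rule continuous_seminorm_add[OF E p(2) q(2)])
  have "s X \<le> ess_sup r a b X \<and> s' X \<le> ess_sup r a b X" if X: "X \<in> R_set E a b" for X
  proof -
    obtain f where f: "regulated E a b f" "X = ae_class a b f" using X by (rule R_setE)
    have "s X \<le> ess_sup r a b X + e \<and> s' X \<le> ess_sup r a b X + e" if e: "0 < e" for e
    proof -
      obtain c where c: "c < ess_sup r a b X + e" "AE t in lebesgue. t \<in> {a..b} \<longrightarrow> r (f t) \<le> c"
        by (rule ess_sup_less[OF r f(1), of "ess_sup r a b X + e"]) (use e f in auto)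
      have "AE t in lebesgue. t \<in> {a..b} \<longrightarrow> p (f t) \<le> c \<and> q (f t) \<le> c"
        using c(2)
      proof eventually_elim
        case (elim t)
        show ?case
        proof
          assume t: "t \<in> {a..b}"
          show "p (f t) \<le> c \<and> q (f t) \<le> c"
            using elim t csn_nonneg[OF E p(2) regulated_mem[OF f(1) t]] csn_nonneg[OF E q(2) regulated_mem[OF f(1) t]] by (simp add: r_def)
        qed
      qed
      hence "AE t in lebesgue. t \<in> {a..b} \<longrightarrow> p (f t) \<le> c" "AE t in lebesgue. t \<in> {a..b} \<longrightarrow> q (f t) \<le> c"
        by (auto elim: eventually_mono)
      from ess_sup_le[OF p(2) f(1) this(1)] ess_sup_le[OF q(2) f(1) this(2)] c(1)
      show ?thesis by (simp add: p(1) q(1) f(2))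
    qed
    thus ?thesis using field_le_epsilon[of "s X"] field_le_epsilon[of "s' X"] by blast
  qed
  thus "\<exists>r\<in>{ess_sup q a b | q. continuous_seminorm E q}. \<forall>X\<in>R_set E a b. s X \<le> r X \<and> s' X \<le> r X"
    using r by blast
next
  fix X assume X: "X \<in> R_set E a b" and z: "\<And>s. s \<in> {ess_sup q a b | q. continuous_seminorm E q} \<Longrightarrow> s X = 0"
  obtain f where f: "regulated E a b f" "X = ae_class a b f" using X by (rule R_setE)
  obtain D where D: "countable D" "\<And>t. t \<in> {a<..<b} - D \<Longrightarrow> limitin E f (f t) (at t)"
    using regulated_continuous[OF ab E f(1)] by blast
  \<comment> \<open>At a point of continuity, a positive value of a seminorm would persist on an
    open set, which is not null.\<close>
  have "f t = 0" if t: "t \<in> {a<..<b} - D" for t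
  proof (rule lcs_eqI_csn[OF E _ lcs_zero[OF E]])
    have tab: "t \<in> {a..b}" using t by auto
    show ft: "f t \<in> topspace E" by (rule regulated_mem[OF f(1) tab])
    fix q assume q: "continuous_seminorm E q"
    show "q (f t - 0) = 0"
    proof (rule ccontr)
      assume "q (f t - 0) \<noteq> 0"
      hence d: "0 < q (f t)" using csn_nonneg[OF E q ft] by simp
      have "ess_sup q a b (ae_class a b f) < q (f t) / 2" using z q d f(2) by force
      then obtain c where c: "c < q (f t) / 2" "AE u in lebesgue. u \<in> {a..b} \<longrightarrow> q (f u) \<le> c"
        by (rule ess_sup_less[OF q f(1)])
      have "\<forall>\<^sub>F u in at t. u \<in> {a<..<b}" by (rule eventually_at_in_open') (use t in auto)
      hence "\<forall>\<^sub>F u in at t. u \<in> {a<..<b} \<and> c < q (f u)"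
        using limitin_csnD[OF E D(2)[OF t] q half_gt_zero[OF d]]
      proof eventually_elim
        case (elim u)
        have "f u \<in> topspace E" using regulated_mem[OF f(1)] elim(1) by auto
        from csn_abs_diff[OF E q this ft] elim c(1) show ?case by simp
      qed
      then obtain U where U: "open U" "t \<in> U" "\<And>u. u \<in> U \<Longrightarrow> u \<noteq> t \<Longrightarrow> u \<in> {a<..<b} \<and> c < q (f u)"
        by (auto simp: eventually_at_topological)
      have "c < q (f t)" using c(1) d by simp
      hence "u \<in> {a..b} \<and> c < q (f u)" if "u \<in> U" for u using U(3)[OF that] tab by (cases "u = t") auto
      moreover have "\<exists>u\<in>U. u \<in> {a..b} \<longrightarrow> q (f u) \<le> c" using AE_lebesgue_open[OF c(2) U(1)] U(2) by blast
      ultimately show False by force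
    qed
  qed
  moreover have ae: "AE t in lebesgue. t \<notin> insert a (insert b D)" by (rule AE_countable_complement) (use D in simp)
  ultimately have "AE t in lebesgue. t \<in> {a..b} \<longrightarrow> f t = (\<lambda>t. 0) t"
    by (intro eventually_mono[OF ae]) auto
  thus "X = 0" unfolding f(2) ae_class_zero[of a b, symmetric] ae_class_eq_iff .
qed

lemma R_space_eq: "R_space E a b = R.T"
proof -
  have "{{Y \<in> R_set E a b. ess_sup q a b (Y - X) < \<epsilon>} | q X \<epsilon>. continuous_seminorm E q \<and> X \<in> R_set E a b \<and> 0 < \<epsilon>}
     = {{y \<in> R_set E a b. q (y - x) < e} | q x e. q \<in> {ess_sup q a b | q. continuous_seminorm E q} \<and> x \<in> R_set E a b \<and> 0 < e}"
    (is "?A = ?B")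
  proof (intro Set.set_eqI iffI)
    fix U assume "U \<in> ?A"
    then obtain q X \<epsilon> where "U = {Y \<in> R_set E a b. ess_sup q a b (Y - X) < \<epsilon>}"
      "continuous_seminorm E q" "X \<in> R_set E a b" "0 < \<epsilon>" by blast
    thus "U \<in> ?B" by (intro CollectI exI[of _ "ess_sup q a b"] exI[of _ X] exI[of _ \<epsilon>]) auto
  next
    fix U assume "U \<in> ?B"
    then obtain s X \<epsilon> where s: "U = {Y \<in> R_set E a b. s (Y - X) < \<epsilon>}"
      "s \<in> {ess_sup q a b | q. continuous_seminorm E q}" "X \<in> R_set E a b" "0 < \<epsilon>" by blast
    then obtain q where "s = ess_sup q a b" "continuous_seminorm E q" by blast
    thus "U \<in> ?A" using s by (intro CollectI exI[of _ q] exI[of _ X] exI[of _ \<epsilon>]) auto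
  qed
  thus ?thesis by (simp only: R_space_def seminorm_topology_def)
qed

lemma lcs_R_space: "lcs (R_space E a b)"
  unfolding R_space_eq by (rule R.lcs_T)

lemma limitin_R_space:
  "limitin (R_space E a b) f X F \<longleftrightarrow> X \<in> R_set E a b \<and> (\<forall>\<^sub>F i in F. f i \<in> R_set E a b) \<and>
     (\<forall>q e. continuous_seminorm E q \<longrightarrow> 0 < e \<longrightarrow> (\<forall>\<^sub>F i in F. ess_sup q a b (f i - X) < e))"
  unfolding R_space_eq R.limitin_T by auto

lemma R_const_mem: "v \<in> topspace E \<Longrightarrow> ae_class a b (\<lambda>t. v) \<in> R_set E a b"
  by (rule R_setI[OF regulated_const[OF ab E]])

lemma linear_R_const: "linear (\<lambda>v::'a. ae_class a b (\<lambda>t. v))"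
  by (rule linearI) (simp_all add: ae_class_add ae_class_scale)

text \<open>Through this embedding by constants, the exponential function inherits its smoothness
  from the evolution map.\<close>

lemma continuous_R_const: "continuous_map E (R_space E a b) (\<lambda>v. ae_class a b (\<lambda>t. v))"
  unfolding continuous_map_limitin limitin_R_space
proof (intro ballI conjI allI impI)
  fix v assume v: "v \<in> topspace E"
  show "ae_class a b (\<lambda>t. v) \<in> R_set E a b" by (rule R_const_mem[OF v])
  note l = limitin_nhdsin_id[OF v]
  show "\<forall>\<^sub>F i in nhdsin E v. ae_class a b (\<lambda>t. i) \<in> R_set E a b"
    using limitinD[OF l openin_topspace v] by eventually_elim (rule R_const_mem)
  fix q and e :: real assume q: "continuous_seminorm E q" and e: "0 < e"
  show "\<forall>\<^sub>F i in nhdsin E v. ess_sup q a b (ae_class a b (\<lambda>t. i) - ae_class a b (\<lambda>t. v)) < e"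
    using limitinD[OF l openin_topspace v] limitin_csnD[OF E l q e]
  proof eventually_elim
    case (elim i)
    have "ess_sup q a b (ae_class a b (\<lambda>t. i - v)) \<le> q (i - v)"
      by (rule ess_sup_le[OF q regulated_const[OF ab E lcs_diff[OF E elim(1) v]]]) simp
    thus ?case using elim(2) by (simp add: ae_class_diff)
  qed
qed

section \<open>Primitives of regulated functions\<close>

lemma weak_integral_increment:
  assumes \<eta>: "AC_primitive E a b \<eta> \<gamma>" and l: "linear l" "continuous_functional E l" and uv: "a \<le> u" "u \<le> v" "v \<le> b"
  shows "((\<lambda>t. l (\<gamma> t)) has_integral l (\<eta> v - \<eta> u)) {u..v}"
proof -
  have w: "((\<lambda>r. l (\<gamma> r)) has_integral l (\<eta> t - \<eta> a)) {a..t}" if "t \<in> {a..b}" for t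
    using \<eta> that l(2) unfolding AC_primitive_def weak_integral_def by blast
  have "(\<lambda>r. l (\<gamma> r)) integrable_on {a..v}" using w[of v] uv by (auto simp: integrable_on_def)
  hence "(\<lambda>r. l (\<gamma> r)) integrable_on {u..v}" by (rule integrable_subinterval_real) (use uv in auto)
  then obtain j where j: "((\<lambda>r. l (\<gamma> r)) has_integral j) {u..v}" by (auto simp: integrable_on_def)
  have "((\<lambda>r. l (\<gamma> r)) has_integral (l (\<eta> u - \<eta> a) + j)) {a..v}"
    by (rule has_integral_combine[OF uv(1,2) w j]) (use uv in auto)
  moreover have "((\<lambda>r. l (\<gamma> r)) has_integral l (\<eta> v - \<eta> a)) {a..v}" by (rule w) (use uv in auto)
  ultimately have "l (\<eta> u - \<eta> a) + j = l (\<eta> v - \<eta> a)" by (rule has_integral_unique)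
  hence "j = l (\<eta> v - \<eta> u)" by (simp add: linear_diff[OF l(1)])
  thus ?thesis using j by simp
qed

lemma AC_primitive_mem: "AC_primitive E a b \<eta> \<gamma> \<Longrightarrow> t \<in> {a..b} \<Longrightarrow> \<eta> t \<in> topspace E"
  unfolding AC_primitive_def using continuous_map_image_subset_topspace by fastforce

text \<open>The weak integral is tested with a functional that attains \<open>q\<close> at the error
  \<open>z\<close>; what remains is the integral of a real function bounded by
  \<open>c\<close>.\<close>

lemma AC_increment_bound:
  assumes \<eta>: "AC_primitive E a b \<eta> \<gamma>" and q: "continuous_seminorm E q" and w: "w \<in> topspace E"
    and uv: "a \<le> u" "u \<le> v" "v \<le> b" and c: "0 \<le> c" "AE t in lebesgue. t \<in> {u..v} \<longrightarrow> q (\<gamma> t - w) \<le> c"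
  shows "q (\<eta> v - \<eta> u - (v - u) *\<^sub>R w) \<le> c * (v - u)"
proof -
  note cE = lcs_closed[OF E]
  have uvm: "\<eta> u \<in> topspace E" "\<eta> v \<in> topspace E" using AC_primitive_mem[OF \<eta>] uv by auto
  define z where "z = \<eta> v - \<eta> u - (v - u) *\<^sub>R w"
  have z: "z \<in> topspace E" unfolding z_def by (intro cE uvm w)
  obtain l where l: "linear l" "continuous_functional E l" "\<And>x. x \<in> topspace E \<Longrightarrow> \<bar>l x\<bar> \<le> q x" "l z = q z"
    using csn_functional[OF E q z] by blast
  have \<gamma>: "\<gamma> t \<in> topspace E" if "t \<in> {a..b}" for t using \<eta> that regulated_mem unfolding AC_primitive_def by metis
  have "((\<lambda>t. l w) has_integral (v - u) * l w) {u..v}" using has_integral_const_real[of "l w" u v] uv by simp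
  from has_integral_diff[OF weak_integral_increment[OF \<eta> l(1,2) uv] this]
  have I: "((\<lambda>t. l (\<gamma> t - w)) has_integral l z) {u..v}"
    by (simp add: z_def linear_diff[OF l(1)] linear_scale[OF l(1)])
  obtain N where N: "negligible N" "{t. \<not> (t \<in> {u..v} \<longrightarrow> q (\<gamma> t - w) \<le> c)} \<subseteq> N"
    using c(2) unfolding eventually_ae_filter_negligible by blast
  \<comment> \<open>The integrand is set to 0 on the null set where the bound may fail, since
    \<open>has_integral_bound\<close> asks for a bound everywhere.\<close>
  define g where "g t = (if t \<in> N then 0 else l (\<gamma> t - w))" for t
  have "(g has_integral l z) {u..v}" by (rule has_integral_spike[OF N(1) _ I]) (simp add: g_def)
  moreover have "norm (g t) \<le> c" if t: "t \<in> cbox u v" for t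
  proof (cases "t \<in> N")
    case False
    hence "q (\<gamma> t - w) \<le> c" using N(2) t by auto
    moreover have "\<bar>l (\<gamma> t - w)\<bar> \<le> q (\<gamma> t - w)" by (rule l(3)[OF cE(3)[OF \<gamma> w]]) (use t uv in auto)
    ultimately show ?thesis using False by (simp add: g_def)
  qed (simp add: g_def c)
  ultimately have "norm (l z) \<le> c * measure lborel (cbox u v)" by (intro has_integral_bound[OF c(1)]) auto
  thus ?thesis using l(4) uv by (simp add: z_def)
qed

text \<open>The fundamental theorem at the points of continuity of \<open>\<gamma>\<close>: close to
  \<open>t\<close>, \<open>AC_increment_bound\<close> applies with \<open>w = \<gamma> t\<close> and
  a small \<open>c\<close>.\<close>

lemma AC_primitive_derivative:
  assumes \<eta>: "AC_primitive E a b \<eta> \<gamma>"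
  shows "\<exists>D. countable D \<and> (\<forall>t\<in>{a<..<b} - D. limitin E \<gamma> (\<gamma> t) (at t) \<and>
    limitin E (\<lambda>s. (\<eta> s - \<eta> t) /\<^sub>R (s - t)) (\<gamma> t) (at t))"
proof -
  have reg: "regulated E a b \<gamma>" using \<eta> by (simp add: AC_primitive_def)
  obtain D where D: "countable D" "\<And>t. t \<in> {a<..<b} - D \<Longrightarrow> limitin E \<gamma> (\<gamma> t) (at t)"
    using regulated_continuous[OF ab E reg] by blast
  note cE = lcs_closed[OF E]
  have "limitin E (\<lambda>s. (\<eta> s - \<eta> t) /\<^sub>R (s - t)) (\<gamma> t) (at t)" if t: "t \<in> {a<..<b} - D" for t
    unfolding limitin_csn[OF E]
  proof (intro conjI allI impI)
    have tab: "t \<in> {a..b}" using t by auto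
    show gt: "\<gamma> t \<in> topspace E" by (rule regulated_mem[OF reg tab])
    have ev: "\<forall>\<^sub>F u in at t. u \<in> {a<..<b}" by (rule eventually_at_in_open') (use t in auto)
    show "\<forall>\<^sub>F s in at t. (\<eta> s - \<eta> t) /\<^sub>R (s - t) \<in> topspace E"
      using ev by eventually_elim (intro cE AC_primitive_mem[OF \<eta>] tab, auto)
    fix q and e :: real assume q: "continuous_seminorm E q" and e: "0 < e"
    have "\<forall>\<^sub>F u in at t. u \<in> {a<..<b} \<and> q (\<gamma> u - \<gamma> t) < e / 2"
      using ev limitin_csnD[OF E D(2)[OF t] q half_gt_zero[OF e]] by eventually_elim simp
    then obtain d where d: "0 < d" "\<And>u. u \<noteq> t \<Longrightarrow> dist u t < d \<Longrightarrow> u \<in> {a<..<b} \<and> q (\<gamma> u - \<gamma> t) < e / 2"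
      by (auto simp: eventually_at)
    have b: "q (\<gamma> u - \<gamma> t) \<le> e / 2" if "dist u t < d" for u
      using d(2)[OF _ that] csn_zero[OF E q] e by (cases "u = t") (auto intro: less_imp_le)
    have "\<forall>\<^sub>F s in at t. dist s t < d" using d(1) by (auto simp: eventually_at)
    moreover have "\<forall>\<^sub>F s in at t. s \<noteq> t" by (simp add: eventually_at_filter)
    ultimately show "\<forall>\<^sub>F s in at t. q ((\<eta> s - \<eta> t) /\<^sub>R (s - t) - \<gamma> t) < e"
    proof eventually_elim
      case (elim s)
      have sab: "s \<in> {a<..<b}" using d(2) elim by blast
      have m: "\<eta> s \<in> topspace E" "\<eta> t \<in> topspace E" using AC_primitive_mem[OF \<eta>] sab tab by auto
      \<comment> \<open>Stated for both orders of \<open>s\<close> and \<open>t\<close>, since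
        increments are estimated from left to right.\<close>
      have inc: "q (\<eta> y - \<eta> x - (y - x) *\<^sub>R \<gamma> t) \<le> e / 2 * (y - x)"
        if "x \<le> y" "x = s \<and> y = t \<or> x = t \<and> y = s" for x y
      proof (rule AC_increment_bound[OF \<eta> q gt])
        have "dist u t < d" if "u \<in> {x..y}" for u
          using that \<open>x = s \<and> y = t \<or> x = t \<and> y = s\<close> \<open>x \<le> y\<close> elim(1) by (auto simp: dist_real_def)
        thus "AE u in lebesgue. u \<in> {x..y} \<longrightarrow> q (\<gamma> u - \<gamma> t) \<le> e / 2" by (intro AE_I2 impI b)
      qed (use that sab tab e in auto)
      have "q (\<eta> s - \<eta> t - (s - t) *\<^sub>R \<gamma> t) \<le> e / 2 * \<bar>s - t\<bar>"
      proof (cases "t \<le> s")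
        case True thus ?thesis using inc[of t s] by simp
      next
        case False
        have "\<eta> s - \<eta> t - (s - t) *\<^sub>R \<gamma> t = - (\<eta> t - \<eta> s - (t - s) *\<^sub>R \<gamma> t)" by (simp add: algebra_simps)
        hence "q (\<eta> s - \<eta> t - (s - t) *\<^sub>R \<gamma> t) = q (\<eta> t - \<eta> s - (t - s) *\<^sub>R \<gamma> t)"
          using csn_uminus[OF E q, of "\<eta> t - \<eta> s - (t - s) *\<^sub>R \<gamma> t"]
            cE(3)[OF cE(3)[OF m(2,1)] cE(4)[OF gt]] by (simp only:)
        thus ?thesis using False inc[of s t] by simp
      qed
      moreover have "\<eta> s - \<eta> t - (s - t) *\<^sub>R \<gamma> t = (s - t) *\<^sub>R ((\<eta> s - \<eta> t) /\<^sub>R (s - t) - \<gamma> t)"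
        using elim by (simp add: scaleR_diff_right)
      moreover have "q ((s - t) *\<^sub>R ((\<eta> s - \<eta> t) /\<^sub>R (s - t) - \<gamma> t)) = \<bar>s - t\<bar> * q ((\<eta> s - \<eta> t) /\<^sub>R (s - t) - \<gamma> t)"
        by (rule continuous_seminormD(3)[OF q]) (intro cE m gt)
      ultimately have "\<bar>s - t\<bar> * q ((\<eta> s - \<eta> t) /\<^sub>R (s - t) - \<gamma> t) \<le> \<bar>s - t\<bar> * (e / 2)" by (simp add: mult.commute)
      hence "q ((\<eta> s - \<eta> t) /\<^sub>R (s - t) - \<gamma> t) \<le> e / 2"
        using elim by (subst (asm) mult_le_cancel_left_pos) auto
      thus ?case using e by simp
    qed
  qed
  thus ?thesis using D by blast
qed

text \<open>Two densities of one primitive agree wherever both are its derivative, that is, off a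
  countable set. So the definite description in \<open>AC_deriv\<close> is legitimate.\<close>

lemma AC_deriv_eq:
  assumes \<eta>: "AC_primitive E a b \<eta> \<gamma>"
  shows "AC_deriv E a b \<eta> = ae_class a b \<gamma>"
  unfolding AC_deriv_def
proof (rule the_equality)
  show "\<exists>\<gamma>'. AC_primitive E a b \<eta> \<gamma>' \<and> ae_class a b \<gamma> = ae_class a b \<gamma>'" using \<eta> by blast
  fix X assume "\<exists>\<gamma>'. AC_primitive E a b \<eta> \<gamma>' \<and> X = ae_class a b \<gamma>'"
  then obtain \<gamma>' where \<eta>': "AC_primitive E a b \<eta> \<gamma>'" and X: "X = ae_class a b \<gamma>'" by blast
  obtain D where D: "countable D" "\<And>t. t \<in> {a<..<b} - D \<Longrightarrow> limitin E (\<lambda>s. (\<eta> s - \<eta> t) /\<^sub>R (s - t)) (\<gamma> t) (at t)"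
    using AC_primitive_derivative[OF \<eta>] by blast
  obtain D' where D': "countable D'" "\<And>t. t \<in> {a<..<b} - D' \<Longrightarrow> limitin E (\<lambda>s. (\<eta> s - \<eta> t) /\<^sub>R (s - t)) (\<gamma>' t) (at t)"
    using AC_primitive_derivative[OF \<eta>'] by blast
  have "\<gamma>' t = \<gamma> t" if "t \<in> {a<..<b} - (D \<union> D')" for t
    by (rule limitin_Hausdorff_unique[OF D'(2) D(2) at_neq_bot lcs_Hausdorff[OF E]]) (use that in auto)
  moreover have ae: "AE t in lebesgue. t \<notin> insert a (insert b (D \<union> D'))" by (rule AE_countable_complement) (use D D' in simp)
  ultimately have "AE t in lebesgue. t \<in> {a..b} \<longrightarrow> \<gamma>' t = \<gamma> t" by (intro eventually_mono[OF ae]) auto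
  thus "X = ae_class a b \<gamma>" unfolding X ae_class_eq_iff .
qed

text \<open>The topology of \<open>AC_space\<close> controls \<open>\<eta> a\<close> and the
  derivative, and \<open>\<eta> b - \<eta> a\<close> is bounded by \<open>b - a\<close> times the
  essential supremum of the latter. Local convexity of \<open>AC_space\<close> moves the question to
  0 by subtraction of \<open>\<eta>0\<close>; in the application it is supplied by the Lie group
  modelled on this space.\<close>

lemma continuous_AC_eval:
  assumes AC: "lcs (AC_space E a b)"
  shows "continuous_map (AC_space E a b) E (\<lambda>\<eta>. \<eta> b)"
  unfolding continuous_map_limitin
proof
  note cE = lcs_closed[OF E]
  fix \<eta>0 assume \<eta>0: "\<eta>0 \<in> topspace (AC_space E a b)"
  let ?F = "nhdsin (AC_space E a b) \<eta>0"
  have mem: "\<eta> \<in> AC_set E a b" if "\<eta> \<in> topspace (AC_space E a b)" for \<eta>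
    using that by (simp add: AC_space_def topspace_pullback_topology)
  have memE: "\<eta> t \<in> topspace E" if "\<eta> \<in> topspace (AC_space E a b)" "t \<in> {a..b}" for \<eta> t
    using mem[OF that(1)] AC_primitive_mem that(2) unfolding AC_set_def by blast
  have bb: "b \<in> {a..b}" using ab by simp
  have ev: "\<forall>\<^sub>F \<eta> in ?F. \<eta> \<in> topspace (AC_space E a b)"
    by (rule limitinD[OF limitin_nhdsin_id[OF \<eta>0] openin_topspace \<eta>0])
  have "limitin (AC_space E a b) (\<lambda>\<eta>. \<eta> - \<eta>0) (\<eta>0 - \<eta>0) ?F"
    by (rule lcs_limitin_diff[OF AC limitin_nhdsin_id[OF \<eta>0]]) (use \<eta>0 in simp)
  hence L: "limitin (AC_space E a b) (\<lambda>\<eta>. \<eta> - \<eta>0) 0 ?F" by simp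
  have P: "limitin (prod_topology E (R_space E a b)) (\<lambda>\<eta>. ((\<eta> - \<eta>0) a, AC_deriv E a b (\<eta> - \<eta>0))) ((0 :: real \<Rightarrow> 'a) a, AC_deriv E a b 0) ?F"
    using L unfolding AC_space_def limitin_pullback by blast
  have l0: "l 0 = 0" if "continuous_functional E l" for l
    using that cE(1) unfolding continuous_functional_def by (metis mult_zero_left scale_zero_left)
  have "AC_primitive E a b 0 (\<lambda>t. 0)"
    unfolding AC_primitive_def weak_integral_def
  proof (intro conjI ballI allI impI regulated_const[OF ab E cE(1)])
    show "continuous_map (top_of_set {a..b}) E 0" using cE(1) by (simp add: zero_fun_def)
    fix t l assume "continuous_functional E l"
    from l0[OF this] show "((\<lambda>t. l 0) has_integral l ((0 :: real \<Rightarrow> 'a) t - (0 :: real \<Rightarrow> 'a) a)) {a..t}" by simp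
  qed (simp add: cE(1))
  hence d0: "AC_deriv E a b 0 = 0" using AC_deriv_eq ae_class_zero by metis
  show "limitin E (\<lambda>\<eta>. \<eta> b) (\<eta>0 b) ?F"
    unfolding limitin_csn[OF E]
  proof (intro conjI allI impI)
    show "\<eta>0 b \<in> topspace E" by (rule memE[OF \<eta>0 bb])
    show "\<forall>\<^sub>F \<eta> in ?F. \<eta> b \<in> topspace E" using ev by eventually_elim (rule memE[OF _ bb])
    fix q and e :: real assume q: "continuous_seminorm E q" and e: "0 < e"
    have "0 < e / (2 * (b - a))" using e ab by simp
    moreover have "limitin (R_space E a b) (\<lambda>\<eta>. AC_deriv E a b (\<eta> - \<eta>0)) 0 ?F"
      using limitin_snd[OF P] d0 by simp
    ultimately have 1: "\<forall>\<^sub>F \<eta> in ?F. ess_sup q a b (AC_deriv E a b (\<eta> - \<eta>0) - 0) < e / (2 * (b - a))"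
      using q unfolding limitin_R_space by blast
    have 2: "\<forall>\<^sub>F \<eta> in ?F. q ((\<eta> - \<eta>0) a - 0) < e / 2"
      using limitin_csnD[OF E limitin_fst[OF P] q half_gt_zero[OF e]] by simp
    have 3: "\<forall>\<^sub>F \<eta> in ?F. \<eta> - \<eta>0 \<in> topspace (AC_space E a b)"
      by (rule limitinD[OF L openin_topspace lcs_zero[OF AC]])
    show "\<forall>\<^sub>F \<eta> in ?F. q (\<eta> b - \<eta>0 b) < e"
      using 1 2 3
    proof eventually_elim
      case (elim \<eta>)
      define \<zeta> where "\<zeta> = \<eta> - \<eta>0"
      have \<zeta>: "\<zeta> \<in> topspace (AC_space E a b)" using elim(3) by (simp add: \<zeta>_def)
      obtain \<gamma> where \<gamma>: "AC_primitive E a b \<zeta> \<gamma>" using mem[OF \<zeta>] by (auto simp: AC_set_def)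
      have reg: "regulated E a b \<gamma>" using \<gamma> by (simp add: AC_primitive_def)
      have "ess_sup q a b (ae_class a b \<gamma>) < e / (2 * (b - a))" using elim(1) AC_deriv_eq[OF \<gamma>] by (simp add: \<zeta>_def)
      then obtain c where c: "c < e / (2 * (b - a))" "AE t in lebesgue. t \<in> {a..b} \<longrightarrow> q (\<gamma> t) \<le> c"
        by (rule ess_sup_less[OF q reg])
      have "q (\<zeta> b - \<zeta> a - (b - a) *\<^sub>R 0) \<le> c * (b - a)"
        by (rule AC_increment_bound[OF \<gamma> q cE(1)]) (use ab AE_bound_nonneg[OF q reg c(2)] c(2) in auto)
      also have "\<dots> < e / 2" using c(1) ab by (simp add: field_simps)
      finally have 4: "q (\<zeta> b - \<zeta> a) < e / 2" by simp
      have aa: "a \<in> {a..b}" using ab by simp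
      have "q ((\<zeta> b - \<zeta> a) + \<zeta> a) \<le> q (\<zeta> b - \<zeta> a) + q (\<zeta> a)"
        by (rule continuous_seminormD(2)[OF q cE(3)[OF memE[OF \<zeta> bb] memE[OF \<zeta> aa]] memE[OF \<zeta> aa]])
      thus ?case using 4 elim(2) by (simp add: \<zeta>_def)
    qed
  qed
qed

end

section \<open>Piecewise continuous curves\<close>

text \<open>The real function \<open>q (g x - g y)\<close> is uniformly continuous on the compact
  square and vanishes on the diagonal.\<close>

lemma lcs_uniformly_continuous:
  fixes a b :: real
  assumes E: "lcs E" and q: "continuous_seminorm E q" and g: "continuous_map (top_of_set {a..b}) E g" and e: "0 < e"
  shows "\<exists>d>0. \<forall>x\<in>{a..b}. \<forall>y\<in>{a..b}. \<bar>x - y\<bar> < d \<longrightarrow> q (g x - g y) < e"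
proof -
  let ?T = "top_of_set {a..b}"
  have gm: "g x \<in> topspace E" if "x \<in> {a..b}" for x using continuous_map_image_subset_topspace[OF g] that by auto
  have "continuous_map (prod_topology ?T ?T) euclideanreal (\<lambda>p. q (g (fst p) - g (snd p)))"
    unfolding continuous_map_limitin
  proof
    fix p assume p: "p \<in> topspace (prod_topology ?T ?T)"
    have gl: "limitin E (\<lambda>i. g (h i)) (g x) F" if "limitin ?T h x F" for h x and F :: "(real \<times> real) filter"
      using continuous_map_limit[OF g that] by (simp add: o_def)
    have "limitin E (\<lambda>p. g (fst p) - g (snd p)) (g (fst p) - g (snd p)) (nhdsin (prod_topology ?T ?T) p)"
      by (intro lcs_limitin_diff[OF E] gl limitin_fst[OF limitin_nhdsin_id[OF p]] limitin_snd[OF limitin_nhdsin_id[OF p]])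
    from continuous_map_limit[OF continuous_seminormD(1)[OF q] this]
    show "limitin euclideanreal (\<lambda>p. q (g (fst p) - g (snd p))) (q (g (fst p) - g (snd p))) (nhdsin (prod_topology ?T ?T) p)"
      by (simp add: o_def)
  qed
  hence "continuous_on ({a..b} \<times> {a..b}) (\<lambda>p. q (g (fst p) - g (snd p)))"
    by (simp add: prod_topology_subtopology_eu)
  hence "uniformly_continuous_on ({a..b} \<times> {a..b}) (\<lambda>p. q (g (fst p) - g (snd p)))"
    by (rule compact_uniformly_continuous) (simp add: compact_Times)
  then obtain d where d: "0 < d" "\<And>p p'. p \<in> {a..b} \<times> {a..b} \<Longrightarrow> p' \<in> {a..b} \<times> {a..b} \<Longrightarrow> dist p' p < d \<Longrightarrow>
      dist (q (g (fst p') - g (snd p'))) (q (g (fst p) - g (snd p))) < e"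
    unfolding uniformly_continuous_on_def using e by metis
  have "q (g x - g y) < e" if xy: "x \<in> {a..b}" "y \<in> {a..b}" "\<bar>x - y\<bar> < d" for x y
    using d(2)[of "(y, y)" "(x, y)"] xy csn_zero[OF E q] csn_nonneg[OF E q lcs_diff[OF E gm[OF xy(1)] gm[OF xy(2)]]]
    by (simp add: dist_Pair_Pair dist_real_def)
  thus ?thesis using d(1) by blast
qed

text \<open>The step functions sample \<open>g\<close> on a grid, and uniform continuity of
  \<open>g\<close> gives their convergence. At 1 the floor is \<open>n\<close>, so the value there
  is \<open>g 0\<close>.\<close>

lemma regulated_periodic:
  fixes n :: nat
  assumes E: "lcs E" and n: "0 < n" and g: "continuous_map (top_of_set {0..1 / real n}) E g"
  shows "regulated E 0 1 (\<lambda>s. g (s - of_int \<lfloor>real n * s\<rfloor> / real n))"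
proof (rule regulatedI_csn[OF E])
  have gm: "g x \<in> topspace E" if "x \<in> {0..1 / real n}" for x
    using continuous_map_image_subset_topspace[OF g] that by auto
  have fr: "s - of_int \<lfloor>real n * s\<rfloor> / real n \<in> {0..1 / real n}" for s
  proof -
    have "of_int \<lfloor>real n * s\<rfloor> \<le> real n * s" "real n * s \<le> of_int \<lfloor>real n * s\<rfloor> + 1" by linarith+
    hence "of_int \<lfloor>real n * s\<rfloor> / real n \<le> s" "s \<le> (of_int \<lfloor>real n * s\<rfloor> + 1) / real n"
      using n by (simp_all add: divide_le_eq le_divide_eq mult.commute)
    thus ?thesis by (simp add: add_divide_distrib)
  qed
  show "g (t - of_int \<lfloor>real n * t\<rfloor> / real n) \<in> topspace E" for t by (rule gm[OF fr])
  \<comment> \<open>The grid of mesh \<open>1 / (n * Suc m)\<close> refines that of mesh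
    \<open>1 / n\<close>. Rounding down therefore never crosses a jump, and the sampled argument
    stays in the domain of \<open>g\<close>.\<close>
  define s where "s m r = g (of_int \<lfloor>real (n * Suc m) * r\<rfloor> / real (n * Suc m) - of_int \<lfloor>real n * r\<rfloor> / real n)" for m r
  have fl: "\<lfloor>real n * r\<rfloor> = \<lfloor>real (n * Suc m) * r\<rfloor> div int (Suc m)" for m r
  proof -
    have "real n * r = (real (n * Suc m) * r) / real_of_int (int (Suc m))" by (simp add: field_simps)
    thus ?thesis using floor_divide_real_eq_div[of "int (Suc m)" "real (n * Suc m) * r"] by simp
  qed
  have arg: "of_int \<lfloor>real (n * Suc m) * r\<rfloor> / real (n * Suc m) - of_int \<lfloor>real n * r\<rfloor> / real n \<in> {0..1 / real n} \<and>
      \<bar>(of_int \<lfloor>real (n * Suc m) * r\<rfloor> / real (n * Suc m) - of_int \<lfloor>real n * r\<rfloor> / real n) - (r - of_int \<lfloor>real n * r\<rfloor> / real n)\<bar> \<le> 1 / real (n * Suc m)" for m r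
  proof -
    define k where "k = \<lfloor>real (n * Suc m) * r\<rfloor>"
    define N where "N = real (n * Suc m)"
    have "0 < n * Suc m" using n by simp
    hence N: "0 < N" unfolding N_def by (simp only: of_nat_0_less_iff)
    have k: "of_int k \<le> N * r" "N * r \<le> of_int k + 1" unfolding k_def N_def by linarith+
    hence "of_int k / N \<le> r" "r \<le> (of_int k + 1) / N" using N by (simp_all add: divide_le_eq le_divide_eq mult.commute)
    hence kr: "of_int k / N \<le> r" "r \<le> of_int k / N + 1 / N" by (simp_all add: add_divide_distrib)
    have "\<lfloor>real n * r\<rfloor> = k div int (Suc m)" unfolding k_def by (rule fl)
    moreover have "(k div int (Suc m)) * int (Suc m) \<le> k" by (metis div_times_less_eq_dividend mult.commute of_nat_0_less_iff zero_less_Suc minus_mod_eq_div_mult minus_mod_eq_mult_div diff_le_eq le_add_same_cancel1 pos_mod_sign)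
    ultimately have "\<lfloor>real n * r\<rfloor> * int (Suc m) \<le> k" by simp
    hence "of_int \<lfloor>real n * r\<rfloor> * real (Suc m) \<le> of_int k" by (metis of_int_le_iff of_int_mult of_int_of_nat_eq)
    hence "of_int \<lfloor>real n * r\<rfloor> \<le> of_int k / real (Suc m)" by (subst pos_le_divide_eq) simp_all
    from divide_right_mono[OF this, of "real n"]
    have "of_int \<lfloor>real n * r\<rfloor> / real n \<le> of_int k / real (Suc m) / real n" by simp
    also have "\<dots> = of_int k / N" unfolding N_def by (simp only: divide_divide_eq_left of_nat_mult mult.commute)
    finally have "of_int \<lfloor>real n * r\<rfloor> / real n \<le> of_int k / N" .
    moreover have "\<lfloor>N * r\<rfloor> = k" by (simp only: N_def k_def)
    ultimately show ?thesis using kr fr[of r] unfolding N_def[symmetric] by auto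
  qed
  show "step_function E 0 1 (s m)" for m
    unfolding step_function_def
  proof (intro conjI exI allI impI)
    show "s m ` {0..1} \<subseteq> topspace E" using gm arg by (auto simp: s_def)
    define N where "N = n * Suc m"
    have N: "0 < N" using n by (simp add: N_def)
    show "is_partition 0 1 N (\<lambda>j. real j / real N)" using N by (simp add: is_partition_def divide_strict_right_mono)
    fix j assume "j < N"
    show "\<forall>t\<in>{real j / real N<..<real (Suc j) / real N}. s m t = g (of_int (int j) / real N - of_int (int j div int (Suc m)) / real n)"
    proof
      fix t assume t: "t \<in> {real j / real N<..<real (Suc j) / real N}"
      hence "real j < real N * t" "real N * t < real j + 1" using N by (simp_all add: field_simps)
      hence "\<lfloor>real (n * Suc m) * t\<rfloor> = int j" unfolding N_def by linarith
      thus "s m t = g (of_int (int j) / real N - of_int (int j div int (Suc m)) / real n)"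
        unfolding s_def fl[of t m] by (simp add: N_def)
    qed
  qed
  fix q and e :: real assume q: "continuous_seminorm E q" and e: "0 < e"
  obtain d where d: "0 < d" "\<forall>x\<in>{0..1 / real n}. \<forall>y\<in>{0..1 / real n}. \<bar>x - y\<bar> < d \<longrightarrow> q (g x - g y) < e"
    using lcs_uniformly_continuous[OF E q g e] by blast
  have "(\<lambda>m. 1 / real (n * Suc m)) \<longlonglongrightarrow> 0"
    using tendsto_mult[OF tendsto_const[of "1 / real n"] LIMSEQ_inverse_real_of_nat] by (simp add: field_simps)
  hence "\<forall>\<^sub>F m in sequentially. 1 / real (n * Suc m) < d" using d(1) by (rule order_tendstoD)
  thus "\<forall>\<^sub>F m in sequentially. \<forall>t\<in>{0..1}. q (s m t - g (t - of_int \<lfloor>real n * t\<rfloor> / real n)) < e"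
  proof eventually_elim
    case (elim m)
    show ?case
    proof
      fix t :: real
      show "q (s m t - g (t - of_int \<lfloor>real n * t\<rfloor> / real n)) < e"
        unfolding s_def using arg[of m t] fr[of t] d(2) elim by (meson le_less_trans)
    qed
  qed
qed

section \<open>Tangent spaces\<close>

lemma charts_atI: "c \<in> charts M \<Longrightarrow> x \<in> fst c \<Longrightarrow> c \<in> charts_at M x"
  and charts_atD: "c \<in> charts_at M x \<Longrightarrow> c \<in> charts M" "c \<in> charts_at M x \<Longrightarrow> x \<in> fst c"
  by (auto simp: charts_at_def)

text \<open>The chain rule for transition maps, that is, the cocycle identity behind the
  compatibility condition in \<open>tangent_set\<close>.\<close>

lemma chart_transition_chain:
  assumes M: "smooth_manifold M" and c: "c \<in> charts_at M x" and d: "d \<in> charts_at M x" and e: "e \<in> charts_at M x"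
    and w: "w \<in> topspace (model M)"
  shows "dir_deriv (model M) (snd e \<circ> chart_inv d) (snd d x) (dir_deriv (model M) (snd d \<circ> chart_inv c) (snd c x) w)
    = dir_deriv (model M) (snd e \<circ> chart_inv c) (snd c x) w"
proof -
  note L = manifold_lcs[OF M]
  note c = charts_atD[OF c] and d = charts_atD[OF d] and e = charts_atD[OF e]
  define W where "W = fst c \<inter> fst d \<inter> fst e"
  have Wo: "openin (model M) (snd c ` W)"
    by (rule chart_open_image[OF c(1)]) (auto simp: W_def intro: openin_Int chart_openin c d e)
  have f: "C1_on (model M) (model M) (snd c ` W) (snd d \<circ> chart_inv c)"
    by (rule smooth_on_imp_C1[OF smooth_on_mono[OF charts_compatible[OF M c(1) d(1)] Wo]]) (auto simp: W_def)
  note g = smooth_on_imp_C1[OF charts_compatible[OF M d(1) e(1)]]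
  have im: "(snd d \<circ> chart_inv c) ` (snd c ` W) \<subseteq> snd d ` (fst d \<inter> fst e)"
    by (auto simp: W_def chart_inv_chart[OF c(1)])
  have xW: "snd c x \<in> snd c ` W" using c d e by (auto simp: W_def)
  have "dir_deriv (model M) ((snd e \<circ> chart_inv d) \<circ> (snd d \<circ> chart_inv c)) (snd c x) w
      = dir_deriv (model M) (snd e \<circ> chart_inv c) (snd c x) w"
    by (rule dir_deriv_cong(2)[OF L Wo xW w]) (auto simp: W_def chart_inv_chart[OF c(1)] chart_inv_chart[OF d(1)])
  thus ?thesis using C1_comp(2)[OF L L L f g im xW w] c(2) by (simp add: chart_inv_chart[OF c(1)])
qed

lemma chart_transition_id:
  assumes M: "smooth_manifold M" and c: "c \<in> charts_at M x" and w: "w \<in> topspace (model M)"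
  shows "dir_deriv (model M) (snd c \<circ> chart_inv c) (snd c x) w = w"
proof -
  note L = manifold_lcs[OF M] and c = charts_atD[OF c]
  have "dir_deriv (model M) (snd c \<circ> chart_inv c) (snd c x) w = dir_deriv (model M) (\<lambda>y. y) (snd c x) w"
    by (rule dir_deriv_cong(2)[OF L chart_image_openin[OF c(1)] _ w]) (use c in \<open>auto simp: chart_inv_chart\<close>)
  also have "\<dots> = w" by (rule C1_linear(2)[OF L L _ _ w]) (auto simp: linear_iff)
  finally show ?thesis .
qed

lemma chart_vec_at:
  assumes "c \<in> charts_at M x"
  shows "chart_vec M c (snd c x) w d =
    (if d \<in> charts_at M x then dir_deriv (model M) (snd d \<circ> chart_inv c) (snd c x) w else 0)"
  using charts_atD[OF assms] by (simp add: chart_vec_def chart_inv_chart)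

lemma chart_transition_C1:
  assumes M: "smooth_manifold M" and c: "c \<in> charts_at M x" and d: "d \<in> charts_at M x"
  shows "C1_on (model M) (model M) (snd c ` (fst c \<inter> fst d)) (snd d \<circ> chart_inv c)" "snd c x \<in> snd c ` (fst c \<inter> fst d)"
  using smooth_on_imp_C1[OF charts_compatible[OF M charts_atD(1)[OF c] charts_atD(1)[OF d]]] charts_atD(2)[OF c] charts_atD(2)[OF d]
  by auto

lemma tangentI:
  assumes "\<And>c. c \<notin> charts_at M x \<Longrightarrow> v c = 0" "\<And>c. c \<in> charts_at M x \<Longrightarrow> v c \<in> topspace (model M)"
    and "\<And>c d. c \<in> charts_at M x \<Longrightarrow> d \<in> charts_at M x \<Longrightarrow> v d = dir_deriv (model M) (snd d \<circ> chart_inv c) (snd c x) (v c)"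
  shows "v \<in> tangent_set M x"
  unfolding tangent_set_def using assms by blast

lemma tangent_zero: "v \<in> tangent_set M x \<Longrightarrow> c \<notin> charts_at M x \<Longrightarrow> v c = 0"
  and tangent_mem: "v \<in> tangent_set M x \<Longrightarrow> c \<in> charts_at M x \<Longrightarrow> v c \<in> topspace (model M)"
  and tangent_transition: "v \<in> tangent_set M x \<Longrightarrow> c \<in> charts_at M x \<Longrightarrow> d \<in> charts_at M x \<Longrightarrow>
    v d = dir_deriv (model M) (snd d \<circ> chart_inv c) (snd c x) (v c)"
  unfolding tangent_set_def by blast+

text \<open>The component in one chart can be prescribed freely. Together with
  \<open>tangent_eq_chart_vec\<close>, this identifies the tangent space with the model
  space.\<close>

lemma chart_vec_tangent:
  assumes M: "smooth_manifold M" and c: "c \<in> charts_at M x" and w: "w \<in> topspace (model M)"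
  shows "chart_vec M c (snd c x) w \<in> tangent_set M x" and "chart_vec M c (snd c x) w c = w"
proof -
  note L = manifold_lcs[OF M]
  show "chart_vec M c (snd c x) w c = w" using chart_transition_id[OF assms] c by (simp add: chart_vec_at[OF c])
  have "dir_deriv (model M) (snd d \<circ> chart_inv c) (snd c x) w \<in> topspace (model M)" if "d \<in> charts_at M x" for d
    by (rule C1_deriv_mem[OF L chart_transition_C1[OF M c that] w])
  thus "chart_vec M c (snd c x) w \<in> tangent_set M x"
    using chart_transition_chain[OF M c _ _ w] by (intro tangentI) (simp_all add: chart_vec_at[OF c])
qed

lemma tangent_eq_chart_vec:
  assumes "v \<in> tangent_set M x" "c \<in> charts_at M x"
  shows "v = chart_vec M c (snd c x) (v c)"
proof
  fix d show "v d = chart_vec M c (snd c x) (v c) d"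
    using tangent_zero[OF assms(1), of d] tangent_transition[OF assms, of d] by (simp add: chart_vec_at[OF assms(2)])
qed

lemma subspace_tangent_set:
  assumes M: "smooth_manifold M"
  shows "subspace (tangent_set M x)"
proof -
  note L = manifold_lcs[OF M]
  note cl = lcs_closed[OF L]
  have lin: "dir_deriv (model M) (snd d \<circ> chart_inv c) (snd c x) (y + z) =
      dir_deriv (model M) (snd d \<circ> chart_inv c) (snd c x) y + dir_deriv (model M) (snd d \<circ> chart_inv c) (snd c x) z"
    "dir_deriv (model M) (snd d \<circ> chart_inv c) (snd c x) (r *\<^sub>R y) = r *\<^sub>R dir_deriv (model M) (snd d \<circ> chart_inv c) (snd c x) y"
    "dir_deriv (model M) (snd d \<circ> chart_inv c) (snd c x) 0 = 0"
    if "c \<in> charts_at M x" "d \<in> charts_at M x" "y \<in> topspace (model M)" "z \<in> topspace (model M)" for c d y z r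
    using C1_dir_deriv_add[OF L L chart_transition_C1[OF M that(1,2)]] C1_dir_deriv_scale[OF L L chart_transition_C1[OF M that(1,2)]]
      C1_dir_deriv_zero[OF L L chart_transition_C1[OF M that(1,2)]] that(3,4) by auto
  show ?thesis
    unfolding subspace_def
  proof (intro conjI ballI allI)
    show "0 \<in> tangent_set M x"
      by (rule tangentI) (simp_all add: lin(3)[OF _ _ cl(1) cl(1)] cl(1))
  next
    fix v w assume v: "v \<in> tangent_set M x" and w: "w \<in> tangent_set M x"
    have "(v + w) d = dir_deriv (model M) (snd d \<circ> chart_inv c) (snd c x) ((v + w) c)"
      if cd: "c \<in> charts_at M x" "d \<in> charts_at M x" for c d
    proof -
      have "v d = dir_deriv (model M) (snd d \<circ> chart_inv c) (snd c x) (v c)"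
        "w d = dir_deriv (model M) (snd d \<circ> chart_inv c) (snd c x) (w c)"
        by (rule tangent_transition[OF v cd], rule tangent_transition[OF w cd])
      hence "v d + w d = dir_deriv (model M) (snd d \<circ> chart_inv c) (snd c x) (v c + w c)"
        by (simp only: lin(1)[OF cd tangent_mem[OF v cd(1)] tangent_mem[OF w cd(1)]])
      thus ?thesis by simp
    qed
    moreover have "c \<notin> charts_at M x \<Longrightarrow> (v + w) c = 0" for c by (simp add: tangent_zero[OF v] tangent_zero[OF w])
    moreover have "c \<in> charts_at M x \<Longrightarrow> (v + w) c \<in> topspace (model M)" for c
      by (simp add: cl(2) tangent_mem[OF v] tangent_mem[OF w])
    ultimately show "v + w \<in> tangent_set M x" by (intro tangentI)
  next
    fix r :: real and v assume v: "v \<in> tangent_set M x"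
    have "(r *\<^sub>R v) d = dir_deriv (model M) (snd d \<circ> chart_inv c) (snd c x) ((r *\<^sub>R v) c)"
      if cd: "c \<in> charts_at M x" "d \<in> charts_at M x" for c d
    proof -
      have "v d = dir_deriv (model M) (snd d \<circ> chart_inv c) (snd c x) (v c)"
        by (rule tangent_transition[OF v cd])
      hence "r *\<^sub>R v d = dir_deriv (model M) (snd d \<circ> chart_inv c) (snd c x) (r *\<^sub>R v c)"
        by (simp only: lin(2)[OF cd tangent_mem[OF v cd(1)] cl(1)])
      thus ?thesis by (simp add: scaleR_fun_def)
    qed
    moreover have "c \<notin> charts_at M x \<Longrightarrow> (r *\<^sub>R v) c = 0" for c by (simp add: scaleR_fun_def tangent_zero[OF v])
    moreover have "c \<in> charts_at M x \<Longrightarrow> (r *\<^sub>R v) c \<in> topspace (model M)" for c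
      by (simp add: scaleR_fun_def cl(4) tangent_mem[OF v])
    ultimately show "r *\<^sub>R v \<in> tangent_set M x" by (intro tangentI)
  qed
qed

text \<open>The other components are continuous functions of the one at \<open>c\<close>, by
  continuity of the differential of a transition map in its direction. So the single component at
  \<open>c\<close> already gives the topology generated by all of them.\<close>

lemma tangent_space_eq_pullback:
  assumes M: "smooth_manifold M" and c: "c \<in> charts_at M x"
  shows "tangent_space M x = pullback_topology (tangent_set M x) (\<lambda>v. v c) (model M)"
proof -
  let ?S = "{{v \<in> tangent_set M x. v c \<in> U} | c U. c \<in> charts_at M x \<and> openin (model M) U}"
  let ?P = "pullback_topology (tangent_set M x) (\<lambda>v. v c) (model M)"
  note L = manifold_lcs[OF M]
  have gen: "openin ?P A" if "A \<in> ?S" for A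
  proof -
    obtain d U where A: "A = {v \<in> tangent_set M x. v d \<in> U}" "d \<in> charts_at M x" "openin (model M) U" using \<open>A \<in> ?S\<close> by blast
    note C = chart_transition_C1[OF M c A(2)]
    have "continuous_map (model M) (model M) (dir_deriv (model M) (snd d \<circ> chart_inv c) (snd c x))"
      unfolding continuous_map_limitin
    proof
      fix y assume y: "y \<in> topspace (model M)"
      have "snd c x \<in> topspace (model M)" using C1_subset[OF C(1)] C(2) by blast
      thus "limitin (model M) (dir_deriv (model M) (snd d \<circ> chart_inv c) (snd c x))
          (dir_deriv (model M) (snd d \<circ> chart_inv c) (snd c x) y) (nhdsin (model M) y)"
        by (intro C1_deriv_cont[OF C _ limitin_nhdsin_id[OF y]]) simp
    qed
    from openin_continuous_map_preimage[OF this A(3)]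
    have o: "openin (model M) {y \<in> topspace (model M). dir_deriv (model M) (snd d \<circ> chart_inv c) (snd c x) y \<in> U}" .
    have "A = (\<lambda>v. v c) -` {y \<in> topspace (model M). dir_deriv (model M) (snd d \<circ> chart_inv c) (snd c x) y \<in> U} \<inter> tangent_set M x"
    proof (intro Set.set_eqI iffI)
      fix v assume "v \<in> A"
      hence v: "v \<in> tangent_set M x" "v d \<in> U" by (auto simp: A(1))
      show "v \<in> (\<lambda>v. v c) -` {y \<in> topspace (model M). dir_deriv (model M) (snd d \<circ> chart_inv c) (snd c x) y \<in> U} \<inter> tangent_set M x"
        using v tangent_mem[OF v(1) c] tangent_transition[OF v(1) c A(2)] by simp
    next
      fix v assume "v \<in> (\<lambda>v. v c) -` {y \<in> topspace (model M). dir_deriv (model M) (snd d \<circ> chart_inv c) (snd c x) y \<in> U} \<inter> tangent_set M x"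
      hence v: "v \<in> tangent_set M x" "dir_deriv (model M) (snd d \<circ> chart_inv c) (snd c x) (v c) \<in> U" by auto
      have "v d \<in> U" unfolding tangent_transition[OF v(1) c A(2)] by (rule v(2))
      thus "v \<in> A" using v(1) by (simp add: A(1))
    qed
    thus ?thesis using o by (auto simp: openin_pullback_topology)
  qed
  show ?thesis
    unfolding topology_eq
  proof (intro allI iffI)
    fix A assume "openin (tangent_space M x) A"
    hence "generate_topology_on ?S A" unfolding tangent_space_def by (rule openin_topology_generated_by)
    thus "openin ?P A"
    proof induction
      case (Basis A) thus ?case by (rule gen)
    qed (auto intro: openin_Int openin_Union)
  next
    fix A assume "openin ?P A"
    then obtain U where U: "openin (model M) U" "A = (\<lambda>v. v c) -` U \<inter> tangent_set M x" by (auto simp: openin_pullback_topology)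
    have "A = {v \<in> tangent_set M x. v c \<in> U}" using U(2) by auto
    hence "A \<in> ?S" using c U(1) by blast
    thus "openin (tangent_space M x) A" unfolding tangent_space_def by (rule topology_generated_by_Basis)
  qed
qed

lemma tangent_space_facts:
  assumes M: "smooth_manifold M" and c: "c \<in> charts_at M x"
  shows lcs_tangent_space: "lcs (tangent_space M x)"
    and topspace_tangent_space: "topspace (tangent_space M x) = tangent_set M x"
    and limitin_tangent_space: "limitin (tangent_space M x) a v F \<longleftrightarrow>
      v \<in> tangent_set M x \<and> (\<forall>\<^sub>F i in F. a i \<in> tangent_set M x) \<and> limitin (model M) (\<lambda>i. a i c) (v c) F"
proof -
  have "inj_on (\<lambda>v. v c) (tangent_set M x)"
  proof (rule inj_onI)
    fix v w assume v: "v \<in> tangent_set M x" and w: "w \<in> tangent_set M x" and "v c = w c"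
    have "v = chart_vec M c (snd c x) (w c)" using tangent_eq_chart_vec[OF v c] \<open>v c = w c\<close> by (simp only:)
    also have "\<dots> = w" by (rule tangent_eq_chart_vec[OF w c, symmetric])
    finally show "v = w" .
  qed
  thus "lcs (tangent_space M x)"
    unfolding tangent_space_eq_pullback[OF assms]
    by (intro lcs_pullback manifold_lcs[OF M] subspace_tangent_set[OF M]) (auto intro: linear_eval)
  show "topspace (tangent_space M x) = tangent_set M x"
    unfolding tangent_space_eq_pullback[OF assms] using tangent_mem[OF _ c] by (auto simp: topspace_pullback_topology)
  show "limitin (tangent_space M x) a v F \<longleftrightarrow>
      v \<in> tangent_set M x \<and> (\<forall>\<^sub>F i in F. a i \<in> tangent_set M x) \<and> limitin (model M) (\<lambda>i. a i c) (v c) F"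
    unfolding tangent_space_eq_pullback[OF assms] by (rule limitin_pullback)
qed

section \<open>Smooth operations on a Lie group\<close>

locale lie =
  fixes G :: "('g, 'e::real_vector) lie_structure" (structure)
  assumes lie: "lie_group G"
begin

abbreviation "M \<equiv> mfd G"
abbreviation "E \<equiv> model (mfd G)"

sublocale group G
  using lie by (simp add: lie_group_def)

lemma M: "smooth_manifold M" and topM: "topspace (mtop M) = carrier G"
  using lie by (simp_all add: lie_group_def)

lemma E: "lcs E"
  by (rule manifold_lcs[OF M])

lemma chart_carrier: "d \<in> charts M \<Longrightarrow> fst d \<subseteq> carrier G"
  using openin_subset[OF chart_openin] topM by blast

lemma smooth_mem: "smooth_map_on P M S f \<Longrightarrow> x \<in> S \<Longrightarrow> f x \<in> carrier G"
  using smooth_map_mem[of P M S f x] topM by simp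

lemma smooth_mult:
  assumes P: "smooth_manifold P" and f: "smooth_map_on P M S f" and g: "smooth_map_on P M S g"
  shows "smooth_map_on P M S (\<lambda>x. f x \<otimes> g x)"
proof -
  have m: "smooth_map_on (prod_manifold M M) M (carrier G \<times> carrier G) (\<lambda>(x, y). x \<otimes> y)"
    using lie by (simp add: lie_group_def)
  have "smooth_map_on P M S (\<lambda>x. (\<lambda>(x, y). x \<otimes> y) (f x, g x))"
    by (rule smooth_map_on_compose[OF P smooth_manifold_prod[OF M M] M smooth_map_on_pair[OF P M M f g] m])
      (use smooth_mem[OF f] smooth_mem[OF g] in auto)
  thus ?thesis by simp
qed

lemma smooth_inv:
  assumes P: "smooth_manifold P" and f: "smooth_map_on P M S f"
  shows "smooth_map_on P M S (\<lambda>x. inv (f x))"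
proof -
  have i: "smooth_map_on M M (carrier G) (\<lambda>x. inv x)" using lie by (simp add: lie_group_def)
  show ?thesis by (rule smooth_map_on_compose[OF P M M f i]) (use smooth_mem[OF f] in auto)
qed

lemma smooth_const: "smooth_manifold P \<Longrightarrow> openin (mtop P) S \<Longrightarrow> k \<in> carrier G \<Longrightarrow> smooth_map_on P M S (\<lambda>x. k)"
  by (rule smooth_map_on_const[OF _ M]) (simp_all add: topM)

text \<open>Obtained by inverting twice, as smoothness of the inversion is part of the definition of
  a Lie group.\<close>

lemma smooth_id: "smooth_map_on M M (carrier G) (\<lambda>x. x)"
proof -
  have "smooth_map_on M M (carrier G) (\<lambda>x. inv (inv x))"
    by (rule smooth_inv[OF M]) (use lie in \<open>simp add: lie_group_def\<close>)
  thus ?thesis by (rule smooth_map_on_cong[OF M M]) simp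
qed

lemma openin_carrier: "openin (mtop M) (carrier G)"
  using openin_topspace[of "mtop M"] by (simp add: topM)

lemma smooth_left: "g \<in> carrier G \<Longrightarrow> smooth_map_on M M (carrier G) (\<lambda>x. g \<otimes> x)"
  by (intro smooth_mult[OF M] smooth_const[OF M] smooth_id openin_carrier)

lemma limitin_mult:
  assumes a: "limitin (mtop M) a x F" and b: "limitin (mtop M) b y F"
  shows "limitin (mtop M) (\<lambda>i. a i \<otimes> b i) (x \<otimes> y) F"
proof -
  have m: "smooth_map_on (prod_manifold M M) M (carrier G \<times> carrier G) (\<lambda>(x, y). x \<otimes> y)"
    using lie by (simp add: lie_group_def)
  have "(x, y) \<in> carrier G \<times> carrier G" using limitin_topspace[OF a] limitin_topspace[OF b] by (simp add: topM)
  from smooth_map_limitin[OF m this] limitin_pairI[OF a b] show ?thesis by fastforce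
qed

lemma limitin_inv:
  assumes a: "limitin (mtop M) a x F"
  shows "limitin (mtop M) (\<lambda>i. inv (a i)) (inv x) F"
proof (rule smooth_map_limitin[OF _ _ a])
  show "smooth_map_on M M (carrier G) (\<lambda>x. inv x)" using lie by (simp add: lie_group_def)
  show "x \<in> carrier G" using limitin_topspace[OF a] by (simp add: topM)
qed

lemma chart_smooth:
  assumes F: "lcs F" and f: "smooth_map_on (lcs_manifold F) M S f" and d: "d \<in> charts M"
  shows "smooth_on F E {y \<in> S. f y \<in> fst d} (\<lambda>y. snd d (f y))"
  by (rule smooth_map_imp_smooth_on[OF F E])
    (rule smooth_map_on_comp[OF smooth_manifold_lcs[OF F] M smooth_manifold_lcs[OF E] f smooth_map_chart(1)[OF M d]])

lemma chart_inv_smooth: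
  assumes F: "lcs F" and h: "smooth_on F E S h" and d: "d \<in> charts M" and im: "h ` S \<subseteq> snd d ` fst d"
  shows "smooth_map_on (lcs_manifold F) M S (\<lambda>y. chart_inv d (h y))"
  by (rule smooth_map_on_compose[OF smooth_manifold_lcs[OF F] smooth_manifold_lcs[OF E] M
        smooth_on_imp_smooth_map[OF F E h] smooth_map_chart(2)[OF M d] im])

text \<open>\<open>tangent_map\<close> evaluates in a chart picked by \<open>SOME\<close>. The chain
  rule for the transition from \<open>d\<close> to this chart \<open>c\<close> replaces it by
  \<open>d\<close>.\<close>

lemma left_act_chart_vec:
  assumes g: "g \<in> carrier G" and d: "d \<in> charts_at M x" and e: "e \<in> charts_at M (g \<otimes> x)" and w: "w \<in> topspace E"
  shows "left_act G g x (chart_vec M d (snd d x) w) e = dir_deriv E (\<lambda>y. snd e (g \<otimes> chart_inv d y)) (snd d x) w"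
proof -
  define c where "c = (SOME c. c \<in> charts_at M x)"
  have c: "c \<in> charts_at M x" unfolding c_def using d by (rule someI)
  note c' = charts_atD[OF c] and d' = charts_atD[OF d] and e' = charts_atD[OF e]
  define W where "W = {z \<in> carrier G. g \<otimes> z \<in> fst e} \<inter> (fst c \<inter> fst d)"
  have W: "openin (mtop M) W"
    unfolding W_def
    by (intro openin_Int openin_preimage_open[OF openin_carrier smooth_map_cont[OF smooth_left[OF g]]] chart_openin c' d' e')
  have Wd: "W \<subseteq> fst d" by (auto simp: W_def)
  have Wo: "openin E (snd d ` W)" by (rule chart_open_image[OF d'(1) W Wd])
  have "x \<in> carrier G" using chart_carrier[OF d'(1)] d'(2) by blast
  hence xW: "snd d x \<in> snd d ` W" by (intro imageI) (simp add: W_def c' d' e')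
  have f: "C1_on E E (snd d ` W) (snd c \<circ> chart_inv d)"
    by (rule smooth_on_imp_C1[OF smooth_on_mono[OF charts_compatible[OF M d'(1) c'(1)] Wo]]) (auto simp: W_def)
  have h: "C1_on E E (snd c ` {x \<in> carrier G \<inter> fst c. g \<otimes> x \<in> fst e}) (snd e \<circ> (\<lambda>h. g \<otimes> h) \<circ> chart_inv c)"
    by (rule smooth_on_imp_C1[OF smooth_map_charts[OF smooth_left[OF g] c'(1) e'(1)]])
  have im: "(snd c \<circ> chart_inv d) ` (snd d ` W) \<subseteq> snd c ` {x \<in> carrier G \<inter> fst c. g \<otimes> x \<in> fst e}"
    by (auto simp: W_def chart_inv_chart[OF d'(1)])
  have "left_act G g x (chart_vec M d (snd d x) w) e
      = dir_deriv E (snd e \<circ> (\<lambda>h. g \<otimes> h) \<circ> chart_inv c) (snd c x) (dir_deriv E (snd c \<circ> chart_inv d) (snd d x) w)"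
    using e c by (simp add: left_act_def tangent_map_def Let_def c_def[symmetric] chart_vec_at[OF d])
  also have "\<dots> = dir_deriv E ((snd e \<circ> (\<lambda>h. g \<otimes> h) \<circ> chart_inv c) \<circ> (snd c \<circ> chart_inv d)) (snd d x) w"
    using C1_comp(2)[OF E E E f h im xW w] d'(2) by (simp add: chart_inv_chart[OF d'(1)])
  also have "\<dots> = dir_deriv E (\<lambda>y. snd e (g \<otimes> chart_inv d y)) (snd d x) w"
    by (rule dir_deriv_cong(2)[OF E Wo xW w]) (auto simp: W_def chart_inv_chart[OF d'(1)] chart_inv_chart[OF c'(1)])
  finally show ?thesis .
qed

text \<open>The three group operations that are differentiated later: the quotient for logarithmic
  derivatives, the translated quotient for the comparison of two curves, and the product for the Lie
  bracket.\<close>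

lemma two_chart_smooth:
  assumes d: "d \<in> charts M" and e: "e \<in> charts M" and k: "k1 \<in> carrier G" "k2 \<in> carrier G" "k3 \<in> carrier G"
  defines "V \<equiv> (snd d ` fst d) \<times> (snd d ` fst d)"
  shows "smooth_on (prod_topology E E) E {p \<in> V. inv (chart_inv d (fst p)) \<otimes> chart_inv d (snd p) \<in> fst e}
      (\<lambda>p. snd e (inv (chart_inv d (fst p)) \<otimes> chart_inv d (snd p)))"
    and "smooth_on (prod_topology E E) E {p \<in> V. k1 \<otimes> chart_inv d (fst p) \<otimes> inv (chart_inv d (snd p)) \<otimes> k2 \<in> fst e}
      (\<lambda>p. snd e (k1 \<otimes> chart_inv d (fst p) \<otimes> inv (chart_inv d (snd p)) \<otimes> k2))"
    and "smooth_on (prod_topology E E) E {p \<in> V. chart_inv d (fst p) \<otimes> chart_inv d (snd p) \<in> fst e}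
      (\<lambda>p. snd e (chart_inv d (fst p) \<otimes> chart_inv d (snd p)))"
proof -
  note P = lcs_prod[OF E E]
  have V: "openin (prod_topology E E) V" unfolding V_def using chart_image_openin[OF d] by (simp add: openin_prod_Times_iff)
  note PM = smooth_manifold_lcs[OF P]
  have 1: "smooth_map_on (lcs_manifold (prod_topology E E)) M V (\<lambda>p. chart_inv d (fst p))"
    by (rule chart_inv_smooth[OF P smooth_on_fst[OF E E V] d]) (auto simp: V_def)
  have 2: "smooth_map_on (lcs_manifold (prod_topology E E)) M V (\<lambda>p. chart_inv d (snd p))"
    by (rule chart_inv_smooth[OF P smooth_on_snd[OF E E V] d]) (auto simp: V_def)
  have V': "openin (mtop (lcs_manifold (prod_topology E E))) V" using V by simp
  show "smooth_on (prod_topology E E) E {p \<in> V. inv (chart_inv d (fst p)) \<otimes> chart_inv d (snd p) \<in> fst e}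
      (\<lambda>p. snd e (inv (chart_inv d (fst p)) \<otimes> chart_inv d (snd p)))"
    by (intro chart_smooth[OF P _ e] smooth_mult[OF PM] smooth_inv[OF PM] 1 2)
  show "smooth_on (prod_topology E E) E {p \<in> V. k1 \<otimes> chart_inv d (fst p) \<otimes> inv (chart_inv d (snd p)) \<otimes> k2 \<in> fst e}
      (\<lambda>p. snd e (k1 \<otimes> chart_inv d (fst p) \<otimes> inv (chart_inv d (snd p)) \<otimes> k2))"
    by (intro chart_smooth[OF P _ e] smooth_mult[OF PM] smooth_inv[OF PM] smooth_const[OF PM V'] 1 2 k)
  show "smooth_on (prod_topology E E) E {p \<in> V. chart_inv d (fst p) \<otimes> chart_inv d (snd p) \<in> fst e}
      (\<lambda>p. snd e (chart_inv d (fst p) \<otimes> chart_inv d (snd p)))"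
    by (intro chart_smooth[OF P _ e] smooth_mult[OF PM] 1 2)
qed

end

section \<open>Left logarithmic derivatives in a chart\<close>

text \<open>The component at \<open>c\<close> of the left logarithmic derivative. The curve is moved
  to the neutral element before it is differentiated, so one chart serves for all times and a
  constant left factor cancels.\<close>

definition log_deriv_at ::
    "('g, 'e::real_vector) lie_structure \<Rightarrow> ('g, 'e) chart \<Rightarrow> (real \<Rightarrow> 'g) \<Rightarrow> real \<Rightarrow> real set \<Rightarrow> 'e \<Rightarrow> bool" where
  "log_deriv_at G c \<zeta> t J x \<longleftrightarrow>
     limitin (model (mfd G)) (\<lambda>s. (snd c (inv\<^bsub>G\<^esub> (\<zeta> t) \<otimes>\<^bsub>G\<^esub> \<zeta> s) - snd c \<one>\<^bsub>G\<^esub>) /\<^sub>R (s - t)) x (at t within J)"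

locale lie_chart = lie G for G :: "('g, 'e::real_vector) lie_structure" (structure) +
  fixes c :: "('g, 'e) chart"
  assumes c: "c \<in> charts M" and c_one: "\<one> \<in> fst c"
begin

abbreviation "x0 \<equiv> snd c \<one>"

lemma chart_one: "chart_inv c x0 = \<one>"
  by (rule chart_inv_chart[OF c c_one])

lemma x0_mem: "x0 \<in> topspace E" "x0 \<in> snd c ` fst c"
  using c_one openin_subset[OF chart_image_openin[OF c]] by auto

definition quot_domain :: "('g, 'e) chart \<Rightarrow> ('e \<times> 'e) set" where
  "quot_domain d = {p \<in> (snd d ` fst d) \<times> (snd d ` fst d). inv (chart_inv d (fst p)) \<otimes> chart_inv d (snd p) \<in> fst c}"

text \<open>The map \<open>(x, y) \<mapsto> x\<^sup>-\<^sup>1 y\<close>, read in \<open>d\<close> on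
  the source and in \<open>c\<close> on the target. Its derivative in the second variable on the
  diagonal is the left translation of tangent vectors to the neutral element.\<close>

definition quot_rep :: "('g, 'e) chart \<Rightarrow> 'e \<times> 'e \<Rightarrow> 'e" where
  "quot_rep d p = snd c (inv (chart_inv d (fst p)) \<otimes> chart_inv d (snd p))"

lemma quot_rep_C1: "d \<in> charts M \<Longrightarrow> C1_on (prod_topology E E) E (quot_domain d) (quot_rep d)"
  unfolding quot_domain_def quot_rep_def
  by (rule smooth_on_imp_C1[OF two_chart_smooth(1)[OF _ c one_closed one_closed one_closed]])

lemma quot_diag: "d \<in> charts M \<Longrightarrow> g \<in> fst d \<Longrightarrow> (snd d g, snd d g) \<in> quot_domain d"
  and quot_rep_diag: "d \<in> charts M \<Longrightarrow> g \<in> fst d \<Longrightarrow> quot_rep d (snd d g, snd d g) = x0"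
  using chart_carrier c_one by (auto simp: quot_domain_def quot_rep_def chart_inv_chart l_inv subset_iff)

text \<open>The translated curve is \<open>quot_rep d\<close> with the first argument frozen at time
  \<open>t\<close>; hence the direction \<open>(0, y)\<close>.\<close>

lemma log_deriv_of_chart_deriv:
  assumes d: "d \<in> charts M" and t: "\<zeta> t \<in> fst d" and ev: "\<forall>\<^sub>F s in at t within J. \<zeta> s \<in> fst d"
    and y: "limitin E (\<lambda>s. (snd d (\<zeta> s) - snd d (\<zeta> t)) /\<^sub>R (s - t)) y (at t within J)"
  shows "log_deriv_at G c \<zeta> t J (dir_deriv E (quot_rep d) (snd d (\<zeta> t), snd d (\<zeta> t)) (0, y))"
proof -
  note P = lcs_prod[OF E E]
  let ?z = "(snd d (\<zeta> t), snd d (\<zeta> t))"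
  let ?b = "\<lambda>s. (0, (snd d (\<zeta> s) - snd d (\<zeta> t)) /\<^sub>R (s - t))"
  have zm: "?z \<in> topspace (prod_topology E E)"
    using C1_subset[OF quot_rep_C1[OF d]] quot_diag[where g = "\<zeta> t", OF d t] by blast
  have \<tau>: "((\<lambda>s. s - t) \<longlongrightarrow> 0) (at t within J)"
    by (rule tendsto_eq_intros tendsto_ident_at | simp)+
  have nz: "\<forall>\<^sub>F s in at t within J. s - t \<noteq> 0" by (simp add: eventually_at_filter)
  have "limitin E (\<lambda>s. (quot_rep d (?z + (s - t) *\<^sub>R ?b s) - quot_rep d ?z) /\<^sub>R (s - t))
      (dir_deriv E (quot_rep d) ?z (0, y)) (at t within J)"
    by (rule C1_quotient[OF P E quot_rep_C1[OF d] quot_diag[OF d t] _ _ \<tau> nz])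
      (use zm lcs_zero[OF E] y in \<open>auto intro!: limitin_pairI\<close>)
  moreover have "\<forall>\<^sub>F s in at t within J. (quot_rep d (?z + (s - t) *\<^sub>R ?b s) - quot_rep d ?z) /\<^sub>R (s - t)
      = (snd c (inv (\<zeta> t) \<otimes> \<zeta> s) - x0) /\<^sub>R (s - t)"
    using ev nz
  proof eventually_elim
    case (elim s)
    have "?z + (s - t) *\<^sub>R ?b s = (snd d (\<zeta> t), snd d (\<zeta> s))" using elim(2) by simp
    hence "quot_rep d (?z + (s - t) *\<^sub>R ?b s) = snd c (inv (\<zeta> t) \<otimes> \<zeta> s)"
      using elim(1) t by (simp only:) (simp add: quot_rep_def chart_inv_chart[OF d])
    thus ?case by (simp only: quot_rep_diag[OF d t])
  qed
  ultimately show ?thesis unfolding log_deriv_at_def by (rule limitin_transform_eventually[rotated])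
qed

text \<open>Matches the action on tangent vectors in \<open>left_log_deriv\<close> with the
  derivative that occurs in \<open>log_deriv_of_chart_deriv\<close>.\<close>

lemma left_act_quot_rep:
  assumes d: "d \<in> charts M" and g: "g \<in> fst d" and w: "w \<in> topspace E"
  shows "left_act G (inv g) g (chart_vec M d (snd d g) w) c = dir_deriv E (quot_rep d) (snd d g, snd d g) (0, w)"
proof -
  have gc: "g \<in> carrier G" using chart_carrier[OF d] g by blast
  have "left_act G (inv g) g (chart_vec M d (snd d g) w) c = dir_deriv E (\<lambda>y. snd c (inv g \<otimes> chart_inv d y)) (snd d g) w"
    using gc g d c c_one w by (intro left_act_chart_vec) (auto simp: charts_at_def l_inv)
  also have "\<dots> = dir_deriv E (quot_rep d) (snd d g, snd d g) (0, w)"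
    by (simp add: dir_deriv_def quot_rep_def chart_inv_chart[OF d g])
  finally show ?thesis .
qed

text \<open>Besides the exceptional sets of the pieces, the partition points are left out, since the
  chart changes there. Continuity of the component of \<open>f\<close> is recorded for the later
  passage from classes to values.\<close>

lemma AC_log_deriv:
  assumes cont: "continuous_map (top_of_set {0..1}) (mtop M) \<eta>" and AC: "AC_data G \<eta> n p cs \<gamma>"
    and f: "\<And>j t. j < n \<Longrightarrow> t \<in> {p j..<p (Suc j)} \<Longrightarrow>
      f t = left_act G (inv (\<eta> t)) (\<eta> t) (chart_vec M (cs j) (snd (cs j) (\<eta> t)) (\<gamma> j t))"
  shows "\<exists>D. countable D \<and> (\<forall>t\<in>{0<..<1} - D. log_deriv_at G c \<eta> t UNIV (f t c) \<and> limitin E (\<lambda>s. f s c) (f t c) (at t))"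
proof -
  have part: "is_partition 0 1 n p" and
    data: "\<And>j. j < n \<Longrightarrow> cs j \<in> charts M \<and> \<eta> ` {p j..p (Suc j)} \<subseteq> fst (cs j) \<and>
        AC_primitive E (p j) (p (Suc j)) (snd (cs j) \<circ> \<eta>) (\<gamma> j)"
    using AC by (auto simp: AC_data_def)
  have lt: "p j < p (Suc j)" if "j < n" for j using part that by (simp add: is_partition_def)
  have "\<forall>j. \<exists>D. countable D \<and> (j < n \<longrightarrow> (\<forall>t\<in>{p j<..<p (Suc j)} - D. limitin E (\<gamma> j) (\<gamma> j t) (at t) \<and>
      limitin E (\<lambda>s. ((snd (cs j) \<circ> \<eta>) s - (snd (cs j) \<circ> \<eta>) t) /\<^sub>R (s - t)) (\<gamma> j t) (at t)))"
  proof
    fix j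
    show "\<exists>D. countable D \<and> (j < n \<longrightarrow> (\<forall>t\<in>{p j<..<p (Suc j)} - D. limitin E (\<gamma> j) (\<gamma> j t) (at t) \<and>
      limitin E (\<lambda>s. ((snd (cs j) \<circ> \<eta>) s - (snd (cs j) \<circ> \<eta>) t) /\<^sub>R (s - t)) (\<gamma> j t) (at t)))"
    proof (cases "j < n")
      case True
      show ?thesis
        using regulated_space.AC_primitive_derivative[OF regulated_space.intro[OF E lt[OF True]]
            data[OF True, THEN conjunct2, THEN conjunct2]] True by (simp only: simp_thms)
    qed (auto intro: exI[of _ "{}"])
  qed
  from this[THEN choice] obtain D where D0: "\<forall>j. countable (D j) \<and> (j < n \<longrightarrow> (\<forall>t\<in>{p j<..<p (Suc j)} - D j. limitin E (\<gamma> j) (\<gamma> j t) (at t) \<and>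
      limitin E (\<lambda>s. ((snd (cs j) \<circ> \<eta>) s - (snd (cs j) \<circ> \<eta>) t) /\<^sub>R (s - t)) (\<gamma> j t) (at t)))" ..
  have D: "countable (D j)" for j using D0 by simp
  have D': "limitin E (\<gamma> j) (\<gamma> j t) (at t)" "limitin E (\<lambda>s. (snd (cs j) (\<eta> s) - snd (cs j) (\<eta> t)) /\<^sub>R (s - t)) (\<gamma> j t) (at t)"
    if "j < n" "t \<in> {p j<..<p (Suc j)} - D j" for j t
    using D0[rule_format, of j, THEN conjunct2, rule_format, OF that] by (simp_all add: o_def)
  define D' where "D' = (\<Union>j. D j) \<union> p ` {..n}"
  have "countable D'" unfolding D'_def by (simp add: D countable_finite)
  moreover have "log_deriv_at G c \<eta> t UNIV (f t c) \<and> limitin E (\<lambda>s. f s c) (f t c) (at t)" if t: "t \<in> {0<..<1} - D'" for t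
  proof -
    have t01: "0 \<le> t" "t < 1" using t by simp_all
    obtain j where j: "j < n" "p j \<le> t" "t < p (Suc j)" using partition_cover[OF part t01] by (elim exE conjE)
    have "p j \<noteq> t" using t j(1) by (auto simp: D'_def)
    hence tj: "t \<in> {p j<..<p (Suc j)}" using j by auto
    note d = data[OF j(1)]
    have dc: "cs j \<in> charts M" using d by blast
    have im: "\<eta> s \<in> fst (cs j)" if "s \<in> {p j..p (Suc j)}" for s using d that by blast
    have L: "limitin E (\<gamma> j) (\<gamma> j t) (at t)"
      "limitin E (\<lambda>s. (snd (cs j) (\<eta> s) - snd (cs j) (\<eta> t)) /\<^sub>R (s - t)) (\<gamma> j t) (at t)"
      using D'[OF j(1), of t] tj t by (simp_all add: D'_def)
    have ev: "\<forall>\<^sub>F s in at t. s \<in> {p j<..<p (Suc j)}" by (rule eventually_at_in_open') (use tj in auto)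
    have evd: "\<forall>\<^sub>F s in at t. \<eta> s \<in> fst (cs j)" using ev by eventually_elim (rule im, simp)
    have td: "\<eta> t \<in> fst (cs j)" by (rule im) (use tj in auto)
    have reg: "regulated E (p j) (p (Suc j)) (\<gamma> j)" using d by (simp add: AC_primitive_def)
    have ft: "f s c = dir_deriv E (quot_rep (cs j)) (snd (cs j) (\<eta> s), snd (cs j) (\<eta> s)) (0, \<gamma> j s)"
      if s: "s \<in> {p j<..<p (Suc j)}" for s
      using left_act_quot_rep[OF dc im regulated_mem[OF reg]] f[OF j(1)] s by auto
    have "continuous_map (top_of_set {p j<..<p (Suc j)}) (mtop M) \<eta>"
    proof (rule continuous_map_from_subtopology_mono[OF cont])
      show "{p j<..<p (Suc j)} \<subseteq> {0..1}"
        using partition_bounds[OF part, of j] partition_bounds[OF part, of "Suc j"] j(1) by auto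
    qed
    hence \<eta>l: "limitin (mtop M) \<eta> (\<eta> t) (at t)"
      by (rule limitin_open_compose[where a = "\<lambda>s. s"]) (use tj in \<open>auto simp: tendsto_ident_at\<close>)
    note dl = chart_limitin[OF dc \<eta>l td]
    have "limitin E (\<lambda>s. dir_deriv E (quot_rep (cs j)) (snd (cs j) (\<eta> s), snd (cs j) (\<eta> s)) (0, \<gamma> j s))
        (dir_deriv E (quot_rep (cs j)) (snd (cs j) (\<eta> t), snd (cs j) (\<eta> t)) (0, \<gamma> j t)) (at t)"
      by (intro C1_deriv_cont[OF quot_rep_C1[OF dc] quot_diag[OF dc td]] limitin_pairI dl L(1)) (simp add: lcs_zero[OF E])
    moreover have "\<forall>\<^sub>F s in at t. dir_deriv E (quot_rep (cs j)) (snd (cs j) (\<eta> s), snd (cs j) (\<eta> s)) (0, \<gamma> j s) = f s c"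
      using ev by eventually_elim (simp add: ft)
    ultimately have "limitin E (\<lambda>s. f s c) (dir_deriv E (quot_rep (cs j)) (snd (cs j) (\<eta> t), snd (cs j) (\<eta> t)) (0, \<gamma> j t)) (at t)"
      by (rule limitin_transform_eventually[rotated])
    moreover have "log_deriv_at G c \<eta> t UNIV (dir_deriv E (quot_rep (cs j)) (snd (cs j) (\<eta> t), snd (cs j) (\<eta> t)) (0, \<gamma> j t))"
      by (rule log_deriv_of_chart_deriv[OF dc td evd L(2)])
    ultimately show ?thesis using ft[OF tj] by simp
  qed
  ultimately show ?thesis by blast
qed

text \<open>
  If \<open>\<zeta>1\<close> and \<open>\<zeta>2\<close> have the same logarithmic derivative, then \<open>\<zeta>1 \<zeta>2\<^sup>-\<^sup>1\<close> has derivative 0: it is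
  locally \<open>H(u, w) = g u w\<^sup>-\<^sup>1 h\<close> with \<open>u, w\<close> moving at the same speed, and \<open>H\<close> is constant on the diagonal.
\<close>

lemma quotient_derivative_zero:
  assumes z1: "limitin (mtop M) \<zeta>1 (\<zeta>1 t) (at t)" and z2: "limitin (mtop M) \<zeta>2 (\<zeta>2 t) (at t)"
    and l1: "log_deriv_at G c \<zeta>1 t UNIV x" and l2: "log_deriv_at G c \<zeta>2 t UNIV x"
    and mem: "\<And>s. s \<in> S \<Longrightarrow> \<zeta>1 s \<in> carrier G \<and> \<zeta>2 s \<in> carrier G" and S: "open S" "t \<in> S"
    and d: "d \<in> charts M" and td: "\<zeta>1 t \<otimes> inv (\<zeta>2 t) \<in> fst d"
  shows "limitin E (\<lambda>s. (snd d (\<zeta>1 s \<otimes> inv (\<zeta>2 s)) - snd d (\<zeta>1 t \<otimes> inv (\<zeta>2 t))) /\<^sub>R (s - t)) 0 (at t)"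
proof -
  note P = lcs_prod[OF E E]
  have c12: "\<zeta>1 t \<in> carrier G" "\<zeta>2 t \<in> carrier G" using mem S by auto
  define H where "H p = snd d (\<zeta>1 t \<otimes> chart_inv c (fst p) \<otimes> inv (chart_inv c (snd p)) \<otimes> inv (\<zeta>2 t))" for p
  define O' where "O' = {p \<in> (snd c ` fst c) \<times> (snd c ` fst c). \<zeta>1 t \<otimes> chart_inv c (fst p) \<otimes> inv (chart_inv c (snd p)) \<otimes> inv (\<zeta>2 t) \<in> fst d}"
  have H: "C1_on (prod_topology E E) E O' H"
    unfolding H_def O'_def by (rule smooth_on_imp_C1[OF two_chart_smooth(2)[OF c d c12(1) inv_closed[OF c12(2)] one_closed]])
  have diag: "\<zeta>1 t \<otimes> g \<otimes> inv g \<otimes> inv (\<zeta>2 t) = \<zeta>1 t \<otimes> inv (\<zeta>2 t)" if "g \<in> carrier G" for g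
    using that c12 by (simp add: m_assoc)
  have z0: "(x0, x0) \<in> O'"
    using x0_mem td diag[OF one_closed] by (auto simp: O'_def chart_one)
  have Hd: "H (y, y) = snd d (\<zeta>1 t \<otimes> inv (\<zeta>2 t))" if "y \<in> snd c ` fst c" for y
  proof -
    have "chart_inv c y \<in> carrier G" using chart_inv_in[OF c that subset_refl] chart_carrier[OF c] by blast
    thus ?thesis by (simp add: H_def diag)
  qed
  have xE: "x \<in> topspace E" by (rule limitin_topspace[OF l1[unfolded log_deriv_at_def]])
  have id: "((\<lambda>r. r) \<longlongrightarrow> 0) (at (0::real))" by (rule tendsto_ident_at)
  have dz: "dir_deriv E H (x0, x0) (x, x) = 0"
  proof (rule dir_derivI[OF lcs_Hausdorff[OF E]])
    have "\<forall>\<^sub>F r in at (0::real). x0 + r *\<^sub>R x \<in> snd c ` fst c"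
      by (rule eventually_line_in[OF E chart_image_openin[OF c] x0_mem(2) xE])
    hence "\<forall>\<^sub>F r in at (0::real). (H ((x0, x0) + r *\<^sub>R (x, x)) - H (x0, x0)) /\<^sub>R r = 0"
      by eventually_elim (simp add: Hd[OF x0_mem(2)] Hd)
    thus "limitin E (\<lambda>r. (H ((x0, x0) + r *\<^sub>R (x, x)) - H (x0, x0)) /\<^sub>R r) 0 (at 0)"
      by (rule limitin_eventually[OF lcs_zero[OF E]])
  qed
  let ?u = "\<lambda>s. inv (\<zeta>1 t) \<otimes> \<zeta>1 s" and ?w = "\<lambda>s. inv (\<zeta>2 t) \<otimes> \<zeta>2 s"
  let ?b = "\<lambda>s. ((snd c (?u s) - x0) /\<^sub>R (s - t), (snd c (?w s) - x0) /\<^sub>R (s - t))"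
  have \<tau>: "((\<lambda>s. s - t) \<longlongrightarrow> 0) (at t)" by (rule tendsto_eq_intros tendsto_ident_at | simp)+
  have nz: "\<forall>\<^sub>F s in at t. s - t \<noteq> 0" by (simp add: eventually_at_filter)
  have "limitin E (\<lambda>s. (H ((x0, x0) + (s - t) *\<^sub>R ?b s) - H (x0, x0)) /\<^sub>R (s - t)) (dir_deriv E H (x0, x0) (x, x)) (at t)"
    by (rule C1_quotient[OF P E H z0 _ limitin_pairI \<tau> nz])
      (use x0_mem l1 l2 in \<open>simp_all add: log_deriv_at_def\<close>)
  moreover have "\<forall>\<^sub>F s in at t. (H ((x0, x0) + (s - t) *\<^sub>R ?b s) - H (x0, x0)) /\<^sub>R (s - t)
      = (snd d (\<zeta>1 s \<otimes> inv (\<zeta>2 s)) - snd d (\<zeta>1 t \<otimes> inv (\<zeta>2 t))) /\<^sub>R (s - t)"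
  proof -
    have "limitin (mtop M) ?u (inv (\<zeta>1 t) \<otimes> \<zeta>1 t) (at t)" "limitin (mtop M) ?w (inv (\<zeta>2 t) \<otimes> \<zeta>2 t) (at t)"
      by (intro limitin_mult z1 z2, simp add: topM c12)+
    hence "limitin (mtop M) ?u \<one> (at t)" "limitin (mtop M) ?w \<one> (at t)" using c12 by simp_all
    hence "\<forall>\<^sub>F s in at t. ?u s \<in> fst c" "\<forall>\<^sub>F s in at t. ?w s \<in> fst c"
      using limitinD[OF _ chart_openin[OF c] c_one] by blast+
    moreover have "\<forall>\<^sub>F s in at t. s \<in> S" by (rule eventually_at_in_open'[OF S])
    ultimately show ?thesis using nz
    proof eventually_elim
      case (elim s)
      have s: "\<zeta>1 s \<in> carrier G" "\<zeta>2 s \<in> carrier G" using mem elim by auto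
      have "(x0, x0) + (s - t) *\<^sub>R ?b s = (snd c (?u s), snd c (?w s))" using elim by simp
      moreover have "\<zeta>1 t \<otimes> ?u s \<otimes> inv (?w s) \<otimes> inv (\<zeta>2 t) = \<zeta>1 s \<otimes> inv (\<zeta>2 s)"
        using s c12 by (simp add: inv_mult_group m_assoc) (simp add: m_assoc[symmetric])
      ultimately have "H ((x0, x0) + (s - t) *\<^sub>R ?b s) = snd d (\<zeta>1 s \<otimes> inv (\<zeta>2 s))"
        using elim by (simp add: H_def chart_inv_chart[OF c])
      thus ?case by (simp only: Hd[OF x0_mem(2)])
    qed
  qed
  ultimately show ?thesis unfolding dz by (rule limitin_transform_eventually[rotated])
qed

text \<open>Continuous functionals reduce the claim to
  \<open>constant_off_countable\<close>.\<close>

lemma lcs_constant_off_countable: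
  fixes a b :: real
  assumes ab: "a \<le> b" and f: "\<And>t. t \<in> {a..b} \<Longrightarrow> limitin E f (f t) (at t within {a..b})" and D: "countable D"
    and deriv: "\<And>t. t \<in> {a<..<b} - D \<Longrightarrow> limitin E (\<lambda>s. (f s - f t) /\<^sub>R (s - t)) 0 (at t)"
  shows "f b = f a"
proof (rule lcs_eqI_csn[OF E])
  show m: "f b \<in> topspace E" "f a \<in> topspace E" using limitin_topspace[OF f] ab by auto
  fix q assume q: "continuous_seminorm E q"
  obtain l where l: "linear l" "continuous_functional E l" "l (f b - f a) = q (f b - f a)"
    using csn_functional[OF E q lcs_diff[OF E m]] by blast
  have lc: "continuous_map E euclideanreal l" using l(2) by (simp add: continuous_functional_def)
  have "l (f b) = l (f a)"
  proof (rule constant_off_countable[OF ab _ D])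
    show "continuous_on {a..b} (\<lambda>t. l (f t))"
      unfolding continuous_on
    proof
      fix t assume "t \<in> {a..b}"
      from continuous_map_limit[OF lc f[OF this]] show "((\<lambda>t. l (f t)) \<longlongrightarrow> l (f t)) (at t within {a..b})"
        by (simp add: o_def)
    qed
    fix t assume t: "t \<in> {a<..<b} - D"
    have "((\<lambda>s. l ((f s - f t) /\<^sub>R (s - t))) \<longlongrightarrow> l 0) (at t)"
      using continuous_map_limit[OF lc deriv[OF t]] by (simp add: o_def)
    moreover have "l ((f s - f t) /\<^sub>R (s - t)) = (l (f s) - l (f t)) / (s - t)" for s
      by (simp add: linear_diff[OF l(1)] linear_scale[OF l(1)] divide_inverse_commute)
    ultimately show "((\<lambda>t. l (f t)) has_real_derivative 0) (at t)"
      by (simp add: has_field_derivative_iff linear_0[OF l(1)])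
  qed
  thus "q (f b - f a) = 0" using l(3) by (simp add: linear_diff[OF l(1)])
qed

text \<open>By \<open>quotient_derivative_zero\<close>, the curve
  \<open>\<theta> = \<zeta>1 \<zeta>2\<^sup>-\<^sup>1\<close> has derivative 0 off \<open>D\<close>
  in every chart that contains it. As charts are available only locally, this gives local constancy,
  and connectedness of the interval does the rest.\<close>

theorem log_deriv_unique:
  assumes z1: "continuous_map (top_of_set {0..1}) (mtop M) \<zeta>1" and z2: "continuous_map (top_of_set {0..1}) (mtop M) \<zeta>2"
    and init: "\<zeta>1 0 = \<zeta>2 0" and D: "countable D"
    and l1: "\<And>t. t \<in> {0<..<1} - D \<Longrightarrow> log_deriv_at G c \<zeta>1 t UNIV (x t)"
    and l2: "\<And>t. t \<in> {0<..<1} - D \<Longrightarrow> log_deriv_at G c \<zeta>2 t UNIV (x t)"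
    and t: "t \<in> {0..1}"
  shows "\<zeta>1 t = \<zeta>2 t"
proof -
  have lim: "limitin (mtop M) \<zeta> (\<zeta> t) (at t within {0..1})"
    if z: "continuous_map (top_of_set {0..1}) (mtop M) \<zeta>" and t: "t \<in> {0..1}" for \<zeta> t
  proof -
    have "limitin (top_of_set {0..1}) (\<lambda>s. s) t (at t within {0..1})"
      unfolding limitin_subtopology using t by (auto simp: tendsto_ident_at eventually_at_filter)
    from continuous_map_limit[OF z this] show ?thesis by (simp add: o_def)
  qed
  have mem: "\<zeta>1 s \<in> carrier G \<and> \<zeta>2 s \<in> carrier G" if "s \<in> {0..1}" for s
    using continuous_map_image_subset_topspace[OF z1] continuous_map_image_subset_topspace[OF z2] that topM by auto
  define \<theta> where "\<theta> s = \<zeta>1 s \<otimes> inv (\<zeta>2 s)" for s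
  have \<theta>l: "limitin (mtop M) \<theta> (\<theta> t) (at t within {0..1})" if "t \<in> {0..1}" for t
    unfolding \<theta>_def by (intro limitin_mult limitin_inv lim z1 z2 that)
  have "\<theta> 0 = \<theta> t"
  proof (rule connected_local_const[where A = "{0..1}"])
    show "\<forall>a\<in>{0..1}. \<forall>\<^sub>F b in at a within {0..1}. \<theta> a = \<theta> b"
    proof
      fix t0 :: real assume t0: "t0 \<in> {0..1}"
      have "\<theta> t0 \<in> topspace (mtop M)" using limitin_topspace[OF \<theta>l[OF t0]] .
      then obtain d where d: "d \<in> charts M" "\<theta> t0 \<in> fst d" using chart_exists[OF M] by metis
      have "\<forall>\<^sub>F s in at t0 within {0..1}. \<theta> s \<in> fst d" by (rule limitinD[OF \<theta>l[OF t0] chart_openin[OF d(1)] d(2)])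
      then obtain e where e: "0 < e" "\<And>s. s \<in> {0..1} \<Longrightarrow> dist s t0 < e \<Longrightarrow> \<theta> s \<in> fst d"
        using d(2) unfolding eventually_at by metis
      have const: "\<theta> v = \<theta> u" if uv: "u \<le> v" "u \<in> {0..1}" "v \<in> {0..1}" "dist u t0 < e" "dist v t0 < e" for u v
      proof -
        have sub: "s \<in> {0..1}" "dist s t0 < e" if "s \<in> {u..v}" for s
          using that uv by (auto simp: dist_real_def)
        have "snd d (\<theta> v) = snd d (\<theta> u)"
        proof (rule lcs_constant_off_countable[OF uv(1) _ D])
          fix s assume s: "s \<in> {u..v}"
          have "{u..v} \<subseteq> {0..1}" using uv by auto
          hence "at s within {u..v} \<le> at s within {0..1}" by (rule at_le)
          hence "limitin (mtop M) \<theta> (\<theta> s) (at s within {u..v})"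
            using \<theta>l[OF sub(1)[OF s]] by (auto simp: limitin_def dest: filter_leD)
          thus "limitin E (\<lambda>s. snd d (\<theta> s)) (snd d (\<theta> s)) (at s within {u..v})"
            by (rule chart_limitin[OF d(1) _ e(2)[OF sub[OF s]]])
        next
          fix s assume s: "s \<in> {u<..<v} - D"
          have s': "s \<in> {0<..<1} - D" "s \<in> {u..v}" using s uv by auto
          have at: "at s within {0..1} = at s" by (rule at_within_interior) (use s' in simp)
          have z1s: "limitin (mtop M) \<zeta>1 (\<zeta>1 s) (at s)" and z2s: "limitin (mtop M) \<zeta>2 (\<zeta>2 s) (at s)"
            using lim[OF z1, of s] lim[OF z2, of s] s' unfolding at by auto
          show "limitin E (\<lambda>r. (snd d (\<theta> r) - snd d (\<theta> s)) /\<^sub>R (r - s)) 0 (at s)"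
            unfolding \<theta>_def
            by (rule quotient_derivative_zero[OF z1s z2s l1[OF s'(1)] l2[OF s'(1)], of "{0<..<1}"])
              (use mem s' d e(2)[OF sub[OF s'(2)]] in \<open>auto simp: \<theta>_def\<close>)
        qed
        thus ?thesis using inj_onD[OF chart_inj[OF d(1)]] e(2) uv by blast
      qed
      have eq: "\<theta> t0 = \<theta> s" if "s \<in> {0..1}" "dist s t0 < e" for s
        using const[of s t0] const[of t0 s] t0 that e(1) by (cases "s \<le> t0") auto
      show "\<forall>\<^sub>F s in at t0 within {0..1}. \<theta> t0 = \<theta> s"
        unfolding eventually_at using e(1) eq by blast
    qed
  qed (use t in auto)
  moreover have "\<theta> 0 = \<one>" using mem[of 0] init by (simp add: \<theta>_def)
  ultimately have "\<zeta>1 t \<otimes> inv (\<zeta>2 t) = \<one>" by (simp add: \<theta>_def)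
  thus ?thesis using mem[OF t] by (metis inv_closed inv_equality inv_inv)
qed

end

section \<open>The evolution map and the exponential function\<close>

lemma continuous_map_real_iff:
  fixes S :: "real set"
  shows "continuous_map (top_of_set S) X f \<longleftrightarrow> (\<forall>t\<in>S. limitin X f (f t) (at t within S))"
proof (intro iffI ballI)
  fix t assume f: "continuous_map (top_of_set S) X f" and t: "t \<in> S"
  have "limitin (top_of_set S) (\<lambda>s. s) t (at t within S)"
    unfolding limitin_subtopology using t by (auto simp: tendsto_ident_at eventually_at_filter)
  from continuous_map_limit[OF f this] show "limitin X f (f t) (at t within S)" by (simp add: o_def)
next
  assume L: "\<forall>t\<in>S. limitin X f (f t) (at t within S)"
  show "continuous_map (top_of_set S) X f"
    unfolding continuous_map_def
  proof (intro conjI allI impI)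
    show "f \<in> topspace (top_of_set S) \<rightarrow> topspace X" using L limitin_topspace by fastforce
    fix U assume U: "openin X U"
    show "openin (top_of_set S) {x \<in> topspace (top_of_set S). f x \<in> U}"
    proof (subst openin_subopen, intro ballI)
      fix t assume "t \<in> {x \<in> topspace (top_of_set S). f x \<in> U}"
      hence t: "t \<in> S" "f t \<in> U" by auto
      have "\<forall>\<^sub>F s in at t within S. f s \<in> U" by (rule limitinD[OF L[rule_format, OF t(1)] U t(2)])
      then obtain T where T: "open T" "t \<in> T" "\<And>s. s \<in> T \<Longrightarrow> s \<noteq> t \<Longrightarrow> s \<in> S \<Longrightarrow> f s \<in> U"
        by (auto simp: eventually_at_topological)
      have "openin (top_of_set S) (S \<inter> T)" using T(1) by (rule openin_open_Int)
      moreover have "S \<inter> T \<subseteq> {x \<in> topspace (top_of_set S). f x \<in> U}" using T(3) t(2) by auto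
      ultimately show "\<exists>T. openin (top_of_set S) T \<and> t \<in> T \<and> T \<subseteq> {x \<in> topspace (top_of_set S). f x \<in> U}"
        using t(1) T(2) by (intro exI[of _ "S \<inter> T"] conjI) auto
    qed
  qed
qed

lemma limitin_filterlim:
  assumes "limitin X f l F" "filterlim g F H"
  shows "limitin X (\<lambda>x. f (g x)) l H"
  using assms by (auto simp: limitin_def intro: eventually_compose_filterlim)

lemma limitin_subset:
  assumes "limitin X f l (at t within S)" "T \<subseteq> S"
  shows "limitin X f l (at t within T)"
  using assms(1) filter_leD[OF at_le[OF assms(2)]] by (simp add: limitin_def)

lemma filterlim_affine_at:
  fixes b :: real
  assumes "b \<noteq> 0"
  shows "filterlim (\<lambda>s. a + b * s) (at (a + b * r)) (at r)"
  unfolding filterlim_at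
  using assms by (intro conjI tendsto_intros) (simp add: eventually_at_filter)

lemma countable_affine_preimage:
  fixes b :: real
  assumes "b \<noteq> 0" "countable D"
  shows "countable {r. a + b * r \<in> D}"
proof -
  have "countable ((\<lambda>r. a + b * r) ` {r. a + b * r \<in> D})"
    by (rule countable_subset[OF _ assms(2)]) auto
  thus ?thesis by (rule countable_image_inj_on) (use assms(1) in \<open>simp add: inj_on_def\<close>)
qed

lemma smooth_map_on_local:
  assumes M: "smooth_manifold M" and N: "smooth_manifold N"
    and loc: "\<And>x. x \<in> S \<Longrightarrow> \<exists>W. x \<in> W \<and> W \<subseteq> S \<and> smooth_map_on M N W f"
  shows "smooth_map_on M N S f"
proof (rule smooth_map_onI_local[OF M N])
  fix x assume "x \<in> S"
  from loc[OF this] obtain W where W: "x \<in> W" "W \<subseteq> S" "smooth_map_on M N W f" by (elim exE conjE)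
  have xM: "x \<in> topspace (mtop M)" using W(1) openin_subset[OF smooth_map_openin[OF W(3)]] by blast
  obtain c where c: "c \<in> charts M" "x \<in> fst c" using chart_exists[OF M xM] by metis
  obtain d where d: "d \<in> charts N" "f x \<in> fst d" using chart_exists[OF N smooth_map_mem[OF W(3,1)]] by metis
  show "\<exists>c d W. smooth_rep M N f x c d W \<and> W \<subseteq> S"
    by (intro exI conjI, rule smooth_map_rep[OF W(3) c(1) d(1) W(1) c(2) d(2)]) (use W(2) in auto)
qed

lemma lcs_euclideanreal: "lcs euclideanreal"
  unfolding lcs_def
proof (intro conjI allI impI)
  show "continuous_map (prod_topology euclideanreal euclideanreal) euclideanreal (\<lambda>(x, y). x + y)"
    unfolding continuous_map_limitin case_prod_unfold
  proof
    fix p :: "real \<times> real" assume p: "p \<in> topspace (prod_topology euclideanreal euclideanreal)"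
    from limitin_fst[OF limitin_nhdsin_id[OF p]] limitin_snd[OF limitin_nhdsin_id[OF p]]
    show "limitin euclideanreal (\<lambda>p. fst p + snd p) (fst p + snd p) (nhdsin (prod_topology euclideanreal euclideanreal) p)"
      by (simp add: tendsto_add)
  qed
  show "continuous_map (prod_topology euclideanreal euclideanreal) euclideanreal (\<lambda>(r, x). r *\<^sub>R x)"
    unfolding continuous_map_limitin case_prod_unfold
  proof
    fix p :: "real \<times> real" assume p: "p \<in> topspace (prod_topology euclideanreal euclideanreal)"
    from limitin_fst[OF limitin_nhdsin_id[OF p]] limitin_snd[OF limitin_nhdsin_id[OF p]]
    show "limitin euclideanreal (\<lambda>p. fst p *\<^sub>R snd p) (fst p *\<^sub>R snd p) (nhdsin (prod_topology euclideanreal euclideanreal) p)"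
      by (simp add: tendsto_mult)
  qed
  fix U :: "real set" assume "openin euclideanreal U \<and> 0 \<in> U"
  then obtain e where "0 < e" "ball 0 e \<subseteq> U" by (auto simp: open_contains_ball)
  thus "\<exists>V. openin euclideanreal V \<and> convex V \<and> 0 \<in> V \<and> V \<subseteq> U" by (intro exI[of _ "ball 0 e"]) simp
qed (auto simp: Hausdorff_space_euclidean)

text \<open>\<open>C1_quotient\<close> for the transition map, with the difference quotient in
  \<open>c\<close> as the moving direction.\<close>

lemma chart_quotient_transition:
  assumes M: "smooth_manifold M" and c: "c \<in> charts_at M x" and d: "d \<in> charts_at M x"
    and \<zeta>: "limitin (mtop M) \<zeta> x F" and \<tau>: "(\<tau> \<longlongrightarrow> 0) F" "\<forall>\<^sub>F s in F. \<tau> s \<noteq> 0"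
    and l: "limitin (model M) (\<lambda>s. (snd c (\<zeta> s) - snd c x) /\<^sub>R \<tau> s) y F"
  shows "limitin (model M) (\<lambda>s. (snd d (\<zeta> s) - snd d x) /\<^sub>R \<tau> s)
    (dir_deriv (model M) (snd d \<circ> chart_inv c) (snd c x) y) F"
proof -
  note L = manifold_lcs[OF M] and c' = charts_atD[OF c] and C = chart_transition_C1[OF M c d]
  have cm: "snd c x \<in> topspace (model M)" using C1_subset[OF C(1)] C(2) by blast
  have "limitin (model M) (\<lambda>s. ((snd d \<circ> chart_inv c) (snd c x + \<tau> s *\<^sub>R ((snd c (\<zeta> s) - snd c x) /\<^sub>R \<tau> s))
      - (snd d \<circ> chart_inv c) (snd c x)) /\<^sub>R \<tau> s) (dir_deriv (model M) (snd d \<circ> chart_inv c) (snd c x) y) F"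
    by (rule C1_quotient[OF L L C _ l \<tau>]) (use cm in \<open>simp add: limitin_def\<close>)
  moreover have "\<forall>\<^sub>F s in F. ((snd d \<circ> chart_inv c) (snd c x + \<tau> s *\<^sub>R ((snd c (\<zeta> s) - snd c x) /\<^sub>R \<tau> s))
      - (snd d \<circ> chart_inv c) (snd c x)) /\<^sub>R \<tau> s = (snd d (\<zeta> s) - snd d x) /\<^sub>R \<tau> s"
    using limitinD[OF \<zeta> chart_openin[OF c'(1)] c'(2)] \<tau>(2)
    by eventually_elim (simp add: chart_inv_chart[OF c'(1)] c'(2))
  ultimately show ?thesis by (rule limitin_transform_eventually[rotated])
qed

text \<open>A limit in one chart entails the limits in all charts around the point, with the
  transformation rule of tangent vectors.\<close>

lemma velocity_eq_chart_vec:
  assumes M: "smooth_manifold M" and c: "c \<in> charts_at M (\<zeta> t)" and cont: "limitin (mtop M) \<zeta> (\<zeta> t) (at t within J)"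
    and nb: "at t within J \<noteq> bot"
    and x: "limitin (model M) (\<lambda>s. (snd c (\<zeta> s) - snd c (\<zeta> t)) /\<^sub>R (s - t)) x (at t within J)"
  shows "velocity M J \<zeta> t = chart_vec M c (snd c (\<zeta> t)) x"
proof
  note L = manifold_lcs[OF M]
  have \<tau>: "((\<lambda>s. s - t) \<longlongrightarrow> 0) (at t within J)" by (rule tendsto_eq_intros tendsto_ident_at | simp)+
  have nz: "\<forall>\<^sub>F s in at t within J. s - t \<noteq> 0" by (simp add: eventually_at_filter)
  fix d
  show "velocity M J \<zeta> t d = chart_vec M c (snd c (\<zeta> t)) x d"
  proof (cases "d \<in> charts_at M (\<zeta> t)")
    case True
    note lim = chart_quotient_transition[OF M c True cont \<tau> nz x]
    have "(THE l. limitin (model M) (\<lambda>s. (snd d (\<zeta> s) - snd d (\<zeta> t)) /\<^sub>R (s - t)) l (at t within J))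
        = dir_deriv (model M) (snd d \<circ> chart_inv c) (snd c (\<zeta> t)) x"
    proof (rule the_equality)
      show "limitin (model M) (\<lambda>s. (snd d (\<zeta> s) - snd d (\<zeta> t)) /\<^sub>R (s - t))
          (dir_deriv (model M) (snd d \<circ> chart_inv c) (snd c (\<zeta> t)) x) (at t within J)" by (rule lim)
      fix l assume "limitin (model M) (\<lambda>s. (snd d (\<zeta> s) - snd d (\<zeta> t)) /\<^sub>R (s - t)) l (at t within J)"
      thus "l = dir_deriv (model M) (snd d \<circ> chart_inv c) (snd c (\<zeta> t)) x"
        by (rule limitin_Hausdorff_unique[OF _ lim nb lcs_Hausdorff[OF L]])
    qed
    thus ?thesis using True by (simp add: velocity_def chart_vec_at[OF c])
  qed (simp add: velocity_def chart_vec_at[OF c])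
qed

section \<open>The Lie algebra seen through one chart, and affine changes of the parameter\<close>

context lie_chart
begin

abbreviation "L \<equiv> lie_algebra G"

lemma c_at: "c \<in> charts_at M \<one>"
  by (rule charts_atI[OF c c_one])

lemma L_facts: "lcs L" "topspace L = tangent_set M \<one>"
  unfolding lie_algebra_def by (rule lcs_tangent_space[OF M c_at], rule topspace_tangent_space[OF M c_at])

lemma limitin_L: "limitin L a v F \<longleftrightarrow>
    v \<in> tangent_set M \<one> \<and> (\<forall>\<^sub>F i in F. a i \<in> tangent_set M \<one>) \<and> limitin E (\<lambda>i. a i c) (v c) F"
  unfolding lie_algebra_def by (rule limitin_tangent_space[OF M c_at])

sublocale RL: regulated_space L 0 1
  by unfold_locales (auto intro: L_facts)

text \<open>The constant factor \<open>h\<close> cancels in the translated curve, and the inner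
  derivative contributes \<open>b\<close>. For \<open>b = 0\<close> the curve is constant, which is
  why differentiability of \<open>\<zeta>\<close> is asked for \<open>b \<noteq> 0\<close>; the
  statement then also covers parameters at which \<open>\<zeta>\<close> has no derivative.\<close>

lemma log_deriv_affine:
  assumes ld: "b \<noteq> 0 \<Longrightarrow> log_deriv_at G c \<zeta> (a + b * r) UNIV x" and x: "x \<in> topspace E" and h: "h \<in> carrier G"
    and S: "open S" "a + b * r \<in> S" and mem: "\<And>s. s \<in> S \<Longrightarrow> \<zeta> s \<in> carrier G"
  shows "log_deriv_at G c (\<lambda>s. h \<otimes> \<zeta> (a + b * s)) r UNIV (b *\<^sub>R x)"
proof (cases "b = 0")
  case True
  have "h \<otimes> \<zeta> a \<in> carrier G" using mem[OF S(2)] h True by simp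
  hence "inv (h \<otimes> \<zeta> a) \<otimes> (h \<otimes> \<zeta> a) = \<one>" by (rule l_inv)
  thus ?thesis using True lcs_zero[OF E] by (simp add: log_deriv_at_def)
next
  case False
  let ?q = "\<lambda>s. (snd c (inv (\<zeta> (a + b * r)) \<otimes> \<zeta> s) - x0) /\<^sub>R (s - (a + b * r))"
  have zr: "\<zeta> (a + b * r) \<in> carrier G" by (rule mem[OF S(2)])
  have "limitin E (\<lambda>s. b *\<^sub>R ?q (a + b * s)) (b *\<^sub>R x) (at r)"
    by (rule lcs_limitin_scaleR[OF E tendsto_const
          limitin_filterlim[OF ld[OF False, unfolded log_deriv_at_def] filterlim_affine_at[OF False]]])
  moreover have "\<forall>\<^sub>F s in at r. b *\<^sub>R ?q (a + b * s)
      = (snd c (inv (h \<otimes> \<zeta> (a + b * r)) \<otimes> (h \<otimes> \<zeta> (a + b * s))) - x0) /\<^sub>R (s - r)"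
  proof -
    have "\<forall>\<^sub>F s in at (a + b * r). s \<in> S" by (rule eventually_at_in_open'[OF S])
    hence "\<forall>\<^sub>F s in at r. a + b * s \<in> S" by (rule eventually_compose_filterlim[OF _ filterlim_affine_at[OF False]])
    moreover have "\<forall>\<^sub>F s in at r. s - r \<noteq> 0" by (simp add: eventually_at_filter)
    ultimately show ?thesis
    proof eventually_elim
      case (elim s)
      have "inv (h \<otimes> \<zeta> (a + b * r)) \<otimes> (h \<otimes> \<zeta> (a + b * s)) = inv (\<zeta> (a + b * r)) \<otimes> \<zeta> (a + b * s)"
        using h zr mem[OF elim(1)] by (simp add: inv_mult_group m_assoc inv_solve_left')
      moreover have "a + b * s - (a + b * r) = b * (s - r)" by (simp add: algebra_simps)
      hence "b *\<^sub>R (z /\<^sub>R (a + b * s - (a + b * r))) = z /\<^sub>R (s - r)" for z :: 'e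
        using False elim(2) by simp
      ultimately show ?case by presburger
    qed
  qed
  ultimately show ?thesis unfolding log_deriv_at_def by (rule limitin_transform_eventually[rotated])
qed

lemma log_deriv_cong:
  assumes "log_deriv_at G c \<zeta> t UNIV x" "open S" "t \<in> S" "\<And>s. s \<in> S \<Longrightarrow> \<zeta> s = \<xi> s"
  shows "log_deriv_at G c \<xi> t UNIV x"
proof -
  have "\<forall>\<^sub>F s in at t. s \<in> S" by (rule eventually_at_in_open'[OF assms(2,3)])
  hence "\<forall>\<^sub>F s in at t. (snd c (inv (\<zeta> t) \<otimes> \<zeta> s) - x0) /\<^sub>R (s - t) = (snd c (inv (\<xi> t) \<otimes> \<xi> s) - x0) /\<^sub>R (s - t)"
    by eventually_elim (simp add: assms(3,4))
  thus ?thesis using assms(1) unfolding log_deriv_at_def by (rule limitin_transform_eventually)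
qed

end

text \<open>The witnesses of \<open>R_regular\<close>, together with a fixed chart at the neutral
  element.\<close>

locale lie_evol = lie_chart G c for G :: "('g, 'e::real_vector) lie_structure" (structure) and c :: "('g, 'e) chart" +
  fixes Evol :: "('g, 'e) tvec aefun \<Rightarrow> real \<Rightarrow> 'g" and N :: "(real \<Rightarrow> 'g, real \<Rightarrow> 'e) manifold"
  assumes Evol: "X \<in> R_set (lie_algebra G) 0 1 \<Longrightarrow>
      Evol X \<in> AC_group_set G \<and> Evol X 0 = \<one> \<and> left_log_deriv G (Evol X) X"
    and N: "AC_manifold G N"
    and Evol_smooth: "smooth_map_on (lcs_manifold (R_space (lie_algebra G) 0 1)) N (R_set (lie_algebra G) 0 1) Evol"
begin

text \<open>The group of absolutely continuous curves is a Lie group itself, so the results on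
  translations hold in it as well.\<close>

sublocale A: lie "AC_group G N"
  using N by unfold_locales (simp add: AC_manifold_def)

lemma AC_group_simps: "mfd (AC_group G N) = N" "carrier (AC_group G N) = AC_group_set G"
  "\<one>\<^bsub>AC_group G N\<^esub> = (\<lambda>t\<in>{0..1}. \<one>)" "\<eta> \<otimes>\<^bsub>AC_group G N\<^esub> \<zeta> = (\<lambda>t\<in>{0..1}. \<eta> t \<otimes> \<zeta> t)"
  by (simp_all add: AC_group_def)

lemma N_facts: "smooth_manifold N" "model N = AC_space E 0 1" "lcs (AC_space E 0 1)"
  using A.M A.E N by (simp_all add: AC_group_simps AC_manifold_def)

lemma AC_group_cont: "\<eta> \<in> AC_group_set G \<Longrightarrow> continuous_map (top_of_set {0..1}) (mtop M) \<eta>"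
  by (simp add: AC_group_set_def)

lemma AC_group_mem: "\<eta> \<in> AC_group_set G \<Longrightarrow> t \<in> {0..1} \<Longrightarrow> \<eta> t \<in> carrier G"
  using continuous_map_image_subset_topspace[OF AC_group_cont] topM by fastforce

text \<open>In the chart that composes curves with a chart of \<open>G\<close>, evaluation at 1
  becomes the evaluation in \<open>AC_space\<close>, which is linear and continuous by
  \<open>continuous_AC_eval\<close>.\<close>

lemma eval_smooth_near_one:
  "\<exists>S. \<one>\<^bsub>AC_group G N\<^esub> \<in> S \<and> smooth_map_on N M S (\<lambda>\<eta>. \<eta> 1)"
proof -
  \<comment> \<open>\<open>AC_manifold\<close> describes charts only over domains that are stable
    under inversion.\<close>
  define U where "U = fst c \<inter> {x \<in> carrier G. inv x \<in> fst c}"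
  have inv_sm: "smooth_map_on M M (carrier G) (\<lambda>x. inv x)" by (rule smooth_inv[OF M smooth_id])
  have U: "openin (mtop M) U"
    unfolding U_def by (intro openin_Int chart_openin c openin_preimage_open[OF openin_carrier smooth_map_cont[OF inv_sm]])
  have Uc: "U \<subseteq> fst c" by (auto simp: U_def)
  have Uch: "(U, snd c) \<in> charts M" by (rule chart_restrict[OF M c U Uc])
  have U1: "\<one> \<in> U" using c_one by (simp add: U_def)
  have Uinv: "(\<lambda>x. inv x) ` U = U"
  proof
    show sub: "(\<lambda>x. inv x) ` U \<subseteq> U" by (auto simp: U_def)
    show "U \<subseteq> (\<lambda>x. inv x) ` U"
    proof
      fix x assume x: "x \<in> U"
      hence "inv x \<in> U" "x = inv (inv x)" using sub by (auto simp: U_def)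
      thus "x \<in> (\<lambda>x. inv x) ` U" by blast
    qed
  qed
  define S where "S = {\<eta> \<in> AC_group_set G. \<eta> ` {0..1} \<subseteq> U}"
  define T where "T = {\<zeta> \<in> AC_set E 0 1. \<zeta> ` {0..1} \<subseteq> snd c ` U}"
  define \<Phi> where "\<Phi> \<eta> = (\<lambda>t. if t \<in> {0..1} then snd c (\<eta> t) else 0)" for \<eta> :: "real \<Rightarrow> 'g"
  have "\<forall>(U, \<phi>)\<in>charts M. \<one> \<in> U \<and> (\<lambda>x. inv x) ` U = U \<longrightarrow>
        (let S = {\<eta> \<in> AC_group_set G. \<eta> ` {0..1} \<subseteq> U};
             T = {\<zeta> \<in> AC_set (model (mfd G)) 0 1. \<zeta> ` {0..1} \<subseteq> \<phi> ` U}
         in openin (mtop N) S \<and> openin (AC_space (model (mfd G)) 0 1) T \<and>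
            diffeomorphism_on N (lcs_manifold (AC_space (model (mfd G)) 0 1)) S T
              (\<lambda>\<eta> t. if t \<in> {0..1} then \<phi> (\<eta> t) else 0))"
    by (rule conjunct2[OF conjunct2[OF N[unfolded AC_manifold_def]]])
  from bspec[OF this Uch] have "diffeomorphism_on N (lcs_manifold (AC_space E 0 1)) S T \<Phi>"
    using U1 Uinv by (simp add: Let_def S_def T_def \<Phi>_def[abs_def])
  hence \<Phi>: "smooth_map_on N (lcs_manifold (AC_space E 0 1)) S \<Phi>" by (simp add: diffeomorphism_on_def)
  note AC = smooth_manifold_lcs[OF N_facts(3)] and EM = smooth_manifold_lcs[OF E]
  have RE: "regulated_space E 0 1" by (rule regulated_space.intro[OF E zero_less_one])
  have "smooth_on (AC_space E 0 1) E (topspace (AC_space E 0 1)) (\<lambda>\<zeta>. \<zeta> 1)"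
    by (rule smooth_on_linear[OF N_facts(3) E linear_eval regulated_space.continuous_AC_eval[OF RE N_facts(3)]])
  note ev = smooth_on_imp_smooth_map[OF N_facts(3) E this]
  have "smooth_map_on N (lcs_manifold E) S (\<lambda>\<eta>. \<Phi> \<eta> 1)"
    by (rule smooth_map_on_compose[OF N_facts(1) AC EM \<Phi> ev]) (use smooth_map_mem[OF \<Phi>] in auto)
  hence "smooth_map_on N M S (\<lambda>\<eta>. chart_inv c (\<Phi> \<eta> 1))"
    by (rule smooth_map_on_compose[OF N_facts(1) EM M _ smooth_map_chart(2)[OF M c]])
      (use Uc in \<open>force simp: S_def \<Phi>_def\<close>)
  hence "smooth_map_on N M S (\<lambda>\<eta>. \<eta> 1)"
    by (rule smooth_map_on_cong[OF N_facts(1) M])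
      (use Uc in \<open>auto simp: S_def \<Phi>_def chart_inv_chart[OF c] subset_iff\<close>)
  moreover have "\<one>\<^bsub>AC_group G N\<^esub> \<in> S"
    using A.one_closed U1 by (auto simp: S_def AC_group_simps)
  ultimately show ?thesis by blast
qed

text \<open>With \<open>\<kappa>\<close> the inverse of \<open>\<eta>0\<close> in the group of
  curves, \<open>\<eta> 1\<close> equals \<open>\<eta>0 1\<close> times the value of
  \<open>\<kappa> \<eta>\<close> at 1, and \<open>\<kappa> \<eta>\<close> is near the neutral
  element when \<open>\<eta>\<close> is near \<open>\<eta>0\<close>.\<close>

lemma eval_smooth: "smooth_map_on N M (AC_group_set G) (\<lambda>\<eta>. \<eta> 1)"
proof (rule smooth_map_on_local[OF N_facts(1) M])
  obtain S where S: "\<one>\<^bsub>AC_group G N\<^esub> \<in> S" "smooth_map_on N M S (\<lambda>\<eta>. \<eta> 1)" using eval_smooth_near_one by blast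
  fix \<eta>0 assume \<eta>0: "\<eta>0 \<in> AC_group_set G"
  hence \<eta>0': "\<eta>0 \<in> carrier (AC_group G N)" by (simp add: AC_group_simps)
  define \<kappa> where "\<kappa> = inv\<^bsub>AC_group G N\<^esub> \<eta>0"
  have \<kappa>': "\<kappa> \<in> carrier (AC_group G N)" unfolding \<kappa>_def using \<eta>0' by (rule A.inv_closed)
  have \<kappa>: "\<kappa> \<in> AC_group_set G" using \<kappa>' by (simp add: AC_group_simps)
  have \<kappa>\<eta>: "\<kappa> \<otimes>\<^bsub>AC_group G N\<^esub> \<eta>0 = \<one>\<^bsub>AC_group G N\<^esub>" unfolding \<kappa>_def by (rule A.l_inv[OF \<eta>0'])
  hence "(\<kappa> \<otimes>\<^bsub>AC_group G N\<^esub> \<eta>0) 1 = (\<one>\<^bsub>AC_group G N\<^esub>) 1" by simp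
  hence k1: "\<kappa> 1 \<otimes> \<eta>0 1 = \<one>" by (simp add: AC_group_simps)
  have m1: "\<kappa> 1 \<in> carrier G" "\<eta>0 1 \<in> carrier G" using AC_group_mem[OF \<kappa>] AC_group_mem[OF \<eta>0] by auto
  have left: "smooth_map_on N N (AC_group_set G) (\<lambda>\<eta>. \<kappa> \<otimes>\<^bsub>AC_group G N\<^esub> \<eta>)"
    using A.smooth_left[OF \<kappa>'] by (simp only: AC_group_simps)
  define W where "W = {\<eta> \<in> AC_group_set G. \<kappa> \<otimes>\<^bsub>AC_group G N\<^esub> \<eta> \<in> S}"
  have 1: "smooth_map_on N M W (\<lambda>\<eta>. (\<kappa> \<otimes>\<^bsub>AC_group G N\<^esub> \<eta>) 1)"
    unfolding W_def by (rule smooth_map_on_comp[OF N_facts(1) N_facts(1) M left S(2)])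
  have "smooth_map_on N M W (\<lambda>\<eta>. \<eta>0 1 \<otimes> (\<kappa> \<otimes>\<^bsub>AC_group G N\<^esub> \<eta>) 1)"
    by (rule smooth_mult[OF N_facts(1) smooth_const[OF N_facts(1) smooth_map_openin[OF 1] m1(2)] 1])
  hence "smooth_map_on N M W (\<lambda>\<eta>. \<eta> 1)"
  proof (rule smooth_map_on_cong[OF N_facts(1) M])
    fix \<eta> assume "\<eta> \<in> W"
    hence e: "\<eta> 1 \<in> carrier G" using AC_group_mem by (auto simp: W_def)
    have "\<eta>0 1 \<otimes> (\<kappa> 1 \<otimes> \<eta> 1) = \<eta> 1"
      using k1 m1 e by (metis inv_equality inv_closed inv_inv m_assoc r_inv l_one)
    thus "\<eta>0 1 \<otimes> (\<kappa> \<otimes>\<^bsub>AC_group G N\<^esub> \<eta>) 1 = \<eta> 1" by (simp add: AC_group_simps)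
  qed
  moreover have "\<eta>0 \<in> W" using \<eta>0 S(1) \<kappa>\<eta> by (simp add: W_def)
  ultimately show "\<exists>W. \<eta>0 \<in> W \<and> W \<subseteq> AC_group_set G \<and> smooth_map_on N M W (\<lambda>\<eta>. \<eta> 1)"
    by (intro exI[of _ W] conjI) (auto simp: W_def)
qed

lemma evol_smooth: "smooth_map_on (lcs_manifold (R_space L 0 1)) M (R_set L 0 1) (\<lambda>X. Evol X 1)"
  by (rule smooth_map_on_compose[OF smooth_manifold_lcs[OF RL.lcs_R_space] N_facts(1) M Evol_smooth eval_smooth])
    (use Evol in auto)

text \<open>The definition of the logarithmic derivative provides some representative
  \<open>f\<close> of the class, equal to the given \<open>g\<close> only almost everywhere. At
  points where both have continuous components they coincide, so \<open>g\<close> gives the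
  derivative off a countable set.\<close>

lemma Evol_facts:
  assumes "regulated L 0 1 g"
  defines "X \<equiv> ae_class 0 1 g"
  shows Evol_cont: "continuous_map (top_of_set {0..1}) (mtop M) (Evol X)"
    and Evol_zero: "Evol X 0 = \<one>"
    and Evol_log_deriv: "\<exists>D. countable D \<and> (\<forall>t\<in>{0<..<1} - D. log_deriv_at G c (Evol X) t UNIV (g t c))"
proof -
  have X: "X \<in> R_set L 0 1" unfolding X_def by (rule RL.R_setI[OF assms(1)])
  note ev = Evol[OF X]
  show cont: "continuous_map (top_of_set {0..1}) (mtop M) (Evol X)" using ev AC_group_cont by blast
  show "Evol X 0 = \<one>" using ev by blast
  obtain n p cs \<gamma> f where AC: "AC_data G (Evol X) n p cs \<gamma>"
    and f: "\<And>j t. j < n \<Longrightarrow> t \<in> {p j..<p (Suc j)} \<Longrightarrow>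
        f t = left_act G (inv (Evol X t)) (Evol X t) (chart_vec M (cs j) (snd (cs j) (Evol X t)) (\<gamma> j t))"
    and fX: "X = ae_class 0 1 f"
    using ev unfolding left_log_deriv_def by auto
  obtain D1 where D1: "countable D1" "\<forall>t\<in>{0<..<1} - D1. log_deriv_at G c (Evol X) t UNIV (f t c) \<and> limitin E (\<lambda>s. f s c) (f t c) (at t)"
    using AC_log_deriv[OF cont AC f] by blast
  obtain D2 where D2: "countable D2" "\<forall>t\<in>{0<..<1} - D2. limitin L g (g t) (at t)"
    using regulated_continuous[OF zero_less_one L_facts(1) assms(1)] by blast
  have ae: "AE t in lebesgue. t \<in> {0..1} \<longrightarrow> f t = g t" using fX[symmetric] by (simp only: X_def ae_class_eq_iff)
  hence ae': "AE t in lebesgue. t \<in> {0<..<1} \<longrightarrow> f t c = g t c" by eventually_elim auto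
  have "log_deriv_at G c (Evol X) t UNIV (g t c)" if t: "t \<in> {0<..<1} - (D1 \<union> D2)" for t
  proof -
    have 1: "log_deriv_at G c (Evol X) t UNIV (f t c)" "limitin E (\<lambda>s. f s c) (f t c) (at t)" using D1(2) t by auto
    have "limitin L g (g t) (at t)" using D2(2) t by auto
    hence 2: "limitin E (\<lambda>s. g s c) (g t c) (at t)" by (simp add: limitin_L)
    have "f t c = g t c" by (rule AE_eq_limit_eq[OF lcs_Hausdorff[OF E] ae' _ 1(2) 2]) (use t in auto)
    thus ?thesis using 1(1) by simp
  qed
  moreover have "countable (D1 \<union> D2)" using D1(1) D2(1) by simp
  ultimately show "\<exists>D. countable D \<and> (\<forall>t\<in>{0<..<1} - D. log_deriv_at G c (Evol X) t UNIV (g t c))" by blast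
qed

section \<open>The exponential function\<close>

abbreviation const_evol :: "('g, 'e) tvec \<Rightarrow> real \<Rightarrow> 'g" where
  "const_evol v \<equiv> Evol (ae_class 0 1 (\<lambda>t. v))"

definition expG :: "('g, 'e) tvec \<Rightarrow> 'g" where
  "expG v = const_evol v 1"

lemma const_regulated: "v \<in> tangent_set M \<one> \<Longrightarrow> regulated L 0 1 (\<lambda>t. v)"
  by (rule regulated_const[OF zero_less_one L_facts(1)]) (simp add: L_facts(2))

lemma L_scale: "v \<in> tangent_set M \<one> \<Longrightarrow> r *\<^sub>R v \<in> tangent_set M \<one>"
  using lcs_scaleR[OF L_facts(1)] by (simp add: L_facts(2))

lemma Evol_mem: "regulated L 0 1 g \<Longrightarrow> t \<in> {0..1} \<Longrightarrow> Evol (ae_class 0 1 g) t \<in> carrier G"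
  using AC_group_mem Evol[OF RL.R_setI] by blast

lemma Evol_unique:
  assumes g: "regulated L 0 1 g" and \<zeta>: "continuous_map (top_of_set {0..1}) (mtop M) \<zeta>" "\<zeta> 0 = \<one>" and D: "countable D"
    and ld: "\<And>t. t \<in> {0<..<1} - D \<Longrightarrow> log_deriv_at G c \<zeta> t UNIV (g t c)" and t: "t \<in> {0..1}"
  shows "Evol (ae_class 0 1 g) t = \<zeta> t"
proof -
  obtain D' where D': "countable D'" "\<forall>t\<in>{0<..<1} - D'. log_deriv_at G c (Evol (ae_class 0 1 g)) t UNIV (g t c)"
    using Evol_log_deriv[OF g] by blast
  show ?thesis
    by (rule log_deriv_unique[OF Evol_cont[OF g] \<zeta>(1) _ _ _ ld t, of "D \<union> D'"])
      (use D D' \<zeta>(2) Evol_zero[OF g] in auto)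
qed

lemma continuous_left_affine:
  fixes a b :: real
  assumes \<zeta>: "continuous_map (top_of_set T) (mtop M) \<zeta>" and h: "h \<in> carrier G"
    and im: "\<And>r. r \<in> {0..1} \<Longrightarrow> a + b * r \<in> T"
  shows "continuous_map (top_of_set {0..1::real}) (mtop M) (\<lambda>r. h \<otimes> \<zeta> (a + b * r))"
proof -
  have "continuous_map (top_of_set {0..1::real}) (top_of_set T) (\<lambda>r. a + b * r)"
    unfolding continuous_map_in_subtopology
  proof
    show "continuous_map (top_of_set {0..1::real}) euclideanreal (\<lambda>r. a + b * r)"
      by (simp add: continuous_intros)
  qed (use im in auto)
  from continuous_map_compose[OF this \<zeta>]
  have "continuous_map (top_of_set {0..1}) (mtop M) (\<lambda>r. \<zeta> (a + b * r))" by (simp add: o_def)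
  hence "limitin (mtop M) (\<lambda>r. \<zeta> (a + b * r)) (\<zeta> (a + b * x)) (nhdsin (top_of_set {0..1}) x)" if "x \<in> {0..1}" for x
    using that unfolding continuous_map_limitin by simp
  moreover have "limitin (mtop M) (\<lambda>r. h) h F" for F :: "real filter"
    using h by (simp add: topM limitin_def)
  ultimately show ?thesis
    unfolding continuous_map_limitin by (auto intro: limitin_mult)
qed

text \<open>The translated and rescaled piece of the evolution of \<open>v\<close> starts at the
  neutral element and has the constant logarithmic derivative \<open>b *\<^sub>R v\<close>; by
  uniqueness it is the evolution of that constant. Negative \<open>b\<close> is included.\<close>

lemma expG_increment:
  assumes v: "v \<in> tangent_set M \<one>" and a: "a \<in> {0..1}" "a + b \<in> {0..1}"
  shows "inv (const_evol v a) \<otimes> const_evol v (a + b) = expG (b *\<^sub>R v)"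
proof -
  note reg = const_regulated[OF v]
  let ?\<eta> = "const_evol v" and ?h = "inv (const_evol v a)"
  define \<zeta> where "\<zeta> r = ?h \<otimes> ?\<eta> (a + b * r)" for r
  have seg: "a + b * r \<in> {0..1}" if "r \<in> {0..1}" for r
  proof -
    have "a + b * r = (1 - r) * a + r * (a + b)" by (simp add: algebra_simps)
    moreover have "(1 - r) * a + r * (a + b) \<in> {0..1}"
      using that a convexD[of "{0..1::real}" a "a + b" "1 - r" r] by auto
    ultimately show ?thesis by simp
  qed
  \<comment> \<open>The logarithmic derivative is known at interior times only, and for
    \<open>b \<noteq> 0\<close> interior parameters are mapped to such times.\<close>
  have seg': "a + b * r \<in> {0<..<1}" if r: "r \<in> {0<..<1}" "b \<noteq> 0" for r
  proof -
    have "0 < r" "r < 1" using r by auto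
    show ?thesis
    proof (cases "0 < b")
      case True
      hence "0 < b * r" "b * r < b" using \<open>0 < r\<close> \<open>r < 1\<close> by auto
      thus ?thesis using a by auto
    next
      case False
      hence b: "b < 0" using r by simp
      hence "b * r < 0" "b < b * r" using \<open>0 < r\<close> \<open>r < 1\<close> by (auto simp: mult_neg_pos)
      thus ?thesis using a by auto
    qed
  qed
  have h: "?h \<in> carrier G" by (rule inv_closed[OF Evol_mem[OF reg a(1)]])
  have \<zeta>c: "continuous_map (top_of_set {0..1}) (mtop M) \<zeta>"
    unfolding \<zeta>_def by (rule continuous_left_affine[OF Evol_cont[OF reg] h seg])
  have \<zeta>0: "\<zeta> 0 = \<one>" using Evol_mem[OF reg a(1)] by (simp add: \<zeta>_def)
  obtain D where D: "countable D" "\<forall>t\<in>{0<..<1} - D. log_deriv_at G c ?\<eta> t UNIV (v c)"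
    using Evol_log_deriv[OF reg] by blast
  define D' where "D' = (if b = 0 then {} else {r. a + b * r \<in> D})"
  have D': "countable D'" unfolding D'_def using countable_affine_preimage[OF _ D(1)] by simp
  have vE: "v c \<in> topspace E" by (rule tangent_mem[OF v c_at])
  have "log_deriv_at G c \<zeta> r UNIV ((b *\<^sub>R v) c)" if r: "r \<in> {0<..<1} - D'" for r
  proof (cases "b = 0")
    case True
    have "\<And>s. \<zeta> s = \<zeta> 0" by (simp add: \<zeta>_def True)
    hence "\<zeta> = (\<lambda>s. \<one>)" using \<zeta>0 by auto
    thus ?thesis using True lcs_zero[OF E] by (simp add: log_deriv_at_def scaleR_fun_def)
  next
    case False
    have "log_deriv_at G c (\<lambda>s. ?h \<otimes> ?\<eta> (a + b * s)) r UNIV (b *\<^sub>R v c)"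
      by (rule log_deriv_affine[OF _ vE h open_greaterThanLessThan[of 0 1]])
        (use D(2) seg'[of r] r False Evol_mem[OF reg] in \<open>auto simp: D'_def\<close>)
    thus ?thesis by (simp add: \<zeta>_def[abs_def] scaleR_fun_def)
  qed
  from Evol_unique[OF const_regulated[OF L_scale[OF v]] \<zeta>c \<zeta>0 D' this, of 1]
  show ?thesis by (simp add: expG_def \<zeta>_def)
qed

lemma const_evol_eq: "v \<in> tangent_set M \<one> \<Longrightarrow> t \<in> {0..1} \<Longrightarrow> const_evol v t = expG (t *\<^sub>R v)"
  using expG_increment[of v 0 t] Evol_zero[OF const_regulated] Evol_mem[OF const_regulated, of v t] by simp

lemma expG_mem: "v \<in> tangent_set M \<one> \<Longrightarrow> expG v \<in> carrier G"
  unfolding expG_def by (rule Evol_mem[OF const_regulated]) auto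

text \<open>Evolutions are defined on the unit interval. The three parameters 0, \<open>s\<close>
  and \<open>s + t\<close> are moved into it by an affine map, at the price of replacing
  \<open>v\<close> by a multiple \<open>w\<close>; then increments of one and the same evolution are
  multiplied.\<close>

lemma expG_add:
  assumes v: "v \<in> tangent_set M \<one>"
  shows "expG ((s + t) *\<^sub>R v) = expG (s *\<^sub>R v) \<otimes> expG (t *\<^sub>R v)"
proof -
  \<comment> \<open>The window from \<open>m\<close> to \<open>m + T\<close> contains 0,
    \<open>s\<close> and \<open>s + t\<close>; the summand 1 in \<open>T\<close> keeps its length
    positive.\<close>
  define m where "m = min 0 (min s (s + t))"
  define T where "T = max 0 (max s (s + t)) - m + 1"
  have T: "0 < T" by (simp add: T_def m_def)
  define w where "w = T *\<^sub>R v"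
  have w: "w \<in> tangent_set M \<one>" unfolding w_def by (rule L_scale[OF v])
  define p where "p x = (x - m) / T" for x
  have p: "p 0 \<in> {0..1}" "p s \<in> {0..1}" "p (s + t) \<in> {0..1}"
  proof -
    have "p x \<in> {0..1}" if "m \<le> x" "x \<le> m + T" for x using that T by (simp add: p_def)
    from this[of 0] this[of s] this[of "s + t"]
    show "p 0 \<in> {0..1}" "p s \<in> {0..1}" "p (s + t) \<in> {0..1}" by (auto simp: T_def m_def)
  qed
  have inc: "inv (const_evol w (p x)) \<otimes> const_evol w (p y) = expG ((y - x) *\<^sub>R v)"
    if "p x \<in> {0..1}" "p y \<in> {0..1}" for x y
  proof -
    have "p x + (y - x) / T = p y" by (simp add: p_def diff_divide_distrib)
    moreover have "((y - x) / T) *\<^sub>R w = (y - x) *\<^sub>R v" using T by (simp add: w_def)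
    ultimately show ?thesis using expG_increment[OF w that(1), of "(y - x) / T"] that(2) by simp
  qed
  have mem: "const_evol w (p x) \<in> carrier G" if "p x \<in> {0..1}" for x by (rule Evol_mem[OF const_regulated[OF w] that])
  have "expG (s *\<^sub>R v) \<otimes> expG (t *\<^sub>R v) = inv (const_evol w (p 0)) \<otimes> const_evol w (p s) \<otimes> (inv (const_evol w (p s)) \<otimes> const_evol w (p (s + t)))"
    using inc[OF p(1,2)] inc[OF p(2,3)] by simp
  also have "\<dots> = inv (const_evol w (p 0)) \<otimes> const_evol w (p (s + t))"
    using mem p by (simp add: m_assoc) (simp add: m_assoc[symmetric])
  also have "\<dots> = expG ((s + t) *\<^sub>R v)" using inc[OF p(1,3)] by simp
  finally show ?thesis by simp
qed

lemma expG_smooth: "smooth_map_on (lcs_manifold L) M (topspace L) expG"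
proof -
  note RM = smooth_manifold_lcs[OF RL.lcs_R_space] and LM = smooth_manifold_lcs[OF L_facts(1)]
  have "smooth_on L (R_space L 0 1) (topspace L) (\<lambda>v. ae_class 0 1 (\<lambda>t. v))"
    by (rule smooth_on_linear[OF L_facts(1) RL.lcs_R_space RL.linear_R_const RL.continuous_R_const])
  from smooth_on_imp_smooth_map[OF L_facts(1) RL.lcs_R_space this]
  show ?thesis
    unfolding expG_def by (rule smooth_map_on_compose[OF LM RM M _ evol_smooth]) (use RL.R_const_mem in auto)
qed

lemma expG_line_smooth:
  assumes v: "v \<in> tangent_set M \<one>"
  shows "smooth_map_on (lcs_manifold euclideanreal) M UNIV (\<lambda>t. expG (t *\<^sub>R v))"
proof -
  note RM = smooth_manifold_lcs[OF lcs_euclideanreal] and LM = smooth_manifold_lcs[OF L_facts(1)]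
  have "continuous_map euclideanreal L (\<lambda>t. t *\<^sub>R v)"
    unfolding continuous_map_limitin
  proof
    fix t :: real assume t: "t \<in> topspace euclideanreal"
    have "((\<lambda>t. t) \<longlongrightarrow> t) (nhdsin euclideanreal t)" using limitin_nhdsin_id[OF t] by simp
    thus "limitin L (\<lambda>t. t *\<^sub>R v) (t *\<^sub>R v) (nhdsin euclideanreal t)"
      by (intro lcs_limitin_scaleR[OF L_facts(1)]) (use v in \<open>auto simp: L_facts(2)\<close>)
  qed
  moreover have "linear (\<lambda>t. t *\<^sub>R v)" by (rule linearI) (simp_all add: scaleR_add_left)
  ultimately have "smooth_on euclideanreal L (topspace euclideanreal) (\<lambda>t. t *\<^sub>R v)"
    by (intro smooth_on_linear[OF lcs_euclideanreal L_facts(1)])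
  hence "smooth_map_on (lcs_manifold euclideanreal) (lcs_manifold L) UNIV (\<lambda>t. t *\<^sub>R v)"
    using smooth_on_imp_smooth_map[OF lcs_euclideanreal L_facts(1)] by simp
  thus ?thesis by (rule smooth_map_on_compose[OF RM LM M _ expG_smooth]) (use L_scale[OF v] in \<open>auto simp: L_facts(2)\<close>)
qed

text \<open>By smoothness, the one-parameter group has some derivative \<open>l\<close> at 0, and by
  the group law \<open>l\<close> is its logarithmic derivative at all times. On the unit interval it
  is the evolution of the constant \<open>v\<close>, so comparison at one time outside the countable
  exceptional set gives \<open>l = v c\<close>.\<close>

lemma expG_velocity:
  assumes v: "v \<in> tangent_set M \<one>"
  shows "velocity M UNIV (\<lambda>t. expG (t *\<^sub>R v)) 0 = v"
proof -
  define u where "u t = expG (t *\<^sub>R v)" for t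
  have um: "u t \<in> carrier G" for t unfolding u_def by (rule expG_mem[OF L_scale[OF v]])
  have uadd: "u (s + t) = u s \<otimes> u t" for s t unfolding u_def by (rule expG_add[OF v])
  have u0: "u 0 = \<one>" using uadd[of 0 0] um[of 0] by (metis add_0 r_cancel_one')
  have sm: "smooth_map_on (lcs_manifold euclideanreal) M UNIV u"
    unfolding u_def[abs_def] by (rule expG_line_smooth[OF v])
  have C: "C1_on euclideanreal E {y \<in> UNIV. u y \<in> fst c} (\<lambda>y. snd c (u y))"
    by (rule smooth_on_imp_C1[OF chart_smooth[OF lcs_euclideanreal sm c]])
  have "0 \<in> {y \<in> UNIV. u y \<in> fst c}" using u0 c_one by simp
  from C1_onD(2)[OF C this, of 1]
  obtain l where l: "limitin E (\<lambda>t. (snd c (u t) - x0) /\<^sub>R t) l (at (0::real))" by (auto simp: u0)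
  have inv_u: "inv (u t) \<otimes> u s = u (s - t)" for s t
    using uadd[of t "s - t"] um by (simp add: inv_solve_left')
  have ld: "log_deriv_at G c u t UNIV l" for t
  proof -
    have "filterlim (\<lambda>s. - t + 1 * s) (at (- t + 1 * t)) (at t)" by (rule filterlim_affine_at) simp
    hence "filterlim (\<lambda>s. s - t) (at 0) (at t)" by simp
    from limitin_filterlim[OF l this] show ?thesis by (simp add: log_deriv_at_def inv_u)
  qed
  note reg = const_regulated[OF v]
  obtain D where D: "countable D" "\<forall>t\<in>{0<..<1} - D. log_deriv_at G c (const_evol v) t UNIV (v c)"
    using Evol_log_deriv[OF reg] by blast
  have "uncountable ({0<..<1::real} - D)" by (rule uncountable_minus_countable[OF _ D(1)]) (simp add: uncountable_open_interval)
  then obtain t where t: "t \<in> {0<..<1} - D" by (metis countable_empty ex_in_conv)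
  have "log_deriv_at G c (const_evol v) t UNIV l"
    by (rule log_deriv_cong[OF ld open_greaterThanLessThan[of 0 1]]) (use t const_evol_eq[OF v] in \<open>auto simp: u_def\<close>)
  hence lv: "l = v c"
    using D(2) t limitin_Hausdorff_unique[OF _ _ at_neq_bot lcs_Hausdorff[OF E]] unfolding log_deriv_at_def by blast
  have "limitin (mtop M) u (u 0) (at 0 within UNIV)"
    by (rule smooth_map_limitin[OF sm]) (simp_all add: tendsto_ident_at)
  hence "velocity M UNIV u 0 = chart_vec M c (snd c (u 0)) (v c)"
    by (rule velocity_eq_chart_vec[OF M, rotated]) (use c_at l lv in \<open>simp_all add: u0\<close>)
  also have "\<dots> = v" unfolding u0 by (rule tangent_eq_chart_vec[OF v c_at, symmetric])
  finally show ?thesis by (simp add: u_def[abs_def])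
qed

lemma smooth_exponential_expG: "smooth_exponential G expG"
  unfolding smooth_exponential_def
  using expG_smooth expG_line_smooth expG_add expG_velocity by (simp add: L_facts(2))

end

section \<open>The Trotter formula\<close>

text \<open>A joint limit in \<open>n\<close> and \<open>t\<close> at each \<open>t0\<close> holds
  on a neighbourhood of \<open>t0\<close> from some index on; finitely many such neighbourhoods
  cover \<open>K\<close>. Thus uniform convergence can be proved by limits along a single
  filter.\<close>

lemma uniform_from_pointwise:
  fixes K :: "real set"
  assumes K: "compact K" and P: "\<And>t0. t0 \<in> K \<Longrightarrow> \<forall>\<^sub>F p in sequentially \<times>\<^sub>F (inf (nhds t0) (principal K)). P (fst p) (snd p)"
  shows "\<forall>\<^sub>F n in sequentially. \<forall>t\<in>K. P n t"
proof -
  have "\<exists>S N. open S \<and> t0 \<in> S \<and> (\<forall>n\<ge>N. \<forall>t\<in>S \<inter> K. P n t)" if t0: "t0 \<in> K" for t0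
  proof -
    from P[OF t0] obtain Pf Pg where Pf: "eventually Pf sequentially" and Pg: "eventually Pg (inf (nhds t0) (principal K))"
      and PP: "\<And>n t. Pf n \<Longrightarrow> Pg t \<Longrightarrow> P n t"
      unfolding eventually_prod_filter by (elim exE conjE) simp
    obtain N where N: "\<forall>n\<ge>N. Pf n" using Pf by (auto simp: eventually_sequentially)
    from Pg have "eventually (\<lambda>t. t \<in> K \<longrightarrow> Pg t) (nhds t0)" by (simp add: eventually_inf_principal)
    then obtain S where S: "open S" "t0 \<in> S" "\<forall>t\<in>S. t \<in> K \<longrightarrow> Pg t" by (auto simp: eventually_nhds)
    have "\<forall>n\<ge>N. \<forall>t\<in>S \<inter> K. P n t" using N S(3) PP by simp
    thus ?thesis using S(1,2) by (intro exI[of _ S] exI[of _ N] conjI)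
  qed
  then obtain S N where S: "\<And>t0. t0 \<in> K \<Longrightarrow> open (S t0) \<and> t0 \<in> S t0 \<and> (\<forall>n\<ge>(N t0 :: nat). \<forall>t\<in>S t0 \<inter> K. P n t)"
    by metis
  have cov: "K \<subseteq> (\<Union>t0\<in>K. S t0)"
  proof
    fix t assume t: "t \<in> K"
    show "t \<in> (\<Union>t0\<in>K. S t0)" by (rule UN_I[OF t]) (use S[OF t] in \<open>elim conjE\<close>)
  qed
  have "open (S t0)" if "t0 \<in> K" for t0 using S[OF that] by (elim conjE)
  from compactE_image[OF K this cov] obtain C where C: "C \<subseteq> K" "finite C" "K \<subseteq> (\<Union>t0\<in>C. S t0)"
    by metis
  have "\<forall>\<^sub>F n in sequentially. \<forall>t0\<in>C. n \<ge> N t0"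
    by (rule eventually_ball_finite[OF C(2)]) (intro ballI eventually_ge_at_top)
  thus ?thesis
  proof eventually_elim
    case (elim n)
    show ?case
    proof
      fix t assume t: "t \<in> K"
      from subsetD[OF C(3) t] obtain t0 where t0: "t0 \<in> C" "t \<in> S t0" by (rule UN_E)
      have "\<forall>n\<ge>N t0. \<forall>t\<in>S t0 \<inter> K. P n t" using S[OF subsetD[OF C(1) t0(1)]] by (elim conjE)
      thus "P n t" using elim t0 t by simp
    qed
  qed
qed

context lie_evol
begin

lemma Evol_periodic:
  assumes t: "0 \<le> t" and n: "0 < n" and tn: "t / real n \<le> \<epsilon>"
    and \<alpha>: "continuous_map (top_of_set {0..\<epsilon>}) (mtop M) \<alpha>" "\<alpha> 0 = \<one>"
    and k: "continuous_map (top_of_set {0..\<epsilon>}) L k"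
    and ld: "\<And>r. r \<in> {0<..<\<epsilon>} \<Longrightarrow> log_deriv_at G c \<alpha> r UNIV (k r c)"
  defines "g \<equiv> \<lambda>s. t *\<^sub>R k (t * (s - of_int \<lfloor>real n * s\<rfloor> / real n))"
  shows regulated_periodic_log_deriv: "regulated L 0 1 g"
    and Evol_periodic_eq_power: "Evol (ae_class 0 1 g) 1 = \<alpha> (t / real n) [^] n"
proof -
  have seg: "t * s \<in> {0..\<epsilon>}" if "s \<in> {0..1 / real n}" for s
  proof -
    have "t * s \<le> t * (1 / real n)" by (rule mult_left_mono) (use that t in auto)
    thus ?thesis using that t tn by auto
  qed
  have km: "k s \<in> tangent_set M \<one>" if "s \<in> {0..\<epsilon>}" for s
    using continuous_map_image_subset_topspace[OF k] that by (auto simp: L_facts(2))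
  have "continuous_map (top_of_set {0..1 / real n}) (top_of_set {0..\<epsilon>}) (\<lambda>s. t * s)"
    unfolding continuous_map_in_subtopology
  proof
    show "continuous_map (top_of_set {0..1 / real n}) euclideanreal (\<lambda>s. t * s)" by (simp add: continuous_intros)
  qed (use seg in auto)
  from continuous_map_compose[OF this k]
  have "continuous_map (top_of_set {0..1 / real n}) L (\<lambda>s. k (t * s))" by (simp add: o_def)
  hence "continuous_map (top_of_set {0..1 / real n}) L (\<lambda>s. t *\<^sub>R k (t * s))"
    unfolding continuous_map_limitin by (intro ballI lcs_limitin_scaleR[OF L_facts(1) tendsto_const]) simp
  from regulated_periodic[OF L_facts(1) n this] show reg: "regulated L 0 1 g" by (simp only: g_def)
  define \<eta> where "\<eta> = Evol (ae_class 0 1 g)"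
  have \<eta>c: "continuous_map (top_of_set {0..1}) (mtop M) \<eta>" unfolding \<eta>_def by (rule Evol_cont[OF reg])
  have \<eta>m: "\<eta> s \<in> carrier G" if "s \<in> {0..1}" for s unfolding \<eta>_def by (rule Evol_mem[OF reg that])
  obtain D where D: "countable D" "\<forall>s\<in>{0<..<1} - D. log_deriv_at G c \<eta> s UNIV (g s c)"
    unfolding \<eta>_def using Evol_log_deriv[OF reg] by (elim exE conjE)
  have n0: "real n \<noteq> 0" and n1: "1 / real n \<noteq> 0" using n by auto
  have \<alpha>m: "\<alpha> s \<in> carrier G" if "s \<in> {0..\<epsilon>}" for s
    using continuous_map_image_subset_topspace[OF \<alpha>(1)] that by (auto simp: topM)
  have t1: "t / real n \<in> {0..\<epsilon>}" using t tn by simp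
  have "\<eta> (real j / real n) = \<alpha> (t / real n) [^] j" if "j \<le> n" for j
    using that
  proof (induction j)
    case 0
    show ?case by (simp add: \<eta>_def Evol_zero[OF reg])
  next
    case (Suc j)
    let ?a = "real j / real n"
    have IH: "\<eta> ?a = \<alpha> (t / real n) [^] j" using Suc by simp
    have a: "?a \<in> {0..1}" using Suc.prems by simp
    have seg1: "?a + 1 / real n * r \<in> {0..1}" if "r \<in> {0..1}" for r
      using that Suc.prems by (simp add: field_simps)
    have seg1': "?a + 1 / real n * r \<in> {0<..<1}" if r: "r \<in> {0<..<1}" for r
    proof -
      have "real j + r < real n" using r Suc.prems by auto
      moreover have "0 < real j + r" using r by auto
      moreover have "?a + 1 / real n * r = (real j + r) / real n" by (simp add: add_divide_distrib)
      ultimately show ?thesis using n by simp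
    qed
    have seg2: "0 + t / real n * r \<in> {0..\<epsilon>}" if "r \<in> {0..1}" for r
      using seg[of "1 / real n * r"] that n by (simp add: divide_right_mono)
    have h: "\<eta> ?a \<in> carrier G" by (rule \<eta>m[OF a])
    \<comment> \<open>The interval from \<open>j / n\<close> to \<open>(j + 1) / n\<close> is
      rescaled to the unit interval. There the evolution (\<open>\<zeta>\<close>) and the translate
      of \<open>\<alpha>\<close> (\<open>\<xi>\<close>) have the same start and the same logarithmic
      derivative \<open>x\<close>. The factor \<open>\<one>\<close> brings \<open>\<zeta>\<close>
      into the form of \<open>log_deriv_affine\<close>.\<close>
    define \<zeta> where "\<zeta> r = \<one> \<otimes> \<eta> (?a + 1 / real n * r)" for r
    define \<xi> where "\<xi> r = \<eta> ?a \<otimes> \<alpha> (0 + t / real n * r)" for r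
    define x where "x r = (t / real n) *\<^sub>R k (t / real n * r) c" for r
    have "\<zeta> 1 = \<xi> 1"
    proof (rule log_deriv_unique[where x = x])
      show "continuous_map (top_of_set {0..1}) (mtop M) \<zeta>"
        unfolding \<zeta>_def by (rule continuous_left_affine[OF \<eta>c one_closed seg1])
      show "continuous_map (top_of_set {0..1}) (mtop M) \<xi>"
        unfolding \<xi>_def by (rule continuous_left_affine[OF \<alpha>(1) h seg2])
      show "\<zeta> 0 = \<xi> 0" using h by (simp add: \<zeta>_def \<xi>_def \<alpha>(2))
      show "countable {r. ?a + 1 / real n * r \<in> D}" by (rule countable_affine_preimage[OF n1 D(1)])
      fix r assume r: "r \<in> {0<..<1} - {r. ?a + 1 / real n * r \<in> D}"
      have sr: "t / real n * r \<in> {0..\<epsilon>}" using seg2[of r] r by simp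
      have kE: "k (t / real n * r) c \<in> topspace E" by (rule tangent_mem[OF km[OF sr] c_at])
      have "real n * (?a + 1 / real n * r) = real j + r" using n0 by (simp add: field_simps)
      moreover have "\<lfloor>real j + r\<rfloor> = int j" using r by (simp add: floor_eq_iff)
      ultimately have "g (?a + 1 / real n * r) = t *\<^sub>R k (t / real n * r)" by (simp add: g_def)
      hence gc: "(1 / real n) *\<^sub>R g (?a + 1 / real n * r) c = x r" by (simp add: x_def scaleR_fun_def)
      have gE: "g (?a + 1 / real n * r) c \<in> topspace E"
        using lcs_scaleR[OF E kE] \<open>g (?a + 1 / real n * r) = _\<close> by (simp add: scaleR_fun_def)
      have "log_deriv_at G c (\<lambda>s. \<one> \<otimes> \<eta> (?a + 1 / real n * s)) r UNIV ((1 / real n) *\<^sub>R g (?a + 1 / real n * r) c)"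
        by (rule log_deriv_affine[OF _ gE one_closed open_greaterThanLessThan[of 0 1]])
          (use D(2) seg1'[of r] r \<eta>m in auto)
      thus "log_deriv_at G c \<zeta> r UNIV (x r)" unfolding \<zeta>_def[abs_def] gc .
      \<comment> \<open>For \<open>t = 0\<close> the curve \<open>\<alpha>\<close> would be
        differentiated at its end point 0, where \<open>ld\<close> is silent; but then
        \<open>\<xi>\<close> is constant, and the constant curve takes the place of
        \<open>\<alpha>\<close>.\<close>
      show "log_deriv_at G c \<xi> r UNIV (x r)"
      proof (cases "t = 0")
        case True
        have "log_deriv_at G c (\<lambda>s. \<eta> ?a \<otimes> (\<lambda>_. \<one>) (0 + 0 * s)) r UNIV (0 *\<^sub>R k (t / real n * r) c)"
          by (rule log_deriv_affine[OF _ kE h open_UNIV]) auto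
        thus ?thesis by (simp add: \<xi>_def[abs_def] x_def True \<alpha>(2))
      next
        case False
        hence pos: "0 < t / real n" using t n by simp
        have "t / real n * r < t / real n * 1" by (rule mult_strict_left_mono) (use pos r in auto)
        moreover have "0 < t / real n * r" by (rule mult_pos_pos[OF pos]) (use r in auto)
        ultimately have s: "0 + t / real n * r \<in> {0<..<\<epsilon>}" using tn by simp
        have "log_deriv_at G c \<alpha> (0 + t / real n * r) UNIV (k (t / real n * r) c)" using ld[OF s] by simp
        from log_deriv_affine[OF this kE h open_greaterThanLessThan s \<alpha>m] show ?thesis by (simp add: \<xi>_def[abs_def] x_def)
      qed
    qed auto
    moreover have "?a + 1 / real n * 1 = real (Suc j) / real n" by (simp add: add_divide_distrib)
    ultimately have "\<eta> (real (Suc j) / real n) = \<eta> ?a \<otimes> \<alpha> (t / real n)"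
      using \<eta>m[of "real (Suc j) / real n"] Suc.prems by (simp add: \<zeta>_def \<xi>_def)
    thus ?case using IH by simp
  qed
  from this[of n] show "Evol (ae_class 0 1 g) 1 = \<alpha> (t / real n) [^] n" using n0 by (simp add: \<eta>_def)
qed

text \<open>At 0, only the continuity of \<open>k\<close> enters: it makes \<open>k\<close> nearly
  \<open>k 0\<close> on \<open>{0..t / real n}\<close>, the range of arguments occurring in
  \<open>g n t\<close>.\<close>

lemma Trotter_core:
  assumes \<epsilon>: "0 < \<epsilon>"
    and \<alpha>: "continuous_map (top_of_set {0..\<epsilon>}) (mtop M) \<alpha>" "\<alpha> 0 = \<one>"
    and k: "continuous_map (top_of_set {0..\<epsilon>}) L k"
    and ld: "\<And>r. r \<in> {0<..<\<epsilon>} \<Longrightarrow> log_deriv_at G c \<alpha> r UNIV (k r c)"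
    and K: "compact K" "K \<subseteq> {0..}"
  shows "uniform_limit_on G K (\<lambda>n t. \<alpha> (t / real n) [^] n) (\<lambda>t. expG (t *\<^sub>R k 0))"
  unfolding uniform_limit_on_def
proof (intro allI impI, elim conjE)
  fix U assume U: "openin (mtop M) U" and U1: "\<one> \<in> U"
  define v where "v = k 0"
  have km: "k s \<in> topspace L" if "s \<in> {0..\<epsilon>}" for s
    using continuous_map_image_subset_topspace[OF k] that by auto
  have vL: "v \<in> topspace L" unfolding v_def by (rule km) (use \<epsilon> in simp)
  hence v: "v \<in> tangent_set M \<one>" by (simp add: L_facts(2))
  define g where "g n t = (\<lambda>s. t *\<^sub>R k (t * (s - of_int \<lfloor>real n * s\<rfloor> / real n)))" for n :: nat and t :: real
  show "\<forall>\<^sub>F n in sequentially. \<forall>t\<in>K. \<alpha> (t / real n) [^] n \<in> (expG (t *\<^sub>R k 0) <# U) \<inter> (U #> expG (t *\<^sub>R k 0))"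
  proof (rule uniform_from_pointwise[OF K(1)])
    fix t0 assume t0: "t0 \<in> K"
    hence t0p: "0 \<le> t0" using K(2) by auto
    \<comment> \<open>Here \<open>n\<close> tends to infinity and, at the same time,
      \<open>t\<close> tends to \<open>t0\<close> within \<open>K\<close>.\<close>
    let ?F = "sequentially \<times>\<^sub>F (inf (nhds t0) (principal K))"
    have ev_snd: "\<forall>\<^sub>F p in ?F. Q (snd p)" if "eventually Q (inf (nhds t0) (principal K))" for Q
      using filterlim_snd[of "inf (nhds t0) (principal K)" sequentially] that unfolding filterlim_iff by blast
    have ev_fst: "\<forall>\<^sub>F p in ?F. Q (fst p)" if "eventually Q sequentially" for Q
      using filterlim_fst[of sequentially "inf (nhds t0) (principal K)"] that unfolding filterlim_iff by blast
    have tK: "\<forall>\<^sub>F p in ?F. snd p \<in> K" by (rule ev_snd) (simp add: eventually_inf_principal)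
    have tlim: "((\<lambda>p. snd p) \<longlongrightarrow> t0) ?F"
    proof -
      have "filterlim snd (inf (nhds t0) (principal K)) ?F" by (rule filterlim_snd)
      thus ?thesis by (rule filterlim_mono) auto
    qed
    have small: "\<forall>\<^sub>F p in ?F. 0 < fst p \<and> 0 \<le> snd p \<and> snd p \<le> t0 + 1 \<and> snd p / real (fst p) < \<delta>" if \<delta>: "0 < \<delta>" for \<delta>
    proof -
      have "\<forall>\<^sub>F n in sequentially. (t0 + 1) / \<delta> < real n \<and> 0 < n"
        by (intro eventually_conj eventually_gt_at_top
            filterlim_real_sequentially[unfolded filterlim_at_top_dense, rule_format])
      from ev_fst[OF this] order_tendstoD(2)[OF tlim, of "t0 + 1"] tK
      have "\<forall>\<^sub>F p in ?F. ((t0 + 1) / \<delta> < real (fst p) \<and> 0 < fst p) \<and> snd p < t0 + 1 \<and> snd p \<in> K"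
        by (simp add: eventually_conj_iff)
      thus ?thesis
      proof eventually_elim
        case (elim p)
        have "snd p < \<delta> * real (fst p)" using elim \<delta> by (auto simp: divide_less_eq mult.commute)
        moreover have "0 \<le> snd p" using elim K(2) by auto
        ultimately show ?case using elim by (simp add: divide_less_eq mult.commute)
      qed
    qed
    have greg: "regulated L 0 1 (g n t)" "Evol (ae_class 0 1 (g n t)) 1 = \<alpha> (t / real n) [^] n"
      if "0 < n" "0 \<le> t" "t / real n < \<epsilon>" for n t
      unfolding g_def
      by (rule regulated_periodic_log_deriv[OF that(2,1) less_imp_le[OF that(3)] \<alpha> k ld], assumption)
        (rule Evol_periodic_eq_power[OF that(2,1) less_imp_le[OF that(3)] \<alpha> k ld], assumption)
    have X0: "ae_class 0 1 (\<lambda>s. t *\<^sub>R v) \<in> R_set L 0 1" for t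
      by (rule RL.R_const_mem[OF lcs_scaleR[OF L_facts(1) vL]])
    have X: "limitin (R_space L 0 1) (\<lambda>p. ae_class 0 1 (g (fst p) (snd p))) (ae_class 0 1 (\<lambda>s. t0 *\<^sub>R v)) ?F"
      unfolding RL.limitin_R_space
    proof (intro conjI allI impI X0)
      show "\<forall>\<^sub>F p in ?F. ae_class 0 1 (g (fst p) (snd p)) \<in> R_set L 0 1"
        using small[OF \<epsilon>] by eventually_elim (intro RL.R_setI greg(1), auto)
      fix q :: "('g, 'e) tvec \<Rightarrow> real" and e :: real assume q: "continuous_seminorm L q" and e: "0 < e"
      note cs = continuous_seminormD[OF q]
      \<comment> \<open>Close to \<open>t0\<close> one has \<open>t \<le> t0 + 1\<close>, so the
        deviation of \<open>k\<close> from \<open>v\<close> contributes at most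
        \<open>e / 3\<close>. Another third is reserved for replacing \<open>t\<close> by
        \<open>t0\<close>, and the last one makes the inequality strict.\<close>
      define e1 where "e1 = e / (3 * (t0 + 1))"
      have e1: "0 < e1" using e t0p by (simp add: e1_def)
      have "0 \<in> {0..\<epsilon>}" using \<epsilon> by simp
      with k have "limitin L k v (at 0 within {0..\<epsilon>})" unfolding continuous_map_real_iff v_def by blast
      from limitin_csnD[OF L_facts(1) this q e1]
      obtain \<delta> where \<delta>: "0 < \<delta>" "\<And>s. s \<in> {0..\<epsilon>} \<Longrightarrow> s \<noteq> 0 \<Longrightarrow> dist s 0 < \<delta> \<Longrightarrow> q (k s - v) < e1"
        unfolding eventually_at by metis
      have \<delta>': "q (k s - v) < e1" if s: "0 \<le> s" "s < \<delta>" "s \<le> \<epsilon>" for s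
      proof (cases "s = 0")
        case True
        thus ?thesis using e1 csn_zero[OF L_facts(1) q] by (simp add: v_def)
      qed (use \<delta>(2)[of s] s in auto)
      have "((\<lambda>p. \<bar>snd p - t0\<bar> * q v) \<longlongrightarrow> \<bar>t0 - t0\<bar> * q v) ?F" by (intro tendsto_intros tlim)
      from order_tendstoD(2)[OF this, of "e / 3"] have "\<forall>\<^sub>F p in ?F. \<bar>snd p - t0\<bar> * q v < e / 3" using e by simp
      with small[OF \<delta>(1)] small[OF \<epsilon>]
      show "\<forall>\<^sub>F p in ?F. ess_sup q 0 1 (ae_class 0 1 (g (fst p) (snd p)) - ae_class 0 1 (\<lambda>s. t0 *\<^sub>R v)) < e"
      proof eventually_elim
        case (elim p)
        define n t where "n = fst p" and "t = snd p"
        have nt: "0 < n" "0 \<le> t" "t \<le> t0 + 1" "t / real n < \<delta>" "t / real n < \<epsilon>" "\<bar>t - t0\<bar> * q v < e / 3"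
          using elim by (auto simp: n_def t_def)
        have bnd: "q (g n t s - t0 *\<^sub>R v) \<le> 2 * e / 3" for s
        proof -
          let ?u = "s - of_int \<lfloor>real n * s\<rfloor> / real n"
          have "of_int \<lfloor>real n * s\<rfloor> \<le> real n * s" "real n * s \<le> of_int \<lfloor>real n * s\<rfloor> + 1" by linarith+
          moreover have "real n * ?u = real n * s - of_int \<lfloor>real n * s\<rfloor>"
            using nt(1) by (simp add: right_diff_distrib)
          ultimately have "0 \<le> real n * ?u" "real n * ?u \<le> 1" by linarith+
          hence u: "0 \<le> ?u" "?u \<le> 1 / real n" using nt(1) by (simp_all add: zero_le_mult_iff le_divide_eq mult.commute)
          have tu: "0 \<le> t * ?u" "t * ?u \<le> t / real n" using u nt(2) mult_left_mono[OF u(2) nt(2)] by auto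
          have "q (k (t * ?u) - v) < e1" by (rule \<delta>') (use tu nt in auto)
          have kL: "k (t * ?u) \<in> topspace L" by (rule km) (use tu nt in auto)
          note cl = lcs_diff[OF L_facts(1) kL vL]
          have "g n t s - t0 *\<^sub>R v = t *\<^sub>R (k (t * ?u) - v) + (t - t0) *\<^sub>R v"
            by (simp add: g_def algebra_simps)
          hence "q (g n t s - t0 *\<^sub>R v) \<le> q (t *\<^sub>R (k (t * ?u) - v)) + q ((t - t0) *\<^sub>R v)"
            using cs(2)[OF lcs_scaleR[OF L_facts(1) cl] lcs_scaleR[OF L_facts(1) vL]] by simp
          also have "\<dots> = t * q (k (t * ?u) - v) + \<bar>t - t0\<bar> * q v"
            using cs(3)[OF cl] cs(3)[OF vL] nt(2) by simp
          also have "\<dots> \<le> (t0 + 1) * e1 + e / 3"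
            by (intro add_mono mult_mono) (use nt t0p \<open>q (k (t * ?u) - v) < e1\<close> csn_nonneg[OF L_facts(1) q cl] in auto)
          also have "\<dots> = 2 * e / 3" using t0p by (simp add: e1_def field_simps)
          finally show ?thesis .
        qed
        have "regulated L 0 1 (\<lambda>s. g n t s + - (t0 *\<^sub>R v))"
          by (intro regulated_add[OF zero_less_one L_facts(1)] greg(1) regulated_const[OF zero_less_one L_facts(1)]
              lcs_uminus[OF L_facts(1)] lcs_scaleR[OF L_facts(1)] vL) (use nt in auto)
        hence reg: "regulated L 0 1 (\<lambda>s. g n t s - t0 *\<^sub>R v)" by simp
        have "ess_sup q 0 1 (ae_class 0 1 (\<lambda>s. g n t s - t0 *\<^sub>R v)) \<le> 2 * e / 3"
          by (rule RL.ess_sup_le[OF q reg]) (intro AE_I2 impI bnd)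
        thus ?case using e by (simp add: ae_class_diff n_def t_def)
      qed
    qed
    \<comment> \<open>The power and \<open>expG (t *\<^sub>R v)\<close> have the same limit
      \<open>expG (t0 *\<^sub>R v)\<close>, by continuity of the evolution map at a constant and of
      \<open>expG\<close>. Hence their quotients in either order tend to the neutral element, as the
      two-sided condition in \<open>uniform_limit_on\<close> requires.\<close>
    have lim1: "limitin (mtop M) (\<lambda>p. Evol (ae_class 0 1 (g (fst p) (snd p))) 1) (expG (t0 *\<^sub>R v)) ?F"
      unfolding expG_def by (rule smooth_map_limitin[OF evol_smooth X0]) (use X in \<open>simp add: lcs_manifold_simps\<close>)
    have "limitin L (\<lambda>p. snd p *\<^sub>R v) (t0 *\<^sub>R v) ?F"
      by (rule lcs_limitin_scaleR[OF L_facts(1) tlim]) (use vL in \<open>simp add: limitin_def\<close>)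
    hence lim2: "limitin (mtop M) (\<lambda>p. expG (snd p *\<^sub>R v)) (expG (t0 *\<^sub>R v)) ?F"
      by (intro smooth_map_limitin[OF expG_smooth]) (use lcs_scaleR[OF L_facts(1) vL] in \<open>auto simp: lcs_manifold_simps\<close>)
    have em: "expG (t *\<^sub>R v) \<in> carrier G" for t by (rule expG_mem[OF L_scale[OF v]])
    have "limitin (mtop M) (\<lambda>p. inv (expG (snd p *\<^sub>R v)) \<otimes> Evol (ae_class 0 1 (g (fst p) (snd p))) 1) \<one> ?F"
      using limitin_mult[OF limitin_inv[OF lim2] lim1] em by simp
    from limitinD[OF this U U1]
    have ev1: "\<forall>\<^sub>F p in ?F. inv (expG (snd p *\<^sub>R v)) \<otimes> Evol (ae_class 0 1 (g (fst p) (snd p))) 1 \<in> U" .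
    have "limitin (mtop M) (\<lambda>p. Evol (ae_class 0 1 (g (fst p) (snd p))) 1 \<otimes> inv (expG (snd p *\<^sub>R v))) \<one> ?F"
      using limitin_mult[OF lim1 limitin_inv[OF lim2]] em by simp
    from limitinD[OF this U U1]
    have ev2: "\<forall>\<^sub>F p in ?F. Evol (ae_class 0 1 (g (fst p) (snd p))) 1 \<otimes> inv (expG (snd p *\<^sub>R v)) \<in> U" .
    show "\<forall>\<^sub>F p in ?F. \<alpha> (snd p / real (fst p)) [^] fst p
        \<in> (expG (snd p *\<^sub>R k 0) <# U) \<inter> (U #> expG (snd p *\<^sub>R k 0))"
      using ev1 ev2 small[OF \<epsilon>]
    proof eventually_elim
      case (elim p)
      let ?x = "\<alpha> (snd p / real (fst p)) [^] fst p" and ?h = "expG (snd p *\<^sub>R v)"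
      have R: "regulated L 0 1 (g (fst p) (snd p))" and eq: "Evol (ae_class 0 1 (g (fst p) (snd p))) 1 = ?x"
        using greg elim by auto
      have x: "?x \<in> carrier G" using Evol_mem[OF R, of 1] eq by simp
      have "?x = ?h \<otimes> (inv ?h \<otimes> ?x)" "?x = (?x \<otimes> inv ?h) \<otimes> ?h"
        using x em by (simp_all add: m_assoc[symmetric]) (simp add: m_assoc)
      thus ?case using elim(1,2) unfolding eq l_coset_def r_coset_def v_def by blast
    qed
  qed
qed

end

section \<open>Second order differences\<close>

lemma C1_translate_diff:
  assumes E: "lcs E" and F: "lcs F" and f: "C1_on E F U f" and a: "a \<in> topspace E"
  shows "C1_on E F {z \<in> U. z + a \<in> U} (\<lambda>z. f (z + a) - f z)"
    and "z \<in> U \<Longrightarrow> z + a \<in> U \<Longrightarrow> y \<in> topspace E \<Longrightarrow>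
      dir_deriv F (\<lambda>z. f (z + a) - f z) z y = dir_deriv F f (z + a) y - dir_deriv F f z y"
proof -
  have lim: "limitin F (\<lambda>t. ((f (z + t *\<^sub>R y + a) - f (z + t *\<^sub>R y)) - (f (z + a) - f z)) /\<^sub>R t)
      (dir_deriv F f (z + a) y - dir_deriv F f z y) (at (0::real))" if "z \<in> U" "z + a \<in> U" "y \<in> topspace E" for z y
    using lcs_limitin_diff[OF F C1_limitin[OF F f that(2,3)] C1_limitin[OF F f that(1,3)]]
    by (simp add: algebra_simps)
  have dd: "dir_deriv F (\<lambda>z. f (z + a) - f z) z y = dir_deriv F f (z + a) y - dir_deriv F f z y"
    if "z \<in> U" "z + a \<in> U" "y \<in> topspace E" for z y
    by (rule dir_derivI[OF lcs_Hausdorff[OF F] lim[OF that]])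
  thus "z \<in> U \<Longrightarrow> z + a \<in> U \<Longrightarrow> y \<in> topspace E \<Longrightarrow>
      dir_deriv F (\<lambda>z. f (z + a) - f z) z y = dir_deriv F f (z + a) y - dir_deriv F f z y" .
  let ?U = "{z \<in> U. z + a \<in> U}"
  have tr: "limitin E (\<lambda>i. b i + a) (z + a) \<Phi>" if "limitin E b z \<Phi>" for b z and \<Phi> :: "'i filter"
    by (rule lcs_limitin_add[OF E that]) (use a in \<open>simp add: limitin_def\<close>)
  have tr': "limitin E (\<lambda>z. z + a) (z + a) (nhdsin E z)" if "z \<in> topspace E" for z
    by (rule lcs_limitin_add[OF E limitin_nhdsin_id[OF that]]) (use a in \<open>simp add: limitin_def\<close>)
  have "openin E {z \<in> topspace E. z + a \<in> U}"
    by (rule openin_continuous_map_preimage[OF _ C1_openin[OF f]]) (simp add: continuous_map_limitin tr')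
  moreover have "U \<inter> {z \<in> topspace E. z + a \<in> U} = ?U" using C1_subset[OF f] by auto
  ultimately have U: "openin E ?U" using openin_Int[OF C1_openin[OF f]] by metis
  show "C1_on E F ?U (\<lambda>z. f (z + a) - f z)"
  proof (rule C1_onI[OF U])
    fix x assume x: "x \<in> ?U"
    hence xU: "x \<in> U" "x + a \<in> U" by auto
    have xE: "x \<in> topspace E" using xU C1_subset[OF f] by blast
    show "limitin F (\<lambda>z. f (z + a) - f z) (f (x + a) - f x) (nhdsin E x)"
      by (rule lcs_limitin_diff[OF F C1_cont[OF f xU(2) tr'[OF xE]] C1_onD(1)[OF f xU(1)]])
    fix y assume y: "y \<in> topspace E"
    show "\<exists>l. limitin F (\<lambda>t. ((f (x + t *\<^sub>R y + a) - f (x + t *\<^sub>R y)) - (f (x + a) - f x)) /\<^sub>R t) l (at (0::real))"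
      using lim[OF xU y] by blast
    have "limitin E (\<lambda>p. fst p + a) (x + a) (nhdsin (prod_topology E E) (x, y))"
      by (rule lcs_limitin_add[OF E nhdsin_fst[OF xE y]]) (use a in \<open>simp add: limitin_def\<close>)
    from lcs_limitin_diff[OF F C1_deriv_cont[OF f xU(2) this nhdsin_snd[OF xE y]] C1_onD(3)[OF f xU(1) y]]
    have "limitin F (\<lambda>p. dir_deriv F f (fst p + a) (snd p) - dir_deriv F f (fst p) (snd p))
      (dir_deriv F f (x + a) y - dir_deriv F f x y) (nhdsin (prod_topology E E) (x, y))" .
    moreover have "\<forall>\<^sub>F p in nhdsin (prod_topology E E) (x, y). dir_deriv F f (fst p + a) (snd p) - dir_deriv F f (fst p) (snd p)
        = dir_deriv F (\<lambda>z. f (z + a) - f z) (fst p) (snd p)"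
      using limitinD[OF nhdsin_fst[OF xE y] U x] limitinD[OF nhdsin_snd[OF xE y] openin_topspace y]
      by eventually_elim (simp add: dd)
    ultimately show "limitin F (\<lambda>p. dir_deriv F (\<lambda>z. f (z + a) - f z) (fst p) (snd p))
        (dir_deriv F (\<lambda>z. f (z + a) - f z) x y) (nhdsin (prod_topology E E) (x, y))"
      unfolding dd[OF xU y] by (rule limitin_transform_eventually[rotated])
  qed
qed

lemma smooth_on_partial_deriv:
  assumes E: "lcs E" and F: "lcs F" and f: "smooth_on E F U f" and v: "v \<in> topspace E"
  shows "smooth_on E F U (\<lambda>z. dir_deriv F f z v)"
proof -
  note U = smooth_on_openin[OF f] and P = lcs_prod[OF E E]
  have "smooth_on E (prod_topology E E) U (\<lambda>z. (z, v))"
    by (rule smooth_on_pair[OF E E E smooth_on_id[OF E U] smooth_on_const[OF E v U]])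
  from smooth_on_comp[OF E P F this smooth_on_dir_deriv[OF f]] v
  show ?thesis by (simp add: o_def image_subset_iff)
qed

text \<open>The mean value estimate is used twice: in direction \<open>v\<close> for the first
  difference \<open>g t\<close>, whose derivative is \<open>h (z + t *\<^sub>R w) - h z\<close>, and
  in direction \<open>w\<close> for \<open>h\<close>. Each use contributes a factor
  \<open>\<bar>t\<bar>\<close>, which accounts for the division by \<open>t\<^sup>2\<close>.\<close>

lemma second_difference:
  assumes E: "lcs E" and F: "lcs F" and f: "smooth_on E F U f" and x: "x \<in> U"
    and v: "v \<in> topspace E" and w: "w \<in> topspace E"
  shows "limitin F (\<lambda>t. (f (x + t *\<^sub>R v + t *\<^sub>R w) - f (x + t *\<^sub>R v) - f (x + t *\<^sub>R w) + f x) /\<^sub>R t\<^sup>2)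
      (dir_deriv F (\<lambda>z. dir_deriv F f z v) x w) (at 0)"
proof -
  define h where "h = (\<lambda>z. dir_deriv F f z v)"
  have f1: "C1_on E F U f" by (rule smooth_on_imp_C1[OF f])
  have h: "C1_on E F U h" unfolding h_def by (rule smooth_on_imp_C1[OF smooth_on_partial_deriv[OF E F f v]])
  define D where "D = dir_deriv F h x w"
  have D: "D \<in> topspace F" unfolding D_def by (rule C1_deriv_mem[OF F h x w])
  have xE: "x \<in> topspace E" using x C1_subset[OF f1] by blast
  define g where "g t z = f (z + t *\<^sub>R w) - f z" for t z
  define \<Delta> where "\<Delta> t = g t (x + t *\<^sub>R v) - g t x" for t
  have tw: "t *\<^sub>R w \<in> topspace E" for t by (rule lcs_scaleR[OF E w])
  let ?x = "\<lambda>p :: real \<times> real. x + fst p *\<^sub>R v + snd p *\<^sub>R w"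
  have lim: "limitin E ?x x (nhds (0, 0))"
  proof -
    note tendsto_fst[OF filterlim_ident, of "(0::real, 0::real)"] tendsto_snd[OF filterlim_ident, of "(0::real, 0::real)"]
    hence "limitin E ?x (x + 0 *\<^sub>R v + 0 *\<^sub>R w) (nhds (0, 0))"
      using v w xE by (intro lcs_limitin_add[OF E] lcs_limitin_scaleR[OF E]) (simp_all add: limitin_def)
    thus ?thesis by simp
  qed
  have "limitin F (\<lambda>t. \<Delta> t /\<^sub>R t\<^sup>2) D (at 0)"
    unfolding limitin_csn[OF F]
  proof (intro conjI allI impI D)
    have wlim: "limitin E (\<lambda>p. w) w (nhds (0 :: real, 0 :: real))" using w by (simp add: limitin_def)
    have main: "\<forall>\<^sub>F t in at 0. \<Delta> t \<in> topspace F \<and> (t \<noteq> 0 \<longrightarrow> q (\<Delta> t /\<^sub>R t\<^sup>2 - D) < e)"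
      if q: "continuous_seminorm F q" and e: "0 < e" for q e
    proof -
      note cs = continuous_seminormD[OF q]
      have "\<forall>\<^sub>F p in nhds (0, 0). ?x p \<in> U \<and> q (dir_deriv F h (?x p) w - D) < e / 2"
        using limitinD[OF lim C1_openin[OF h] x]
          limitin_csnD[OF F C1_deriv_cont[OF h x lim wlim] q half_gt_zero[OF e]] unfolding D_def
        by eventually_elim simp
      then obtain Q where Q: "eventually Q (nhds (0::real))"
        "\<And>s s'. Q s \<Longrightarrow> Q s' \<Longrightarrow> ?x (s, s') \<in> U \<and> q (dir_deriv F h (?x (s, s')) w - D) < e / 2"
        unfolding nhds_prod eventually_prod_same by (elim exE conjE) (rule that, assumption, simp)
      from Q(1) obtain \<delta> where \<delta>: "0 < \<delta>" "\<And>s. \<bar>s\<bar> < \<delta> \<Longrightarrow> Q s" by (auto simp: eventually_nhds_metric dist_real_def)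
      have "\<forall>\<^sub>F t in at (0::real). \<bar>t\<bar> < \<delta>" using \<delta>(1) by (auto simp: eventually_at dist_real_def)
      thus ?thesis
      proof eventually_elim
        case (elim t)
        have th: "Q (\<theta> * t)" if "0 \<le> \<theta>" "\<theta> \<le> 1" for \<theta>
        proof (rule \<delta>(2))
          have "\<bar>\<theta> * t\<bar> \<le> \<bar>t\<bar>" using that by (simp add: abs_mult mult_left_le_one_le)
          thus "\<bar>\<theta> * t\<bar> < \<delta>" using elim by simp
        qed
        have Q0: "Q 0" "Q t" using th[of 0] th[of 1] by simp_all
        let ?z = "\<lambda>\<theta>. x + (\<theta> * t) *\<^sub>R v"
        note G = C1_translate_diff[OF E F f1 tw[of t]]
        have z: "?z \<theta> \<in> U" "?z \<theta> + t *\<^sub>R w \<in> U" if "0 \<le> \<theta>" "\<theta> \<le> 1" for \<theta>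
          using Q(2)[OF th[OF that] Q0(1)] Q(2)[OF th[OF that] Q0(2)] by simp_all
        have "q (g t (x + t *\<^sub>R v) - g t x - t *\<^sub>R (t *\<^sub>R D)) \<le> \<bar>t\<bar> * (\<bar>t\<bar> * (e / 2))"
          unfolding g_def
        proof (rule C1_line_estimate[OF E F G(1) q v lcs_scaleR[OF F D]])
          fix \<theta> :: real assume \<theta>: "0 \<le> \<theta>" "\<theta> \<le> 1"
          show "?z \<theta> \<in> {z \<in> U. z + t *\<^sub>R w \<in> U}" using z[OF \<theta>] by simp
          have "q (h (?z \<theta> + t *\<^sub>R w) - h (?z \<theta>) - t *\<^sub>R D) \<le> \<bar>t\<bar> * (e / 2)"
          proof (rule C1_line_estimate[OF E F h q w D])
            fix \<theta>' :: real assume \<theta>': "0 \<le> \<theta>'" "\<theta>' \<le> 1"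
            from Q(2)[OF th[OF \<theta>] th[OF \<theta>']]
            show "?z \<theta> + (\<theta>' * t) *\<^sub>R w \<in> U" "q (dir_deriv F h (?z \<theta> + (\<theta>' * t) *\<^sub>R w) w - D) \<le> e / 2" by simp_all
          qed
          thus "q (dir_deriv F (\<lambda>z. f (z + t *\<^sub>R w) - f z) (?z \<theta>) v - t *\<^sub>R D) \<le> \<bar>t\<bar> * (e / 2)"
            using G(2)[OF z[OF \<theta>] v] by (simp add: h_def)
        qed
        hence est: "q (\<Delta> t - t\<^sup>2 *\<^sub>R D) \<le> t\<^sup>2 * (e / 2)"
          by (simp add: \<Delta>_def power2_eq_square mult.assoc[symmetric])
        have fm: "f y \<in> topspace F" if "y \<in> U" for y by (rule C1_mem[OF f1 that])
        have \<Delta>m: "\<Delta> t \<in> topspace F"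
          unfolding \<Delta>_def g_def using z[of 0] z[of 1] by (intro lcs_diff[OF F] fm) simp_all
        show ?case
        proof (intro conjI \<Delta>m impI)
          assume t: "t \<noteq> 0"
          have "\<Delta> t /\<^sub>R t\<^sup>2 - D = inverse (t\<^sup>2) *\<^sub>R (\<Delta> t - t\<^sup>2 *\<^sub>R D)" using t by (simp add: scaleR_diff_right)
          hence "q (\<Delta> t /\<^sub>R t\<^sup>2 - D) = inverse (t\<^sup>2) * q (\<Delta> t - t\<^sup>2 *\<^sub>R D)"
            using cs(3)[OF lcs_diff[OF F \<Delta>m lcs_scaleR[OF F D]], of "inverse (t\<^sup>2)"] by simp
          also have "\<dots> \<le> inverse (t\<^sup>2) * (t\<^sup>2 * (e / 2))" by (rule mult_left_mono[OF est]) simp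
          also have "\<dots> < e" using t e by simp
          finally show "q (\<Delta> t /\<^sub>R t\<^sup>2 - D) < e" .
        qed
      qed
    qed
    have nz: "\<forall>\<^sub>F t in at (0::real). t \<noteq> 0" by (simp add: eventually_at_filter)
    \<comment> \<open>The zero seminorm extracts the mere membership of the quotient in
      \<open>F\<close> from the estimate.\<close>
    have "continuous_seminorm F (\<lambda>x. 0)" by (simp add: continuous_seminorm_def)
    from main[OF this zero_less_one] show "\<forall>\<^sub>F t in at 0. \<Delta> t /\<^sub>R t\<^sup>2 \<in> topspace F"
      by eventually_elim (simp add: lcs_scaleR[OF F])
    fix q :: "'b \<Rightarrow> real" and e :: real assume "continuous_seminorm F q" "0 < e"
    from main[OF this] nz show "\<forall>\<^sub>F t in at 0. q (\<Delta> t /\<^sub>R t\<^sup>2 - D) < e" by eventually_elim simp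
  qed
  thus ?thesis by (simp add: D_def h_def \<Delta>_def g_def algebra_simps)
qed

context lie_chart
begin

text \<open>If the first argument is the neutral element, the quotient is the second argument. At
  time 0, the logarithmic derivative is thus the ordinary one.\<close>

lemma quot_rep_deriv_one:
  assumes w: "w \<in> topspace E"
  shows "dir_deriv E (quot_rep c) (x0, x0) (0, w) = w"
proof (rule dir_derivI[OF lcs_Hausdorff[OF E] limitin_eventually[OF w]])
  have "\<forall>\<^sub>F t in at (0::real). x0 + t *\<^sub>R w \<in> snd c ` fst c"
    by (rule eventually_line_in[OF E chart_image_openin[OF c] _ w]) (use c_one in simp)
  moreover have "\<forall>\<^sub>F t in at (0::real). t \<noteq> 0" by (simp add: eventually_at_filter)
  ultimately show "\<forall>\<^sub>F t in at (0::real). (quot_rep c ((x0, x0) + t *\<^sub>R (0, w)) - quot_rep c (x0, x0)) /\<^sub>R t = w"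
  proof eventually_elim
    case (elim t)
    have "chart_inv c (x0 + t *\<^sub>R w) \<in> carrier G"
      using chart_inv_in[OF c elim(1) order_refl] chart_carrier[OF c] by blast
    hence "quot_rep c (x0, x0 + t *\<^sub>R w) = x0 + t *\<^sub>R w"
      using chart_chart_inv[OF elim(1) order_refl] by (simp add: quot_rep_def chart_one)
    thus ?case using elim(2) quot_rep_diag[OF c c_one] by simp
  qed
qed

text \<open>\<open>C1_curve\<close> speaks of derivatives relative to the set \<open>J\<close> of
  all times spent in the chart domain, \<open>velocity\<close> of those relative to
  \<open>{0..1}\<close>. As the curve stays in the domain for a short while, the two notions agree
  at 0.\<close>

lemma C1_curve_local:
  assumes \<gamma>: "C1_curve M \<gamma>" "\<gamma> 0 = \<one>"
  shows "\<exists>\<epsilon> \<gamma>'. 0 < \<epsilon> \<and> \<epsilon> \<le> 1 \<and> (\<forall>t\<in>{0..\<epsilon>}. \<gamma> t \<in> fst c) \<and> continuous_map (top_of_set {0..\<epsilon>}) E \<gamma>' \<and>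
    (\<forall>t\<in>{0..\<epsilon>}. limitin E (\<lambda>s. (snd c (\<gamma> s) - snd c (\<gamma> t)) /\<^sub>R (s - t)) (\<gamma>' t) (at t within {0..\<epsilon>})) \<and>
    velocity M {0..1} \<gamma> 0 = chart_vec M c x0 (\<gamma>' 0)"
proof -
  have cont: "continuous_map (top_of_set {0..1}) (mtop M) \<gamma>" using \<gamma>(1) by (simp add: C1_curve_def)
  define J where "J = {t \<in> {0..1}. \<gamma> t \<in> fst c}"
  have "\<forall>c\<in>charts M. C1_curve_on E {t \<in> {0..1}. \<gamma> t \<in> fst c} (snd c \<circ> \<gamma>)" using \<gamma>(1) by (simp add: C1_curve_def)
  from bspec[OF this c, folded J_def] obtain \<gamma>' where \<gamma>'c: "continuous_map (top_of_set J) E \<gamma>'"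
    and \<gamma>': "\<And>t. t \<in> J \<Longrightarrow> limitin E (\<lambda>s. (snd c (\<gamma> s) - snd c (\<gamma> t)) /\<^sub>R (s - t)) (\<gamma>' t) (at t within J)"
    unfolding C1_curve_on_def o_def by (elim exE conjE) blast
  have "\<forall>\<^sub>F t in at 0 within {0..1}. \<gamma> t \<in> fst c"
    by (rule limitinD[OF _ chart_openin[OF c], of _ "\<gamma> 0"])
      (use bspec[OF cont[unfolded continuous_map_real_iff], of 0] \<gamma>(2) c_one in simp_all)
  then obtain \<delta> where \<delta>: "0 < \<delta>" "\<And>t. t \<in> {0..1} \<Longrightarrow> t \<noteq> 0 \<Longrightarrow> dist t 0 < \<delta> \<Longrightarrow> \<gamma> t \<in> fst c"
    unfolding eventually_at by metis
  have \<delta>': "t \<in> J" if "t \<in> {0..1}" "t < \<delta>" for t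
    using \<delta>(2)[of t] that \<gamma>(2) c_one by (cases "t = 0") (simp_all add: J_def)
  define \<epsilon> where "\<epsilon> = min 1 (\<delta> / 2)"
  have \<epsilon>: "0 < \<epsilon>" "\<epsilon> \<le> 1" "\<epsilon> < \<delta>" using \<delta>(1) by (auto simp: \<epsilon>_def)
  have sub: "{0..\<epsilon>} \<subseteq> J" using \<delta>' \<epsilon> by auto
  have J0: "0 \<in> J" using sub \<epsilon>(1) by auto
  have nhd: "at 0 within J = at 0 within {0..1}"
    by (rule at_within_nhd[of _ "{-\<delta><..<\<delta>}"]) (use \<delta>(1) \<delta>' in \<open>auto simp: J_def\<close>)
  have "velocity M {0..1} \<gamma> 0 = chart_vec M c (snd c (\<gamma> 0)) (\<gamma>' 0)"
  proof (rule velocity_eq_chart_vec[OF M])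
    show "c \<in> charts_at M (\<gamma> 0)" using c_at \<gamma>(2) by simp
    show "limitin (mtop M) \<gamma> (\<gamma> 0) (at 0 within {0..1})" using cont by (simp add: continuous_map_real_iff)
    show "at (0::real) within {0..1} \<noteq> bot" by (simp add: at_within_Icc_at_right)
    show "limitin E (\<lambda>s. (snd c (\<gamma> s) - snd c (\<gamma> 0)) /\<^sub>R (s - 0)) (\<gamma>' 0) (at 0 within {0..1})"
      using \<gamma>'[OF J0] unfolding nhd .
  qed
  hence vel: "velocity M {0..1} \<gamma> 0 = chart_vec M c x0 (\<gamma>' 0)" by (simp add: \<gamma>(2))
  show ?thesis
  proof (intro exI[of _ \<epsilon>] exI[of _ \<gamma>'] conjI ballI \<epsilon>(1,2) vel)
    show "\<gamma> t \<in> fst c" if "t \<in> {0..\<epsilon>}" for t using sub that by (auto simp: J_def)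
    show "continuous_map (top_of_set {0..\<epsilon>}) E \<gamma>'" using \<gamma>'c sub by (rule continuous_map_from_subtopology_mono)
    show "limitin E (\<lambda>s. (snd c (\<gamma> s) - snd c (\<gamma> t)) /\<^sub>R (s - t)) (\<gamma>' t) (at t within {0..\<epsilon>})" if "t \<in> {0..\<epsilon>}" for t
      by (rule limitin_subset[OF \<gamma>' sub]) (use sub that in auto)
  qed
qed

end

context lie_evol
begin

text \<open>Translates derivatives in the chart into a continuous curve \<open>k\<close> in the Lie
  algebra. Asking for derivatives at interior times and for a continuous extension
  \<open>\<alpha>'\<close> to 0 is what makes the result applicable to the commutator curve.\<close>

lemma Trotter_chart:
  assumes \<epsilon>: "0 < \<epsilon>"
    and \<alpha>: "continuous_map (top_of_set {0..\<epsilon>}) (mtop M) \<alpha>" "\<alpha> 0 = \<one>" "\<And>t. t \<in> {0..\<epsilon>} \<Longrightarrow> \<alpha> t \<in> fst c"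
    and \<alpha>': "continuous_map (top_of_set {0..\<epsilon>}) E \<alpha>'"
      "\<And>t. t \<in> {0<..<\<epsilon>} \<Longrightarrow> limitin E (\<lambda>s. (snd c (\<alpha> s) - snd c (\<alpha> t)) /\<^sub>R (s - t)) (\<alpha>' t) (at t)"
    and K: "compact K" "K \<subseteq> {0..}"
  shows "uniform_limit_on G K (\<lambda>n t. \<alpha> (t / real n) [^] n) (\<lambda>t. expG (t *\<^sub>R chart_vec M c x0 (\<alpha>' 0)))"
proof -
  define f where "f t = dir_deriv E (quot_rep c) (snd c (\<alpha> t), snd c (\<alpha> t)) (0, \<alpha>' t)" for t
  have \<alpha>'m: "\<alpha>' t \<in> topspace E" if "t \<in> {0..\<epsilon>}" for t
    using continuous_map_image_subset_topspace[OF \<alpha>'(1)] that by auto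
  have f: "limitin E f (f t) (at t within {0..\<epsilon>})" if t: "t \<in> {0..\<epsilon>}" for t
  proof -
    have "limitin (mtop M) \<alpha> (\<alpha> t) (at t within {0..\<epsilon>})" "limitin E \<alpha>' (\<alpha>' t) (at t within {0..\<epsilon>})"
      using \<alpha>(1) \<alpha>'(1) t by (simp_all add: continuous_map_real_iff)
    note l = chart_limitin[OF c this(1) \<alpha>(3)[OF t]] this(2)
    have z: "limitin E (\<lambda>i. 0) 0 (at t within {0..\<epsilon>})" using lcs_zero[OF E] by (simp add: limitin_def)
    show ?thesis unfolding f_def
      by (rule C1_deriv_cont[OF quot_rep_C1[OF c] quot_diag[OF c \<alpha>(3)[OF t]] limitin_pairI[OF l(1) l(1)] limitin_pairI[OF z l(2)]])
  qed
  have fm: "f t \<in> topspace E" if "t \<in> {0..\<epsilon>}" for t by (rule limitin_topspace[OF f[OF that]])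
  define k where "k t = chart_vec M c x0 (f t)" for t
  note ct = chart_vec_tangent[OF M c_at fm]
  have "continuous_map (top_of_set {0..\<epsilon>}) L k"
    unfolding continuous_map_real_iff limitin_L
  proof (intro ballI conjI)
    fix t assume t: "t \<in> {0..\<epsilon>}"
    show "k t \<in> tangent_set M \<one>" unfolding k_def by (rule ct(1)[OF t])
    have J: "\<forall>\<^sub>F s in at t within {0..\<epsilon>}. s \<in> {0..\<epsilon>}" by (simp add: eventually_at_filter)
    thus "\<forall>\<^sub>F s in at t within {0..\<epsilon>}. k s \<in> tangent_set M \<one>" unfolding k_def by eventually_elim (rule ct(1))
    have "\<forall>\<^sub>F s in at t within {0..\<epsilon>}. f s = k s c" using J by eventually_elim (simp only: k_def ct(2))
    thus "limitin E (\<lambda>s. k s c) (k t c) (at t within {0..\<epsilon>})"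
      using f[OF t] unfolding k_def ct(2)[OF t] by (rule limitin_transform_eventually)
  qed
  moreover have "log_deriv_at G c \<alpha> t UNIV (k t c)" if t: "t \<in> {0<..<\<epsilon>}" for t
  proof -
    have ti: "t \<in> {0..\<epsilon>}" using t by simp
    have "\<forall>\<^sub>F s in at t. s \<in> {0<..<\<epsilon>}" by (rule eventually_at_in_open'[OF open_greaterThanLessThan t])
    hence ev: "\<forall>\<^sub>F s in at t. \<alpha> s \<in> fst c" by eventually_elim (rule \<alpha>(3), simp)
    show ?thesis
      using log_deriv_of_chart_deriv[OF c \<alpha>(3)[OF ti] ev \<alpha>'(2)[OF t]] by (simp only: k_def ct(2)[OF ti]) (simp only: f_def)
  qed
  ultimately have "uniform_limit_on G K (\<lambda>n t. \<alpha> (t / real n) [^] n) (\<lambda>t. expG (t *\<^sub>R k 0))"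
    by (rule Trotter_core[OF \<epsilon> \<alpha>(1,2) _ _ K])
  moreover have "k 0 = chart_vec M c x0 (\<alpha>' 0)"
    using quot_rep_deriv_one[OF \<alpha>'m[of 0]] \<epsilon> by (simp add: k_def f_def \<alpha>(2))
  ultimately show ?thesis by simp
qed

theorem strong_Trotter: "strong_Trotter G"
  unfolding strong_Trotter_def
proof (intro exI[of _ expG] conjI smooth_exponential_expG allI impI)
  fix \<gamma> and K :: "real set" assume "C1_curve M \<gamma> \<and> \<gamma> 0 = \<one>" and "compact K \<and> K \<subseteq> {0..}"
  hence \<gamma>: "C1_curve M \<gamma>" "\<gamma> 0 = \<one>" and K: "compact K" "K \<subseteq> {0..}" by auto
  obtain \<epsilon> \<gamma>' where
    \<epsilon>: "0 < \<epsilon>" "\<epsilon> \<le> 1" "\<forall>t\<in>{0..\<epsilon>}. \<gamma> t \<in> fst c" "continuous_map (top_of_set {0..\<epsilon>}) E \<gamma>'"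
    and d: "\<forall>t\<in>{0..\<epsilon>}. limitin E (\<lambda>s. (snd c (\<gamma> s) - snd c (\<gamma> t)) /\<^sub>R (s - t)) (\<gamma>' t) (at t within {0..\<epsilon>})"
    and vel: "velocity M {0..1} \<gamma> 0 = chart_vec M c x0 (\<gamma>' 0)"
    using C1_curve_local[OF \<gamma>] by (elim exE conjE)
  have "continuous_map (top_of_set {0..1}) (mtop M) \<gamma>" using \<gamma>(1) by (simp add: C1_curve_def)
  hence "continuous_map (top_of_set {0..\<epsilon>}) (mtop M) \<gamma>"
    by (rule continuous_map_from_subtopology_mono) (use \<epsilon>(2) in auto)
  thus "uniform_limit_on G K (\<lambda>n t. \<gamma> (t / real n) [^] n) (\<lambda>t. expG (t *\<^sub>R velocity M {0..1} \<gamma> 0))"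
    unfolding vel
  proof (rule Trotter_chart[where \<alpha> = \<gamma> and \<alpha>' = \<gamma>', OF \<epsilon>(1) _ \<gamma>(2) _ \<epsilon>(4) _ K])
    show "\<gamma> t \<in> fst c" if "t \<in> {0..\<epsilon>}" for t using \<epsilon>(3) that by simp
    fix t assume t: "t \<in> {0<..<\<epsilon>}"
    have "at t within {0..\<epsilon>} = at t" by (rule at_within_interior) (use t in simp)
    thus "limitin E (\<lambda>s. (snd c (\<gamma> s) - snd c (\<gamma> t)) /\<^sub>R (s - t)) (\<gamma>' t) (at t)"
      using bspec[OF d, of t] t by simp
  qed
qed

end

section \<open>The commutator formula\<close>

text \<open>Both sides are limits of literally the same difference quotient.\<close>

lemma dir_deriv_partial:
  "dir_deriv F (\<lambda>y. f (x, y)) y u = dir_deriv F f (x, y) (0, u)"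
  "dir_deriv F (\<lambda>x. f (x, y)) x v = dir_deriv F f (x, y) (v, 0)"
  by (simp_all add: dir_deriv_def)

lemma filterlim_sqrt_within:
  assumes "0 \<le> t" "\<And>s. s \<in> S \<Longrightarrow> 0 \<le> s \<and> sqrt s \<in> T"
  shows "filterlim sqrt (at (sqrt t) within T) (at t within S)"
  unfolding filterlim_at
proof
  show "(sqrt \<longlongrightarrow> sqrt t) (at t within S)" by (intro tendsto_intros)
  have "\<forall>\<^sub>F s in at t within S. s \<in> S \<and> s \<noteq> t" by (simp add: eventually_at_filter)
  thus "\<forall>\<^sub>F s in at t within S. sqrt s \<in> T \<and> sqrt s \<noteq> sqrt t"
    by eventually_elim (use assms in auto)
qed

context lie_chart
begin

definition mult_rep :: "'e \<times> 'e \<Rightarrow> 'e" where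
  "mult_rep p = snd c (chart_inv c (fst p) \<otimes> chart_inv c (snd p))"

definition mult_domain :: "('e \<times> 'e) set" where
  "mult_domain = {p \<in> (snd c ` fst c) \<times> (snd c ` fst c). chart_inv c (fst p) \<otimes> chart_inv c (snd p) \<in> fst c}"

definition group_commutator :: "'g \<Rightarrow> 'g \<Rightarrow> 'g" where
  "group_commutator g h = g \<otimes> h \<otimes> inv g \<otimes> inv h"

definition comm_rep :: "'e \<times> 'e \<Rightarrow> 'e" where
  "comm_rep p = snd c (group_commutator (chart_inv c (fst p)) (chart_inv c (snd p)))"

definition comm_domain :: "('e \<times> 'e) set" where
  "comm_domain = {p \<in> (snd c ` fst c) \<times> (snd c ` fst c). group_commutator (chart_inv c (fst p)) (chart_inv c (snd p)) \<in> fst c}"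

text \<open>The mixed second derivative of the multiplication at the neutral element. Since
  \<open>mult_rep\<close> is the identity on both axes, it is the whole second order term in the
  expansion of a product, and \<open>bracket_rep\<close>, its antisymmetrization, is the Lie bracket
  in the chart.\<close>

definition bilinear_part :: "'e \<Rightarrow> 'e \<Rightarrow> 'e" where
  "bilinear_part a u = dir_deriv E (\<lambda>p. dir_deriv E mult_rep p (0, u)) (x0, x0) (a, 0)"

definition bracket_rep :: "'e \<Rightarrow> 'e \<Rightarrow> 'e" where
  "bracket_rep a u = bilinear_part a u - bilinear_part u a"

lemma mult_rep_smooth: "smooth_on (prod_topology E E) E mult_domain mult_rep"
  unfolding mult_domain_def mult_rep_def by (rule two_chart_smooth(3)[OF c c one_closed one_closed one_closed])

lemma comm_rep_smooth: "smooth_on (prod_topology E E) E comm_domain comm_rep"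
proof -
  note P = lcs_prod[OF E E]
  let ?V = "(snd c ` fst c) \<times> (snd c ` fst c)"
  have V: "openin (prod_topology E E) ?V" using chart_image_openin[OF c] by (simp add: openin_prod_Times_iff)
  note PM = smooth_manifold_lcs[OF P]
  have 1: "smooth_map_on (lcs_manifold (prod_topology E E)) M ?V (\<lambda>p. chart_inv c (fst p))"
    by (rule chart_inv_smooth[OF P smooth_on_fst[OF E E V] c]) auto
  have 2: "smooth_map_on (lcs_manifold (prod_topology E E)) M ?V (\<lambda>p. chart_inv c (snd p))"
    by (rule chart_inv_smooth[OF P smooth_on_snd[OF E E V] c]) auto
  show ?thesis
    unfolding comm_domain_def comm_rep_def group_commutator_def
    by (intro chart_smooth[OF P _ c] smooth_mult[OF PM] smooth_inv[OF PM] 1 2)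
qed

lemma x0_E: "x0 \<in> topspace E"
  using openin_subset[OF chart_image_openin[OF c]] c_one by blast

lemma group_commutator_one: "g \<in> carrier G \<Longrightarrow> group_commutator g \<one> = \<one>" "g \<in> carrier G \<Longrightarrow> group_commutator \<one> g = \<one>"
  by (simp_all add: group_commutator_def)

lemma group_commutator_eq: "g \<in> carrier G \<Longrightarrow> h \<in> carrier G \<Longrightarrow> group_commutator g h = (g \<otimes> h) \<otimes> inv (h \<otimes> g)"
  by (simp add: group_commutator_def inv_mult_group m_assoc)

lemma base_domains: "(x0, x0) \<in> mult_domain" "(x0, x0) \<in> comm_domain" "mult_rep (x0, x0) = x0" "comm_rep (x0, x0) = x0"
  using c_one by (auto simp: mult_domain_def comm_domain_def mult_rep_def comm_rep_def chart_one group_commutator_one)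

lemma chart_inv_carrier: "x \<in> snd c ` fst c \<Longrightarrow> chart_inv c x \<in> carrier G"
  using chart_inv_in[OF c _ order_refl] chart_carrier[OF c] by blast

lemma rep_axes:
  assumes "x \<in> snd c ` fst c"
  shows "mult_rep (x, x0) = x" "mult_rep (x0, x) = x" "comm_rep (x, x0) = x0" "comm_rep (x0, x) = x0"
  using chart_inv_carrier[OF assms] chart_chart_inv[OF assms order_refl]
  by (simp_all add: mult_rep_def comm_rep_def chart_one group_commutator_one)

text \<open>In the chart, the left invariant field of \<open>u\<close> is the derivative of
  \<open>mult_rep (y, z)\<close> in \<open>z\<close> at \<open>x0\<close> in direction
  \<open>u c\<close>, as a function of \<open>y\<close>. Its derivative in direction
  \<open>v c\<close> is the mixed one, and its value at the neutral element is
  \<open>u c\<close>.\<close>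

lemma lie_bracket_chart:
  assumes v: "v \<in> tangent_set M \<one>" and w: "w \<in> tangent_set M \<one>"
  shows "lie_bracket G v w c = bracket_rep (v c) (w c)"
proof -
  have field: "left_act G (chart_inv c y) \<one> u c = dir_deriv E mult_rep (y, x0) (0, u c)"
    if u: "u \<in> tangent_set M \<one>" and y: "y \<in> snd c ` fst c" for u y
  proof -
    have g: "chart_inv c y \<in> carrier G" by (rule chart_inv_carrier[OF y])
    have cg: "c \<in> charts_at M (chart_inv c y \<otimes> \<one>)"
      using charts_atI[OF c] chart_inv_in[OF c y order_refl] g by simp
    have "left_act G (chart_inv c y) \<one> (chart_vec M c x0 (u c)) c = dir_deriv E (\<lambda>z. snd c (chart_inv c y \<otimes> chart_inv c z)) x0 (u c)"
      by (rule left_act_chart_vec[OF g c_at cg tangent_mem[OF u c_at]])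
    also have "\<dots> = dir_deriv E (\<lambda>z. mult_rep (y, z)) x0 (u c)" by (simp add: mult_rep_def)
    also have "\<dots> = dir_deriv E mult_rep (y, x0) (0, u c)" by (rule dir_deriv_partial(1))
    finally show ?thesis using tangent_eq_chart_vec[OF u c_at] by simp
  qed
  have x0V: "x0 \<in> snd c ` fst c" using c_one by simp
  have one: "left_act G \<one> \<one> u c = u c" if u: "u \<in> tangent_set M \<one>" for u
  proof -
    note uE = tangent_mem[OF u c_at]
    have "left_act G \<one> \<one> u c = dir_deriv E (\<lambda>z. mult_rep (x0, z)) x0 (u c)"
      using field[OF u x0V] unfolding chart_one by (simp only: dir_deriv_partial(1))
    also have "\<dots> = dir_deriv E (\<lambda>z. z) x0 (u c)"
      by (rule dir_deriv_cong(2)[OF E chart_image_openin[OF c] x0V uE]) (rule rep_axes(2))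
    also have "\<dots> = u c" by (rule C1_linear(2)[OF E E _ _ uE]) (simp_all add: linear_iff)
    finally show ?thesis .
  qed
  have der: "dir_deriv E (\<lambda>y. left_act G (chart_inv c y) \<one> u c) x0 (v c) = bilinear_part (v c) (u c)"
    if u: "u \<in> tangent_set M \<one>" and v: "v \<in> tangent_set M \<one>" for u v
  proof -
    have "dir_deriv E (\<lambda>y. left_act G (chart_inv c y) \<one> u c) x0 (v c) = dir_deriv E (\<lambda>y. dir_deriv E mult_rep (y, x0) (0, u c)) x0 (v c)"
      by (rule dir_deriv_cong(2)[OF E chart_image_openin[OF c] x0V tangent_mem[OF v c_at]]) (rule field[OF u])
    also have "\<dots> = bilinear_part (v c) (u c)" unfolding bilinear_part_def by (rule dir_deriv_partial(2)[of _ "\<lambda>p. dir_deriv E mult_rep p (0, u c)"])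
    finally show ?thesis .
  qed
  show ?thesis
    using c_at by (simp add: lie_bracket_def vector_field_bracket_def one[OF v] one[OF w] der[OF w v] der[OF v w] bracket_rep_def)
qed

text \<open>
  The commutator is \<open>(g h) (h g)\<^sup>-\<^sup>1\<close>, and \<open>(p, q) \<mapsto> p q\<^sup>-\<^sup>1\<close> is constant on the diagonal and, in the chart,
  the identity in \<open>p\<close> if \<open>q\<close> is the neutral element. So the commutator grows like the difference
  of the second order terms of \<open>g h\<close> and \<open>h g\<close>.
\<close>

lemma comm_rep_second_order:
  assumes a: "a \<in> topspace E" and u: "u \<in> topspace E"
  shows "limitin E (\<lambda>t. (comm_rep (x0 + t *\<^sub>R a, x0 + t *\<^sub>R u) - x0) /\<^sub>R t\<^sup>2) (bracket_rep a u) (at 0)"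
proof -
  note P = lcs_prod[OF E E]
  let ?V = "snd c ` fst c"
  have x0V: "x0 \<in> ?V" using c_one by simp
  have line: "\<forall>\<^sub>F t in at (0::real). x0 + t *\<^sub>R b \<in> ?V" if "b \<in> topspace E" for b
    by (rule eventually_line_in[OF E chart_image_openin[OF c] x0V that])
  define m where "m b b' t = mult_rep (x0 + t *\<^sub>R b, x0 + t *\<^sub>R b')" for b b' t
  have second: "limitin E (\<lambda>t. (m b b' t - x0 - t *\<^sub>R b - t *\<^sub>R b') /\<^sub>R t\<^sup>2) (bilinear_part b b') (at 0)"
    if b: "b \<in> topspace E" and b': "b' \<in> topspace E" for b b'
  proof -
    \<comment> \<open>The second difference along the two axes: by \<open>rep_axes\<close>, the
      values on the axes are the arguments themselves.\<close>
    have "limitin E (\<lambda>t. (mult_rep ((x0, x0) + t *\<^sub>R (0, b') + t *\<^sub>R (b, 0)) - mult_rep ((x0, x0) + t *\<^sub>R (0, b'))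
        - mult_rep ((x0, x0) + t *\<^sub>R (b, 0)) + mult_rep (x0, x0)) /\<^sub>R t\<^sup>2) (bilinear_part b b') (at 0)"
      unfolding bilinear_part_def
      by (rule second_difference[OF P E mult_rep_smooth base_domains(1)]) (use b b' lcs_zero[OF E] in auto)
    moreover have "\<forall>\<^sub>F t in at 0. (mult_rep ((x0, x0) + t *\<^sub>R (0, b') + t *\<^sub>R (b, 0)) - mult_rep ((x0, x0) + t *\<^sub>R (0, b'))
        - mult_rep ((x0, x0) + t *\<^sub>R (b, 0)) + mult_rep (x0, x0)) /\<^sub>R t\<^sup>2 = (m b b' t - x0 - t *\<^sub>R b - t *\<^sub>R b') /\<^sub>R t\<^sup>2"
      using line[OF b] line[OF b']
      by eventually_elim (simp add: rep_axes base_domains(3) m_def algebra_simps)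
    ultimately show ?thesis by (rule limitin_transform_eventually[rotated])
  qed
  have "(m a u t - x0 - t *\<^sub>R a - t *\<^sub>R u) /\<^sub>R t\<^sup>2 - (m u a t - x0 - t *\<^sub>R u - t *\<^sub>R a) /\<^sub>R t\<^sup>2 = (m a u t - m u a t) /\<^sub>R t\<^sup>2" for t
    by (simp add: algebra_simps)
  with lcs_limitin_diff[OF E second[OF a u] second[OF u a]]
  have diff: "limitin E (\<lambda>t. (m a u t - m u a t) /\<^sub>R t\<^sup>2) (bracket_rep a u) (at 0)"
    by (simp only: bracket_rep_def)
  have xlim: "limitin E (\<lambda>t. x0 + t *\<^sub>R b) x0 (at (0::real))" if b: "b \<in> topspace E" for b
  proof -
    have "limitin E (\<lambda>t. x0 + t *\<^sub>R b) (x0 + 0 *\<^sub>R b) (at (0::real))"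
      by (intro lcs_limitin_add[OF E] lcs_limitin_scaleR[OF E tendsto_ident_at]) (use b x0_E in \<open>simp_all add: limitin_def\<close>)
    thus ?thesis by simp
  qed
  have mlim: "limitin E (\<lambda>t. m b b' t) x0 (at 0)" if b: "b \<in> topspace E" and b': "b' \<in> topspace E" for b b'
    using C1_cont[OF smooth_on_imp_C1[OF mult_rep_smooth] base_domains(1) limitin_pairI[OF xlim[OF b] xlim[OF b']]]
    by (simp add: m_def base_domains(3))
  have prodlim: "limitin (mtop M) (\<lambda>t. chart_inv c (x0 + t *\<^sub>R b) \<otimes> chart_inv c (x0 + t *\<^sub>R b')) \<one> (at 0)"
    if b: "b \<in> topspace E" and b': "b' \<in> topspace E" for b b'
    using limitin_mult[OF chart_inv_limitin[OF c xlim[OF b] x0V] chart_inv_limitin[OF c xlim[OF b'] x0V]]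
    by (simp add: chart_one)
  \<comment> \<open>The quotient of two elements in the chart; the outer factors
    \<open>\<one>\<close> fit it to the shape provided by \<open>two_chart_smooth\<close>.\<close>
  define \<kappa> where "\<kappa> = (\<lambda>p. snd c (\<one> \<otimes> chart_inv c (fst p) \<otimes> inv (chart_inv c (snd p)) \<otimes> \<one>))"
  define D where "D = {p \<in> ?V \<times> ?V. \<one> \<otimes> chart_inv c (fst p) \<otimes> inv (chart_inv c (snd p)) \<otimes> \<one> \<in> fst c}"
  have \<kappa>: "C1_on (prod_topology E E) E D \<kappa>"
    unfolding \<kappa>_def D_def by (rule smooth_on_imp_C1[OF two_chart_smooth(2)[OF c c one_closed one_closed one_closed]])
  have D0: "(x0, x0) \<in> D" using c_one by (auto simp: D_def chart_one)
  have diag: "\<kappa> (y, y) = x0" if "y \<in> ?V" for y using chart_inv_carrier[OF that] by (simp add: \<kappa>_def)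
  have ax: "\<kappa> (y, x0) = y" if "y \<in> ?V" for y
    using chart_inv_carrier[OF that] chart_chart_inv[OF that order_refl] by (simp add: \<kappa>_def chart_one)
  have br: "bracket_rep a u \<in> topspace E" by (rule limitin_topspace[OF diff])
  have "dir_deriv E (\<lambda>y. \<kappa> (y, x0)) x0 (bracket_rep a u) = dir_deriv E (\<lambda>y. y) x0 (bracket_rep a u)"
    by (rule dir_deriv_cong(2)[OF E chart_image_openin[OF c] x0V br]) (rule ax)
  also have "\<dots> = bracket_rep a u" by (rule C1_linear(2)[OF E E _ _ br]) (simp_all add: linear_iff)
  finally have dk: "dir_deriv E \<kappa> (x0, x0) (bracket_rep a u, 0) = bracket_rep a u" unfolding dir_deriv_partial(2) .
  have z: "limitin E (\<lambda>t. 0) 0 (at (0::real))" using lcs_zero[OF E] by (simp add: limitin_def)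
  have t2: "((\<lambda>t::real. t\<^sup>2) \<longlongrightarrow> 0) (at 0)" by (rule tendsto_eq_intros tendsto_ident_at | simp)+
  have nz: "\<forall>\<^sub>F t in at (0::real). t\<^sup>2 \<noteq> 0" by (simp add: eventually_at_filter)
  \<comment> \<open>The base point moves on the diagonal, where \<open>\<kappa>\<close> has the
    value \<open>x0\<close>, and the step is \<open>t\<^sup>2\<close>. The product in the other
    order differs from it in the first component only, by \<open>t\<^sup>2\<close> times a
    convergent direction.\<close>
  have "limitin E (\<lambda>t. (\<kappa> ((m u a t, m u a t) + t\<^sup>2 *\<^sub>R ((m a u t - m u a t) /\<^sub>R t\<^sup>2, 0)) - \<kappa> (m u a t, m u a t)) /\<^sub>R t\<^sup>2)
      (bracket_rep a u) (at 0)"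
    using C1_quotient[OF P E \<kappa> D0 limitin_pairI[OF mlim[OF u a] mlim[OF u a]] limitin_pairI[OF diff z] t2 nz]
    unfolding dk .
  moreover have "\<forall>\<^sub>F t in at 0. (\<kappa> ((m u a t, m u a t) + t\<^sup>2 *\<^sub>R ((m a u t - m u a t) /\<^sub>R t\<^sup>2, 0)) - \<kappa> (m u a t, m u a t)) /\<^sub>R t\<^sup>2
      = (comm_rep (x0 + t *\<^sub>R a, x0 + t *\<^sub>R u) - x0) /\<^sub>R t\<^sup>2"
    using nz line[OF a] line[OF u] limitinD[OF prodlim[OF a u] chart_openin[OF c] c_one]
      limitinD[OF prodlim[OF u a] chart_openin[OF c] c_one]
  proof eventually_elim
    case (elim t)
    let ?x = "chart_inv c (x0 + t *\<^sub>R a)" and ?y = "chart_inv c (x0 + t *\<^sub>R u)"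
    have xy: "?x \<in> carrier G" "?y \<in> carrier G" using chart_inv_carrier elim by auto
    have au: "m a u t = snd c (?x \<otimes> ?y)" and ua: "m u a t = snd c (?y \<otimes> ?x)" by (simp_all add: m_def mult_rep_def)
    have "(m u a t, m u a t) + t\<^sup>2 *\<^sub>R ((m a u t - m u a t) /\<^sub>R t\<^sup>2, 0) = (m a u t, m u a t)" using elim(1) by simp
    moreover have "\<kappa> (m a u t, m u a t) = comm_rep (x0 + t *\<^sub>R a, x0 + t *\<^sub>R u)"
      using elim(4,5) xy by (simp add: \<kappa>_def au ua chart_inv_chart[OF c] comm_rep_def group_commutator_eq)
    moreover have "\<kappa> (m u a t, m u a t) = x0" using elim(5) by (intro diag) (simp add: ua)
    ultimately show ?case by simp
  qed
  ultimately show ?thesis by (rule limitin_transform_eventually[rotated])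
qed

text \<open>
  The second difference of the commutator in direction \<open>(a, u)\<close> compares its values at \<open>2t\<close> and at \<open>t\<close>;
  by quadratic growth, it tends to \<open>4 - 2\<close> times the bracket.
\<close>

lemma comm_rep_second_deriv:
  assumes a: "a \<in> topspace E" and u: "u \<in> topspace E"
  shows "dir_deriv E (\<lambda>p. dir_deriv E comm_rep p (a, u)) (x0, x0) (a, u) = 2 *\<^sub>R bracket_rep a u"
proof -
  let ?z = "(a, u)" and ?p = "(x0, x0)"
  define h where "h t = (comm_rep (x0 + t *\<^sub>R a, x0 + t *\<^sub>R u) - x0) /\<^sub>R t\<^sup>2" for t
  have h: "limitin E h (bracket_rep a u) (at 0)" unfolding h_def by (rule comm_rep_second_order[OF a u])
  have "filterlim (\<lambda>t. 0 + 2 * t) (at (0 + 2 * 0)) (at (0::real))" by (rule filterlim_affine_at) simp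
  hence "filterlim (\<lambda>t. 2 * t) (at 0) (at (0::real))" by simp
  from limitin_filterlim[OF h this] have h2: "limitin E (\<lambda>t. h (2 * t)) (bracket_rep a u) (at 0)" .
  have "limitin E (\<lambda>t. 4 *\<^sub>R h (2 * t) - 2 *\<^sub>R h t) (4 *\<^sub>R bracket_rep a u - 2 *\<^sub>R bracket_rep a u) (at 0)"
    by (intro lcs_limitin_diff[OF E] lcs_limitin_scaleR[OF E tendsto_const] h h2)
  \<comment> \<open>By definition of \<open>h\<close>, the commutator exceeds \<open>x0\<close> by
    \<open>4 * t\<^sup>2\<close> times \<open>h (2 * t)\<close> at the double argument, and by
    \<open>t\<^sup>2\<close> times \<open>h t\<close> at the simple one.\<close>
  moreover have "\<forall>\<^sub>F t in at 0. 4 *\<^sub>R h (2 * t) - 2 *\<^sub>R h t = (comm_rep (?p + t *\<^sub>R ?z + t *\<^sub>R ?z) - comm_rep (?p + t *\<^sub>R ?z)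
      - comm_rep (?p + t *\<^sub>R ?z) + comm_rep ?p) /\<^sub>R t\<^sup>2"
  proof -
    have "\<forall>\<^sub>F t in at (0::real). t \<noteq> 0" by (simp add: eventually_at_filter)
    thus ?thesis
    proof eventually_elim
      case (elim t)
      have p: "(x0 + t *\<^sub>R a, x0 + t *\<^sub>R u) + t *\<^sub>R ?z = (x0 + (2 * t) *\<^sub>R a, x0 + (2 * t) *\<^sub>R u)"
        "?p + t *\<^sub>R ?z = (x0 + t *\<^sub>R a, x0 + t *\<^sub>R u)"
        by (simp_all add: scaleR_add_left[symmetric] add.assoc)
      have eq: "4 *\<^sub>R (A /\<^sub>R (2 * t)\<^sup>2) - 2 *\<^sub>R (B /\<^sub>R t\<^sup>2) = (A - B - B) /\<^sub>R t\<^sup>2" for A B :: 'e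
      proof -
        have "4 *\<^sub>R (y /\<^sub>R (2 * t)\<^sup>2) = y /\<^sub>R t\<^sup>2" for y :: 'e using elim by (simp add: power_mult_distrib)
        moreover have "2 *\<^sub>R (B /\<^sub>R t\<^sup>2) = B /\<^sub>R t\<^sup>2 + B /\<^sub>R t\<^sup>2" by (rule scaleR_2)
        ultimately show ?thesis by (simp only: scaleR_diff_right scaleR_add_right diff_diff_add)
      qed
      show ?case unfolding h_def p base_domains(4) eq by (simp add: algebra_simps)
    qed
  qed
  ultimately have l: "limitin E (\<lambda>t. (comm_rep (?p + t *\<^sub>R ?z + t *\<^sub>R ?z) - comm_rep (?p + t *\<^sub>R ?z)
      - comm_rep (?p + t *\<^sub>R ?z) + comm_rep ?p) /\<^sub>R t\<^sup>2) (4 *\<^sub>R bracket_rep a u - 2 *\<^sub>R bracket_rep a u) (at 0)"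
    by (rule limitin_transform_eventually[rotated])
  have "dir_deriv E (\<lambda>p. dir_deriv E comm_rep p ?z) ?p ?z = 4 *\<^sub>R bracket_rep a u - 2 *\<^sub>R bracket_rep a u"
    by (rule limitin_Hausdorff_unique[OF second_difference[OF lcs_prod[OF E E] E comm_rep_smooth base_domains(2)]
        l at_neq_bot lcs_Hausdorff[OF E]]) (use a u in auto)
  also have "4 *\<^sub>R bracket_rep a u - 2 *\<^sub>R bracket_rep a u = 2 *\<^sub>R bracket_rep a u" by (simp add: scaleR_diff_left[symmetric])
  finally show ?thesis .
qed

end

section \<open>The commutator of two curves, reparametrized by the square root\<close>

context lie_chart
begin

text \<open>On both axes the commutator is constant, and the differential is additive in its
  direction.\<close>

lemma comm_rep_deriv_base:
  assumes a: "a \<in> topspace E" and u: "u \<in> topspace E"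
  shows "dir_deriv E comm_rep (x0, x0) (a, u) = 0"
proof -
  have x0V: "x0 \<in> snd c ` fst c" using c_one by simp
  note cong = dir_deriv_cong(2)[OF E chart_image_openin[OF c] x0V]
    and const = C1_const(2)[OF E x0_E chart_image_openin[OF c]]
  have "dir_deriv E (\<lambda>x. comm_rep (x, x0)) x0 a = dir_deriv E (\<lambda>x. x0) x0 a"
    by (rule cong[OF a]) (rule rep_axes(3))
  also have "\<dots> = 0" by (rule const)
  finally have 1: "dir_deriv E comm_rep (x0, x0) (a, 0) = 0" unfolding dir_deriv_partial(2) .
  have "dir_deriv E (\<lambda>x. comm_rep (x0, x)) x0 u = dir_deriv E (\<lambda>x. x0) x0 u"
    by (rule cong[OF u]) (rule rep_axes(4))
  also have "\<dots> = 0" by (rule const)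
  finally have 2: "dir_deriv E comm_rep (x0, x0) (0, u) = 0" unfolding dir_deriv_partial(1) .
  have "dir_deriv E comm_rep (x0, x0) ((a, 0) + (0, u)) = dir_deriv E comm_rep (x0, x0) (a, 0) + dir_deriv E comm_rep (x0, x0) (0, u)"
    by (rule C1_dir_deriv_add[OF lcs_prod[OF E E] E smooth_on_imp_C1[OF comm_rep_smooth] base_domains(2)])
      (use a u lcs_zero[OF E] in auto)
  thus ?thesis by (simp add: 1 2)
qed

text \<open>Let \<open>r = sqrt t\<close> and let \<open>f r\<close> be the derivative of the
  commutator along \<open>p\<close>. The chain rule gives
  \<open>\<alpha>' t = (1 / (2 * r)) *\<^sub>R f r\<close>. Since \<open>f 0 = 0\<close>, the
  quotient of \<open>f r\<close> by \<open>r\<close> tends to the second derivative in the direction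
  \<open>(a, u)\<close>, which is twice the bracket; the factor 2 cancels that of the square
  root.\<close>

lemma commutator_curve:
  assumes \<gamma>: "C1_curve M \<gamma>" "\<gamma> 0 = \<one>" and \<eta>: "C1_curve M \<eta>" "\<eta> 0 = \<one>"
    and \<alpha>_def: "\<alpha> = (\<lambda>t. group_commutator (\<gamma> (sqrt t)) (\<eta> (sqrt t)))"
  shows "\<exists>\<epsilon> \<alpha>'. 0 < \<epsilon> \<and> continuous_map (top_of_set {0..\<epsilon>}) (mtop M) \<alpha> \<and> (\<forall>t\<in>{0..\<epsilon>}. \<alpha> t \<in> fst c) \<and>
    continuous_map (top_of_set {0..\<epsilon>}) E \<alpha>' \<and>
    (\<forall>t\<in>{0<..<\<epsilon>}. limitin E (\<lambda>s. (snd c (\<alpha> s) - snd c (\<alpha> t)) /\<^sub>R (s - t)) (\<alpha>' t) (at t)) \<and>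
    \<alpha>' 0 = lie_bracket G (velocity M {0..1} \<gamma> 0) (velocity M {0..1} \<eta> 0) c"
proof -
  note P = lcs_prod[OF E E]
  obtain \<epsilon>1 \<gamma>' where
    \<epsilon>1: "0 < \<epsilon>1" "\<epsilon>1 \<le> 1" "\<forall>t\<in>{0..\<epsilon>1}. \<gamma> t \<in> fst c" "continuous_map (top_of_set {0..\<epsilon>1}) E \<gamma>'"
    and d1: "\<forall>t\<in>{0..\<epsilon>1}. limitin E (\<lambda>s. (snd c (\<gamma> s) - snd c (\<gamma> t)) /\<^sub>R (s - t)) (\<gamma>' t) (at t within {0..\<epsilon>1})"
    and vel1: "velocity M {0..1} \<gamma> 0 = chart_vec M c x0 (\<gamma>' 0)"
    using C1_curve_local[OF \<gamma>] by (elim exE conjE)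
  obtain \<epsilon>2 \<eta>' where
    \<epsilon>2: "0 < \<epsilon>2" "\<epsilon>2 \<le> 1" "\<forall>t\<in>{0..\<epsilon>2}. \<eta> t \<in> fst c" "continuous_map (top_of_set {0..\<epsilon>2}) E \<eta>'"
    and d2: "\<forall>t\<in>{0..\<epsilon>2}. limitin E (\<lambda>s. (snd c (\<eta> s) - snd c (\<eta> t)) /\<^sub>R (s - t)) (\<eta>' t) (at t within {0..\<epsilon>2})"
    and vel2: "velocity M {0..1} \<eta> 0 = chart_vec M c x0 (\<eta>' 0)"
    using C1_curve_local[OF \<eta>] by (elim exE conjE)
  define \<epsilon>0 where "\<epsilon>0 = min \<epsilon>1 \<epsilon>2"
  have \<epsilon>0: "0 < \<epsilon>0" "{0..\<epsilon>0} \<subseteq> {0..\<epsilon>1}" "{0..\<epsilon>0} \<subseteq> {0..\<epsilon>2}" "{0..\<epsilon>0} \<subseteq> {0..1}"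
    using \<epsilon>1(1,2) \<epsilon>2(1) by (auto simp: \<epsilon>0_def)
  have curves: "limitin (mtop M) \<gamma> (\<gamma> s) (at s within {0..1})" "limitin (mtop M) \<eta> (\<eta> s) (at s within {0..1})"
    if "s \<in> {0..1}" for s
    using \<gamma>(1) \<eta>(1) that unfolding C1_curve_def continuous_map_real_iff by simp_all
  define p where "p s = (snd c (\<gamma> s), snd c (\<eta> s))" for s
  define q where "q s = (\<gamma>' s, \<eta>' s)" for s
  have p0: "p 0 = (x0, x0)" by (simp add: p_def \<gamma>(2) \<eta>(2))
  have fc: "\<gamma> s \<in> fst c" "\<eta> s \<in> fst c" if "s \<in> {0..\<epsilon>0}" for s
    using \<epsilon>1(3) \<epsilon>2(3) subsetD[OF \<epsilon>0(2) that] subsetD[OF \<epsilon>0(3) that] by simp_all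
  have pc: "limitin (prod_topology E E) p (p s) (at s within {0..\<epsilon>0})" if s: "s \<in> {0..\<epsilon>0}" for s
    unfolding p_def[abs_def]
    by (intro limitin_pairI chart_limitin[OF c] limitin_subset[OF curves(1) \<epsilon>0(4)] limitin_subset[OF curves(2) \<epsilon>0(4)]
        fc[OF s] subsetD[OF \<epsilon>0(4) s])
  have qc: "limitin (prod_topology E E) q (q s) (at s within {0..\<epsilon>0})" if s: "s \<in> {0..\<epsilon>0}" for s
    unfolding q_def[abs_def]
    by (intro limitin_pairI limitin_subset[OF bspec[OF \<epsilon>1(4)[unfolded continuous_map_real_iff]] \<epsilon>0(2)]
        limitin_subset[OF bspec[OF \<epsilon>2(4)[unfolded continuous_map_real_iff]] \<epsilon>0(3)] subsetD[OF \<epsilon>0(2) s] subsetD[OF \<epsilon>0(3) s])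
  have pd: "limitin (prod_topology E E) (\<lambda>s'. (p s' - p s) /\<^sub>R (s' - s)) (q s) (at s within {0..\<epsilon>0})"
    if s: "s \<in> {0..\<epsilon>0}" for s
    using limitin_pairI[OF limitin_subset[OF bspec[OF d1 subsetD[OF \<epsilon>0(2) s]] \<epsilon>0(2)]
        limitin_subset[OF bspec[OF d2 subsetD[OF \<epsilon>0(3) s]] \<epsilon>0(3)]]
    by (simp add: p_def q_def)
  note C = smooth_on_imp_C1[OF comm_rep_smooth]
  have z0: "0 \<in> {0..\<epsilon>0}" using \<epsilon>0(1) by simp
  have "\<forall>\<^sub>F s in at 0 within {0..\<epsilon>0}. p s \<in> comm_domain"
    by (rule limitinD[OF pc[OF z0] C1_openin[OF C]]) (simp add: p0 base_domains(2))
  then obtain \<delta>0 where \<delta>0: "0 < \<delta>0" "\<And>s. s \<in> {0..\<epsilon>0} \<Longrightarrow> s \<noteq> 0 \<Longrightarrow> dist s 0 < \<delta>0 \<Longrightarrow> p s \<in> comm_domain"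
    unfolding eventually_at by metis
  define \<delta> where "\<delta> = min \<epsilon>0 (\<delta>0 / 2)"
  have \<delta>: "0 < \<delta>" "{0..\<delta>} \<subseteq> {0..\<epsilon>0}" "\<delta> < \<delta>0" using \<delta>0(1) \<epsilon>0(1) by (auto simp: \<delta>_def)
  have pm: "p s \<in> comm_domain" if s: "s \<in> {0..\<delta>}" for s
    using \<delta>0(2)[OF subsetD[OF \<delta>(2) s]] s \<delta>(3) p0 base_domains(2) by (cases "s = 0") auto
  \<comment> \<open>Chosen so that the square root maps \<open>{0..\<epsilon>}\<close> into
    \<open>{0..\<delta>}\<close>.\<close>
  define \<epsilon> where "\<epsilon> = \<delta>\<^sup>2"
  have \<epsilon>: "0 < \<epsilon>" using \<delta>(1) by (simp add: \<epsilon>_def)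
  have sq: "sqrt s \<in> {0..\<delta>}" if "s \<in> {0..\<epsilon>}" for s
    using that \<delta>(1) real_le_lsqrt[of \<delta> s] by (auto simp: \<epsilon>_def)
  have fl: "filterlim sqrt (at (sqrt t) within {0..\<delta>}) (at t within {0..\<epsilon>})" if "t \<in> {0..\<epsilon>}" for t
    by (rule filterlim_sqrt_within) (use that sq in auto)
  define f where "f s = dir_deriv E comm_rep (p s) (q s)" for s
  define a u where "a = \<gamma>' 0" and "u = \<eta>' 0"
  have qm: "q s \<in> topspace (prod_topology E E)" if "s \<in> {0..\<epsilon>0}" for s by (rule limitin_topspace[OF qc[OF that]])
  have au: "a \<in> topspace E" "u \<in> topspace E" using qm[OF z0] by (simp_all add: q_def a_def u_def)
  have fcont: "limitin E f (f s) (at s within {0..\<delta>})" if s: "s \<in> {0..\<delta>}" for s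
    unfolding f_def[abs_def]
    by (intro C1_deriv_cont[OF C pm[OF s]] limitin_subset[OF pc \<delta>(2)] limitin_subset[OF qc \<delta>(2)] subsetD[OF \<delta>(2) s])
  have f0: "limitin E (\<lambda>s. f s /\<^sub>R s) (2 *\<^sub>R bracket_rep a u) (at 0 within {0..\<delta>})"
  proof -
    define h where "h = (\<lambda>(x, y). dir_deriv E comm_rep x y)"
    have h: "C1_on (prod_topology (prod_topology E E) (prod_topology E E)) E (comm_domain \<times> topspace (prod_topology E E)) h"
      unfolding h_def by (rule smooth_on_imp_C1[OF smooth_on_dir_deriv[OF comm_rep_smooth]])
    have mem: "(p 0, q 0) \<in> comm_domain \<times> topspace (prod_topology E E)"
      using pm[of 0] qm[OF z0] \<delta>(1) by simp
    note ql = limitin_subset[OF qc[OF z0] \<delta>(2)] and pl = limitin_subset[OF pd[OF z0] \<delta>(2)]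
    have c1: "limitin (prod_topology E E) (\<lambda>s. p 0) (p 0) (at 0 within {0..\<delta>})"
      using x0_E by (simp add: limitin_def p0)
    have c2: "limitin (prod_topology E E) (\<lambda>s. 0) 0 (at 0 within {0..\<delta>})"
      using lcs_zero[OF P] by (simp add: limitin_def)
    have nz: "\<forall>\<^sub>F s in at 0 within {0..\<delta>}. s - 0 \<noteq> 0" by (simp add: eventually_at_filter)
    have t0: "((\<lambda>s. s - 0) \<longlongrightarrow> 0) (at 0 within {0..\<delta>})" by (simp add: tendsto_ident_at)
    \<comment> \<open>\<open>f s\<close> is \<open>h (p s, q s)\<close> and is compared with
      \<open>h (p 0, q s) = 0\<close>, the direction \<open>q s\<close> being kept. So it is
      \<open>p\<close> alone that is differentiated; the curve \<open>q\<close> consists of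
      derivatives of C^1 curves and is merely continuous.\<close>
    have "limitin E (\<lambda>s. (h ((p 0, q s) + (s - 0) *\<^sub>R ((p s - p 0) /\<^sub>R (s - 0), 0)) - h (p 0, q s)) /\<^sub>R (s - 0))
        (dir_deriv E h (p 0, q 0) (q 0, 0)) (at 0 within {0..\<delta>})"
      by (rule C1_quotient[OF lcs_prod[OF P P] E h mem limitin_pairI[OF c1 ql] limitin_pairI[OF pl c2] t0 nz])
    moreover have eq: "dir_deriv E h (p 0, q 0) (q 0, 0) = 2 *\<^sub>R bracket_rep a u"
      unfolding dir_deriv_partial(2)[symmetric]
      using comm_rep_second_deriv[OF au] by (simp add: h_def p0 q_def a_def u_def)
    moreover have "\<forall>\<^sub>F s in at 0 within {0..\<delta>}.
        (h ((p 0, q s) + (s - 0) *\<^sub>R ((p s - p 0) /\<^sub>R (s - 0), 0)) - h (p 0, q s)) /\<^sub>R (s - 0) = f s /\<^sub>R s"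
    proof -
      have "\<forall>\<^sub>F s in at 0 within {0..\<delta>}. s \<in> {0..\<delta>} \<and> s \<noteq> 0" by (simp add: eventually_at_filter)
      thus ?thesis
      proof eventually_elim
        case (elim s)
        have "q s \<in> topspace (prod_topology E E)" by (rule qm) (use elim \<delta>(2) in auto)
        hence "h (p 0, q s) = 0" using comm_rep_deriv_base by (simp add: h_def p0 q_def)
        moreover have "(p 0, q s) + (s - 0) *\<^sub>R ((p s - p 0) /\<^sub>R (s - 0), 0) = (p s, q s)" using elim by simp
        ultimately show ?case by (simp add: h_def f_def)
      qed
    qed
    ultimately show ?thesis unfolding eq by (elim limitin_transform_eventually[rotated])
  qed
  \<comment> \<open>The value at 0 is the limit from the right, as division by \<open>sqrt t\<close>
    breaks down there.\<close>
  define \<alpha>' where "\<alpha>' t = (if t = 0 then bracket_rep a u else (1 / (2 * sqrt t)) *\<^sub>R f (sqrt t))" for t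
  have \<alpha>_rep: "\<alpha> t \<in> fst c" "snd c (\<alpha> t) = comm_rep (p (sqrt t))" if t: "t \<in> {0..\<epsilon>}" for t
    using pm[OF sq[OF t]] fc[OF subsetD[OF \<delta>(2) sq[OF t]]]
    by (simp_all add: comm_domain_def comm_rep_def p_def \<alpha>_def chart_inv_chart[OF c])
  have "continuous_map (top_of_set {0..\<epsilon>}) (mtop M) \<alpha>"
    unfolding continuous_map_real_iff
  proof
    fix t assume t: "t \<in> {0..\<epsilon>}"
    have sub: "{0..\<delta>} \<subseteq> {0..1}" by (rule order_trans[OF \<delta>(2) \<epsilon>0(4)])
    have s1: "sqrt t \<in> {0..1}" by (rule subsetD[OF sub sq[OF t]])
    note l = limitin_filterlim[OF limitin_subset[OF curves(1)[OF s1] sub] fl[OF t]]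
      limitin_filterlim[OF limitin_subset[OF curves(2)[OF s1] sub] fl[OF t]]
    show "limitin (mtop M) \<alpha> (\<alpha> t) (at t within {0..\<epsilon>})"
      unfolding \<alpha>_def group_commutator_def by (intro limitin_mult limitin_inv l)
  qed
  moreover have "continuous_map (top_of_set {0..\<epsilon>}) E \<alpha>'"
    unfolding continuous_map_real_iff
  proof
    fix t assume t: "t \<in> {0..\<epsilon>}"
    show "limitin E \<alpha>' (\<alpha>' t) (at t within {0..\<epsilon>})"
    proof (cases "t = 0")
      case True
      have "filterlim sqrt (at 0 within {0..\<delta>}) (at 0 within {0..\<epsilon>})" using fl[OF t] True by simp
      from lcs_limitin_scaleR[OF E tendsto_const[of "1/2"] limitin_filterlim[OF f0 this]]
      have "limitin E (\<lambda>s. (1/2) *\<^sub>R (f (sqrt s) /\<^sub>R sqrt s)) (\<alpha>' t) (at 0 within {0..\<epsilon>})" by (simp add: \<alpha>'_def True)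
      moreover have "\<forall>\<^sub>F s in at 0 within {0..\<epsilon>}. (1/2) *\<^sub>R (f (sqrt s) /\<^sub>R sqrt s) = \<alpha>' s"
      proof -
        have "\<forall>\<^sub>F s in at 0 within {0..\<epsilon>}. s \<noteq> 0" by (simp add: eventually_at_filter)
        thus ?thesis
        proof eventually_elim
          case (elim s)
          have "1 / 2 * inverse (sqrt s) = 1 / (2 * sqrt s)" by (simp only: inverse_eq_divide times_divide_times_eq mult_1)
          thus ?case using elim by (simp only: \<alpha>'_def scaleR_scaleR if_False)
        qed
      qed
      ultimately show ?thesis unfolding True by (rule limitin_transform_eventually[rotated])
    next
      case False
      have "((\<lambda>s. 1 / (2 * sqrt s)) \<longlongrightarrow> 1 / (2 * sqrt t)) (at t within {0..\<epsilon>})"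
        by (intro tendsto_intros) (use False in auto)
      from lcs_limitin_scaleR[OF E this limitin_filterlim[OF fcont[OF sq[OF t]] fl[OF t]]]
      have "limitin E (\<lambda>s. (1 / (2 * sqrt s)) *\<^sub>R f (sqrt s)) (\<alpha>' t) (at t within {0..\<epsilon>})" using False by (simp add: \<alpha>'_def)
      moreover have "\<forall>\<^sub>F s in at t within {0..\<epsilon>}. (1 / (2 * sqrt s)) *\<^sub>R f (sqrt s) = \<alpha>' s"
      proof -
        have "\<forall>\<^sub>F s in at t within {0..\<epsilon>}. s \<noteq> 0" using False by (intro eventually_neq_at_within)
        thus ?thesis by eventually_elim (simp add: \<alpha>'_def)
      qed
      ultimately show ?thesis by (rule limitin_transform_eventually[rotated])
    qed
  qed
  moreover have "limitin E (\<lambda>s. (snd c (\<alpha> s) - snd c (\<alpha> t)) /\<^sub>R (s - t)) (\<alpha>' t) (at t)" if t: "t \<in> {0<..<\<epsilon>}" for t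
  proof -
    have ti: "t \<in> {0..\<epsilon>}" using t by simp
    have att: "at t within {0..\<epsilon>} = at t" by (rule at_within_interior) (use t in simp)
    define s0 where "s0 = sqrt t"
    have s0: "s0 \<in> {0..\<delta>}" unfolding s0_def by (rule sq[OF ti])
    have nz: "\<forall>\<^sub>F s in at s0 within {0..\<delta>}. s - s0 \<noteq> 0" by (simp add: eventually_at_filter)
    have t0: "((\<lambda>s. s - s0) \<longlongrightarrow> 0) (at s0 within {0..\<delta>})" by (rule tendsto_eq_intros tendsto_ident_at | simp)+
    have c1: "limitin (prod_topology E E) (\<lambda>s. p s0) (p s0) (at s0 within {0..\<delta>})"
      using limitin_topspace[OF pc[OF subsetD[OF \<delta>(2) s0]]] by (simp add: limitin_def)
    have "limitin E (\<lambda>s. (comm_rep (p s0 + (s - s0) *\<^sub>R ((p s - p s0) /\<^sub>R (s - s0))) - comm_rep (p s0)) /\<^sub>R (s - s0)) (f s0) (at s0 within {0..\<delta>})"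
      unfolding f_def by (rule C1_quotient[OF P E C pm[OF s0] c1 limitin_subset[OF pd[OF subsetD[OF \<delta>(2) s0]] \<delta>(2)] t0 nz])
    moreover have "\<forall>\<^sub>F s in at s0 within {0..\<delta>}. (comm_rep (p s0 + (s - s0) *\<^sub>R ((p s - p s0) /\<^sub>R (s - s0))) - comm_rep (p s0)) /\<^sub>R (s - s0)
        = (comm_rep (p s) - comm_rep (p s0)) /\<^sub>R (s - s0)"
      using nz by eventually_elim simp
    ultimately have "limitin E (\<lambda>s. (comm_rep (p s) - comm_rep (p s0)) /\<^sub>R (s - s0)) (f s0) (at s0 within {0..\<delta>})"
      by (rule limitin_transform_eventually[rotated])
    from limitin_filterlim[OF this[unfolded s0_def] fl[OF ti]]
    have l: "limitin E (\<lambda>s. (comm_rep (p (sqrt s)) - comm_rep (p (sqrt t))) /\<^sub>R (sqrt s - sqrt t)) (f (sqrt t)) (at t)"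
      unfolding att .
    have "inverse (sqrt t) / 2 = 1 / (2 * sqrt t)" by (simp add: inverse_eq_divide)
    hence quot: "((\<lambda>s. (sqrt s - sqrt t) / (s - t)) \<longlongrightarrow> 1 / (2 * sqrt t)) (at t)"
      using DERIV_real_sqrt[of t] t by (simp add: has_field_derivative_iff mult.commute)
    have \<alpha>'t: "\<alpha>' t = (1 / (2 * sqrt t)) *\<^sub>R f (sqrt t)" using t by (simp add: \<alpha>'_def)
    \<comment> \<open>The chain rule written out: the quotient of the square root times the quotient
      of the commutator along \<open>p\<close>, both taken between \<open>t\<close> and
      \<open>s\<close>.\<close>
    have "limitin E (\<lambda>s. ((sqrt s - sqrt t) / (s - t)) *\<^sub>R ((comm_rep (p (sqrt s)) - comm_rep (p (sqrt t))) /\<^sub>R (sqrt s - sqrt t)))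
        (\<alpha>' t) (at t)"
      unfolding \<alpha>'t by (rule lcs_limitin_scaleR[OF E quot l])
    moreover have "\<forall>\<^sub>F s in at t. ((sqrt s - sqrt t) / (s - t)) *\<^sub>R ((comm_rep (p (sqrt s)) - comm_rep (p (sqrt t))) /\<^sub>R (sqrt s - sqrt t))
        = (snd c (\<alpha> s) - snd c (\<alpha> t)) /\<^sub>R (s - t)"
    proof -
      have "\<forall>\<^sub>F s in at t. s \<in> {0<..<\<epsilon>}" by (rule eventually_at_in_open'[OF open_greaterThanLessThan t])
      moreover have "\<forall>\<^sub>F s in at t. s \<noteq> t" by (simp add: eventually_at_filter)
      ultimately show ?thesis
      proof eventually_elim
        case (elim s)
        have "sqrt s \<noteq> sqrt t" using elim by simp
        hence "((sqrt s - sqrt t) / (s - t)) *\<^sub>R (z /\<^sub>R (sqrt s - sqrt t)) = z /\<^sub>R (s - t)" for z :: 'e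
          by (simp add: divide_inverse)
        moreover have "s \<in> {0..\<epsilon>}" using elim by simp
        ultimately show ?case by (simp only: \<alpha>_rep(2)[OF ti] \<alpha>_rep(2))
      qed
    qed
    ultimately show ?thesis by (rule limitin_transform_eventually[rotated])
  qed
  moreover have "\<alpha>' 0 = lie_bracket G (velocity M {0..1} \<gamma> 0) (velocity M {0..1} \<eta> 0) c"
    unfolding vel1 vel2 a_def[symmetric] u_def[symmetric]
    by (subst lie_bracket_chart) (simp_all add: chart_vec_tangent[OF M c_at] au \<alpha>'_def)
  ultimately show ?thesis using \<epsilon> \<alpha>_rep(1) by (intro exI[of _ \<epsilon>] exI[of _ \<alpha>'] conjI ballI)
qed

text \<open>
  The components of the bracket with respect to different charts are compatible, since each of them is
  the initial derivative of one and the same curve.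
\<close>

lemma lie_bracket_velocity_chart_vec:
  assumes \<gamma>: "C1_curve M \<gamma>" "\<gamma> 0 = \<one>" and \<eta>: "C1_curve M \<eta>" "\<eta> 0 = \<one>"
  defines "B \<equiv> lie_bracket G (velocity M {0..1} \<gamma> 0) (velocity M {0..1} \<eta> 0)"
  shows "B = chart_vec M c x0 (B c)"
proof
  fix d
  show "B d = chart_vec M c x0 (B c) d"
  proof (cases "d \<in> charts_at M \<one>")
    case False
    thus ?thesis by (simp add: B_def lie_bracket_def vector_field_bracket_def chart_vec_at[OF c_at])
  next
    case True
    note d' = charts_atD[OF True]
    \<comment> \<open>The whole construction is repeated in the chart \<open>d\<close>; the group
      commutator does not depend on the chart, so the curve is the same.\<close>
    interpret D: lie_chart G d by unfold_locales (rule d')+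
    define \<alpha> where "\<alpha> = (\<lambda>t. group_commutator (\<gamma> (sqrt t)) (\<eta> (sqrt t)))"
    have \<alpha>D: "(\<lambda>t. D.group_commutator (\<gamma> (sqrt t)) (\<eta> (sqrt t))) = \<alpha>"
      by (simp add: \<alpha>_def D.group_commutator_def group_commutator_def)
    obtain \<epsilon>1 \<alpha>1 where 1: "0 < \<epsilon>1" "continuous_map (top_of_set {0..\<epsilon>1}) (mtop M) \<alpha>" "\<forall>t\<in>{0..\<epsilon>1}. \<alpha> t \<in> fst c"
      "continuous_map (top_of_set {0..\<epsilon>1}) E \<alpha>1"
      "\<forall>t\<in>{0<..<\<epsilon>1}. limitin E (\<lambda>s. (snd c (\<alpha> s) - snd c (\<alpha> t)) /\<^sub>R (s - t)) (\<alpha>1 t) (at t)" "\<alpha>1 0 = B c"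
      using commutator_curve[OF \<gamma> \<eta> \<alpha>_def] unfolding B_def[symmetric] by (elim exE conjE)
    obtain \<epsilon>2 \<alpha>2 where 2: "0 < \<epsilon>2" "\<forall>t\<in>{0..\<epsilon>2}. \<alpha> t \<in> fst d" "continuous_map (top_of_set {0..\<epsilon>2}) E \<alpha>2"
      "\<forall>t\<in>{0<..<\<epsilon>2}. limitin E (\<lambda>s. (snd d (\<alpha> s) - snd d (\<alpha> t)) /\<^sub>R (s - t)) (\<alpha>2 t) (at t)" "\<alpha>2 0 = B d"
      using D.commutator_curve[OF \<gamma> \<eta> \<alpha>D[symmetric]] unfolding B_def[symmetric] by (elim exE conjE)
    define \<epsilon> where "\<epsilon> = min \<epsilon>1 \<epsilon>2"
    have \<epsilon>: "0 < \<epsilon>" "\<epsilon> \<le> \<epsilon>1" "\<epsilon> \<le> \<epsilon>2" using 1(1) 2(1) by (auto simp: \<epsilon>_def)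
    have \<alpha>0: "\<alpha> 0 = \<one>" by (simp add: \<alpha>_def \<gamma>(2) \<eta>(2) group_commutator_one)
    let ?T = "snd d \<circ> chart_inv c"
    have eq: "\<alpha>2 t = dir_deriv E ?T (snd c (\<alpha> t)) (\<alpha>1 t)" if t: "t \<in> {0<..<\<epsilon>}" for t
    proof -
      have t': "t \<in> {0..\<epsilon>1}" "t \<in> {0..\<epsilon>2}" "t \<in> {0<..<\<epsilon>1}" "t \<in> {0<..<\<epsilon>2}" using t \<epsilon> by auto
      have at: "at t within {0..\<epsilon>1} = at t" by (rule at_within_interior) (use t'(3) in simp)
      have \<alpha>l: "limitin (mtop M) \<alpha> (\<alpha> t) (at t)" using bspec[OF 1(2)[unfolded continuous_map_real_iff] t'(1)] unfolding at .
      have nz: "\<forall>\<^sub>F s in at t. s - t \<noteq> 0" by (simp add: eventually_at_filter)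
      have t0: "((\<lambda>s. s - t) \<longlongrightarrow> 0) (at t)" by (rule tendsto_eq_intros tendsto_ident_at | simp)+
      have ch: "c \<in> charts_at M (\<alpha> t)" "d \<in> charts_at M (\<alpha> t)"
        using charts_atI[OF c] charts_atI[OF d'(1)] 1(3) 2(2) t' by auto
      show ?thesis
        by (rule limitin_Hausdorff_unique[OF bspec[OF 2(4) t'(4)] chart_quotient_transition[OF M ch \<alpha>l t0 nz bspec[OF 1(5) t'(3)]]
            at_neq_bot lcs_Hausdorff[OF E]])
    qed
    \<comment> \<open>At 0 there are only the continuous extensions \<open>\<alpha>1\<close> and
      \<open>\<alpha>2\<close> of the two derivatives. The transition rule \<open>eq\<close>, valid
      at interior times, is carried to 0 by a limit along the open interval.\<close>
    have z1: "0 \<in> {0..\<epsilon>1}" and z2: "0 \<in> {0..\<epsilon>2}" using 1(1) 2(1) by auto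
    have s: "{0<..<\<epsilon>} \<subseteq> {0..\<epsilon>1}" "{0<..<\<epsilon>} \<subseteq> {0..\<epsilon>2}" using \<epsilon> by auto
    have l2: "limitin E \<alpha>2 (\<alpha>2 0) (at 0 within {0<..<\<epsilon>})"
      by (rule limitin_subset[OF bspec[OF 2(3)[unfolded continuous_map_real_iff] z2] s(2)])
    have l1: "limitin E \<alpha>1 (\<alpha>1 0) (at 0 within {0<..<\<epsilon>})"
      by (rule limitin_subset[OF bspec[OF 1(4)[unfolded continuous_map_real_iff] z1] s(1)])
    have l0: "limitin E (\<lambda>t. snd c (\<alpha> t)) x0 (at 0 within {0<..<\<epsilon>})"
      using chart_limitin[OF c limitin_subset[OF bspec[OF 1(2)[unfolded continuous_map_real_iff] z1] s(1)]] c_one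
      by (simp add: \<alpha>0)
    have "limitin E (\<lambda>t. dir_deriv E ?T (snd c (\<alpha> t)) (\<alpha>1 t)) (dir_deriv E ?T x0 (\<alpha>1 0)) (at 0 within {0<..<\<epsilon>})"
      by (rule C1_deriv_cont[OF chart_transition_C1[OF M c_at True] l0 l1])
    moreover have "\<forall>\<^sub>F t in at 0 within {0<..<\<epsilon>}. dir_deriv E ?T (snd c (\<alpha> t)) (\<alpha>1 t) = \<alpha>2 t"
    proof -
      have "\<forall>\<^sub>F t in at 0 within {0<..<\<epsilon>}. t \<in> {0<..<\<epsilon>}" by (simp add: eventually_at_filter)
      thus ?thesis by eventually_elim (rule eq[symmetric])
    qed
    ultimately have l3: "limitin E \<alpha>2 (dir_deriv E ?T x0 (\<alpha>1 0)) (at 0 within {0<..<\<epsilon>})"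
      by (rule limitin_transform_eventually[rotated])
    have "at 0 within {0<..<\<epsilon>} = at_right 0"
      by (rule at_within_nhd[of _ "{-1<..<\<epsilon>}"]) (use \<epsilon>(1) in auto)
    hence "at 0 within {0<..<\<epsilon>} \<noteq> bot" by simp
    from limitin_Hausdorff_unique[OF l2 l3 this lcs_Hausdorff[OF E]]
    show ?thesis using True by (simp add: 1(6) 2(5) chart_vec_at[OF c_at])
  qed
qed

end

context lie_evol
begin

theorem strong_commutator: "strong_commutator G"
  unfolding strong_commutator_def
proof (intro exI[of _ expG] conjI smooth_exponential_expG allI impI)
  fix \<gamma> \<eta> and K :: "real set"
  assume "C1_curve M \<gamma> \<and> \<gamma> 0 = \<one> \<and> C1_curve M \<eta> \<and> \<eta> 0 = \<one>" and "compact K \<and> K \<subseteq> {0..}"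
  hence \<gamma>: "C1_curve M \<gamma>" "\<gamma> 0 = \<one>" and \<eta>: "C1_curve M \<eta>" "\<eta> 0 = \<one>" and K: "compact K" "K \<subseteq> {0..}" by auto
  let ?B = "lie_bracket G (velocity M {0..1} \<gamma> 0) (velocity M {0..1} \<eta> 0)"
  define \<alpha> where "\<alpha> = (\<lambda>t. group_commutator (\<gamma> (sqrt t)) (\<eta> (sqrt t)))"
  obtain \<epsilon> \<alpha>' where 1: "0 < \<epsilon>" "continuous_map (top_of_set {0..\<epsilon>}) (mtop M) \<alpha>" "\<forall>t\<in>{0..\<epsilon>}. \<alpha> t \<in> fst c"
    "continuous_map (top_of_set {0..\<epsilon>}) E \<alpha>'"
    "\<forall>t\<in>{0<..<\<epsilon>}. limitin E (\<lambda>s. (snd c (\<alpha> s) - snd c (\<alpha> t)) /\<^sub>R (s - t)) (\<alpha>' t) (at t)" "\<alpha>' 0 = ?B c"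
    using commutator_curve[OF \<gamma> \<eta> \<alpha>_def] by (elim exE conjE)
  have \<alpha>0: "\<alpha> 0 = \<one>" by (simp add: \<alpha>_def \<gamma>(2) \<eta>(2) group_commutator_one)
  have "uniform_limit_on G K (\<lambda>n t. \<alpha> (t / real n) [^] n) (\<lambda>t. expG (t *\<^sub>R chart_vec M c x0 (\<alpha>' 0)))"
    by (rule Trotter_chart[OF 1(1,2) \<alpha>0 bspec[OF 1(3)] 1(4) bspec[OF 1(5)] K])
  \<comment> \<open>The tangent vector with the component of the bracket at \<open>c\<close> is the
    bracket itself, because its components are compatible.\<close>
  hence U: "uniform_limit_on G K (\<lambda>n t. \<alpha> (t / real n) [^] n) (\<lambda>t. expG (t *\<^sub>R ?B))"
    unfolding 1(6) lie_bracket_velocity_chart_vec[OF \<gamma> \<eta>, symmetric] .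
  have sq: "filterlim (\<lambda>n::nat. n\<^sup>2) sequentially sequentially"
    by (rule filterlim_subseq) (simp add: strict_mono_def power_strict_mono)
  have \<alpha>n: "\<alpha> (t / real (n\<^sup>2)) = \<gamma> (sqrt t / real n) \<otimes> \<eta> (sqrt t / real n) \<otimes> inv (\<gamma> (sqrt t / real n)) \<otimes> inv (\<eta> (sqrt t / real n))"
    for t n by (simp add: \<alpha>_def group_commutator_def real_sqrt_divide)
  have "uniform_limit_on G K (\<lambda>n t. \<alpha> (t / real (n\<^sup>2)) [^] n\<^sup>2) (\<lambda>t. expG (t *\<^sub>R ?B))"
    unfolding uniform_limit_on_def
  proof (intro allI impI)
    fix U assume "openin (mtop M) U \<and> \<one> \<in> U"
    from U[unfolded uniform_limit_on_def, rule_format, OF this]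
    show "\<forall>\<^sub>F n in sequentially. \<forall>t\<in>K. \<alpha> (t / real (n\<^sup>2)) [^] n\<^sup>2 \<in> (expG (t *\<^sub>R ?B) <# U) \<inter> (U #> expG (t *\<^sub>R ?B))"
      by (rule eventually_compose_filterlim[OF _ sq])
  qed
  thus "uniform_limit_on G K (\<lambda>n t. (\<gamma> (sqrt t / real n) \<otimes> \<eta> (sqrt t / real n) \<otimes> inv (\<gamma> (sqrt t / real n)) \<otimes>
      inv (\<eta> (sqrt t / real n))) [^] n\<^sup>2) (\<lambda>t. expG (t *\<^sub>R ?B))"
    unfolding \<alpha>n .
qed

end

theorem theoremI:
  fixes G :: "('g, 'e::real_vector) lie_structure"
  assumes "lie_group G"
    and "integral_complete (model (mfd G))"
    and "R_regular G"
  shows "strong_Trotter G \<and> strong_commutator G"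
proof -
  interpret lie G by unfold_locales (rule assms(1))
  obtain Evol N where Evol: "\<forall>X\<in>R_set (lie_algebra G) 0 1.
      Evol X \<in> AC_group_set G \<and> Evol X 0 = \<one>\<^bsub>G\<^esub> \<and> left_log_deriv G (Evol X) X"
    and N: "AC_manifold G N" "smooth_map_on (lcs_manifold (R_space (lie_algebra G) 0 1)) N (R_set (lie_algebra G) 0 1) Evol"
    using assms(3) unfolding R_regular_def by (elim exE conjE)
  have "\<one>\<^bsub>G\<^esub> \<in> topspace (mtop M)" by (simp add: topM)
  then obtain c where c: "c \<in> charts M" "\<one>\<^bsub>G\<^esub> \<in> fst c" using chart_exists[OF M] by metis
  interpret lie_evol G c Evol N
    by unfold_locales (use c Evol N in auto)
  show ?thesis using strong_Trotter strong_commutator by (rule conjI)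
qed

end
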